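(* Let $n,m$ be positive integers and $\mathcal H=L^2(\mathbf R^n,\mathbf C^m)$. Let $D:\mathsf D(D)\to\mathcal H$ be a self-adjoint (inhomogeneous) first order differential operator with constant coefficients such that $$\|u\|+\|\nabla u\|\lesssim\|Du\|\qquad\text{for all }u\in\mathsf D(D)\cap\overline{\mathsf R(D)}.$$ Let $B$ be a bounded operator on $\mathcal H$ given by multiplication by a matrix-valued function, such that for some $\delta>0$, $\mathrm{Re}(BDu,Du)\ge\delta\|Du\|^2$ for all $u\in\mathsf D(D)$. Then $$\int_0^\infty\|tBD(I+t^2BDBD)^{-1}u\|^2\,\frac{dt}t\lesssim\|u\|^2\qquad\text{for all }u\in\mathcal H.$$
   Context: $\mathsf D(D),\mathsf R(D)$ denote the domain and range of $D$; $(\cdot,\cdot)$, $\|\cdot\|$ are the hermitian product and norm of $\mathcal H$. An inhomogeneous first order differential operator with constant coefficients is one of the form $D=D_1+D_0$ with $D_1$ a homogeneous first order constant coefficient differential operator and $D_0$ multiplication by a constant matrix. $\lesssim$ means inequality up to a constant independent of $u$. (The assumptions ensure that $tBD(I+t^2BDBD)^{-1}$ is a bounded operator, uniformly in $t>0$.) *)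

theory Defs
  imports "HOL-Analysis.Analysis"
begin

section \<open>The Hilbert space \<open>L\<^sup>2(R\<^sup>n, C\<^sup>m)\<close>\<close>

definition square_integrable :: "(real^'n \<Rightarrow> complex^'m) \<Rightarrow> bool" where
  "square_integrable f \<longleftrightarrow>
     f \<in> borel_measurable lebesgue \<and> integrable lebesgue (\<lambda>x. (norm (f x))\<^sup>2)"

definition L2_rel :: "(real^'n \<Rightarrow> complex^'m) \<Rightarrow> (real^'n \<Rightarrow> complex^'m) \<Rightarrow> bool" where
  "L2_rel f g \<longleftrightarrow>
     square_integrable f \<and> square_integrable g \<and> (AE x in lebesgue. f x = g x)"

lemma square_integrable_zero: "square_integrable (\<lambda>x. 0)"
  by (simp add: square_integrable_def)

quotient_type ('n, 'm) L2 = "real^'n::finite \<Rightarrow> complex^'m::finite" / partial: L2_rel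
proof (rule part_equivpI)
  show "\<exists>f. L2_rel f f"
    using square_integrable_zero by (auto simp: L2_rel_def)
  show "symp L2_rel"
    by (rule sympI) (auto simp: L2_rel_def elim: eventually_mono)
  show "transp L2_rel"
    by (rule transpI) (auto simp: L2_rel_def elim: eventually_elim2)
qed

lemma square_integrable_add:
  assumes "square_integrable f" "square_integrable g"
  shows "square_integrable (\<lambda>x. f x + g x)"
proof -
  have [measurable]: "f \<in> borel_measurable lebesgue" "g \<in> borel_measurable lebesgue"
    using assms by (auto simp: square_integrable_def)
  have bnd: "integrable lebesgue (\<lambda>x. 2 * (norm (f x))\<^sup>2 + 2 * (norm (g x))\<^sup>2)"
    using assms by (auto simp: square_integrable_def)
  have le: "(norm (f x + g x))\<^sup>2 \<le> 2 * (norm (f x))\<^sup>2 + 2 * (norm (g x))\<^sup>2" for x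
  proof -
    have "(norm (f x + g x))\<^sup>2 \<le> (norm (f x) + norm (g x))\<^sup>2"
      by (simp add: norm_triangle_ineq power_mono)
    also have "\<dots> \<le> 2 * (norm (f x))\<^sup>2 + 2 * (norm (g x))\<^sup>2"
      using sum_squares_bound[of "norm (f x)" "norm (g x)"] by (simp add: power2_sum)
    finally show ?thesis .
  qed
  have "integrable lebesgue (\<lambda>x. (norm (f x + g x))\<^sup>2)"
    by (rule Bochner_Integration.integrable_bound[OF bnd]) (use le in simp_all)
  then show ?thesis
    by (simp add: square_integrable_def)
qed

lemma norm_vector_scalar_mult:
  fixes v :: "complex^'m"
  shows "norm (c *s v) = cmod c * norm v"
  by (simp add: norm_vec_def norm_mult L2_set_right_distrib)

lemma square_integrable_scaleC:
  assumes "square_integrable f"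
  shows "square_integrable (\<lambda>x. (c::complex) *s f x)"
proof -
  have [measurable]: "f \<in> borel_measurable lebesgue"
    using assms by (auto simp: square_integrable_def)
  have lin: "bounded_linear (\<lambda>v :: complex^'m. c *s v)"
    by (rule bounded_linear_intro[where K = "cmod c"])
      (simp_all add: vec_eq_iff distrib_left norm_vector_scalar_mult)
  have "(\<lambda>x. c *s f x) \<in> borel_measurable lebesgue"
    by (rule borel_measurable_continuous_on[OF linear_continuous_on[OF lin]]) fact
  then show ?thesis
    using assms by (auto simp: square_integrable_def norm_vector_scalar_mult power_mult_distrib)
qed

lemma square_integrable_scaleR:
  "square_integrable f \<Longrightarrow> square_integrable (\<lambda>x. (r::real) *\<^sub>R f x)"
  by (auto simp: square_integrable_def power_mult_distrib)

lemma square_integrable_diff: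
  "square_integrable f \<Longrightarrow> square_integrable g \<Longrightarrow> square_integrable (\<lambda>x. f x - g x)"
  using square_integrable_add[of f "\<lambda>x. (-1) *\<^sub>R g x"] square_integrable_scaleR[of g "-1"] by simp

lemma norm_mult_le_sum_squares: "norm x * norm y \<le> (norm x)\<^sup>2 + (norm y)\<^sup>2"
proof -
  have "0 \<le> norm x * norm y" by simp
  with sum_squares_bound[of "norm x" "norm y"] show ?thesis by linarith
qed

lemma square_integrable_inner:
  assumes "square_integrable f" "square_integrable g"
  shows "integrable lebesgue (\<lambda>x. f x \<bullet> g x)"
proof -
  have [measurable]: "f \<in> borel_measurable lebesgue" "g \<in> borel_measurable lebesgue"
    using assms by (auto simp: square_integrable_def)
  have bnd: "integrable lebesgue (\<lambda>x. (norm (f x))\<^sup>2 + (norm (g x))\<^sup>2)"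
    using assms by (auto simp: square_integrable_def)
  have le: "\<bar>f x \<bullet> g x\<bar> \<le> (norm (f x))\<^sup>2 + (norm (g x))\<^sup>2" for x
    using Cauchy_Schwarz_ineq2 norm_mult_le_sum_squares by (rule order_trans)
  show ?thesis
    by (rule Bochner_Integration.integrable_bound[OF bnd]) (use le in simp_all)
qed

lift_definition hprod :: "('n::finite, 'm::finite) L2 \<Rightarrow> ('n, 'm) L2 \<Rightarrow> complex"
  is "\<lambda>f g. \<integral>x. (\<Sum>i\<in>UNIV. f x $ i * cnj (g x $ i)) \<partial>lebesgue"
proof -
  fix f f' g g' :: "real^'n \<Rightarrow> complex^'m"
  assume fg: "L2_rel f f'" "L2_rel g g'"
  then have "AE x in lebesgue. (\<Sum>i\<in>UNIV. f x $ i * cnj (g x $ i)) =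
      (\<Sum>i\<in>UNIV. f' x $ i * cnj (g' x $ i))"
    unfolding L2_rel_def by (auto elim: eventually_elim2)
  moreover have [measurable]: "f \<in> borel_measurable lebesgue" "g \<in> borel_measurable lebesgue"
    "f' \<in> borel_measurable lebesgue" "g' \<in> borel_measurable lebesgue"
    using fg by (auto simp: L2_rel_def square_integrable_def)
  have comp [measurable]: "(\<lambda>x. h x $ i) \<in> borel_measurable lebesgue"
    if [measurable]: "h \<in> borel_measurable lebesgue" for h :: "real^'n \<Rightarrow> complex^'m" and i
    by (intro borel_measurable_continuous_on[OF linear_continuous_on[OF bounded_linear_vec_nth]]) auto
  have cnjm [measurable]: "(\<lambda>x. cnj (h x)) \<in> borel_measurable lebesgue"
    if [measurable]: "h \<in> borel_measurable lebesgue" for h :: "real^'n \<Rightarrow> complex"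
    by (intro borel_measurable_continuous_on[OF linear_continuous_on[OF bounded_linear_cnj]]) auto
  ultimately show "(\<integral>x. (\<Sum>i\<in>UNIV. f x $ i * cnj (g x $ i)) \<partial>lebesgue) =
      (\<integral>x. (\<Sum>i\<in>UNIV. f' x $ i * cnj (g' x $ i)) \<partial>lebesgue)"
    by (intro integral_cong_AE) measurable
qed

lift_definition scaleC_L2 :: "complex \<Rightarrow> ('n::finite, 'm::finite) L2 \<Rightarrow> ('n, 'm) L2"
  is "\<lambda>c f x. c *s f x"
  by (auto simp: L2_rel_def square_integrable_scaleC)

lemma Re_integral_hermitian:
  fixes f g :: "real^'n \<Rightarrow> complex^'m"
  assumes fg: "square_integrable f" "square_integrable g"
  shows "Re (\<integral>x. (\<Sum>i\<in>UNIV. f x $ i * cnj (g x $ i)) \<partial>lebesgue) = (\<integral>x. f x \<bullet> g x \<partial>lebesgue)"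
proof -
  have [measurable]: "f \<in> borel_measurable lebesgue" "g \<in> borel_measurable lebesgue"
    using fg by (auto simp: L2_rel_def square_integrable_def)
  have comp [measurable]: "(\<lambda>x. h x $ i) \<in> borel_measurable lebesgue"
    if [measurable]: "h \<in> borel_measurable lebesgue" for h :: "real^'n \<Rightarrow> complex^'m" and i
    by (intro borel_measurable_continuous_on[OF linear_continuous_on[OF bounded_linear_vec_nth]]) auto
  have cnjm [measurable]: "(\<lambda>x. cnj (h x)) \<in> borel_measurable lebesgue"
    if [measurable]: "h \<in> borel_measurable lebesgue" for h :: "real^'n \<Rightarrow> complex"
    by (intro borel_measurable_continuous_on[OF linear_continuous_on[OF bounded_linear_cnj]]) auto
  have bnd: "integrable lebesgue (\<lambda>x. (norm (f x))\<^sup>2 + (norm (g x))\<^sup>2)"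
    using fg by (auto simp: L2_rel_def square_integrable_def)
  have "integrable lebesgue (\<lambda>x. f x $ i * cnj (g x $ i))" for i
  proof (rule Bochner_Integration.integrable_bound[OF bnd])
    show "(\<lambda>x. f x $ i * cnj (g x $ i)) \<in> borel_measurable lebesgue" by measurable
    have "cmod (f x $ i) * cmod (g x $ i) \<le> (norm (f x))\<^sup>2 + (norm (g x))\<^sup>2" for x
    proof -
      have "cmod (f x $ i) * cmod (g x $ i) \<le> norm (f x) * norm (g x)"
        by (intro mult_mono Finite_Cartesian_Product.norm_nth_le) auto
      also have "\<dots> \<le> (norm (f x))\<^sup>2 + (norm (g x))\<^sup>2"
        by (rule norm_mult_le_sum_squares)
      finally show ?thesis .
    qed
    then show "AE x in lebesgue. norm (f x $ i * cnj (g x $ i)) \<le>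
        norm ((norm (f x))\<^sup>2 + (norm (g x))\<^sup>2)"
      by (simp add: norm_mult)
  qed
  then have "integrable lebesgue (\<lambda>x. \<Sum>i\<in>UNIV. f x $ i * cnj (g x $ i))"
    by simp
  then have "Re (\<integral>x. (\<Sum>i\<in>UNIV. f x $ i * cnj (g x $ i)) \<partial>lebesgue) =
      (\<integral>x. Re (\<Sum>i\<in>UNIV. f x $ i * cnj (g x $ i)) \<partial>lebesgue)"
    by (simp only: integral_Re)
  also have "\<dots> = (\<integral>x. f x \<bullet> g x \<partial>lebesgue)"
    by (simp add: inner_vec_def inner_complex_def)
  finally show ?thesis .
qed

instantiation L2 :: (finite, finite) real_vector
begin

lift_definition zero_L2 :: "('a, 'b) L2" is "\<lambda>x. 0"
  by (auto simp: L2_rel_def square_integrable_zero)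

lift_definition plus_L2 :: "('a, 'b) L2 \<Rightarrow> ('a, 'b) L2 \<Rightarrow> ('a, 'b) L2"
  is "\<lambda>f g x. f x + g x"
  by (auto simp: L2_rel_def square_integrable_add elim: eventually_elim2)

lift_definition scaleR_L2 :: "real \<Rightarrow> ('a, 'b) L2 \<Rightarrow> ('a, 'b) L2"
  is "\<lambda>r f x. r *\<^sub>R f x"
  by (auto simp: L2_rel_def square_integrable_scaleR)

lift_definition uminus_L2 :: "('a, 'b) L2 \<Rightarrow> ('a, 'b) L2" is "\<lambda>f x. - f x"
  by (auto simp: L2_rel_def square_integrable_def)

lift_definition minus_L2 :: "('a, 'b) L2 \<Rightarrow> ('a, 'b) L2 \<Rightarrow> ('a, 'b) L2"
  is "\<lambda>f g x. f x - g x"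
  by (auto simp: L2_rel_def square_integrable_diff elim: eventually_elim2)

instance
proof
  fix u v w :: "('a, 'b) L2" and r s :: real
  show "u + v + w = u + (v + w)"
    by transfer (auto simp: L2_rel_def square_integrable_add add.assoc)
  show "u + v = v + u"
    by transfer (auto simp: L2_rel_def square_integrable_add add.commute)
  show "0 + u = u"
    by transfer (auto simp: L2_rel_def square_integrable_add)
  show "- u + u = 0"
    by transfer (auto simp: L2_rel_def square_integrable_zero)
  show "u - v = u + - v"
    by transfer (auto simp: L2_rel_def square_integrable_diff)
  show "r *\<^sub>R (u + v) = r *\<^sub>R u + r *\<^sub>R v"
    by transfer (auto simp: L2_rel_def square_integrable_add square_integrable_scaleR scaleR_add_right)
  show "(r + s) *\<^sub>R u = r *\<^sub>R u + s *\<^sub>R u"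
    by transfer (auto simp: L2_rel_def square_integrable_add square_integrable_scaleR scaleR_add_left)
  show "r *\<^sub>R s *\<^sub>R u = (r * s) *\<^sub>R u"
    by transfer (auto simp: L2_rel_def square_integrable_scaleR)
  show "1 *\<^sub>R u = u"
    by transfer (auto simp: L2_rel_def)
qed

end

lemma Re_hprod_eq_0_iff: "Re (hprod u u) = 0 \<longleftrightarrow> u = 0"
proof transfer
  fix f :: "real^'n \<Rightarrow> complex^'m"
  assume "L2_rel f f"
  then have f: "square_integrable f" by (simp add: L2_rel_def)
  have "(\<integral>x. f x \<bullet> f x \<partial>lebesgue) = 0 \<longleftrightarrow> (AE x in lebesgue. f x \<bullet> f x = 0)"
    by (intro integral_nonneg_eq_0_iff_AE square_integrable_inner f) auto
  then show "Re (\<integral>x. (\<Sum>i\<in>UNIV. f x $ i * cnj (f x $ i)) \<partial>lebesgue) = 0 \<longleftrightarrow> L2_rel f (\<lambda>x. 0)"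
    using f by (simp add: L2_rel_def square_integrable_zero Re_integral_hermitian)
qed

instantiation L2 :: (finite, finite) real_inner
begin

definition norm_L2 :: "('a, 'b) L2 \<Rightarrow> real" where
  "norm_L2 u = sqrt (Re (hprod u u))"

definition dist_L2 :: "('a, 'b) L2 \<Rightarrow> ('a, 'b) L2 \<Rightarrow> real" where
  "dist_L2 u v = norm (u - v)"

definition sgn_L2 :: "('a, 'b) L2 \<Rightarrow> ('a, 'b) L2" where
  "sgn_L2 u = u /\<^sub>R norm u"

definition uniformity_L2 :: "(('a, 'b) L2 \<times> ('a, 'b) L2) filter" where
  "uniformity_L2 = (INF e\<in>{0<..}. principal {(u, v). dist u v < e})"

definition inner_L2 :: "('a, 'b) L2 \<Rightarrow> ('a, 'b) L2 \<Rightarrow> real" where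
  "inner_L2 u v = Re (hprod u v)"

definition open_L2 :: "('a, 'b) L2 set \<Rightarrow> bool" where
  "open_L2 U \<longleftrightarrow> (\<forall>u\<in>U. eventually (\<lambda>(u', v). u' = u \<longrightarrow> v \<in> U) uniformity)"

instance
proof
  fix u v w :: "('a, 'b) L2" and r s :: real and U :: "('a, 'b) L2 set"
  show "dist u v = norm (u - v)"
    by (rule dist_L2_def)
  show "sgn u = u /\<^sub>R norm u"
    by (rule sgn_L2_def)
  show "(uniformity :: (('a, 'b) L2 \<times> ('a, 'b) L2) filter) =
      (INF e\<in>{0<..}. principal {(u, v). dist u v < e})"
    by (rule uniformity_L2_def)
  show "open U \<longleftrightarrow> (\<forall>u\<in>U. \<forall>\<^sub>F (u', v) in uniformity. u' = u \<longrightarrow> v \<in> U)"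
    by (rule open_L2_def)
  show "u \<bullet> v = v \<bullet> u"
    unfolding inner_L2_def
    by transfer (simp add: L2_rel_def Re_integral_hermitian inner_commute)
  show "(u + v) \<bullet> w = u \<bullet> w + v \<bullet> w"
    unfolding inner_L2_def
  proof transfer
    fix f g h :: "real^'a \<Rightarrow> complex^'b"
    assume "L2_rel f f" "L2_rel g g" "L2_rel h h"
    then have fgh: "square_integrable f" "square_integrable g" "square_integrable h"
      by (simp_all add: L2_rel_def)
    note [simp del] = vector_add_component
    show "Re (\<integral>x. (\<Sum>i\<in>UNIV. (f x + g x) $ i * cnj (h x $ i)) \<partial>lebesgue) =
        Re (\<integral>x. (\<Sum>i\<in>UNIV. f x $ i * cnj (h x $ i)) \<partial>lebesgue) +
        Re (\<integral>x. (\<Sum>i\<in>UNIV. g x $ i * cnj (h x $ i)) \<partial>lebesgue)"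
      using fgh by (simp add: Re_integral_hermitian square_integrable_add inner_add_left
          square_integrable_inner)
  qed
  show "r *\<^sub>R u \<bullet> v = r * (u \<bullet> v)"
    unfolding inner_L2_def
  proof transfer
    fix r and f g :: "real^'a \<Rightarrow> complex^'b"
    assume "L2_rel f f" "L2_rel g g"
    then have fg: "square_integrable f" "square_integrable g"
      by (simp_all add: L2_rel_def)
    note [simp del] = vector_scaleR_component
    show "Re (\<integral>x. (\<Sum>i\<in>UNIV. (r *\<^sub>R f x) $ i * cnj (g x $ i)) \<partial>lebesgue) =
        r * Re (\<integral>x. (\<Sum>i\<in>UNIV. f x $ i * cnj (g x $ i)) \<partial>lebesgue)"
      using fg by (simp add: Re_integral_hermitian square_integrable_scaleR)
  qed
  show "0 \<le> u \<bullet> u"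
    unfolding inner_L2_def
    by transfer (simp add: L2_rel_def Re_integral_hermitian)
  show "u \<bullet> u = 0 \<longleftrightarrow> u = 0"
    by (simp add: inner_L2_def Re_hprod_eq_0_iff)
  show "norm u = sqrt (u \<bullet> u)"
    by (simp add: norm_L2_def inner_L2_def)
qed

end

section \<open>Distributional derivatives\<close>

definition partial_deriv :: "'n \<Rightarrow> (real^'n \<Rightarrow> real) \<Rightarrow> real^'n \<Rightarrow> real" where
  "partial_deriv j \<phi> x = frechet_derivative \<phi> (at x) (axis j 1)"

primrec times_cont_diff :: "nat \<Rightarrow> (real^'n \<Rightarrow> real) \<Rightarrow> bool" where
  "times_cont_diff 0 \<phi> \<longleftrightarrow> continuous_on UNIV \<phi>"
| "times_cont_diff (Suc k) \<phi> \<longleftrightarrow>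
     \<phi> differentiable_on UNIV \<and> (\<forall>j. times_cont_diff k (partial_deriv j \<phi>))"

definition test_function :: "(real^'n \<Rightarrow> real) \<Rightarrow> bool" where
  "test_function \<phi> \<longleftrightarrow>
     (\<forall>k. times_cont_diff k \<phi>) \<and> compact (closure {x. \<phi> x \<noteq> 0})"

text \<open>The distributions \<open>u\<close> and \<open>\<partial>\<^sub>j u\<close> evaluated at a (real-valued) test function.\<close>

definition distribution :: "('n::finite, 'm::finite) L2 \<Rightarrow> (real^'n \<Rightarrow> real) \<Rightarrow> complex^'m" where
  "distribution u \<phi> = (\<integral>x. \<phi> x *\<^sub>R rep_L2 u x \<partial>lebesgue)"

definition distribution_partial ::
  "'n \<Rightarrow> ('n::finite, 'm::finite) L2 \<Rightarrow> (real^'n \<Rightarrow> real) \<Rightarrow> complex^'m" where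
  "distribution_partial j u \<phi> = - distribution u (partial_deriv j \<phi>)"

definition has_weak_gradient :: "('n::finite, 'm::finite) L2 \<Rightarrow> ('n, 'm) L2 ^ 'n \<Rightarrow> bool" where
  "has_weak_gradient u g \<longleftrightarrow>
     (\<forall>\<phi>. test_function \<phi> \<longrightarrow> (\<forall>j. distribution (g $ j) \<phi> = distribution_partial j u \<phi>))"

section \<open>Operators\<close>

text \<open>An unbounded operator is given by its domain \<open>domD\<close> and a total function \<open>D\<close>,
  of which only the values on \<open>domD\<close> matter.\<close>

definition densely_defined_operator ::
  "('n::finite, 'm::finite) L2 set \<Rightarrow> (('n, 'm) L2 \<Rightarrow> ('n, 'm) L2) \<Rightarrow> bool" where
  "densely_defined_operator domD D \<longleftrightarrow>
     0 \<in> domD \<and>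
     (\<forall>u\<in>domD. \<forall>v\<in>domD. u + v \<in> domD \<and> D (u + v) = D u + D v) \<and>
     (\<forall>c. \<forall>u\<in>domD. scaleC_L2 c u \<in> domD \<and> D (scaleC_L2 c u) = scaleC_L2 c (D u)) \<and>
     closure domD = UNIV"

definition adjoint_graph ::
  "('n::finite, 'm::finite) L2 set \<Rightarrow> (('n, 'm) L2 \<Rightarrow> ('n, 'm) L2) \<Rightarrow>
   (('n, 'm) L2 \<times> ('n, 'm) L2) set" where
  "adjoint_graph domD D = {(v, w). \<forall>u\<in>domD. hprod (D u) v = hprod u w}"

definition self_adjoint_operator ::
  "('n::finite, 'm::finite) L2 set \<Rightarrow> (('n, 'm) L2 \<Rightarrow> ('n, 'm) L2) \<Rightarrow> bool" where
  "self_adjoint_operator domD D \<longleftrightarrow>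
     densely_defined_operator domD D \<and> adjoint_graph domD D = {(u, D u) | u. u \<in> domD}"

text \<open>\<open>D u = (\<Sum>j. A\<^sub>j \<partial>\<^sub>j u) + A\<^sub>0 u\<close> in the sense of distributions. The domain is not
  prescribed; a self-adjoint \<open>D\<close> of this kind automatically has the maximal domain, since the
  maximal operator is a Fourier multiplier.\<close>

definition first_order_const_coeff_operator ::
  "('n::finite, 'm::finite) L2 set \<Rightarrow> (('n, 'm) L2 \<Rightarrow> ('n, 'm) L2) \<Rightarrow> bool" where
  "first_order_const_coeff_operator domD D \<longleftrightarrow>
     (\<exists>(A :: 'n \<Rightarrow> complex^'m^'m) (A0 :: complex^'m^'m). \<forall>u\<in>domD. \<forall>\<phi>. test_function \<phi> \<longrightarrow>
        distribution (D u) \<phi> = (\<Sum>j\<in>UNIV. A j *v distribution_partial j u \<phi>) + A0 *v distribution u \<phi>)"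

definition matrix_multiplication_operator ::
  "(('n::finite, 'm::finite) L2 \<Rightarrow> ('n, 'm) L2) \<Rightarrow> bool" where
  "matrix_multiplication_operator B \<longleftrightarrow>
     (\<exists>b :: real^'n \<Rightarrow> complex^'m^'m. \<forall>u. AE x in lebesgue. rep_L2 (B u) x = b x *v rep_L2 u x)"

text \<open>\<open>(I + t\<^sup>2 BDBD)\<^sup>-\<^sup>1\<close>, the inverse of \<open>I + t\<^sup>2 BDBD\<close> on the natural domain of the
  composition \<open>BDBD\<close>.\<close>

definition resolvent_BDBD ::
  "('n::finite, 'm::finite) L2 set \<Rightarrow> (('n, 'm) L2 \<Rightarrow> ('n, 'm) L2) \<Rightarrow>
   (('n, 'm) L2 \<Rightarrow> ('n, 'm) L2) \<Rightarrow> real \<Rightarrow> ('n, 'm) L2 \<Rightarrow> ('n, 'm) L2" where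
  "resolvent_BDBD domD D B t =
     inv_into {w \<in> domD. B (D w) \<in> domD} (\<lambda>w. w + t\<^sup>2 *\<^sub>R B (D (B (D w))))"

end

theory Submission
 imports Defs "HOL-Analysis.Analysis"
begin

text \<open>
 The proof follows the argument of Auscher, Axelsson and McIntosh for Dirac operators of Kato type,
 with all square functions discretised at the scales \<open>t = 2\<^sup>-\<^sup>k\<close>.

 \<^emph>\<open>Reduction.\<close> Write \<open>P\<^sub>t = (I + t\<^sup>2BDBD)\<^sup>-\<^sup>1\<close> and \<open>Q\<^sub>t = tBDP\<^sub>t\<close>. As \<open>D\<close> is self-adjoint and \<open>B\<close>
 accretive on its range, the resolvents of \<open>BD\<close> on the imaginary axis are uniformly bounded, and \<open>P\<^sub>t\<close>,
 \<open>Q\<^sub>t\<close> are their combinations. The norms of \<open>Q\<^sub>tu\<close> on a dyadic interval of \<open>t\<close> are comparable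
 (\<open>QQ_comparable\<close>), and coercivity gives decay for \<open>t > 1\<close> (\<open>QQ_decay\<close>), so it suffices to sum over
 \<open>t = 2\<^sup>-\<^sup>k \<le> 1\<close>. Splitting \<open>u = P\<^sub>1u + B(DQ\<^sub>1u)\<close>, the first part is harmless, since
 \<open>Q\<^sub>tP\<^sub>1 = tP\<^sub>tQ\<^sub>1\<close>, and there remains \<open>\<Theta>\<^sub>k = Q\<^sub>tB\<close>, applied to vectors in the range of \<open>D\<close>.

 \<^emph>\<open>Principal part.\<close> Since \<open>D\<close> is a differential operator and \<open>B\<close> a multiplication, \<open>\<Theta>\<^sub>k\<close> decays off the
 diagonal at scale \<open>t\<close> (\<open>weighted_QQ\<close>). It is compared with \<open>\<Gamma>\<^sub>k = \<gamma>\<^sub>kE\<^sub>k\<close>: take the means \<open>E\<^sub>ku\<close> over the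
 dyadic cubes of side \<open>t\<close>, and apply \<open>\<Theta>\<^sub>k\<close> to the resulting constants. For the
 unperturbed resolvent \<open>S\<^sub>t = (I + t\<^sup>2D\<^sup>2)\<^sup>-\<^sup>1\<close> and \<open>v\<close> in the range of \<open>D\<close>,
 \<open>\<Theta>\<^sub>kv - \<Gamma>\<^sub>kv = \<Theta>\<^sub>k(v - S\<^sub>tv) + (\<Theta>\<^sub>k - \<Gamma>\<^sub>k)S\<^sub>tv - \<Gamma>\<^sub>k(v - S\<^sub>tv)\<close>. The first term is controlled by \<open>tDS\<^sub>tv\<close>
 algebraically, the second by a Poincare type inequality (\<open>principal_part\<close>) and the hypothesis
 on the gradient, the third by almost orthogonality (\<open>Eop_block\<close>). As
 \<open>\<Sum>\<^sub>k \<parallel>tDS\<^sub>tv\<parallel>\<^sup>2 \<lesssim> \<parallel>v\<parallel>\<^sup>2\<close> by a telescoping sum, the differences are square summable (\<open>difference_sum\<close>).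

 \<^emph>\<open>Carleson measure.\<close> By the dyadic Carleson embedding theorem, \<open>\<Sum>\<^sub>k \<parallel>\<gamma>\<^sub>kE\<^sub>kv\<parallel>\<^sup>2 \<lesssim> \<parallel>v\<parallel>\<^sup>2\<close> follows if
 \<open>|\<gamma>\<^sub>k|\<^sup>2\<close> satisfies a packing condition. The rows of \<open>\<gamma>\<^sub>k\<close> are sorted into finitely many narrow
 cones around unit vectors \<open>\<nu>\<close>. For each cube of side \<open>l\<close>, the function
 \<open>f = (I - sDQ\<^sub>sB)(\<chi>\<nu>)\<close> with \<open>s = \<epsilon>l\<close>, where \<open>\<chi>\<close> is the indicator of a ball around the cube, has mean close to
 \<open>\<nu>\<close> on the cube because a derivative has small mean, while \<open>Bf = P\<^sub>sB(\<chi>\<nu>)\<close> varies at the scale \<open>l\<close>,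
 so that \<open>\<gamma>\<^sub>kE\<^sub>kf\<close> is square summable on the cube (\<open>test_functions\<close>). A stopping time
 argument turns this into the packing condition (\<open>carleson_from_tests\<close>).\<close>

text \<open>Integrals over \<open>real^'n\<close> are taken with respect to \<open>lborel\<close>: \<open>NN\<close> denotes the non-negative one, \<open>LI\<close> that of
integrable functions. The squared norm occurs so often that it gets a name, \<open>sq\<close>.\<close>

notation scaleR (infixr "*R" 75)

abbreviation tends :: "(nat => 'a::topological_space) => 'a => bool" (infix "---->" 60) where
 "X ----> l == X \<longlonglongrightarrow> l"

abbreviation nnint :: "('a::euclidean_space => ennreal) => ennreal" (binder "NN " 10) where
 "nnint f == nn_integral lborel f"

abbreviation lbint :: "('a::euclidean_space => 'b::{banach, second_countable_topology}) => 'b" (binder "LI " 10) where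
 "lbint f == integral\<^sup>L lborel f"

abbreviation bfun :: "('a::topological_space => 'b::topological_space) set" where
 "bfun == borel_measurable borel"

abbreviation esq :: "'a::real_normed_vector => ennreal" where
 "esq x == ennreal ((norm x)\<^sup>2)"

abbreviation sq :: "'a::real_normed_vector => real" where
 "sq x == (norm x)\<^sup>2"

section \<open>Square integrable functions\<close>

definition sqint :: "(real^'n => complex^'m) => bool" where
 "sqint f \<longleftrightarrow> f : bfun \<and> integrable lborel (%x. sq (f x))"

lemma sqint_integrable: "sqint f ==> integrable lborel (%x. sq (f x))" by (simp add: sqint_def)

lemma sqint_iff_nn:
 assumes "f : bfun"
 shows "sqint f \<longleftrightarrow> (NN x. esq (f x)) < \<infinity>"
 using assms by (auto simp: sqint_def integrable_iff_bounded)

lemma sqint_imp_square_integrable: "sqint f ==> square_integrable f" unfolding sqint_def square_integrable_def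
 by (auto simp: integrable_completion intro: measurable_completion)

lemma ex_borel_version:
 fixes f :: "real^'n => 'b::euclidean_space"
 assumes f: "f : borel_measurable lebesgue"
 shows "\<exists>g\<in>bfun. AE x in lborel. f x = g x"
proof -
 have "\<exists>g\<in>borel_measurable lborel. AE x in lborel. f x \<bullet> b = g x" for b
  by (rule completion_ex_borel_measurable_real) (use f in measurable)
 then obtain g where g: "!!b. g b : borel_measurable lborel" "!!b. AE x in lborel. f x \<bullet> b = g b x" by metis
 have gm: "!!b. g b : bfun" using g(1) by simp
 have "AE x in lborel. \<forall>b\<in>Basis. f x \<bullet> b = g b x" by (intro AE_finite_allI) (auto simp: g)
 then have "AE x in lborel. f x = (\<Sum>b\<in>Basis. g b x *R b)"
  by eventually_elim (auto simp: euclidean_eq_iff[where 'a='b])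
 moreover have "(%x. \<Sum>b\<in>Basis. g b x *R b) : bfun"
  by (intro borel_measurable_sum borel_measurable_scaleR gm borel_measurable_const)
 ultimately show ?thesis by (rule rev_bexI[rotated])
qed

lemma L2_rel_rep: "L2_rel (rep_L2 u) (rep_L2 u)" using Quotient_rep_reflp[OF Quotient_L2] .

text \<open>Representatives are chosen Borel measurable, so that integrals over products and translates can be
formed with respect to \<open>lborel\<close>.\<close>

definition fn :: "('n::finite, 'm::finite) L2 => real^'n => complex^'m" where
 "fn u = (SOME f. f : bfun \<and> (AE x in lborel. rep_L2 u x = f x))"

definition mk :: "(real^'n => complex^'m) => ('n::finite, 'm::finite) L2" where
 "mk f = abs_L2 f"

lemma fn_props: "fn u : bfun \<and> (AE x in lborel. rep_L2 u x = fn u x)"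
proof -
 have "\<exists>f. f : bfun \<and> (AE x in lborel. rep_L2 u x = f x)"
  using ex_borel_version[of "rep_L2 u"] L2_rel_rep[of u] unfolding L2_rel_def square_integrable_def by blast
 from someI_ex[OF this] show ?thesis unfolding fn_def .
qed

lemma fn_measurable [measurable]: "fn u : bfun" using fn_props by blast

lemma fn_rep: "AE x in lborel. rep_L2 u x = fn u x" using fn_props by blast

lemma sqint_fn: "sqint (fn u)"
proof -
 have "square_integrable (rep_L2 u)" using L2_rel_rep by (auto simp: L2_rel_def)
 then have i: "integrable lebesgue (%x. sq (rep_L2 u x))" and [measurable]: "rep_L2 u : borel_measurable lebesgue"
  by (auto simp: square_integrable_def)
 have [measurable]: "fn u : borel_measurable lebesgue" by (simp add: measurable_completion)
 have "integrable lebesgue (%x. sq (fn u x))"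
  by (rule integrable_cong_AE_imp[OF i]) (use fn_rep[of u] in "auto simp: AE_completion_iff")
 then show ?thesis by (simp add: sqint_def integrable_completion)
qed

lemma mk_cong_AE:
 assumes "sqint f" "square_integrable g" "AE x in lborel. f x = g x"
 shows "abs_L2 f = abs_L2 g"
 using assms Quotient_rel_abs[OF Quotient_L2, of f g]
 by (auto simp: L2_rel_def AE_completion_iff sqint_imp_square_integrable)

lemma mk_fn [simp]: "mk (fn u) = u"
proof -
 have "abs_L2 (fn u) = abs_L2 (rep_L2 u)"
  by (rule mk_cong_AE) (use fn_rep[of u] L2_rel_rep[of u] sqint_fn[of u] in "auto simp: L2_rel_def elim: eventually_mono")
 then show ?thesis unfolding mk_def using Quotient_abs_rep[OF Quotient_L2] by simp
qed

lemma fn_mk: assumes "sqint f" shows "AE x in lborel. fn (mk f) x = f x"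
proof -
 have "L2_rel f f" using assms by (simp add: L2_rel_def sqint_imp_square_integrable)
 then have "L2_rel (rep_L2 (abs_L2 f)) f" using Quotient_rep_abs[OF Quotient_L2] by blast
 then have "AE x in lborel. rep_L2 (abs_L2 f) x = f x" by (simp add: L2_rel_def AE_completion_iff)
 with fn_rep[of "abs_L2 f"] show ?thesis unfolding mk_def by eventually_elim simp
qed

lemma mk_eqI:
 assumes "sqint f" "sqint g" "AE x in lborel. f x = g x"
 shows "mk f = mk g"
 unfolding mk_def by (rule mk_cong_AE) (use assms sqint_imp_square_integrable in auto)

lemma L2_eqI: assumes "AE x in lborel. fn u x = fn v x" shows "u = v" using mk_eqI[OF sqint_fn sqint_fn assms] by simp

lemma rep_abs_AE: assumes "square_integrable f" shows "AE x in lebesgue. rep_L2 (abs_L2 f) x = f x"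
proof -
 have "L2_rel f f" using assms by (simp add: L2_rel_def)
 then have "L2_rel (rep_L2 (abs_L2 f)) f" using Quotient_rep_abs[OF Quotient_L2] by blast
 then show ?thesis by (simp add: L2_rel_def AE_completion_iff)
qed

lemma sq_int_rep: "square_integrable (rep_L2 u)" using L2_rel_rep[of u] by (simp add: L2_rel_def)

lemma fn_abs: "square_integrable f ==> AE x in lborel. fn (abs_L2 f) x = f x"
 using rep_abs_AE[of f] fn_rep[of "abs_L2 f"] unfolding AE_completion_iff by (auto elim: eventually_elim2)

lemma fn_zero: "AE x in lborel. fn 0 x = 0" unfolding zero_L2_def using fn_abs[OF square_integrable_zero] by simp

lemma fn_add: "AE x in lborel. fn (u + v) x = fn u x + fn v x"
 using fn_abs[OF square_integrable_add[OF sq_int_rep[of u] sq_int_rep[of v]]] fn_rep[of u] fn_rep[of v]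
 unfolding plus_L2_def map_fun_def o_def id_def by eventually_elim simp

lemma fn_diff: "AE x in lborel. fn (u - v) x = fn u x - fn v x"
 using fn_abs[OF square_integrable_diff[OF sq_int_rep[of u] sq_int_rep[of v]]] fn_rep[of u] fn_rep[of v]
 unfolding minus_L2_def map_fun_def o_def id_def by eventually_elim simp

lemma fn_scaleR: "AE x in lborel. fn (r *R u) x = r *R fn u x"
 using fn_abs[OF square_integrable_scaleR[OF sq_int_rep[of u], of r]] fn_rep[of u]
 unfolding scaleR_L2_def map_fun_def o_def id_def by eventually_elim simp

lemma fn_scaleC: "AE x in lborel. fn (scaleC_L2 c u) x = c *s fn u x"
 using fn_abs[OF square_integrable_scaleC[OF sq_int_rep[of u], of c]] fn_rep[of u]
 unfolding scaleC_L2_def map_fun_def o_def id_def by eventually_elim simp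

lemma fn_sum: "finite I ==> AE x in lborel. fn (sum u I) x = (\<Sum>i\<in>I. fn (u i) x)"
proof (induction I rule: finite_induct)
 case empty
 then show ?case using fn_zero by simp
next
 case (insert i I)
 then show ?case using fn_add[of "u i" "sum u I"] insert(3) by (auto elim: eventually_elim2)
qed

lemma inner_L2_eq: "u \<bullet> v = (LI x. fn u x \<bullet> fn v x)"
proof -
 have [measurable]: "rep_L2 u : borel_measurable lebesgue" "rep_L2 v : borel_measurable lebesgue"
  using sq_int_rep[of u] sq_int_rep[of v] by (auto simp: square_integrable_def)
 have [measurable]: "fn u : borel_measurable lebesgue" "fn v : borel_measurable lebesgue"
  by (auto simp add: measurable_completion)
 have "u \<bullet> v = Re (\<integral>x. (\<Sum>i\<in>UNIV. rep_L2 u x $ i * cnj (rep_L2 v x $ i)) \<partial>lebesgue)"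
  by (simp add: inner_L2_def hprod_def)
 also have "... = (\<integral>x. rep_L2 u x \<bullet> rep_L2 v x \<partial>lebesgue)"
  by (rule Re_integral_hermitian[OF sq_int_rep sq_int_rep])
 also have "... = (\<integral>x. fn u x \<bullet> fn v x \<partial>lebesgue)"
  by (rule integral_cong_AE) (use fn_rep[of u] fn_rep[of v] in "auto simp: AE_completion_iff elim: eventually_elim2")
 finally show ?thesis by (simp add: integral_completion)
qed

lemma sqint_inner_integrable:
 assumes "sqint f" "sqint g"
 shows "integrable lborel (%x. f x \<bullet> g x)"
 using square_integrable_inner[of f g] assms sqint_imp_square_integrable[of f] sqint_imp_square_integrable[of g]
 by (auto simp: sqint_def integrable_completion)

lemma norm_L2_sq: "sq u = (LI x. sq (fn u x))" by (simp add: power2_norm_eq_inner inner_L2_eq)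

lemma norm_L2_nn: "esq u = (NN x. esq (fn u x))"
 unfolding norm_L2_sq by (rule nn_integral_eq_integral[symmetric]) (use sqint_fn[of u] in "auto simp: sqint_def")

lemma inner_mk: assumes "sqint f" "sqint g" shows "mk f \<bullet> mk g = (LI x. f x \<bullet> g x)"
proof -
 have [measurable]: "f : bfun" "g : bfun" using assms by (auto simp: sqint_def)
 show ?thesis unfolding inner_L2_eq
  by (rule integral_cong_AE) (use fn_mk[OF assms(1)] fn_mk[OF assms(2)] in "auto elim: eventually_elim2")
qed

lemma inner_mk2: assumes "sqint g" shows "u \<bullet> mk g = (LI x. fn u x \<bullet> g x)"
 using inner_mk[OF sqint_fn assms, of u] by simp

lemma norm_mk_nn: assumes "sqint f" shows "esq (mk f) = (NN x. esq (f x))"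
 unfolding norm_L2_nn by (rule nn_integral_cong_AE) (use fn_mk[OF assms] in "auto elim: eventually_mono")

lemma sqint_add: "sqint f ==> sqint g ==> sqint (%x. f x + g x)"
 using square_integrable_add[of f g] sqint_imp_square_integrable[of f] sqint_imp_square_integrable[of g]
 by (auto simp: sqint_def integrable_completion square_integrable_def)

text \<open>A Cauchy sequence has a subsequence whose increments decay so fast that it converges
 almost everywhere; by Fatou's lemma the pointwise limit is the limit in norm.\<close>

lemma L2_Cauchy_convergent:
 fixes X :: "nat => ('n::finite, 'm::finite) L2"
 assumes "Cauchy X"
 shows "convergent X"
proof -
 have "\<exists>N. \<forall>m\<ge>N. \<forall>n\<ge>N. norm (X m - X n) < (1/4)^k" for k
  using CauchyD[OF assms, of "(1/4)^k"] by auto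
 then obtain N where N: "!!k m n. m >= N k ==> n >= N k ==> norm (X m - X n) < (1/4)^k" by metis
 define r where "r k = (\<Sum>i\<le>k. N i)" for k
 have rN: "r k >= N k" for k unfolding r_def by (rule member_le_sum) auto
 have rmono: "r k <= r (Suc k)" for k unfolding r_def by simp
 define g where "g k = fn (X (r k))" for k
 have gm [measurable]: "g k : bfun" for k unfolding g_def by measurable
 have AEd: "AE x in lborel. fn (X (r (Suc k)) - X (r k)) x = g (Suc k) x - g k x" for k unfolding g_def by (rule fn_diff)
 have incr: "(NN x. esq (g (Suc k) x - g k x)) <= ennreal ((1/4)^k)" for k
 proof -
  have "(NN x. esq (g (Suc k) x - g k x))
   = (NN x. esq (fn (X (r (Suc k)) - X (r k)) x))"
   by (rule nn_integral_cong_AE) (use AEd[of k] in "auto elim: eventually_mono")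
  also have "... = esq (X (r (Suc k)) - X (r k))" by (rule norm_L2_nn[symmetric])
  also have "... <= ennreal ((1/4)^k)"
  proof (rule ennreal_leI)
   have a: "norm (X (r (Suc k)) - X (r k)) <= (1/4)^k" using N[of k "r (Suc k)" "r k"] rN[of k] rmono[of k] by linarith
   have "sq (X (r (Suc k)) - X (r k)) <= ((1/4)^k)\<^sup>2" by (rule power_mono[OF a]) simp
   also have "... <= (1/4)^k" by (simp add: power2_eq_square mult_le_one power_le_one mult_left_le)
   finally show "sq (X (r (Suc k)) - X (r k)) <= (1/4)^k" .
  qed
  finally show ?thesis .
 qed
 have "(NN x. (\<Sum>k. ennreal (2^k * sq (g (Suc k) x - g k x))))
   = (\<Sum>k. \<integral>\<^sup>+x. ennreal (2^k * sq (g (Suc k) x - g k x)) \<partial>lborel)"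
  by (rule nn_integral_suminf) measurable
 also have "... <= (\<Sum>k. ennreal ((1/2)^k))"
 proof (intro suminf_le summableI)
  fix k
  have "(NN x. ennreal (2^k * sq (g (Suc k) x - g k x)))
   = ennreal (2^k) * (NN x. esq (g (Suc k) x - g k x))" by (subst nn_integral_cmult[symmetric]) (auto simp: ennreal_mult)
  also have "... <= ennreal (2^k) * ennreal ((1/4)^k)" by (rule mult_left_mono[OF incr]) simp
  also have "... = ennreal ((1/2)^k)" by (simp add: ennreal_mult[symmetric] power_mult_distrib[symmetric] del: ennreal_power)
  finally show "(NN x. ennreal (2^k * sq (g (Suc k) x - g k x))) <= ennreal ((1/2)^k)" .
 qed
 also have "... = ennreal (\<Sum>k. (1/2)^k)" by (rule suminf_ennreal2[OF _ summable_geometric]) simp_all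
 finally have "(NN x. (\<Sum>k. ennreal (2^k * sq (g (Suc k) x - g k x)))) <= ennreal (\<Sum>k. (1/2)^k)" .
 from neq_top_trans[OF ennreal_neq_top this]
 have fin: "(NN x. (\<Sum>k. ennreal (2^k * sq (g (Suc k) x - g k x)))) ~= \<infinity>"
  by (simp only: infinity_ennreal_def not_False_eq_True)
 have "AE x in lborel. (\<Sum>k. ennreal (2^k * sq (g (Suc k) x - g k x))) ~= \<infinity>"
  by (rule nn_integral_PInf_AE[OF _ fin]) measurable
 then have conv: "AE x in lborel. convergent (%k. g k x)"
 proof eventually_elim
  case (elim x)
  define c where "c k = 2^k * sq (g (Suc k) x - g k x)" for k
  define F where "F = (\<Sum>k. ennreal (c k))"
  have Ffin: "F ~= top" using elim unfolding F_def c_def by (simp only: infinity_ennreal_def not_False_eq_True)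
  define C where "C = enn2real F"
  have le: "c k <= C" for k
  proof -
   have "ennreal (c k) <= F" unfolding F_def using sum_le_suminf[OF summableI, of "{k}" "%k. ennreal (c k)"] by simp
   from enn2real_mono[OF this] show ?thesis using Ffin by (simp add: C_def c_def less_top)
  qed
  have C0: "C >= 0" by (simp add: C_def)
  have "norm (g (Suc k) x - g k x) <= sqrt C * (sqrt (1/2))^k" for k
  proof -
   have "sq (g (Suc k) x - g k x) <= C * (1/2)^k" using le[of k] by (simp add: c_def field_simps power_one_over)
   then have "norm (g (Suc k) x - g k x) <= sqrt (C * (1/2)^k)" using real_le_rsqrt by blast
   then show ?thesis by (simp add: real_sqrt_mult real_sqrt_power)
  qed
  moreover have "summable (%k. sqrt C * (sqrt (1/2))^k)"
   by (intro summable_mult summable_geometric) (auto simp: real_sqrt_divide)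
  ultimately have s: "summable (%k. g (Suc k) x - g k x)" by (metis (no_types, lifting) summable_comparison_test')
  have "(%n. \<Sum>k<n. g (Suc k) x - g k x) = (%n. g n x - g 0 x)" using sum_lessThan_telescope[of "%k. g k x"] by simp
  with summable_LIMSEQ[OF s] have "(%n. g n x - g 0 x + g 0 x) ----> suminf (%k. g (Suc k) x - g k x) + g 0 x"
   by (intro tendsto_add tendsto_const) simp
  then show ?case by (auto simp: convergent_def)
 qed
 define h where "h x = lim (%k. g k x)" for x
 have hm [measurable]: "h : bfun" unfolding h_def by (rule borel_measurable_lim_metric) (rule gm)
 have lim: "AE x in lborel. (%k. g k x) ----> h x" using conv by eventually_elim (simp add: h_def convergent_LIMSEQ_iff)
 have fatou: "(NN x. esq (h x - fn u x)) <= ennreal (e\<^sup>2)"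
  if e: "!!j. j >= J ==> norm (X (r j) - u) <= e" for u e J
 proof -
  have "(NN x. esq (h x - fn u x))
   = (NN x. liminf (%j. esq (g j x - fn u x)))"
  proof (rule nn_integral_cong_AE, use lim in eventually_elim)
   case (elim x)
   have "(%j. esq (g j x - fn u x)) ----> esq (h x - fn u x)" by (intro tendsto_ennrealI tendsto_intros elim)
   then show ?case using lim_imp_Liminf[OF sequentially_bot] by metis
  qed
  also have "... <= liminf (%j. \<integral>\<^sup>+x. esq (g j x - fn u x) \<partial>lborel)"
   by (rule nn_integral_liminf) measurable
  also have "... <= ennreal (e\<^sup>2)"
  proof (rule Liminf_le)
   show "\<forall>\<^sub>F j in sequentially. (NN x. esq (g j x - fn u x)) <= ennreal (e\<^sup>2)"
    using eventually_ge_at_top[of J]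
   proof eventually_elim
    case (elim j)
    have "(NN x. esq (g j x - fn u x)) = (NN x. esq (fn (X (r j) - u) x))"
     by (rule nn_integral_cong_AE) (use fn_diff[of "X (r j)" u] in \<open>auto simp: g_def elim: eventually_mono\<close>)
    also have "... = esq (X (r j) - u)" by (rule norm_L2_nn[symmetric])
    also have "... <= ennreal (e\<^sup>2)" using e[OF elim] by (intro ennreal_leI power_mono) auto
    finally show ?case .
   qed
  qed simp
  finally show ?thesis .
 qed
 have diffint: "sqint (%x. h x - fn (X (r 0)) x)"
 proof -
  have "(NN x. esq (h x - fn (X (r 0)) x)) <= ennreal (1\<^sup>2)"
  proof (rule fatou[of 0])
   fix j :: nat
   have "mono r" using rmono by (intro incseq_SucI)
   then have "r j >= r 0" by (simp add: monoD)
   then show "norm (X (r j) - X (r 0)) <= 1" using N[of 0 "r j" "r 0"] rN[of 0] by simp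
  qed
  then have "(NN x. esq (h x - fn (X (r 0)) x)) < \<infinity>" by (rule le_less_trans) simp
  then show ?thesis by (subst sqint_iff_nn) auto
 qed
 then have hs: "sqint h" using sqint_add[OF diffint sqint_fn[of "X (r 0)"]] by simp
 have lim2: "norm (X n - mk h) <= (1/4)^k" if n: "n >= N k" for n k
 proof -
  have "(NN x. esq (h x - fn (X n) x)) <= ennreal (((1/4)^k)\<^sup>2)"
  proof (rule fatou[of k])
   fix j assume "j >= k"
   have "mono r" using rmono by (intro incseq_SucI)
   then have "r j >= r k" using \<open>j \<ge> k\<close> by (simp add: monoD)
   then show "norm (X (r j) - X n) <= (1/4)^k" using N[of k "r j" n] rN[of k] n by simp
  qed
  also have "(NN x. esq (h x - fn (X n) x)) = (NN x. esq (fn (mk h - X n) x))"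
   by (rule nn_integral_cong_AE) (use fn_diff[of "mk h" "X n"] fn_mk[OF hs] in \<open>auto elim: eventually_elim2\<close>)
  also have "... = esq (mk h - X n)" by (rule norm_L2_nn[symmetric])
  finally have "sq (mk h - X n) <= ((1/4)^k)\<^sup>2" by (simp del: ennreal_power)
  then show ?thesis by (metis norm_minus_commute power2_le_imp_le zero_le_divide_1_iff zero_le_numeral zero_le_power)
 qed
 have "X ----> mk h"
 proof (rule LIMSEQ_I)
  fix e :: real assume "e > 0"
  then obtain k where "(1/4)^k < e" using real_arch_pow_inv[of e "1/4"] by auto
  then show "\<exists>no. \<forall>n\<ge>no. norm (X n - mk h) < e"
   using lim2[of k] by (intro exI[of _ "N k"]) (auto intro: le_less_trans)
 qed
 then show ?thesis by (auto simp: convergent_def)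
qed

instance L2 :: (finite, finite) complete_space by standard (rule L2_Cauchy_convergent)

section \<open>Hilbert space geometry\<close>

lemma orthogonal_projection_exists:
 fixes S :: "'a::{real_inner, complete_space} set"
 assumes S: "subspace S" "closed S"
 shows "\<exists>p\<in>S. \<forall>s\<in>S. (x - p) \<bullet> s = 0"
proof -
 define d where "d = Inf ((%s. sq (x - s)) ` S)"
 have ne: "S ~= {}" using S subspace_0 by auto
 have bdd: "bdd_below ((%s. sq (x - s)) ` S)" by (intro bdd_belowI[of _ 0]) auto
 have dle: "d <= sq (x - s)" if "s : S" for s unfolding d_def by (rule cInf_lower) (use that bdd in auto)
 have "\<exists>s\<in>S. sq (x - s) < d + e" if "e > 0" for e
  using cInf_lessD[of "(%s. sq (x - s)) ` S" "d + e"] ne that by (auto simp: d_def)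
 then have "\<exists>s\<in>S. sq (x - s) < d + inverse (real (Suc n))" for n by simp
 then obtain s where s: "!!n. s n : S" "!!n. sq (x - s n) < d + inverse (real (Suc n))" by metis
 have par: "sq (s m - s n) <= 2 * inverse (real (Suc m)) + 2 * inverse (real (Suc n))" for m n
 proof -
  have mid: "(1/2) *R (s m + s n) : S" using S s by (intro subspace_scale subspace_add) auto
  have "sq (s m - s n) = 2 * sq (x - s m) + 2 * sq (x - s n) - 4 * sq (x - (1/2) *R (s m + s n))"
   by (simp add: power2_norm_eq_inner inner_simps inner_commute algebra_simps)
  then have "sq (s m - s n) <= 2 * sq (x - s m) + 2 * sq (x - s n) - 4 * d" using dle[OF mid] by simp
  also have "... <= 2 * (d + inverse (real (Suc m))) + 2 * (d + inverse (real (Suc n))) - 4 * d"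
   using s(2)[of m] s(2)[of n] by (intro diff_mono add_mono mult_left_mono) auto
  finally show ?thesis by (simp add: algebra_simps)
 qed
 have "Cauchy s"
 proof (rule metric_CauchyI)
  fix e :: real assume e: "e > 0"
  obtain M where M: "inverse (real (Suc M)) < e\<^sup>2 / 4" using reals_Archimedean[of "e\<^sup>2/4"] e by auto
  show "\<exists>M. \<forall>m\<ge>M. \<forall>n\<ge>M. dist (s m) (s n) < e"
  proof (intro exI[of _ M] allI impI)
   fix m n assume "m >= M" "n >= M"
   then have "inverse (real (Suc m)) <= inverse (real (Suc M))" "inverse (real (Suc n)) <= inverse (real (Suc M))"
    by (auto intro!: le_imp_inverse_le)
   then have "sq (s m - s n) < e\<^sup>2" using par[of m n] M by linarith
   then show "dist (s m) (s n) < e" using e by (simp add: dist_norm power2_less_imp_less)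
  qed
 qed
 then obtain p where p: "s ----> p" using Cauchy_convergent_iff convergent_def by blast
 have pS: "p : S" using closed_sequentially[OF S(2) _ p] s by auto
 have "(%n. sq (x - s n)) ----> sq (x - p)" by (intro tendsto_intros p)
 moreover have "(%n. d + inverse (real (Suc n))) ----> d + 0" by (intro tendsto_intros LIMSEQ_inverse_real_of_nat)
 ultimately have "sq (x - p) <= d + 0" by (rule LIMSEQ_le) (use s(2) less_imp_le in blast)
 then have min: "sq (x - p) <= sq (x - y)" if "y : S" for y using dle[OF that] by linarith
 have "(x - p) \<bullet> y = 0" if y: "y : S" for y
 proof (cases "y = 0")
  case False
  define c where "c = ((x - p) \<bullet> y) / (y \<bullet> y)"
  have "p + c *R y : S" using S pS y by (intro subspace_add subspace_scale)
  note min[OF this]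
  also have "sq (x - (p + c *R y)) = sq (x - p) + (c\<^sup>2 * (y \<bullet> y) - 2 * c * ((x - p) \<bullet> y))"
   unfolding power2_norm_eq_inner by (simp add: inner_simps inner_commute algebra_simps power2_eq_square)
  finally have "0 <= c\<^sup>2 * (y \<bullet> y) - 2 * c * ((x - p) \<bullet> y)" by linarith
  also have "... = - ((x - p) \<bullet> y)\<^sup>2 / (y \<bullet> y)"
   using False by (simp add: c_def power2_eq_square field_simps)
  finally have "((x - p) \<bullet> y)\<^sup>2 / (y \<bullet> y) <= 0" by simp
  then show ?thesis using False
   by (simp add: divide_le_0_iff) (metis inner_ge_zero inner_eq_zero_iff le_less not_less zero_le_power2 zero_eq_power2)
 qed simp
 with pS show ?thesis by blast
qed

lemma subspace_closure_inner:
 fixes S :: "'a::real_normed_vector set"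
 assumes "subspace S"
 shows "subspace (closure S)"
 unfolding subspace_def
proof (intro conjI ballI allI)
 show "0 : closure S" using subspace_0[OF assms] closure_subset by blast
next
 fix x y assume "x : closure S" "y : closure S"
 then obtain f g where f: "!!n. f n : S" "f ----> x" and g: "!!n. g n : S" "g ----> y" by (auto simp: closure_sequential)
 have "(%n. f n + g n) ----> x + y" by (intro tendsto_add f g)
 then show "x + y : closure S"
  using f g subspace_add[OF assms] unfolding closure_sequential by (intro exI[of _ "%n. f n + g n"]) auto
next
 fix c x assume "x : closure S"
 then obtain f where f: "!!n. f n : S" "f ----> x" by (auto simp: closure_sequential)
 have "(%n. c *R f n) ----> c *R x" by (intro tendsto_intros f)
 then show "c *R x : closure S"
  using f subspace_scale[OF assms] unfolding closure_sequential by (intro exI[of _ "%n. c *R f n"]) auto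
qed

lemma dense_if_orthogonal_trivial:
 fixes S :: "'a::{real_inner, complete_space} set"
 assumes S: "subspace S" and z: "!!x. (!!s. s : S ==> x \<bullet> s = 0) ==> x = 0"
 shows "closure S = UNIV"
proof -
 have "x : closure S" for x
 proof -
  obtain p where p: "p : closure S" "\<forall>s\<in>closure S. (x - p) \<bullet> s = 0"
   using orthogonal_projection_exists[of "closure S" x] S subspace_closure_inner[OF S] by auto
  then have "x - p = 0" by (intro z) (use closure_subset in blast)
  with p show ?thesis by simp
 qed
 then show ?thesis by auto
qed

text \<open>Riesz representation, obtained from the projection onto the kernel of a functional.\<close>

lemma adjoint_vector_exists:
 fixes B :: "'a::{real_inner, complete_space} => 'a"
 assumes B: "bounded_linear B"
 shows "\<exists>y. \<forall>z. B z \<bullet> x = z \<bullet> y"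
proof (cases "\<forall>z. B z \<bullet> x = 0")
 case True
 then show ?thesis by (intro exI[of _ 0]) simp
next
 case False
 then obtain z0 where z0: "B z0 \<bullet> x ~= 0" by blast
 interpret B: bounded_linear B by fact
 define S where "S = {z. B z \<bullet> x = 0}"
 have "subspace S" unfolding S_def subspace_def by (auto simp: B.add B.scaleR B.zero inner_simps)
 moreover have "closed S" unfolding S_def by (intro closed_Collect_eq continuous_intros B.continuous_on)
 ultimately obtain p where p: "p : S" "!!s. s : S ==> (z0 - p) \<bullet> s = 0"
  using orthogonal_projection_exists[of S z0] by blast
 define e where "e = z0 - p"
 have Be: "B e \<bullet> x = B z0 \<bullet> x" using p(1) by (simp add: e_def B.diff inner_simps S_def)
 then have e0: "e ~= 0" using z0 by (auto simp: B.zero)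
 have "B z \<bullet> x = z \<bullet> (((B e \<bullet> x) / (e \<bullet> e)) *R e)" for z
 proof -
  have "z - ((B z \<bullet> x) / (B e \<bullet> x)) *R e : S"
   using z0 Be by (simp add: S_def B.diff B.scaleR inner_simps)
  from p(2)[OF this, folded e_def] have "e \<bullet> z = ((B z \<bullet> x) / (B e \<bullet> x)) * (e \<bullet> e)"
   by (simp add: inner_simps)
  then show ?thesis using e0 z0 Be by (simp add: inner_commute field_simps)
 qed
 then show ?thesis by blast
qed

section \<open>Resolvents of \<open>BD\<close>\<close>

definition tk :: "nat => real" where "tk k = (1/2)^k"

lemma tk_pos [simp]: "tk k > 0" "tk k ~= 0" and tk_Suc: "tk (Suc k) = tk k / 2" and tk_le_1: "tk k <= 1"
 by (auto simp: tk_def power_le_one)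

text \<open>The Hilbert space is treated as a real one; \<open>J\<close> is multiplication by \<open>\<i>\<close>. The assumption \<open>D_adj\<close> says
that the adjoint of the symmetric operator \<open>D\<close> is not larger than \<open>D\<close>.\<close>

locale dirac =
 fixes J :: "'a::{real_inner, complete_space} => 'a"
  and dom :: "'a set" and D B :: "'a => 'a" and \<delta> :: real
 assumes J_lin: "linear J" and JJ [simp]: "J (J x) = - x" and norm_J [simp]: "norm (J x) = norm x"
  and dom_subspace: "subspace dom"
  and dom_dense: "closure dom = UNIV"
  and D_add: "x : dom ==> y : dom ==> D (x + y) = D x + D y"
  and D_scaleR: "x : dom ==> D (r *R x) = r *R D x"
  and J_dom: "x : dom ==> J x : dom" and D_J: "x : dom ==> D (J x) = J (D x)"
  and D_sym: "x : dom ==> y : dom ==> D x \<bullet> y = x \<bullet> D y"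
  and D_adj: "(!!x. x : dom ==> D x \<bullet> v = x \<bullet> w) ==> v : dom \<and> D v = w"
  and B_bl: "bounded_linear B" and B_J: "B (J x) = J (B x)"
  and \<delta>_pos: "\<delta> > 0" and accretive: "x : dom ==> \<delta> * sq (D x) <= B (D x) \<bullet> D x"
begin

lemma J_add: "J (x + y) = J x + J y" and J_scaleR: "J (r *R x) = r *R J x"
 and J_diff: "J (x - y) = J x - J y" and J_minus: "J (- x) = - J x" and J_zero [simp]: "J 0 = 0"
 using J_lin by (simp_all add: linear_add linear_scale linear_diff linear_neg linear_0)

lemma J_isometry: "J x \<bullet> J y = x \<bullet> y"
proof -
 have "sq (J x + J y) = sq (x + y)" by (metis J_add norm_J)
 moreover have "sq (J x) = sq x" "sq (J y) = sq y" by simp_all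
 ultimately show ?thesis unfolding power2_norm_eq_inner by (simp add: inner_simps inner_commute)
qed

lemma J_skew: "J x \<bullet> y = - (x \<bullet> J y)" using J_isometry[of "J x" y] by (simp add: inner_commute)

lemma dom_add: "x : dom ==> y : dom ==> x + y : dom"
 and dom_scaleR: "x : dom ==> r *R x : dom"
 and dom_zero [simp]: "0 : dom"
 and dom_diff: "x : dom ==> y : dom ==> x - y : dom"
 using dom_subspace by (auto intro: subspace_add subspace_scale subspace_0 subspace_diff subspace_neg)

lemma D_diff: "x : dom ==> y : dom ==> D (x - y) = D x - D y"
 using D_add[of x "(-1) *R y"] D_scaleR[of y "-1"] dom_scaleR[of y "-1"] by simp

lemma D_zero [simp]: "D 0 = 0" using D_scaleR[of 0 0] by simp

lemmas B_simps = linear_add[OF bounded_linear.linear[OF B_bl]] linear_scale[OF bounded_linear.linear[OF B_bl]]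
 linear_diff[OF bounded_linear.linear[OF B_bl]] linear_neg[OF bounded_linear.linear[OF B_bl]]
 linear_0[OF bounded_linear.linear[OF B_bl]]

definition Bn :: real where "Bn = onorm B"

lemma B_bound: "norm (B x) <= Bn * norm x" and Bn_nonneg: "Bn >= 0"
 using onorm[OF B_bl] onorm_pos_le[OF B_bl] by (auto simp: Bn_def)

lemma D_closed:
 assumes "!!n. w n : dom" "w ----> x" "(%n. D (w n)) ----> z"
 shows "x : dom \<and> D x = z"
proof (rule D_adj)
 fix y assume y: "y : dom"
 have "(%n. D y \<bullet> w n) ----> D y \<bullet> x" "(%n. y \<bullet> D (w n)) ----> y \<bullet> z"
  by (intro tendsto_intros assms)+
 moreover have "(%n. D y \<bullet> w n) = (%n. y \<bullet> D (w n))" using D_sym y assms(1) by auto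
 ultimately show "D y \<bullet> x = y \<bullet> z" using LIMSEQ_unique by metis
qed

lemma coercive: "x : dom ==> \<delta> * norm (D x) <= norm (B (D x))"
proof -
 assume x: "x : dom"
 have "\<delta> * sq (D x) <= norm (B (D x)) * norm (D x)"
  using accretive[OF x] Cauchy_Schwarz_ineq2[of "B (D x)" "D x"] by linarith
 then show ?thesis by (cases "norm (D x) = 0") (auto simp: power2_eq_square)
qed

text \<open>Pairing \<open>w + tJBDw\<close> with \<open>JDw\<close> kills the first term, because \<open>(w, Dw)\<close> is real, and
 leaves the accretive form.\<close>

lemma resolvent_D_bound:
 assumes w: "w : dom"
 shows "\<delta> * \<bar>t\<bar> * norm (D w) <= norm (w + t *R J (B (D w)))"
proof -
 have "w \<bullet> J (D w) = D w \<bullet> J w" using D_sym[OF w J_dom[OF w]] D_J[OF w] by simp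
 also have "... = - (w \<bullet> J (D w))" using J_skew[of "D w" w] by (simp add: inner_commute)
 finally have 0: "w \<bullet> J (D w) = 0" by simp
 have "(w + t *R J (B (D w))) \<bullet> J (D w) = t * (B (D w) \<bullet> D w)" by (simp add: inner_simps 0 J_isometry)
 then have "\<bar>t\<bar> * (B (D w) \<bullet> D w) <= norm (w + t *R J (B (D w))) * norm (D w)"
  using Cauchy_Schwarz_ineq2[of "w + t *R J (B (D w))" "J (D w)"] accretive[OF w] \<delta>_pos
  by (simp add: abs_mult) (smt (verit) mult_nonneg_nonneg zero_le_power2)
 moreover have "\<bar>t\<bar> * (\<delta> * sq (D w)) <= \<bar>t\<bar> * (B (D w) \<bullet> D w)"
  by (rule mult_left_mono[OF accretive[OF w]]) simp
 ultimately have "(\<delta> * \<bar>t\<bar> * norm (D w)) * norm (D w) <= norm (w + t *R J (B (D w))) * norm (D w)"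
  by (simp add: power2_eq_square mult_ac)
 then show ?thesis by (cases "D w = 0") (simp, metis mult_right_le_imp_le zero_less_norm_iff)
qed

text \<open>The uniform bound for the resolvents \<open>(I + tJBD)\<^sup>-\<^sup>1\<close>.\<close>

definition C0 :: real where "C0 = 1 + Bn / \<delta>"

lemma C0_ge_1: "C0 >= 1" using Bn_nonneg \<delta>_pos by (simp add: C0_def)

lemma resolvent_bound:
 assumes w: "w : dom"
 shows "norm w <= C0 * norm (w + t *R J (B (D w)))"
proof -
 let ?u = "w + t *R J (B (D w))"
 have "norm w <= norm ?u + norm (t *R J (B (D w)))" using norm_triangle_ineq4[of ?u "t *R J (B (D w))"] by simp
 also have "norm (t *R J (B (D w))) = \<bar>t\<bar> * norm (B (D w))" by simp
 also have "... <= \<bar>t\<bar> * (Bn * norm (D w))" by (rule mult_left_mono[OF B_bound]) simp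
 also have "... = (Bn / \<delta>) * (\<delta> * \<bar>t\<bar> * norm (D w))" using \<delta>_pos by simp
 also have "... <= (Bn / \<delta>) * norm ?u"
  by (rule mult_left_mono[OF resolvent_D_bound[OF w]]) (use Bn_nonneg \<delta>_pos in simp)
 finally show ?thesis by (simp add: C0_def algebra_simps)
qed

lemma resolvent_op_linear:
 assumes "x : dom" "y : dom"
 shows "(x + y) + t *R J (B (D (x + y))) = (x + t *R J (B (D x))) + (y + t *R J (B (D y)))"
  "(x - y) + t *R J (B (D (x - y))) = (x + t *R J (B (D x))) - (y + t *R J (B (D y)))"
  "(r *R x) + t *R J (B (D (r *R x))) = r *R (x + t *R J (B (D x)))"
 using assms by (simp_all add: D_add D_diff D_scaleR B_simps J_add J_diff J_scaleR algebra_simps)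

text \<open>The range of \<open>I + tJBD\<close> is closed by the lower bounds; a vector \<open>v\<close> orthogonal to it lies in
 the range of \<open>D\<close> by self-adjointness and satisfies \<open>(Bv, v) = 0\<close>, so it vanishes.\<close>

lemma resolvent_surj:
 assumes t: "t ~= 0"
 shows "\<exists>w\<in>dom. w + t *R J (B (D w)) = u"
proof -
 define T where "T w = w + t *R J (B (D w))" for w
 have sub: "subspace (T ` dom)" unfolding subspace_def
 proof (intro conjI ballI allI)
  show "0 : T ` dom" by (rule image_eqI[of _ _ 0]) (auto simp: T_def B_simps)
 next
  fix a b assume "a : T ` dom" "b : T ` dom"
  then obtain x y where xy: "x : dom" "y : dom" "a = T x" "b = T y" by auto
  then have "a + b = T (x + y)" using resolvent_op_linear(1)[of x y t] by (simp add: T_def)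
  then show "a + b : T ` dom" using xy dom_add by auto
 next
  fix r a assume "a : T ` dom"
  then obtain x where x: "x : dom" "a = T x" by auto
  then have "r *R a = T (r *R x)" using resolvent_op_linear(3)[of x x r t] by (simp add: T_def)
  then show "r *R a : T ` dom" using x dom_scaleR by auto
 qed
 have Tdiff: "T x - T y = T (x - y)" if "x : dom" "y : dom" for x y
  using resolvent_op_linear(2)[of x y t] that by (simp add: T_def)
 have closed: "closed (T ` dom)" unfolding closed_sequential_limits
 proof (intro allI impI, elim conjE)
  fix v l assume v: "\<forall>n. v n : T ` dom" and l: "v ----> l"
  then have "\<forall>n. \<exists>x. x : dom \<and> v n = T x" by auto
  from choice[OF this] obtain w where w: "!!n. w n : dom" "!!n. v n = T (w n)" by auto
  have C: "Cauchy v" using l LIMSEQ_imp_Cauchy by blast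
  have Cau: "Cauchy f" if f: "!!m n. norm (f m - f n) <= K * norm (v m - v n)" and K: "K > 0" for f :: "nat => 'a" and K
  proof (rule metric_CauchyI)
   fix e :: real assume "e > 0"
   then obtain M where "\<forall>m\<ge>M. \<forall>n\<ge>M. norm (v m - v n) < e / K"
    using CauchyD[OF C, of "e / K"] K by auto
   then have "norm (f m - f n) < e" if "m >= M" "n >= M" for m n
    using le_less_trans[OF f[of m n], of e] that K by (simp add: pos_less_divide_eq mult.commute)
   then show "\<exists>M. \<forall>m\<ge>M. \<forall>n\<ge>M. dist (f m) (f n) < e" unfolding dist_norm by blast
  qed
  have vT: "v m - v n = T (w m - w n)" for m n using Tdiff[OF w(1) w(1), of m n] w(2) by simp
  have "Cauchy w"
  proof (rule Cau[of _ C0])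
   show "norm (w m - w n) <= C0 * norm (v m - v n)" for m n
    using resolvent_bound[OF dom_diff[OF w(1) w(1)], of m n t] unfolding vT T_def .
  qed (use C0_ge_1 in simp)
  then obtain x where x: "w ----> x" using Cauchy_convergent_iff convergent_def by blast
  have "Cauchy (%n. D (w n))"
  proof (rule Cau[of _ "1 / (\<delta> * \<bar>t\<bar>)"])
   show "norm (D (w m) - D (w n)) <= 1 / (\<delta> * \<bar>t\<bar>) * norm (v m - v n)" for m n
    using resolvent_D_bound[OF dom_diff[OF w(1) w(1)], of t m n] t \<delta>_pos unfolding vT T_def
    by (simp add: D_diff[OF w(1) w(1), symmetric] pos_le_divide_eq mult_ac)
  qed (use t \<delta>_pos in simp)
  then obtain z where z: "(%n. D (w n)) ----> z" using Cauchy_convergent_iff convergent_def by blast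
  have xz: "x : dom" "D x = z" using D_closed[OF w(1) x z] by auto
  have bJ: "bounded_linear J"
   using J_lin by (intro bounded_linear.intro bounded_linear_axioms.intro) (auto intro!: exI[of _ 1])
  have "(%n. T (w n)) ----> T x" unfolding T_def
   by (intro tendsto_intros bounded_linear.tendsto[OF bJ] bounded_linear.tendsto[OF B_bl] x)
    (use z xz in simp)
  moreover have "(%n. T (w n)) = v" using w(2) by auto
  ultimately have "l = T x" using l LIMSEQ_unique by simp
  then show "l : T ` dom" using xz by simp
 qed
 have "closure (T ` dom) = UNIV"
 proof (rule dense_if_orthogonal_trivial[OF sub])
  fix v assume v: "!!s. s : T ` dom ==> v \<bullet> s = 0"
  obtain y where y: "!!z. B z \<bullet> J v = z \<bullet> y" using adjoint_vector_exists[OF B_bl] by blast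
  have "D x \<bullet> (t *R y) = x \<bullet> v" if "x : dom" for x
  proof -
   have "v \<bullet> T x = 0" using v that by auto
   then have "v \<bullet> x = t * (J v \<bullet> B (D x))" by (simp add: T_def inner_simps J_skew)
   then show ?thesis using y[of "D x"] by (simp add: inner_commute)
  qed
  from D_adj[of "t *R y" v, OF this] have ty: "t *R y : dom" "D (t *R y) = v" by auto
  have "t * (B v \<bullet> v) = t * (B (J v) \<bullet> J v)" by (simp add: B_J J_isometry)
  also have "... = J v \<bullet> (t *R y)" using y[of "J v"] by simp
  also have "... = D (J (t *R y)) \<bullet> (t *R y)" using D_J[OF ty(1)] ty by simp
  also have "... = J (t *R y) \<bullet> D (t *R y)" using D_sym[OF J_dom[OF ty(1)] ty(1)] .
  also have "... = - (t *R y \<bullet> J v)" using J_skew ty(2) by simp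
  finally have "t * (B v \<bullet> v) = - (t *R y \<bullet> J v)" "t * (B v \<bullet> v) = J v \<bullet> (t *R y)"
   using y[of "J v"] by (simp_all add: B_J J_isometry)
  then have "B v \<bullet> v = 0" using t by (simp add: inner_commute)
  then show "v = 0" using accretive[OF ty(1)] ty(2) \<delta>_pos by (simp add: mult_le_0_iff)
 qed
 then have "T ` dom = UNIV" using closed by (simp add: closure_closed)
 then have "u : T ` dom" by simp
 then show ?thesis unfolding T_def by auto
qed

definition res :: "real => 'a => 'a" where
 "res t u = (SOME w. w : dom \<and> w + t *R J (B (D w)) = u)"

lemma res: assumes "t ~= 0" shows "res t u : dom" "res t u + t *R J (B (D (res t u))) = u"
proof -
 have "res t u : dom \<and> res t u + t *R J (B (D (res t u))) = u"
  unfolding res_def by (rule someI_ex) (use resolvent_surj[OF assms, of u] in auto)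
 then show "res t u : dom" "res t u + t *R J (B (D (res t u))) = u" by auto
qed

lemma res_unique: assumes "t ~= 0" "w : dom" "w + t *R J (B (D w)) = u" shows "res t u = w"
proof -
 have "norm (res t u - w) <= C0 * norm ((res t u - w) + t *R J (B (D (res t u - w))))"
  by (rule resolvent_bound[OF dom_diff[OF res(1)[OF assms(1)] assms(2)]])
 also have "(res t u - w) + t *R J (B (D (res t u - w))) = 0"
  using resolvent_op_linear(2)[OF res(1)[OF assms(1), of u] assms(2), of t] res(2)[OF assms(1), of u] assms(3) by simp
 finally show ?thesis by simp
qed

lemma res_norm: "t ~= 0 ==> norm (res t u) <= C0 * norm u" using resolvent_bound[OF res(1), of t u t] res(2)[of t u] by simp

lemma res_D_norm: "t ~= 0 ==> \<delta> * \<bar>t\<bar> * norm (D (res t u)) <= norm u"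
 using resolvent_D_bound[OF res(1), of t t u] res(2)[of t u] by simp

text \<open>From \<open>I + t\<^sup>2BDBD = (I + tJBD)(I - tJBD)\<close>: the operators \<open>(I + t\<^sup>2BDBD)\<^sup>-\<^sup>1\<close> and \<open>tBD(I + t\<^sup>2BDBD)\<^sup>-\<^sup>1\<close>.\<close>

definition PP :: "real => 'a => 'a" where "PP t u = (1/2) *R (res t u + res (-t) u)"
definition QQ :: "real => 'a => 'a" where "QQ t u = (1/2) *R J (res t u - res (-t) u)"

text \<open>The pair solves a first order system uniquely; linearity and the commutation rules follow from this.\<close>

lemma PQ_unique:
 assumes t: "t ~= 0" and p: "p : dom" and q: "q : dom"
  and 1: "t *R B (D p) = q" and 2: "p + t *R B (D q) = u"
 shows "PP t u = p" "QQ t u = q"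
proof -
 have "res t u = p - J q"
 proof (rule res_unique[OF t])
  show "p - J q : dom" using p q J_dom dom_diff by auto
  have "t *R J (B (D (p - J q))) = J (t *R B (D p)) + t *R B (D q)"
   using p q by (simp add: D_diff J_dom D_J B_simps B_J J_diff J_scaleR algebra_simps)
  then show "p - J q + t *R J (B (D (p - J q))) = u" using 1 2 by (simp add: algebra_simps)
 qed
 moreover have "res (-t) u = p + J q"
 proof (rule res_unique)
  show "p + J q : dom" using p q J_dom dom_add by auto
  have "t *R J (B (D (p + J q))) = J (t *R B (D p)) - t *R B (D q)"
   using p q by (simp add: D_add J_dom D_J B_simps B_J J_add J_scaleR algebra_simps)
  then have "p + J q + (-t) *R J (B (D (p + J q))) = p + J q - (J (t *R B (D p)) - t *R B (D q))" by simp
  also have "... = u" unfolding 1 using 2 by simp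
  finally show "p + J q + (-t) *R J (B (D (p + J q))) = u" .
 qed (use t in simp)
 ultimately show "PP t u = p" "QQ t u = q" by (simp_all add: PP_def QQ_def J_diff J_add J_scaleR J_minus flip: scaleR_2)
qed

lemma PQ:
 assumes t: "t ~= 0"
 shows PP_dom: "PP t u : dom" and QQ_dom: "QQ t u : dom"
  and QQ_eq: "t *R B (D (PP t u)) = QQ t u" and PQ_sum: "PP t u + t *R B (D (QQ t u)) = u"
proof -
 let ?a = "res t u" and ?b = "res (-t) u"
 have a: "?a : dom" "?a + t *R J (B (D ?a)) = u" using res[OF t] by auto
 have b: "?b : dom" "?b - t *R J (B (D ?b)) = u" using res[of "-t" u] t by auto
 show "PP t u : dom" "QQ t u : dom" using a b by (auto simp: PP_def QQ_def intro!: dom_scaleR dom_add J_dom dom_diff)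
 have ta: "t *R B (D ?a) = - J (u - ?a)"
  using arg_cong[OF a(2), of J] by (simp add: J_add J_diff J_scaleR algebra_simps)
 have tb: "t *R B (D ?b) = - J (?b - u)"
  using arg_cong[OF b(2), of J] by (simp add: J_add J_diff J_scaleR algebra_simps)
 have "t *R B (D (PP t u)) = t *R ((1/2) *R (B (D ?a) + B (D ?b)))"
  unfolding PP_def using D_scaleR[OF dom_add[OF a(1) b(1)], of "1/2"] D_add[OF a(1) b(1)] by (simp only: B_simps)
 also have "... = (1/2) *R (t *R B (D ?a) + t *R B (D ?b))" by (simp add: algebra_simps)
 also have "... = QQ t u" unfolding ta tb QQ_def by (simp add: J_diff J_add)
 finally show "t *R B (D (PP t u)) = QQ t u" .
 have "t *R B (D (QQ t u)) = t *R ((1/2) *R J (B (D ?a) - B (D ?b)))"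
  unfolding QQ_def using D_scaleR[OF J_dom[OF dom_diff[OF a(1) b(1)]], of "1/2"] D_J[OF dom_diff[OF a(1) b(1)]] D_diff[OF a(1) b(1)]
  by (simp only: B_simps B_J)
 also have "... = (1/2) *R J (t *R B (D ?a) - t *R B (D ?b))" by (simp add: J_scaleR J_diff algebra_simps)
 also have "... = (1/2) *R (2 *R u - ?a - ?b)" unfolding ta tb by (simp add: J_diff J_add J_minus scaleR_2)
 finally show "PP t u + t *R B (D (QQ t u)) = u" by (simp add: PP_def algebra_simps)
qed

lemma PQ_linear: assumes t: "t ~= 0" shows PP_linear: "linear (PP t)" and QQ_linear: "linear (QQ t)"
proof -
 have "PP t (x + y) = PP t x + PP t y \<and> QQ t (x + y) = QQ t x + QQ t y" for x y
 proof -
  have 1: "t *R B (D (PP t x + PP t y)) = t *R B (D (PP t x)) + t *R B (D (PP t y))"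
   by (simp add: D_add PP_dom[OF t] B_simps algebra_simps)
  have 2: "PP t x + PP t y + t *R B (D (QQ t x + QQ t y)) = (PP t x + t *R B (D (QQ t x))) + (PP t y + t *R B (D (QQ t y)))"
   by (simp add: D_add QQ_dom[OF t] B_simps algebra_simps)
  show ?thesis
   using PQ_unique[OF t dom_add[OF PP_dom[OF t, of x] PP_dom[OF t, of y]] dom_add[OF QQ_dom[OF t, of x] QQ_dom[OF t, of y]], of "x + y"] 1 2
   by (simp add: QQ_eq[OF t] PQ_sum[OF t])
 qed
 moreover have "PP t (r *R x) = r *R PP t x \<and> QQ t (r *R x) = r *R QQ t x" for r x
 proof -
  have 1: "t *R B (D (r *R PP t x)) = r *R (t *R B (D (PP t x)))"
   by (simp add: D_scaleR PP_dom[OF t] B_simps)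
  have 2: "r *R PP t x + t *R B (D (r *R QQ t x)) = r *R (PP t x + t *R B (D (QQ t x)))"
   by (simp add: D_scaleR QQ_dom[OF t] B_simps algebra_simps)
  show ?thesis
   using PQ_unique[OF t dom_scaleR[OF PP_dom[OF t, of x], of r] dom_scaleR[OF QQ_dom[OF t, of x], of r], of "r *R x"] 1 2
   by (simp add: QQ_eq[OF t] PQ_sum[OF t])
 qed
 ultimately show "linear (PP t)" "linear (QQ t)" by (auto intro!: linearI)
qed

lemma PP_norm: assumes "t ~= 0" shows "norm (PP t u) <= C0 * norm u"
proof -
 have "2 * norm (PP t u) = norm (res t u + res (-t) u)" unfolding PP_def norm_scaleR by simp
 also have "... <= C0 * norm u + C0 * norm u" using assms by (intro norm_triangle_mono res_norm) auto
 finally show ?thesis by linarith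
qed

lemma QQ_norm: assumes "t ~= 0" shows "norm (QQ t u) <= C0 * norm u"
proof -
 have "2 * norm (QQ t u) = norm (res t u - res (-t) u)" unfolding QQ_def norm_scaleR by simp
 also have "... <= norm (res t u) + norm (res (-t) u)" by (rule norm_triangle_ineq4)
 also have "... <= C0 * norm u + C0 * norm u" using assms by (intro add_mono res_norm) auto
 finally show ?thesis by linarith
qed

lemma DQQ_norm: "t ~= 0 ==> \<delta> * \<bar>t\<bar> * norm (D (QQ t u)) <= norm u"
proof -
 assume t: "t ~= 0"
 have "norm (D (QQ t u)) <= (1/2) * (norm (D (res t u)) + norm (D (res (-t) u)))"
  using norm_triangle_ineq4[of "D (res t u)" "D (res (-t) u)"] res(1)[of t u] res(1)[of "-t" u] t
  by (simp add: QQ_def D_scaleR D_diff dom_diff D_J J_dom del: scaleR_diff_right)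
 then have "\<delta> * \<bar>t\<bar> * norm (D (QQ t u)) <= \<delta> * \<bar>t\<bar> * ((1/2) * (norm (D (res t u)) + norm (D (res (-t) u))))"
  using \<delta>_pos by (intro mult_left_mono) auto
 also have "... = (\<delta> * \<bar>t\<bar> * norm (D (res t u)) + \<delta> * \<bar>-t\<bar> * norm (D (res (-t) u))) / 2"
  by (simp only: abs_minus_cancel distrib_left times_divide_eq_right mult_1_left) simp
 also have "... <= norm u" using add_mono[OF res_D_norm[of t u] res_D_norm[of "-t" u]] t by simp
 finally show ?thesis .
qed

lemma PQ_BD:
 assumes t: "t ~= 0" and y: "y : dom"
 shows "PP t (t *R B (D y)) = QQ t y" "QQ t (t *R B (D y)) = y - PP t y"
proof -
 have e: "t *R B (D (QQ t y)) = y - PP t y" using PQ_sum[OF t, of y] by (simp add: algebra_simps)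
 have 2: "QQ t y + t *R B (D (y - PP t y)) = t *R B (D y)"
  using QQ_eq[OF t, of y] by (simp add: D_diff y PP_dom[OF t] B_simps algebra_simps)
 show "PP t (t *R B (D y)) = QQ t y" "QQ t (t *R B (D y)) = y - PP t y"
  using PQ_unique[OF t QQ_dom[OF t] dom_diff[OF y PP_dom[OF t]] e 2] by auto
qed

lemma PQ_commute:
 assumes t: "t ~= 0" and s: "s ~= 0"
 shows "PP t (PP s u) = PP s (PP t u)" "QQ t (PP s u) = PP s (QQ t u)"
proof -
 note lin = linear_add[OF PP_linear[OF s]] linear_scale[OF PP_linear[OF s]]
 let ?p = "PP t u" and ?q = "QQ t u"
 have 1: "t *R B (D (PP s ?p)) = PP s ?q"
 proof -
  have "t *R B (D (PP s ?p)) = (t / s) *R QQ s ?p" using QQ_eq[OF s, of ?p] s by (simp flip: QQ_eq[OF s])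
  also have "... = (t / s) *R PP s (s *R B (D ?p))" using PQ_BD[OF s PP_dom[OF t]] by simp
  also have "... = PP s (t *R B (D ?p))" using s by (simp add: lin(2))
  finally show ?thesis using QQ_eq[OF t] by simp
 qed
 have 2: "PP s ?p + t *R B (D (PP s ?q)) = PP s u"
 proof -
  have "t *R B (D (PP s ?q)) = (t / s) *R QQ s ?q" using s by (simp flip: QQ_eq[OF s])
  also have "... = (t / s) *R PP s (s *R B (D ?q))" using PQ_BD[OF s QQ_dom[OF t]] by simp
  also have "... = PP s (t *R B (D ?q))" using s by (simp add: lin(2))
  finally show ?thesis using PQ_sum[OF t, of u] by (metis lin(1))
 qed
 show "PP t (PP s u) = PP s (PP t u)" "QQ t (PP s u) = PP s (QQ t u)"
  using PQ_unique[OF t PP_dom[OF s] PP_dom[OF s] 1 2] by auto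
qed

text \<open>Both sides are \<open>tBD\<close> applied to the product of the two resolvents.\<close>

lemma QQ_PP_ratio:
 assumes t: "t ~= 0" and s: "s ~= 0"
 shows "QQ t (PP s u) = (t / s) *R PP t (QQ s u)"
proof -
 have "QQ t (PP s u) = t *R B (D (PP t (PP s u)))" using QQ_eq[OF t] by simp
 also have "... = (t / s) *R (s *R B (D (PP s (PP t u))))" using s PQ_commute(1)[OF t s] by simp
 also have "... = (t / s) *R QQ s (PP t u)" using QQ_eq[OF s] by simp
 also have "... = (t / s) *R PP t (QQ s u)" using PQ_commute(2)[OF s t] by simp
 finally show ?thesis .
qed

lemma QQ_PP_norm:
 assumes t: "t > 0" and s: "s > 0"
 shows "norm (QQ t (PP s u)) <= (t / s) * C0\<^sup>2 * norm u"
proof -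
 have "norm (QQ t (PP s u)) = (t / s) * norm (PP t (QQ s u))" using t s by (simp add: QQ_PP_ratio)
 also have "... <= (t / s) * (C0 * (C0 * norm u))" using PP_norm[of t "QQ s u"] QQ_norm[of s u] t s C0_ge_1
  by (intro mult_left_mono) (auto intro: order_trans mult_left_mono)
 finally show ?thesis by (simp add: power2_eq_square mult_ac)
qed

text \<open>\<open>QQ t\<close> and \<open>QQ s\<close> are comparable when \<open>t\<close> and \<open>s\<close> are, which reduces the square function
 over \<open>t\<close> to a sum over \<open>t = 2\<^sup>-\<^sup>k\<close>.\<close>

lemma QQ_comparable:
 assumes "0 < t" "t <= s" "s <= 2 * t"
 shows "norm (QQ t u) <= (2 + 3 * C0) * norm (QQ s u)"
proof -
 have s: "s ~= 0" and t: "t ~= 0" using assms by auto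
 note lin = linear_add[OF QQ_linear[OF t]] linear_scale[OF QQ_linear[OF t]]
 have "u = PP s u + (s / t) *R (t *R B (D (QQ s u)))" using PQ_sum[OF s, of u] t by simp
 then have "QQ t u = QQ t (PP s u) + (s / t) *R QQ t (t *R B (D (QQ s u)))" by (metis lin)
 also have "... = (t / s) *R PP t (QQ s u) + (s / t) *R (QQ s u - PP t (QQ s u))"
  by (simp add: QQ_PP_ratio[OF t s] PQ_BD(2)[OF t QQ_dom[OF s]])
 finally have "norm (QQ t u) = norm ((t / s) *R PP t (QQ s u) + (s / t) *R (QQ s u - PP t (QQ s u)))"
  by (rule arg_cong)
 also have "... <= (t / s) * norm (PP t (QQ s u)) + (s / t) * (norm (QQ s u) + norm (PP t (QQ s u)))"
  using assms by (intro order_trans[OF norm_triangle_ineq] add_mono) (auto intro!: mult_left_mono norm_triangle_ineq4 divide_right_mono)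
 also have "... <= 1 * (C0 * norm (QQ s u)) + 2 * (norm (QQ s u) + C0 * norm (QQ s u))"
 proof (rule add_mono)
  have r1: "t / s <= 1" by (rule divide_le_eq_1_pos[THEN iffD2]) (use assms in linarith)+
  have r2: "s / t <= 2" by (rule pos_divide_le_eq[THEN iffD2]) (use assms in linarith)+
  show "(t / s) * norm (PP t (QQ s u)) <= 1 * (C0 * norm (QQ s u))"
   by (rule mult_mono[OF r1 PP_norm[OF t] zero_le_one norm_ge_zero])
  show "(s / t) * (norm (QQ s u) + norm (PP t (QQ s u))) <= 2 * (norm (QQ s u) + C0 * norm (QQ s u))"
   by (rule mult_mono[OF r2 add_left_mono[OF PP_norm[OF t]]]) (rule zero_le_numeral, rule add_nonneg_nonneg[OF norm_ge_zero norm_ge_zero])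
 qed
 also have "... = (2 + 3 * C0) * norm (QQ s u)" by (simp add: distrib_right)
 finally show ?thesis .
qed

lemma range_orthogonal: assumes "!!s. s : D ` dom ==> n \<bullet> s = 0" shows "n : dom" "D n = 0"
 using D_adj[of n 0] assms by (auto simp: inner_commute)

lemma range_subspace: "subspace (D ` dom)" unfolding subspace_def
proof (intro conjI ballI allI)
 show "0 : D ` dom" by (rule image_eqI[of _ _ 0]) auto
 fix x y assume "x : D ` dom" "y : D ` dom"
 then show "x + y : D ` dom" by (auto simp flip: D_add intro!: dom_add imageI)
next
 fix c x assume "x : D ` dom"
 then show "c *R x : D ` dom" by (auto simp flip: D_scaleR intro!: dom_scaleR imageI)
qed

text \<open>Coercivity of \<open>D\<close> means that \<open>0\<close> is isolated in the spectrum, so large \<open>t\<close> are harmless.\<close>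

lemma QQ_decay:
 assumes c: "!!x. x : dom ==> x : closure (D ` dom) ==> norm x <= c * norm (D x)" and t: "t > 0" and c0: "c >= 0"
 shows "norm (QQ t u) <= (Bn * c * (1 + C0) / \<delta>\<^sup>2) / t * norm u"
proof -
 have t0: "t ~= 0" using t by simp
 define z where "z = D (PP t u)"
 have Bz: "t *R B z = QQ t u" using QQ_eq[OF t0] z_def by simp
 have Bzd: "B z : dom" using dom_scaleR[OF QQ_dom[OF t0, of u], of "1/t"] t0 by (simp flip: Bz)
 have "t\<^sup>2 *R B (D (B z)) = t *R B (D (t *R B z))"
  by (simp add: D_scaleR Bzd B_simps power2_eq_square)
 also have "... = u - PP t u" using PQ_sum[OF t0, of u] Bz by (simp add: algebra_simps)
 finally have "t\<^sup>2 * norm (B (D (B z))) = norm (u - PP t u)" by (metis abs_of_nonneg norm_scaleR zero_le_power2)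
 also have "... <= (1 + C0) * norm u"
  using norm_triangle_ineq4[of u "PP t u"] PP_norm[OF t0, of u] by (simp add: algebra_simps)
 finally have 1: "t\<^sup>2 * norm (B (D (B z))) <= (1 + C0) * norm u" .
 have "t\<^sup>2 * (\<delta> * norm (D (B z))) <= t\<^sup>2 * norm (B (D (B z)))"
  by (rule mult_left_mono[OF coercive[OF Bzd]]) simp
 with 1 have 2: "t\<^sup>2 * (\<delta> * norm (D (B z))) <= (1 + C0) * norm u" by linarith
 obtain a where a: "a : closure (D ` dom)" "!!s. s : closure (D ` dom) ==> (B z - a) \<bullet> s = 0"
  using orthogonal_projection_exists[OF subspace_closure_inner[OF range_subspace] closed_closure, of "B z"] by blast
 have n: "B z - a : dom" "D (B z - a) = 0" using range_orthogonal[OF a(2), OF subsetD[OF closure_subset]] by auto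
 have ad: "a : dom" using dom_diff[OF Bzd n(1)] by simp
 have "D a = D (B z)" using n(2) D_diff[OF Bzd ad] by simp
 then have an: "norm a <= c * norm (D (B z))" using c[OF ad a(1)] by simp
 have zr: "z : closure (D ` dom)" unfolding z_def by (rule subsetD[OF closure_subset]) (rule imageI[OF PP_dom[OF t0]])
 have "\<delta> * sq z <= B z \<bullet> z" using accretive[OF PP_dom[OF t0]] by (simp add: z_def)
 also have "... = a \<bullet> z" using a(2)[OF zr] by (simp add: inner_simps)
 also have "... <= norm a * norm z" by (rule norm_cauchy_schwarz)
 finally have "\<delta> * norm z <= norm a" by (cases "norm z = 0") (auto simp: power2_eq_square)
 with an have 3: "\<delta> * norm z <= c * norm (D (B z))" by linarith
 have "t * (t * (\<delta>\<^sup>2 * norm z)) = t\<^sup>2 * (\<delta> * (\<delta> * norm z))" by (simp add: power2_eq_square)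
 also have "... <= t\<^sup>2 * (\<delta> * (c * norm (D (B z))))" using 3 \<delta>_pos by (intro mult_left_mono) auto
 also have "... = c * (t\<^sup>2 * (\<delta> * norm (D (B z))))" by simp
 also have "... <= c * ((1 + C0) * norm u)" by (rule mult_left_mono[OF 2 c0])
 finally have 4: "t * norm z <= c * (1 + C0) / \<delta>\<^sup>2 / t * norm u" using t \<delta>_pos by (simp add: field_simps)
 have "norm (QQ t u) = t * norm (B z)" using Bz t by (metis abs_of_pos norm_scaleR)
 also have "... <= t * (Bn * norm z)" by (rule mult_left_mono[OF B_bound]) (use t in simp)
 also have "... = Bn * (t * norm z)" by simp
 also have "... <= Bn * (c * (1 + C0) / \<delta>\<^sup>2 / t * norm u)" by (rule mult_left_mono[OF 4 Bn_nonneg])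
 finally show ?thesis by simp
qed

lemma resolvent_unique_inverse:
 assumes t: "t > 0"
 shows "inv_into {w : dom. B (D w) : dom} (%w. w + t\<^sup>2 *R B (D (B (D w)))) u = PP t u"
proof -
 have t0: "t ~= 0" using t by simp
 have key: "PP t v = w" if "w : dom" "B (D w) : dom" "w + t\<^sup>2 *R B (D (B (D w))) = v" for w v
  by (rule PQ_unique(1)[OF t0 that(1) dom_scaleR[OF that(2), of t]])
   (use that in "auto simp: D_scaleR B_simps power2_eq_square")
 have BD: "B (D (PP t u)) : dom" using dom_scaleR[OF QQ_dom[OF t0, of u], of "1/t"] t0 by (simp flip: QQ_eq[OF t0])
 have eq: "PP t u + t\<^sup>2 *R B (D (B (D (PP t u)))) = u"
  using PQ_sum[OF t0, of u] unfolding QQ_eq[OF t0, symmetric] by (simp add: D_scaleR BD B_simps power2_eq_square)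
 have inj: "inj_on (%w. w + t\<^sup>2 *R B (D (B (D w)))) {w : dom. B (D w) : dom}"
  by (rule inj_onI) (use key in "metis (mono_tags, lifting) mem_Collect_eq")
 have "inv_into {w : dom. B (D w) : dom} (%w. w + t\<^sup>2 *R B (D (B (D w)))) (PP t u + t\<^sup>2 *R B (D (B (D (PP t u))))) = PP t u"
  by (rule inv_into_f_eq[OF inj]) (use BD PP_dom[OF t0] in auto)
 then show ?thesis by (simp only: eq)
qed

text \<open>The case \<open>B = I\<close>, which supplies the smooth approximations \<open>S.PP t\<close> of the identity.\<close>

lemma dirac_identity: "dirac J dom D (%x. x) 1" by (rule dirac.intro)
  (rule J_lin JJ norm_J dom_subspace dom_dense D_add D_scaleR J_dom D_J D_sym D_adj bounded_linear_ident refl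
   zero_less_one order_eq_refl | assumption | simp add: power2_norm_eq_inner)+

end

sublocale dirac \<subseteq> S: dirac J dom D "%x. x" 1 using dirac_identity .

context dirac
begin

lemma S_facts:
 assumes t: "t ~= 0"
 shows S_norm: "norm (S.PP t u) <= norm u" and SQ_norm: "norm (S.QQ t u) <= norm u"
  and S_pos: "0 <= S.PP t u \<bullet> u" and S_contr: "S.PP t u \<bullet> u <= sq u"
proof -
 let ?p = "S.PP t u" and ?q = "S.QQ t u"
 have u: "u = ?p + t *R D ?q" and q: "?q = t *R D ?p" using S.PQ_sum[OF t, of u] S.QQ_eq[OF t, of u] by auto
 have x: "?p \<bullet> (t *R D ?q) = (norm ?q)\<^sup>2" using D_sym[OF S.PP_dom[OF t] S.QQ_dom[OF t], of u u] q
  by (metis inner_scaleR_left inner_scaleR_right power2_norm_eq_inner)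
 have "sq u = sq (?p + t *R D ?q)" using u by simp
 also have "... = (norm ?p)\<^sup>2 + 2 * (norm ?q)\<^sup>2 + sq (t *R D ?q)"
  using x unfolding power2_norm_eq_inner by (simp add: inner_simps inner_commute)
 finally have n: "sq u = (norm ?p)\<^sup>2 + 2 * (norm ?q)\<^sup>2 + sq (t *R D ?q)" .
 have "(norm ?p)\<^sup>2 <= sq u" "(norm ?q)\<^sup>2 <= sq u" using n by auto
 then show 1: "norm ?p <= norm u" "norm ?q <= norm u" using power2_le_imp_le by auto
 have "?p \<bullet> u = ?p \<bullet> (?p + t *R D ?q)" using u by simp
 then have e: "?p \<bullet> u = (norm ?p)\<^sup>2 + (norm ?q)\<^sup>2"
  using x by (simp add: inner_add_right power2_norm_eq_inner)
 then show "0 <= ?p \<bullet> u" by simp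
 show "?p \<bullet> u <= sq u" using e n zero_le_power2[of "norm (t *R D ?q)"] zero_le_power2[of "norm ?q"] by linarith
qed

text \<open>In the functional calculus of \<open>D\<close>, \<open>1/(1 + x/4) - 1/(1 + x) = (3/4)x/((1 + x/4)(1 + x))\<close> with \<open>x = t\<^sup>2D\<^sup>2\<close>.
Hence the square function of \<open>S.QQ\<close> telescopes.\<close>

lemma S_telescope:
 assumes t: "t > 0"
 shows "S.PP (t/2) u - S.PP t u = (3/2) *R S.QQ (t/2) (S.QQ t u)"
  and "(3/4) * sq (S.QQ t u) <= (S.PP (t/2) u - S.PP t u) \<bullet> u"
proof -
 define s where "s = t / 2"
 have t0: "t ~= 0" and s0: "s ~= 0" and ts: "t = 2 * s" using t by (auto simp: s_def)
 let ?p = "S.PP t u" and ?q = "S.QQ t u"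
 note lin = linear_add[OF S.PP_linear[OF s0]] linear_scale[OF S.PP_linear[OF s0]]
 have u: "u = ?p + 2 *R (s *R D ?q)" and q: "?q = 2 *R (s *R D ?p)"
  using S.PQ_sum[OF t0, of u] S.QQ_eq[OF t0, of u] by (auto simp: ts)
 have qd: "?q : dom" "?p : dom" using S.QQ_dom[OF t0] S.PP_dom[OF t0] by auto
 have "S.PP s u = S.PP s ?p + 2 *R S.PP s (s *R D ?q)" by (subst u) (simp only: lin)
 also have "S.PP s (s *R D ?q) = S.QQ s ?q" using S.PQ_BD(1)[OF s0 qd(1)] .
 finally have a: "S.PP s u = S.PP s ?p + 2 *R S.QQ s ?q" .
 have sq: "S.PP s ?q = 2 *R S.QQ s ?p"
  using arg_cong[OF q, of "S.PP s"] lin(2)[of 2 "s *R D ?p"] S.PQ_BD(1)[OF s0 qd(2)] by simp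
 have "?p = S.PP s ?p + s *R D (S.QQ s ?p)" using S.PQ_sum[OF s0, of ?p] by simp
 also have "S.QQ s ?p = (1/2) *R S.PP s ?q" using sq by simp
 also have "s *R D ((1/2) *R S.PP s ?q) = (1/2) *R S.QQ s ?q"
  using S.QQ_eq[OF s0, of ?q] by (simp add: D_scaleR S.PP_dom[OF s0] flip: S.QQ_eq[OF s0])
 finally have b: "?p = S.PP s ?p + (1/2) *R S.QQ s ?q" .
 have "A - p = (3/2) *R Y" if "A = X + 2 *R Y" "p = X + (1/2) *R Y" for A p X Y :: 'a
  using that by (simp flip: scaleR_left_diff_distrib)
 from this[OF a b] have c: "S.PP s u - ?p = (3/2) *R S.QQ s ?q" .
 then show "S.PP (t/2) u - S.PP t u = (3/2) *R S.QQ (t/2) (S.QQ t u)" by (simp add: s_def)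
 define X where "X = S.PP s ?q \<bullet> ?q"
 have X: "X <= (norm ?q)\<^sup>2" "0 <= X" using S_contr[OF s0] S_pos[OF s0] by (auto simp: X_def)
 have "S.QQ s ?q \<bullet> ?p = (s *R D (S.PP s ?q)) \<bullet> ?p" using S.QQ_eq[OF s0] by simp
 also have "... = S.PP s ?q \<bullet> (s *R D ?p)" using D_sym[OF S.PP_dom[OF s0] qd(2)] by simp
 also have "s *R D ?p = (1/2) *R ?q" using q by (metis scaleR_half_double scaleR_2 scaleR_add_right)
 finally have d: "S.QQ s ?q \<bullet> ?p = X / 2" by (simp add: X_def)
 have "S.QQ s ?q \<bullet> (s *R D ?q) = (s *R D (S.QQ s ?q)) \<bullet> ?q"
  using D_sym[OF S.QQ_dom[OF s0] qd(1)] by simp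
 also have "s *R D (S.QQ s ?q) = ?q - S.PP s ?q" using S.PQ_sum[OF s0, of ?q] by (simp add: algebra_simps)
 finally have e: "S.QQ s ?q \<bullet> (s *R D ?q) = (norm ?q)\<^sup>2 - X" by (simp add: X_def inner_simps power2_norm_eq_inner)
 have "S.QQ s ?q \<bullet> u = S.QQ s ?q \<bullet> (?p + 2 *R (s *R D ?q))" using u by simp
 also have "... = X / 2 + 2 * ((norm ?q)\<^sup>2 - X)" unfolding inner_add_right inner_scaleR_right[of _ 2] d e ..
 finally have "S.QQ s ?q \<bullet> u >= (norm ?q)\<^sup>2 / 2" using X unfolding right_diff_distrib by linarith
 then show "(3/4) * sq (S.QQ t u) <= (S.PP (t/2) u - S.PP t u) \<bullet> u" using c by (simp add: s_def)
qed

lemma S_square_sum: "(\<Sum>k<K. sq (S.QQ (tk k) u)) <= (4/3) * sq u"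
proof -
 have "(\<Sum>k<K. (3/4) * sq (S.QQ (tk k) u)) <= (\<Sum>k<K. S.PP (tk (Suc k)) u \<bullet> u - S.PP (tk k) u \<bullet> u)"
  by (rule sum_mono) (use S_telescope(2) in "simp add: tk_Suc inner_simps")
 also have "... = S.PP (tk K) u \<bullet> u - S.PP (tk 0) u \<bullet> u" by (rule sum_lessThan_telescope)
 also have "... <= sq u" using S_contr[of "tk K" u] S_pos[of "tk 0" u] by simp
 finally show ?thesis using sum_distrib_left[of "3/4" "%k. sq (S.QQ (tk k) u)" "{..<K}"] by linarith
qed

text \<open>Strong convergence holds on the domain with rate \<open>t\<close>, and extends by density and contractivity.\<close>

lemma S_tendsto: "(%k. S.PP (tk k) u) ----> u"
proof (rule LIMSEQ_I)
 fix e :: real assume e: "e > 0"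
 obtain v where v: "v : dom" "dist v u < e / 4"
  using closure_approachable[of u dom] dom_dense e by (auto dest: spec[of _ "e/4"])
 have "tk ----> 0" unfolding tk_def by (rule LIMSEQ_realpow_zero) auto
 then have "(%k. tk k * norm (D v)) ----> 0 * norm (D v)" by (intro tendsto_intros)
 then obtain N where N: "!!k. k >= N ==> tk k * norm (D v) < e / 4"
  using order_tendstoD(2)[of "%k. tk k * norm (D v)" 0 sequentially "e/4"] e unfolding eventually_sequentially by auto
 show "\<exists>N. \<forall>k\<ge>N. norm (S.PP (tk k) u - u) < e"
 proof (intro exI[of _ N] allI impI)
  fix k assume "k >= N"
  have t0: "tk k ~= 0" by simp
  have "v - S.PP (tk k) v = S.QQ (tk k) (tk k *R D v)" using S.PQ_BD(2)[OF t0 v(1)] by simp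
  then have "norm (v - S.PP (tk k) v) <= tk k * norm (D v)"
   using SQ_norm[OF t0, of "tk k *R D v"] tk_pos(1)[of k] by (metis abs_of_pos norm_scaleR)
  then have 1: "norm (v - S.PP (tk k) v) < e / 4" using N[OF \<open>k \<ge> N\<close>] by linarith
  have 2: "norm (S.PP (tk k) (u - v)) <= norm (u - v)" by (rule S_norm[OF t0])
  have "S.PP (tk k) u - u = S.PP (tk k) (u - v) - (v - S.PP (tk k) v) - (u - v)"
   using linear_diff[OF S.PP_linear[OF t0]] by simp
  then have "norm (S.PP (tk k) u - u) <= norm (S.PP (tk k) (u - v)) + norm (v - S.PP (tk k) v) + norm (u - v)"
   using norm_triangle_ineq4[of "S.PP (tk k) (u - v) - (v - S.PP (tk k) v)" "u - v"]
    norm_triangle_ineq4[of "S.PP (tk k) (u - v)" "v - S.PP (tk k) v"] by simp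
  then show "norm (S.PP (tk k) u - u) < e" using 1 2 v(2) e by (simp add: dist_norm norm_minus_commute)
 qed
qed

end

section \<open>Smooth functions\<close>

definition smooth :: "(real^'n => real) => bool" where
 "smooth \<phi> \<longleftrightarrow> (\<forall>k. times_cont_diff k \<phi>)"

lemma partial_deriv_eq: "(\<phi> has_derivative \<phi>') (at x) ==> partial_deriv j \<phi> x = \<phi>' (axis j 1)"
 unfolding partial_deriv_def by (metis frechet_derivative_at)

lemma tcd_has_derivative:
 "times_cont_diff (Suc k) \<phi> ==> (\<phi> has_derivative frechet_derivative \<phi> (at x)) (at x)"
 by (simp add: differentiable_on_def frechet_derivative_works)

lemma tcd_Suc: "times_cont_diff (Suc k) \<phi> ==> times_cont_diff k \<phi>"
proof (induction k arbitrary: \<phi>)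
 case 0
 then show ?case by (simp add: differentiable_imp_continuous_on)
next
 case (Suc k)
 have "times_cont_diff k (partial_deriv j \<phi>)" for j by (rule Suc.IH) (use Suc.prems in simp)
 then show ?case using Suc.prems by simp
qed

lemma tcd_SucI:
 assumes "!!x. (\<phi> has_derivative \<phi>' x) (at x)" "!!j. times_cont_diff k (%x. \<phi>' x (axis j 1))"
 shows "times_cont_diff (Suc k) \<phi>"
proof -
 have "partial_deriv j \<phi> = (%x. \<phi>' x (axis j 1))" for j using partial_deriv_eq[OF assms(1)] by auto
 moreover have "\<phi> differentiable_on UNIV" using assms(1) by (auto simp: differentiable_on_def differentiable_def)
 ultimately show ?thesis using assms(2) by simp
qed

lemma tcd_const: "times_cont_diff k (%x. c)"
proof (induction k arbitrary: c)
 case (Suc k)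
 show ?case by (rule tcd_SucI[where \<phi>' = "%x h. 0"]) (use Suc in auto)
qed simp

lemma tcd_add: "times_cont_diff k \<phi> ==> times_cont_diff k \<psi> ==> times_cont_diff k (%x. \<phi> x + \<psi> x)"
proof (induction k arbitrary: \<phi> \<psi>)
 case (Suc k)
 show ?case
  by (rule tcd_SucI[OF has_derivative_add[OF tcd_has_derivative[OF Suc.prems(1)] tcd_has_derivative[OF Suc.prems(2)]]])
   (use Suc in "auto simp flip: partial_deriv_def")
qed (simp add: continuous_on_add)

lemma tcd_mult: "times_cont_diff k \<phi> ==> times_cont_diff k \<psi> ==> times_cont_diff k (%x. \<phi> x * \<psi> x)"
proof (induction k arbitrary: \<phi> \<psi>)
 case (Suc k)
 show ?case
 proof (rule tcd_SucI[OF has_derivative_mult[OF tcd_has_derivative[OF Suc.prems(1)] tcd_has_derivative[OF Suc.prems(2)]]])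
  fix j
  have "times_cont_diff k (partial_deriv j \<phi>)" "times_cont_diff k (partial_deriv j \<psi>)" using Suc.prems by simp_all
  then have "times_cont_diff k (%x. \<phi> x * partial_deriv j \<psi> x)" "times_cont_diff k (%x. partial_deriv j \<phi> x * \<psi> x)"
   using Suc.IH tcd_Suc[OF Suc.prems(1)] tcd_Suc[OF Suc.prems(2)] by blast+
  from tcd_add[OF this]
  show "times_cont_diff k (%x. \<phi> x * frechet_derivative \<psi> (at x) (axis j 1) + frechet_derivative \<phi> (at x) (axis j 1) * \<psi> x)"
   by (simp add: partial_deriv_def)
 qed
qed (simp add: continuous_on_mult)

lemma tcd_inverse:
 assumes nz: "!!x. \<phi> x ~= 0" and \<phi>: "times_cont_diff k \<phi>"
 shows "times_cont_diff k (%x. inverse (\<phi> x))"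
 using \<phi>
proof (induction k)
 case 0
 then show ?case using nz by (simp add: continuous_on_inverse)
next
 case (Suc k)
 have d: "((%x. inverse (\<phi> x)) has_derivative (%h. - (inverse (\<phi> x) * frechet_derivative \<phi> (at x) h * inverse (\<phi> x)))) (at x)" for x
  by (rule Deriv.has_derivative_inverse[OF nz tcd_has_derivative[OF Suc.prems]])
 show ?case
 proof (rule tcd_SucI[OF d])
  fix j
  have i: "times_cont_diff k (%x. inverse (\<phi> x))" by (rule Suc.IH[OF tcd_Suc[OF Suc.prems]])
  have "times_cont_diff k (partial_deriv j \<phi>)" using Suc.prems by simp
  from tcd_mult[OF tcd_const[of k "-1"] tcd_mult[OF tcd_mult[OF i this] i]]
  show "times_cont_diff k (%x. - (inverse (\<phi> x) * frechet_derivative \<phi> (at x) (axis j 1) * inverse (\<phi> x)))"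
   by (simp add: partial_deriv_def)
 qed
qed

lemma affine_has_derivative:
 assumes "(\<phi> has_derivative \<phi>') (at (c *R x + b))"
 shows "((%x. \<phi> (c *R x + b)) has_derivative (%h. \<phi>' (c *R h))) (at x)"
proof -
 have "((%x. c *R x + b) has_derivative (%h. c *R h)) (at x)" by (auto intro!: derivative_eq_intros)
 from has_derivative_compose[OF this assms] show ?thesis .
qed

lemma tcd_affine: "times_cont_diff k \<phi> ==> times_cont_diff k (%x. \<phi> (c *R x + b))"
proof (induction k arbitrary: \<phi>)
 case 0
 then show ?case by (auto intro!: continuous_on_compose2[of UNIV \<phi>] continuous_intros)
next
 case (Suc k)
 note d = tcd_has_derivative[OF Suc.prems]
 show ?case
 proof (rule tcd_SucI[OF affine_has_derivative[OF d]])
  fix j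
  have "times_cont_diff k (%x. c * partial_deriv j \<phi> (c *R x + b))"
   by (intro tcd_mult tcd_const Suc.IH) (use Suc.prems in simp)
  then show "times_cont_diff k (%x. frechet_derivative \<phi> (at (c *R x + b)) (c *R axis j 1))"
   using linear_scale[OF has_derivative_linear[OF d]] by (simp add: partial_deriv_def)
 qed
qed

lemma smooth_const: "smooth (%x. c)"
 and smooth_add: "smooth \<phi> ==> smooth \<psi> ==> smooth (%x. \<phi> x + \<psi> x)"
 and smooth_mult: "smooth \<phi> ==> smooth \<psi> ==> smooth (%x. \<phi> x * \<psi> x)"
 and smooth_inverse: "(!!x. \<phi> x ~= 0) ==> smooth \<phi> ==> smooth (%x. inverse (\<phi> x))"
 and smooth_affine: "smooth \<phi> ==> smooth (%x. \<phi> (c *R x + b))"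
 by (auto simp: smooth_def tcd_const tcd_add tcd_mult tcd_inverse tcd_affine)

lemma smooth_sum: "finite I ==> (!!i. i : I ==> smooth (\<phi> i)) ==> smooth (%x. \<Sum>i\<in>I. \<phi> i x)"
 by (induction I rule: finite_induct) (auto simp: smooth_const smooth_add)

lemma smooth_prod: "finite I ==> (!!i. i : I ==> smooth (\<phi> i)) ==> smooth (%x. \<Prod>i\<in>I. \<phi> i x)"
 by (induction I rule: finite_induct) (auto simp: smooth_const smooth_mult)

lemma smooth_power: "smooth \<phi> ==> smooth (%x. \<phi> x ^ N)" by (induction N) (auto simp: smooth_const smooth_mult)

lemma smooth_coord: "smooth (%x. x $ i)" unfolding smooth_def
proof
 fix k show "times_cont_diff k (%x. x $ i)"
 proof (cases k)
  case 0
  then show ?thesis by (auto intro!: continuous_intros)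
 next
  case (Suc k)
  have "((%x :: real^'a. x $ i) has_derivative (%h. h $ i)) (at x)" for x
   by (rule bounded_linear_imp_has_derivative[OF bounded_linear_vec_nth])
  from tcd_SucI[OF this tcd_const, of k] show ?thesis by (simp add: Suc)
 qed
qed

lemma smooth_partial: "smooth \<phi> ==> smooth (partial_deriv j \<phi>)"
 unfolding smooth_def using times_cont_diff.simps(2) by blast

lemma smooth_has_derivative: "smooth \<phi> ==> (\<phi> has_derivative frechet_derivative \<phi> (at x)) (at x)"
 unfolding smooth_def using tcd_has_derivative by blast

lemma smooth_continuous: "smooth \<phi> ==> continuous_on UNIV \<phi>"
 unfolding smooth_def using times_cont_diff.simps(1) by blast

lemma smooth_measurable: "smooth \<phi> ==> \<phi> : bfun" by (rule borel_measurable_continuous_onI[OF smooth_continuous])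

lemma frechet_sum:
 assumes "smooth \<phi>"
 shows "frechet_derivative \<phi> (at x) h = (\<Sum>j\<in>UNIV. h $ j * partial_deriv j \<phi> x)"
proof -
 have l: "linear (frechet_derivative \<phi> (at x))" by (rule has_derivative_linear[OF smooth_has_derivative[OF assms]])
 have "h = (\<Sum>j\<in>UNIV. h $ j *R axis j 1)" using basis_expansion[of h] by (simp add: scalar_mult_eq_scaleR)
 then have "frechet_derivative \<phi> (at x) h = frechet_derivative \<phi> (at x) (\<Sum>j\<in>UNIV. h $ j *R axis j 1)" by simp
 also have "... = (\<Sum>j\<in>UNIV. h $ j * partial_deriv j \<phi> x)"
  unfolding linear_sum[OF l] linear_scale[OF l] by (simp add: partial_deriv_def)
 finally show ?thesis .
qed

lemma partial_mult:
 assumes "smooth \<phi>" "smooth \<psi>"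
 shows "partial_deriv j (%x. \<phi> x * \<psi> x) x = \<phi> x * partial_deriv j \<psi> x + partial_deriv j \<phi> x * \<psi> x"
 using partial_deriv_eq[OF has_derivative_mult[OF smooth_has_derivative[OF assms(1)] smooth_has_derivative[OF assms(2)]]]
 by (simp add: partial_deriv_def)

lemma partial_affine:
 assumes "smooth \<phi>"
 shows "partial_deriv j (%x. \<phi> (c *R x + b)) x = c * partial_deriv j \<phi> (c *R x + b)"
 using partial_deriv_eq[OF affine_has_derivative[OF smooth_has_derivative[OF assms]]]
  linear_scale[OF has_derivative_linear[OF smooth_has_derivative[OF assms]]] by (simp add: partial_deriv_def)

lemma partial_deriv_line:
 assumes "smooth \<phi>" "((%s. \<phi> (x + s *R axis j 1)) has_real_derivative d) (at 0)"
 shows "partial_deriv j \<phi> x = d"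
proof -
 have "((%s :: real. x + s *R axis j 1) has_derivative (%h. h *R axis j 1)) (at 0)"
  by (auto intro!: derivative_eq_intros)
 moreover have "(\<phi> has_derivative frechet_derivative \<phi> (at x)) (at (x + 0 *R axis j 1))"
  using smooth_has_derivative[OF assms(1)] by simp
 ultimately have "((%s. \<phi> (x + s *R axis j 1)) has_derivative (%h. frechet_derivative \<phi> (at x) (h *R axis j 1))) (at 0)"
  by (rule has_derivative_compose)
 then have "((%s. \<phi> (x + s *R axis j 1)) has_real_derivative (partial_deriv j \<phi> x)) (at 0)"
  using linear_scale[OF has_derivative_linear[OF smooth_has_derivative[OF assms(1), of x]]]
  by (simp add: has_field_derivative_def partial_deriv_def mult.commute[of _ "frechet_derivative \<phi> (at x) (axis j 1)"] fun_eq_iff)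
 then show ?thesis using DERIV_unique assms(2) by blast
qed

lemma test_function_iff: "test_function \<phi> \<longleftrightarrow> smooth \<phi> \<and> (\<exists>R. \<forall>x. norm x > R --> \<phi> x = 0)"
proof -
 have "compact (closure {x. \<phi> x ~= 0}) \<longleftrightarrow> bounded {x. \<phi> x ~= 0}" by simp
 also have "... \<longleftrightarrow> (\<exists>R. \<forall>x. norm x > R --> \<phi> x = 0)"
  unfolding bounded_iff by (auto simp: not_less[symmetric])
 finally show ?thesis by (simp add: test_function_def smooth_def)
qed

lemma test_smooth: "test_function \<phi> ==> smooth \<phi>" by (simp add: test_function_iff)

lemma test_mult_left: "smooth \<omega> ==> test_function \<phi> ==> test_function (%x. \<omega> x * \<phi> x)"
 by (auto simp: test_function_iff smooth_mult)

lemma test_affine: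
 assumes "test_function \<phi>" "c ~= 0"
 shows "test_function (%x. \<phi> (c *R x + b))"
proof -
 obtain R where R: "!!x. norm x > R ==> \<phi> x = 0" using assms by (auto simp: test_function_iff)
 have "\<phi> (c *R x + b) = 0" if "norm x > (\<bar>R\<bar> + norm b) / \<bar>c\<bar>" for x
 proof (rule R)
  have "\<bar>R\<bar> + norm b < \<bar>c\<bar> * norm x" using that assms(2) by (simp add: pos_divide_less_eq mult.commute)
  then show "R < norm (c *R x + b)" using norm_triangle_ineq2[of "c *R x" "- b"] by simp
 qed
 then show ?thesis using assms by (auto simp: test_function_iff smooth_affine)
qed

lemma test_partial:
 assumes "test_function \<phi>" shows "test_function (partial_deriv j \<phi>)"
proof -
 obtain R where R: "!!x. norm x > R ==> \<phi> x = 0" and s: "smooth \<phi>" using assms by (auto simp: test_function_iff)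
 have "partial_deriv j \<phi> x = 0" if x: "norm x > R" for x
 proof -
  have "(\<phi> has_derivative (%h. 0)) (at x)"
  proof (rule has_derivative_transform_within_open[of "%x. 0"])
   show "open {x :: real^'a. norm x > R}" by (intro open_Collect_less continuous_intros)
  qed (use x R in auto)
  from partial_deriv_eq[OF this] show ?thesis .
 qed
 then show ?thesis using smooth_partial[OF s] by (auto simp: test_function_iff)
qed

lemma test_bounded:
 assumes "test_function \<phi>" obtains M where "!!x. \<bar>\<phi> x\<bar> <= M" "M >= 0"
proof -
 obtain R where R: "!!x. norm x > R ==> \<phi> x = 0" and s: "smooth \<phi>" using assms by (auto simp: test_function_iff)
 have "compact (\<phi> ` cball 0 R)"
  by (intro compact_continuous_image continuous_on_subset[OF smooth_continuous[OF s]]) auto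
 then have "bounded (\<phi> ` cball 0 R)" by (rule compact_imp_bounded)
 then obtain M where M': "\<forall>y \<in> \<phi> ` cball 0 R. norm y <= M" unfolding bounded_iff ..
 have M: "\<bar>\<phi> x\<bar> <= M" if "norm x <= R" for x using bspec[OF M' imageI, of x] that by simp
 have "\<bar>\<phi> x\<bar> <= max M 0" for x using R[of x] M[of x] by (cases "norm x > R") auto
 then show ?thesis using that[of "max M 0"] by auto
qed

lemma test_lipschitz:
 assumes "test_function \<phi>" obtains L where "!!x y. \<bar>\<phi> x - \<phi> y\<bar> <= L * norm (x - y)" "L >= 0"
proof -
 have s: "smooth \<phi>" by (rule test_smooth[OF assms])
 have "\<exists>M. \<forall>x. \<bar>partial_deriv j \<phi> x\<bar> <= M \<and> M >= 0" for j
  using test_bounded[OF test_partial[OF assms, of j]] by metis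
 then obtain M where M: "!!j x. \<bar>partial_deriv j \<phi> x\<bar> <= M j" "!!j. M j >= 0" by metis
 define L where "L = (\<Sum>j\<in>UNIV. M j)"
 have "norm (\<phi> x - \<phi> y) <= L * norm (x - y)" for x y
 proof (rule differentiable_bound[of UNIV])
  show "(\<phi> has_derivative frechet_derivative \<phi> (at z)) (at z within UNIV)" for z
   using smooth_has_derivative[OF s] by simp
  show "onorm (frechet_derivative \<phi> (at z)) <= L" for z
  proof (rule onorm_le)
   fix h
   have "norm (frechet_derivative \<phi> (at z) h) <= (\<Sum>j\<in>UNIV. \<bar>h $ j * partial_deriv j \<phi> z\<bar>)"
    unfolding frechet_sum[OF s] real_norm_def by (rule sum_abs)
   also have "... <= (\<Sum>j\<in>UNIV. norm h * M j)"
    unfolding abs_mult by (intro sum_mono mult_mono M component_le_norm_cart) auto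
   finally show "norm (frechet_derivative \<phi> (at z) h) <= L * norm h" by (simp add: L_def sum_distrib_left mult.commute)
  qed
 qed auto
 moreover have "L >= 0" unfolding L_def by (rule sum_nonneg) (use M in auto)
 ultimately show ?thesis using that by auto
qed

subsection \<open>Cutoffs\<close>

text \<open>The functions \<open>s\<^sup>-\<^sup>j exp(-1/s)\<close> are closed under differentiation up to linear combinations, which gives
smoothness by induction.\<close>

definition flat :: "nat => real => real" where
 "flat j s = (if s > 0 then exp (- inverse s) * inverse s ^ j else 0)"

lemma flat_le: "\<bar>flat j s\<bar> <= fact (j + 2) * s\<^sup>2"
proof (cases "s > 0")
 case True
 define y where "y = inverse s"
 have y: "y > 0" using True by (simp add: y_def)
 have "y ^ (j + 2) /\<^sub>R fact (j + 2) <= exp y"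
  unfolding exp_def using sum_le_suminf[OF summable_exp_generic[of y], of "{j + 2}"] y by simp
 then have "y ^ (j + 2) <= fact (j + 2) * exp y" by (simp add: divide_simps mult.commute)
 then have "y ^ j * y\<^sup>2 * exp (- y) <= fact (j + 2) * exp y * exp (- y)"
  by (intro mult_right_mono) (simp_all only: power_add exp_ge_zero)
 then have "y ^ j * y\<^sup>2 * exp (- y) <= fact (j + 2)" by (simp add: exp_minus field_simps)
 then have "y ^ j * y\<^sup>2 * exp (- y) * s\<^sup>2 <= fact (j + 2) * s\<^sup>2" by (rule mult_right_mono) simp
 moreover have "y\<^sup>2 * s\<^sup>2 = 1" using True by (simp add: y_def power_mult_distrib[symmetric])
 then have "y ^ j * y\<^sup>2 * exp (- y) * s\<^sup>2 = flat j s" using True by (simp add: flat_def y_def[symmetric] mult_ac)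
 ultimately have "flat j s <= fact (j + 2) * s\<^sup>2" by (simp only:)
 moreover have "0 <= flat j s" by (simp add: flat_def)
 ultimately show ?thesis by (simp only: abs_of_nonneg)
qed (simp add: flat_def)

lemma flat_deriv: "(flat j has_real_derivative (flat (j + 2) s - j * flat (j + 1) s)) (at s)"
proof -
 consider "s > 0" | "s < 0" | "s = 0" by linarith
 then show ?thesis
 proof cases
  case 1
  have "((%s. exp (- inverse s) * inverse s ^ j) has_real_derivative (flat (j + 2) s - j * flat (j + 1) s)) (at s)"
   using 1 by (auto intro!: derivative_eq_intros simp: flat_def algebra_simps power2_eq_square power_Suc[symmetric] simp del: power_Suc)
    (cases j; simp add: algebra_simps)
  then show ?thesis by (rule has_field_derivative_transform_within_open[of _ _ _ "{0<..}"]) (use 1 in "auto simp: flat_def")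
 next
  case 2
  have "((%s. 0) has_real_derivative (flat (j + 2) s - j * flat (j + 1) s)) (at s)" using 2 by (simp add: flat_def)
  then show ?thesis by (rule has_field_derivative_transform_within_open[of _ _ _ "{..<0}"]) (use 2 in "auto simp: flat_def")
 next
  case 3
  have "((%h. (flat j (0 + h) - flat j 0) / h) \<longlongrightarrow> 0) (at 0)"
  proof (rule Lim_null_comparison)
   show "\<forall>\<^sub>F h in at 0. norm ((flat j (0 + h) - flat j 0) / h) <= fact (j + 2) * \<bar>h\<bar>"
    using flat_le[of j]
    by (auto simp: eventually_at_filter flat_def[of j 0] divide_le_eq power2_eq_square abs_mult_self_eq mult.assoc intro!: always_eventually)
   have "((%h :: real. fact (j + 2) * \<bar>h\<bar>) \<longlongrightarrow> fact (j + 2) * \<bar>0\<bar>) (at 0)" by (intro tendsto_intros)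
   then show "((%h :: real. fact (j + 2) * \<bar>h\<bar>) \<longlongrightarrow> 0) (at 0)" by simp
  qed
  then show ?thesis using 3 by (simp add: DERIV_def flat_def)
 qed
qed

lemma continuous_on_flat: "continuous_on A (flat j)"
 by (rule DERIV_continuous_on[OF has_field_derivative_at_within[OF flat_deriv]])

lemma smooth_flat: "smooth (%x. flat j (a * x $ i + b))"
proof -
 have "times_cont_diff k (%x. flat j (a * x $ i + b))" for k
 proof (induction k arbitrary: j)
  case 0
  show ?case using continuous_on_flat[of UNIV j] by (auto intro!: continuous_on_compose2[of UNIV "flat j"] continuous_intros)
 next
  case (Suc k)
  have d: "((%x. flat j (a * x $ i + b)) has_derivative
    (%h. (flat (j + 2) (a * x $ i + b) - j * flat (j + 1) (a * x $ i + b)) * (a * h $ i))) (at x)" for x :: "real^'a"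
  proof -
   have 1: "((%x. a * x $ i + b) has_derivative (%h. a * h $ i)) (at x)"
    by (auto intro!: derivative_eq_intros bounded_linear_imp_has_derivative[OF bounded_linear_vec_nth])
   have 2: "(flat j has_derivative (%h. (flat (j + 2) (a * x $ i + b) - j * flat (j + 1) (a * x $ i + b)) * h)) (at (a * x $ i + b))"
    using flat_deriv[of j "a * x $ i + b"] by (simp add: has_field_derivative_def)
   show ?thesis using has_derivative_compose[OF 1 2] .
  qed
  show ?case
  proof (rule tcd_SucI[OF d])
   fix j' :: 'a
   have "times_cont_diff k (%x. (flat (j + 2) (a * x $ i + b) + (- j) * flat (j + 1) (a * x $ i + b)) * (a * axis j' 1 $ i))"
    by (intro tcd_mult tcd_add tcd_const Suc.IH)
   then show "times_cont_diff k (%x. (flat (j + 2) (a * x $ i + b) - j * flat (j + 1) (a * x $ i + b)) * (a * axis j' 1 $ i))"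
    by simp
  qed
 qed
 then show ?thesis by (simp add: smooth_def)
qed

definition sstep :: "real => real" where
 "sstep s = flat 0 s * inverse (flat 0 s + flat 0 (1 - s))"

lemma flat_nonneg: "flat j s >= 0" and flat_pos: "s > 0 ==> flat j s > 0" and flat_zero: "s <= 0 ==> flat j s = 0"
 by (auto simp: flat_def)

lemma sstep_denom: "flat 0 s + flat 0 (1 - s) > 0"
 using flat_pos[of s 0] flat_pos[of "1 - s" 0] flat_nonneg[of 0 s] flat_nonneg[of 0 "1 - s"]
 by (cases "s > 0") (auto intro: add_pos_nonneg add_nonneg_pos)

lemma sstep_range: "0 <= sstep s" "sstep s <= 1"
proof -
 show "0 <= sstep s" using sstep_denom[of s] flat_nonneg[of 0 s] by (simp add: sstep_def)
 show "sstep s <= 1" using sstep_denom[of s] flat_nonneg[of 0 "1 - s"] by (simp add: sstep_def field_simps)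
qed

lemma sstep_0: "s <= 0 ==> sstep s = 0" and sstep_1: "s >= 1 ==> sstep s = 1"
 using flat_pos[of s 0] by (auto simp: sstep_def flat_zero)

lemma smooth_sstep: "smooth (%x. sstep (a * x $ i + b))"
proof -
 have "smooth (%x. flat 0 (1 - (a * x $ i + b)))" using smooth_flat[of 0 "- a" i "1 - b"] by (simp add: algebra_simps)
 moreover have "flat 0 (a * x $ i + b) + flat 0 (1 - (a * x $ i + b)) ~= 0" for x :: "real^'a"
  using sstep_denom[of "a * x $ i + b"] by simp
 ultimately show ?thesis unfolding sstep_def by (intro smooth_mult smooth_inverse smooth_add smooth_flat)
qed

lemma sstep_deriv: "\<exists>s' L. (\<forall>s. (sstep has_real_derivative s' s) (at s)) \<and> (\<forall>s. \<bar>s' s\<bar> <= L) \<and> L >= 0"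
proof -
 define d where "d s = flat 0 s + flat 0 (1 - s)" for s
 define s' where "s' s = (flat 2 s * d s - flat 0 s * (flat 2 s - flat 2 (1 - s))) * inverse (d s * d s)" for s
 have d0: "d s > 0" for s using sstep_denom by (simp add: d_def)
 have f: "(flat 0 has_real_derivative flat 2 s) (at s)" for s using flat_deriv[of 0 s] by (simp add: numeral_2_eq_2)
 have f1: "((%s. flat 0 (1 - s)) has_real_derivative - flat 2 (1 - s)) (at s)" for s
 proof -
  have "((%s. 1 - s) has_real_derivative - 1) (at s)" by (auto intro!: derivative_eq_intros)
  from DERIV_chain2[where g = "%s. 1 - s", OF f this] show ?thesis by simp
 qed
 have dd: "(d has_real_derivative (flat 2 s - flat 2 (1 - s))) (at s)" for s
  unfolding d_def using DERIV_add[OF f[of s] f1[of s]] by simp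
 have D: "(sstep has_real_derivative s' s) (at s)" for s
 proof -
  have "((%s. flat 0 s / d s) has_real_derivative s' s) (at s)"
   using DERIV_divide[OF f[of s] dd[of s]] d0[of s] by (simp add: s'_def divide_inverse)
  then show ?thesis unfolding sstep_def[abs_def] d_def divide_inverse .
 qed
 have "continuous_on {0..1} s'" unfolding s'_def d_def
  by (intro continuous_intros continuous_on_flat continuous_on_compose2[OF continuous_on_flat[of UNIV]]) (use d0 in "auto simp: d_def less_imp_neq[symmetric]")
 then have "bounded (s' ` {0..1})" by (intro compact_imp_bounded compact_continuous_image) auto
 then obtain L where L': "\<forall>y \<in> s' ` {0..1}. norm y <= L" unfolding bounded_iff ..
 have L: "\<bar>s' s\<bar> <= L" if "s : {0..1}" for s using bspec[OF L' imageI[OF that]] by simp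
 have "\<bar>s' s\<bar> <= max L 0" for s
 proof (cases "s : {0..1}")
  case False
  then have "s' s = 0" by (auto simp: s'_def d_def flat_zero algebra_simps)
  then show ?thesis by simp
 qed (use L in force)
 then show ?thesis using D by (intro exI[of _ s'] exI[of _ "max L 0"]) auto
qed

definition cutoff :: "real^'n => real^'n => real => real^'n => real" where
 "cutoff a l \<epsilon> x = (\<Prod>i\<in>UNIV. sstep ((x $ i - a $ i) / \<epsilon>) * sstep ((a $ i + l $ i - x $ i) / \<epsilon>))"

lemma smooth_cutoff: "smooth (cutoff a l \<epsilon>)"
proof -
 have "smooth (%x. sstep ((x $ i - a $ i) / \<epsilon>))" for i
  using smooth_sstep[of "1 / \<epsilon>" i "- a $ i / \<epsilon>"] by (simp add: diff_divide_distrib)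
 moreover have "smooth (%x. sstep ((a $ i + l $ i - x $ i) / \<epsilon>))" for i
  using smooth_sstep[of "- (1 / \<epsilon>)" i "(a $ i + l $ i) / \<epsilon>"] by (simp add: diff_divide_distrib add_divide_distrib algebra_simps)
 ultimately show ?thesis unfolding cutoff_def[abs_def] by (intro smooth_prod smooth_mult) auto
qed

lemma cutoff_range: "0 <= cutoff a l \<epsilon> x" "cutoff a l \<epsilon> x <= 1"
 unfolding cutoff_def by (auto intro!: prod_nonneg prod_le_1 mult_nonneg_nonneg mult_le_one sstep_range)

lemma cutoff_eq_1:
 assumes "\<epsilon> > 0" "!!i. a $ i + \<epsilon> <= x $ i" "!!i. x $ i <= a $ i + l $ i - \<epsilon>"
 shows "cutoff a l \<epsilon> x = 1"
proof -
 have "sstep ((x $ i - a $ i) / \<epsilon>) = 1" "sstep ((a $ i + l $ i - x $ i) / \<epsilon>) = 1" for i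
  using assms(1) assms(2)[of i] assms(3)[of i] by (auto intro!: sstep_1 simp: pos_le_divide_eq)
 then show ?thesis by (simp add: cutoff_def)
qed

lemma cutoff_eq_0:
 assumes "\<epsilon> > 0" "x $ i <= a $ i \<or> a $ i + l $ i <= x $ i"
 shows "cutoff a l \<epsilon> x = 0"
proof -
 have "sstep ((x $ i - a $ i) / \<epsilon>) = 0 \<or> sstep ((a $ i + l $ i - x $ i) / \<epsilon>) = 0"
  using assms by (auto intro!: sstep_0 simp: divide_le_0_iff)
 then show ?thesis unfolding cutoff_def by (intro prod_zero) auto
qed

lemma test_cutoff:
 assumes "\<epsilon> > 0"
 shows "test_function (cutoff a l \<epsilon>)"
proof -
 have "cutoff a l \<epsilon> x = 0" if x: "norm x > norm a + (\<Sum>i\<in>UNIV. \<bar>l $ i\<bar>)" for x :: "real^'a"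
 proof (rule ccontr)
  assume "cutoff a l \<epsilon> x ~= 0"
  then have "a $ i < x $ i \<and> x $ i < a $ i + l $ i" for i using cutoff_eq_0[OF assms, of x i a l] by force
  then have b: "\<bar>(x - a) $ i\<bar> <= \<bar>l $ i\<bar>" for i by (smt (verit) vector_minus_component)
  have "norm (x - a) <= (\<Sum>i\<in>UNIV. \<bar>(x - a) $ i\<bar>)" by (rule norm_le_l1_cart)
  also have "... <= (\<Sum>i\<in>UNIV. \<bar>l $ i\<bar>)" by (rule sum_mono) (rule b)
  finally show False using x norm_triangle_sub[of x a] by linarith
 qed
 then show ?thesis using smooth_cutoff by (auto simp: test_function_iff)
qed

lemma cutoff_partial:
 "\<exists>L\<ge>0. \<forall>(a :: real^'n) l \<epsilon> x j. \<epsilon> > 0 --> \<bar>partial_deriv j (cutoff a l \<epsilon>) x\<bar> <= L / \<epsilon>"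
proof -
 obtain s' L where s': "!!s. (sstep has_real_derivative s' s) (at s)" and L: "!!s. \<bar>s' s\<bar> <= L" "L >= 0"
  using sstep_deriv by blast
 have "\<bar>partial_deriv j (cutoff a l \<epsilon>) x\<bar> <= 2 * L / \<epsilon>" if e: "\<epsilon> > 0" for a x l :: "real^'n" and \<epsilon> j
 proof -
  define K where "K = (\<Prod>i\<in>UNIV - {j}. sstep ((x $ i - a $ i) / \<epsilon>) * sstep ((a $ i + l $ i - x $ i) / \<epsilon>))"
  have K: "0 <= K" "K <= 1"
   unfolding K_def by (auto intro!: prod_nonneg prod_le_1 mult_nonneg_nonneg mult_le_one sstep_range)
  let ?u = "(x $ j - a $ j) / \<epsilon>" and ?v = "(a $ j + l $ j - x $ j) / \<epsilon>"
  define d where "d = s' ?u / \<epsilon> * sstep ?v + sstep ?u * (- s' ?v / \<epsilon>)"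
  have eq: "cutoff a l \<epsilon> (x + s *R axis j 1) = K * (sstep ((x $ j + s - a $ j) / \<epsilon>) * sstep ((a $ j + l $ j - (x $ j + s)) / \<epsilon>))" for s
  proof -
   have "cutoff a l \<epsilon> (x + s *R axis j 1) =
     (sstep ((x $ j + s - a $ j) / \<epsilon>) * sstep ((a $ j + l $ j - (x $ j + s)) / \<epsilon>)) *
     (\<Prod>i\<in>UNIV - {j}. sstep (((x + s *R axis j 1) $ i - a $ i) / \<epsilon>) * sstep ((a $ i + l $ i - (x + s *R axis j 1) $ i) / \<epsilon>))"
    unfolding cutoff_def by (subst prod.remove[of UNIV j]) (auto simp: axis_def)
   also have "(\<Prod>i\<in>UNIV - {j}. sstep (((x + s *R axis j 1) $ i - a $ i) / \<epsilon>) * sstep ((a $ i + l $ i - (x + s *R axis j 1) $ i) / \<epsilon>)) = K"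
    unfolding K_def by (rule prod.cong) (auto simp: axis_def)
   finally show ?thesis by simp
  qed
  have 1: "((%s. sstep ((x $ j + s - a $ j) / \<epsilon>)) has_real_derivative s' ?u / \<epsilon>) (at 0)"
  proof -
   have "((%s. (x $ j + s - a $ j) / \<epsilon>) has_real_derivative 1 / \<epsilon>) (at 0)"
    using e by (auto intro!: derivative_eq_intros)
   from DERIV_chain2[where g = "%s. (x $ j + s - a $ j) / \<epsilon>", OF s' this] show ?thesis by simp
  qed
  have 2: "((%s. sstep ((a $ j + l $ j - (x $ j + s)) / \<epsilon>)) has_real_derivative - s' ?v / \<epsilon>) (at 0)"
  proof -
   have "((%s. (a $ j + l $ j - (x $ j + s)) / \<epsilon>) has_real_derivative - 1 / \<epsilon>) (at 0)"
    using e by (auto intro!: derivative_eq_intros)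
   from DERIV_chain2[where g = "%s. (a $ j + l $ j - (x $ j + s)) / \<epsilon>", OF s' this] show ?thesis by simp
  qed
  have "((%s. cutoff a l \<epsilon> (x + s *R axis j 1)) has_real_derivative K * d) (at 0)"
   unfolding eq using DERIV_cmult[OF DERIV_mult[OF 1 2], of K] by (simp add: d_def algebra_simps)
  then have "partial_deriv j (cutoff a l \<epsilon>) x = K * d" by (rule partial_deriv_line[OF smooth_cutoff])
  moreover have "\<bar>K * d\<bar> <= 1 * \<bar>d\<bar>" unfolding abs_mult by (rule mult_right_mono) (use K in auto)
  moreover have "\<bar>d\<bar> <= \<bar>s' ?u / \<epsilon> * sstep ?v\<bar> + \<bar>sstep ?u * (- s' ?v / \<epsilon>)\<bar>" unfolding d_def by (rule abs_triangle_ineq)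
  moreover have "\<bar>s' ?u / \<epsilon> * sstep ?v\<bar> <= L / \<epsilon> * 1"
   unfolding abs_mult by (rule mult_mono) (use L e sstep_range in "auto intro!: divide_right_mono")
  moreover have "\<bar>sstep ?u * (- s' ?v / \<epsilon>)\<bar> <= 1 * (L / \<epsilon>)"
   unfolding abs_mult by (rule mult_mono) (use L e sstep_range in "auto intro!: divide_right_mono")
  ultimately show ?thesis by simp
 qed
 then show ?thesis using L by (intro exI[of _ "2 * L"]) auto
qed

subsection \<open>Weights\<close>

text \<open>Polynomial weights replace the exponential ones of Davies' method: their logarithmic derivative is
bounded as well, and they are smooth at the centre.\<close>

definition weight :: "real => nat => real^'n => real^'n => real" where
 "weight c N a x = inverse ((1 + c\<^sup>2 * sq (x - a)) ^ N)"

lemma weight_base: "1 <= 1 + c\<^sup>2 * sq (x - a)" by simp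

lemma weight_range: "0 < weight c N a x" "weight c N a x <= 1"
proof -
 have *: "1 <= (1 + c\<^sup>2 * sq (x - a)) ^ N" by (rule one_le_power[OF weight_base])
 then show "0 < weight c N a x" unfolding weight_def
  by (rule positive_imp_inverse_positive[OF less_le_trans[OF zero_less_one]])
 have "inverse ((1 + c\<^sup>2 * sq (x - a)) ^ N) <= inverse 1" by (rule le_imp_inverse_le[OF * zero_less_one])
 then show "weight c N a x <= 1" unfolding weight_def by simp
qed

lemma smooth_weight: "smooth (weight c N a)"
proof -
 have n: "sq (x - a) = (\<Sum>i\<in>UNIV. (x $ i + (- (a $ i))) * (x $ i + (- (a $ i))))" for x
  by (simp add: power2_norm_eq_inner inner_vec_def)
 have "1 + c\<^sup>2 * sq (x - a) ~= 0" for x using weight_base[of c x a] by linarith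
 then have nz: "(1 + c\<^sup>2 * sq (x - a)) ^ N ~= 0" for x by simp
 show ?thesis unfolding weight_def[abs_def]
 proof (rule smooth_inverse[OF nz], unfold n)
  show "smooth (%x. (1 + c\<^sup>2 * (\<Sum>i\<in>UNIV. (x $ i + - (a $ i)) * (x $ i + - (a $ i)))) ^ N)"
   by (intro smooth_power smooth_add smooth_const smooth_mult smooth_sum smooth_coord) auto
 qed
qed

lemma weight_partial:
 assumes c: "c >= 0"
 shows "\<bar>partial_deriv j (weight c N a) x\<bar> <= real N * c * weight c N a x"
proof -
 define n2 where "n2 = sq (x - a)"
 define q where "q = 1 + c\<^sup>2 * n2"
 define y where "y = (x - a) $ j"
 have q: "q > 0" using weight_base[of c x a] by (simp add: q_def n2_def add_pos_nonneg)
 have wq: "weight c N a x = inverse (q ^ N)" by (simp add: weight_def q_def n2_def)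
 have eq: "weight c N a (x + s *R axis j 1) = inverse ((1 + c\<^sup>2 * (n2 + 2 * s * y + s\<^sup>2)) ^ N)" for s
 proof -
  have "sq (x + s *R axis j 1 - a) = sq ((x - a) + s *R axis j 1)" by (simp add: algebra_simps)
  also have "... = (x - a) \<bullet> (x - a) + 2 * s * y + s\<^sup>2"
   unfolding power2_norm_eq_inner inner_add_left inner_add_right
   by (simp add: inner_axis inner_axis' y_def power2_eq_square del: inner_diff_left inner_diff_right)
  finally show ?thesis by (simp add: weight_def n2_def power2_norm_eq_inner)
 qed
 have 1: "((%s. (1 + c\<^sup>2 * (n2 + 2 * s * y + s\<^sup>2))) has_real_derivative c\<^sup>2 * (2 * y)) (at 0)"
  by (auto intro!: derivative_eq_intros)
 have 2: "((%s. (1 + c\<^sup>2 * (n2 + 2 * s * y + s\<^sup>2)) ^ N) has_real_derivative (real N * q ^ (N - 1) * (c\<^sup>2 * (2 * y)))) (at 0)"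
  using DERIV_power[OF 1, of N] by (simp add: mult_ac q_def)
 have "((%s. weight c N a (x + s *R axis j 1)) has_real_derivative
   - (real N * q ^ (N - 1) * (c\<^sup>2 * (2 * y))) * inverse ((q ^ N) ^ Suc (Suc 0))) (at 0)"
  unfolding eq using DERIV_inverse_fun[OF 2] q unfolding q_def by simp
 then have "partial_deriv j (weight c N a) x = - (real N * q ^ (N - 1) * (c\<^sup>2 * (2 * y))) * inverse ((q ^ N) ^ Suc (Suc 0))"
  by (rule partial_deriv_line[OF smooth_weight])
 also have "\<bar>...\<bar> = real N * (q ^ (N - 1) * (c\<^sup>2 * (2 * \<bar>y\<bar>)) * (weight c N a x * weight c N a x))"
  using q by (simp add: abs_mult wq mult_ac)
 also have "... <= real N * (c * weight c N a x)"
 proof (cases N)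
  case (Suc M)
  have "2 * (c * \<bar>y\<bar>) <= 1 + (c * \<bar>y\<bar>)\<^sup>2" using sum_squares_bound[of 1 "c * \<bar>y\<bar>"] by simp
  also have "... <= q"
  proof -
   have "\<bar>y\<bar>\<^sup>2 <= n2" unfolding y_def n2_def by (rule power_mono[OF component_le_norm_cart]) simp
   then have "c\<^sup>2 * \<bar>y\<bar>\<^sup>2 <= c\<^sup>2 * n2" by (rule mult_left_mono) simp
   then show ?thesis by (simp add: q_def power_mult_distrib)
  qed
  finally have h: "c * (2 * (c * \<bar>y\<bar>)) <= c * q" by (rule mult_left_mono[OF _ c])
  have qN: "q ^ (N - 1) * q = q ^ N" by (simp only: Suc diff_Suc_1 power_Suc mult.commute)
  have "q ^ N ~= 0" using q by simp
  then have w: "q ^ (N - 1) * q * weight c N a x = 1" unfolding qN wq by (rule right_inverse)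
  have "q ^ (N - 1) * (c\<^sup>2 * (2 * \<bar>y\<bar>)) * (weight c N a x * weight c N a x)
    = (c * (2 * (c * \<bar>y\<bar>))) * (q ^ (N - 1) * weight c N a x * weight c N a x)"
   by (simp add: power2_eq_square mult_ac)
  also have "... <= (c * q) * (q ^ (N - 1) * weight c N a x * weight c N a x)"
   by (rule mult_right_mono[OF h]) (use q weight_range[of c N a x] in auto)
  also have "... = c * (q ^ (N - 1) * q * weight c N a x) * weight c N a x" by (simp add: mult_ac)
  also have "... = c * weight c N a x" unfolding w by simp
  finally show ?thesis by (rule mult_left_mono) simp
 qed simp
 finally show ?thesis by (simp add: mult_ac)
qed

section \<open>Test functions and distributions\<close>

text \<open>Bounded Borel functions of bounded support: the multipliers against which every element of
\<open>L\<^sup>2\<close> may be integrated, including test functions and indicators of cubes.\<close>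

definition bbs :: "(real^'n => real) => bool" where
 "bbs \<phi> \<longleftrightarrow> \<phi> : bfun \<and> (\<exists>M R. \<forall>x. \<bar>\<phi> x\<bar> <= M \<and> (norm x > R --> \<phi> x = 0))"

lemma bbs_measurable: "bbs \<phi> ==> \<phi> : bfun" by (simp add: bbs_def)

lemma test_bbs: assumes "test_function \<phi>" shows "bbs \<phi>"
proof -
 obtain M where M: "!!x. \<bar>\<phi> x\<bar> <= M" by (rule test_bounded[OF assms]) auto
 obtain R where R: "!!x. norm x > R ==> \<phi> x = 0" using assms by (auto simp: test_function_iff)
 show ?thesis unfolding bbs_def using M R smooth_measurable[OF test_smooth[OF assms]] by blast
qed

lemma bbs_indicator: assumes "A : sets borel" "bounded A" shows "bbs (indicator A)"
proof -
 obtain R where "!!x. x : A ==> norm x <= R" using assms(2) by (auto simp: bounded_iff)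
 then have "\<forall>x. \<bar>indicator A x :: real\<bar> <= 1 \<and> (norm x > R --> indicator A x = (0::real))"
  by (auto simp: indicator_def not_less[symmetric])
 moreover have "indicat_real A : bfun" using assms(1) by simp
 ultimately show ?thesis unfolding bbs_def by (intro conjI exI[of _ 1] exI[of _ R])
qed

lemma bbs_square_integrable: assumes "bbs \<phi>" shows "integrable lborel (%x. (\<phi> x)\<^sup>2)"
proof -
 obtain M R where MR: "!!x. \<bar>\<phi> x\<bar> <= M" "!!x. norm x > R ==> \<phi> x = 0" and [measurable]: "\<phi> : bfun"
  using assms by (auto simp: bbs_def)
 have b: "integrable lborel (%x :: real^'a. M\<^sup>2 * indicator (cball 0 R) x)"
  by (intro integrable_mult_right integrable_real_indicator) (use emeasure_lborel_cball_finite in auto)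
 show ?thesis
 proof (rule Bochner_Integration.integrable_bound[OF b])
  show "AE x in lborel. norm ((\<phi> x)\<^sup>2) <= norm (M\<^sup>2 * indicator (cball 0 R) x)"
  proof (rule AE_I2)
   fix x
   have "(\<phi> x)\<^sup>2 <= M\<^sup>2" using MR(1)[of x] by (simp add: abs_le_square_iff[symmetric])
   then show "norm ((\<phi> x)\<^sup>2) <= norm (M\<^sup>2 * indicator (cball 0 R) x)"
    using MR(2)[of x] by (auto simp: indicator_def not_le)
  qed
 qed simp
qed

lemma bbs_sqint: assumes "bbs \<phi>" shows "sqint (%x. \<phi> x *R w)"
 using bbs_square_integrable[OF assms] bbs_measurable[OF assms] by (auto simp: sqint_def power_mult_distrib)

lemma bbs_integrable:
 assumes "bbs \<phi>" "sqint f"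
 shows "integrable lborel (%x. \<phi> x *R f x)"
proof -
 have [measurable]: "\<phi> : bfun" "f : bfun" using assms by (auto simp: bbs_def sqint_def)
 have b: "integrable lborel (%x. (\<phi> x)\<^sup>2 + sq (f x))"
  using bbs_square_integrable[OF assms(1)] sqint_integrable[OF assms(2)] by simp
 show ?thesis
 proof (rule Bochner_Integration.integrable_bound[OF b])
  show "AE x in lborel. norm (\<phi> x *R f x) <= norm ((\<phi> x)\<^sup>2 + sq (f x))"
  proof (rule AE_I2)
   fix x
   show "norm (\<phi> x *R f x) <= norm ((\<phi> x)\<^sup>2 + sq (f x))"
    using norm_mult_le_sum_squares[of "\<phi> x" "f x"] by simp
  qed
 qed measurable
qed

lemma bbs_integrable_real: assumes "bbs \<phi>" shows "integrable lborel \<phi>"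
proof -
 obtain M R where MR: "!!x. \<bar>\<phi> x\<bar> <= M" "!!x. norm x > R ==> \<phi> x = 0" and [measurable]: "\<phi> : bfun"
  using assms by (auto simp: bbs_def)
 have b: "integrable lborel (%x :: real^'a. M * indicator (cball 0 R) x)"
  by (intro integrable_mult_right integrable_real_indicator) (use emeasure_lborel_cball_finite in auto)
 show ?thesis
 proof (rule Bochner_Integration.integrable_bound[OF b])
  show "AE x in lborel. norm (\<phi> x) <= norm (M * indicator (cball 0 R) x)"
  proof (rule AE_I2)
   fix x
   show "norm (\<phi> x) <= norm (M * indicator (cball 0 R) x)"
    using MR(2)[of x] MR(1)[of x] by (auto simp: indicator_def not_le)
  qed
 qed simp
qed

lemma bbs_mult: "bbs \<phi> ==> bbs \<psi> ==> bbs (%x. \<phi> x * \<psi> x)"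
proof -
 assume a: "bbs \<phi>" "bbs \<psi>"
 obtain M R where MR: "!!x. \<bar>\<phi> x\<bar> <= M" "!!x. norm x > R ==> \<phi> x = 0" using a(1) by (auto simp: bbs_def)
 obtain M' where M': "!!x. \<bar>\<psi> x\<bar> <= M'" using a(2) by (auto simp: bbs_def)
 have [measurable]: "\<phi> : bfun" "\<psi> : bfun" using a by (auto simp: bbs_def)
 have "\<bar>\<phi> x * \<psi> x\<bar> <= M * M'" for x unfolding abs_mult
  by (rule mult_mono[OF MR(1) M']) (use MR(1)[of x] in auto)
 then show "bbs (%x. \<phi> x * \<psi> x)" unfolding bbs_def using MR(2) by (intro conjI exI[of _ "M * M'"] exI[of _ R]) auto
qed

lemma distribution_eq:
 assumes [measurable]: "\<phi> : bfun"
 shows "distribution u \<phi> = (LI x. \<phi> x *R fn u x)"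
proof -
 have [measurable]: "rep_L2 u : borel_measurable lebesgue" using sq_int_rep[of u] by (auto simp: square_integrable_def)
 have [measurable]: "fn u : borel_measurable lebesgue" "\<phi> : borel_measurable lebesgue"
  by (auto simp add: measurable_completion)
 have "distribution u \<phi> = (\<integral>x. \<phi> x *R fn u x \<partial>lebesgue)" unfolding distribution_def
  by (rule integral_cong_AE) (use fn_rep[of u] in "auto simp: AE_completion_iff elim: eventually_mono")
 then show ?thesis by (simp add: integral_completion)
qed

definition tw :: "(real^'n => real) => complex^'m => ('n::finite, 'm::finite) L2" where
 "tw \<phi> w = mk (%x. \<phi> x *R w)"

lemma inner_tw: assumes "bbs \<phi>" shows "u \<bullet> tw \<phi> w = w \<bullet> distribution u \<phi>"
proof -
 have "u \<bullet> tw \<phi> w = (LI x. w \<bullet> (\<phi> x *R fn u x))"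
  unfolding tw_def inner_mk2[OF bbs_sqint[OF assms]] by (simp add: inner_commute)
 also have "... = w \<bullet> distribution u \<phi>" unfolding distribution_eq[OF bbs_measurable[OF assms]]
  by (rule integral_inner_right) (use bbs_integrable[OF assms sqint_fn] in auto)
 finally show ?thesis .
qed

lemma distribution_add: assumes "bbs \<phi>" shows "distribution (u + v) \<phi> = distribution u \<phi> + distribution v \<phi>"
 and distribution_diff: "distribution (u - v) \<phi> = distribution u \<phi> - distribution v \<phi>"
proof -
 have "w \<bullet> distribution (u + v) \<phi> = w \<bullet> (distribution u \<phi> + distribution v \<phi>)" for w
  by (simp add: inner_tw[OF assms, symmetric] inner_simps)
 then show "distribution (u + v) \<phi> = distribution u \<phi> + distribution v \<phi>" using vector_eq_ldot by blast
 have "w \<bullet> distribution (u - v) \<phi> = w \<bullet> (distribution u \<phi> - distribution v \<phi>)" for w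
  by (simp add: inner_tw[OF assms, symmetric] inner_simps)
 then show "distribution (u - v) \<phi> = distribution u \<phi> - distribution v \<phi>" using vector_eq_ldot by blast
qed

lemma distribution_zero: assumes "bbs \<phi>" shows "distribution 0 \<phi> = 0"
 using distribution_diff[OF assms, of 0 0] by simp

lemma distribution_sum: assumes "bbs \<phi>" "finite I"
 shows "distribution (sum u I) \<phi> = (\<Sum>i\<in>I. distribution (u i) \<phi>)"
 using assms(2)
proof (induction I rule: finite_induct)
 case empty
 show ?case using distribution_zero[OF assms(1)] by simp
qed (simp add: distribution_add[OF assms(1)])

lemma distribution_tw:
 assumes "bbs \<phi>" "bbs \<psi>"
 shows "distribution (tw \<psi> w) \<phi> = (LI x. \<phi> x * \<psi> x) *R w"
proof -
 have [measurable]: "\<phi> : bfun" "\<psi> : bfun" using assms by (auto simp: bbs_def)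
 have "distribution (tw \<psi> w) \<phi> = (LI x. (\<phi> x * \<psi> x) *R w)"
  unfolding distribution_eq[OF bbs_measurable[OF assms(1)]]
  by (rule integral_cong_AE) (use fn_mk[OF bbs_sqint[OF assms(2), of w]] in "auto simp: tw_def elim: eventually_mono")
 then show ?thesis using bbs_integrable_real[OF bbs_mult[OF assms]] by simp
qed

text \<open>Cutoffs of boxes converge to indicators, and boxes generate the Borel sets.\<close>

lemma zero_if_distribution_zero:
 fixes u :: "('n::finite, 'm::finite) L2"
 assumes z: "!!\<phi>. test_function \<phi> ==> distribution u \<phi> = 0"
 shows "u = 0"
proof -
 have box0: "distribution u (indicator (box a b)) = 0" for a b
 proof -
  define l where "l = b - a"
  have bl: "b = a + l" by (simp add: l_def)
  define \<phi> where "\<phi> n = cutoff a l (inverse (real (Suc n)))" for n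
  have t: "test_function (\<phi> n)" for n unfolding \<phi>_def by (rule test_cutoff) simp
  have [measurable]: "\<phi> n : bfun" for n using test_bbs[OF t] by (simp add: bbs_def)
  have bb: "bbs (indicator (box a b))" by (rule bbs_indicator) auto
  have lim: "(%n. \<phi> n x) ----> indicator (box a b) x" for x
  proof (cases "x : box a b")
   case True
   then have ab: "!!i. a $ i < x $ i" "!!i. x $ i < b $ i" by (auto simp: mem_box_cart)
   define e where "e = Min ((%i. min (x $ i - a $ i) (b $ i - x $ i)) ` UNIV)"
   have "e > 0" unfolding e_def using ab by (subst Min_gr_iff) auto
   have e: "e <= x $ i - a $ i" "e <= b $ i - x $ i" for i
   proof -
    have "e <= min (x $ i - a $ i) (b $ i - x $ i)" unfolding e_def by (rule Min_le) auto
    then show "e <= x $ i - a $ i" "e <= b $ i - x $ i" by auto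
   qed
   have "\<forall>\<^sub>F n in sequentially. inverse (real (Suc n)) < e"
    using order_tendstoD(2)[OF LIMSEQ_inverse_real_of_nat \<open>e > 0\<close>] .
   then have "\<forall>\<^sub>F n in sequentially. \<phi> n x = indicator (box a b) x"
   proof eventually_elim
    case (elim n)
    have "\<phi> n x = 1" unfolding \<phi>_def
    proof (rule cutoff_eq_1)
     show "a $ i + inverse (real (Suc n)) <= x $ i" "x $ i <= a $ i + l $ i - inverse (real (Suc n))" for i
      using e[of i] elim by (auto simp: bl)
    qed simp
    then show ?case using True by simp
   qed
   then show ?thesis by (rule tendsto_eventually)
  next
   case False
   then obtain i where "x $ i <= a $ i \<or> a $ i + l $ i <= x $ i" by (force simp: mem_box_cart bl not_less)
   then have "\<phi> n x = 0" for n unfolding \<phi>_def by (intro cutoff_eq_0) auto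
   then show ?thesis using False by simp
  qed
  have dom: "\<bar>\<phi> n x\<bar> <= indicator (box a b) x" for n x
  proof (cases "x : box a b")
   case True
   then show ?thesis using cutoff_range[of a l "inverse (real (Suc n))" x] by (simp add: \<phi>_def)
  next
   case False
   then obtain i where "x $ i <= a $ i \<or> a $ i + l $ i <= x $ i" by (force simp: mem_box_cart bl not_less)
   then have "\<phi> n x = 0" unfolding \<phi>_def by (intro cutoff_eq_0) auto
   then show ?thesis by simp
  qed
  have "(%n. \<integral>x. \<phi> n x *R fn u x \<partial>lborel) ----> (LI x. indicator (box a b) x *R fn u x)"
  proof (rule integral_dominated_convergence[where w = "%x. norm (indicator (box a b) x *R fn u x)"])
   show "integrable lborel (%x. norm (indicator (box a b) x *R fn u x))"
    by (rule integrable_norm[OF bbs_integrable[OF bb sqint_fn]])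
   show "AE x in lborel. (%n. \<phi> n x *R fn u x) ----> indicator (box a b) x *R fn u x"
    by (intro AE_I2 tendsto_intros lim)
   show "AE x in lborel. norm (\<phi> n x *R fn u x) <= norm (indicator (box a b) x *R fn u x)" for n
    using dom[of n] by (intro AE_I2) (auto intro!: mult_right_mono)
  qed measurable
  moreover have "(LI x. \<phi> n x *R fn u x) = 0" for n using z[OF t[of n]] by (simp add: distribution_eq)
  ultimately have "(LI x. indicator (box a b) x *R fn u x) = 0"
   using LIMSEQ_unique[OF tendsto_const[of 0 sequentially]] by simp
  then show ?thesis by (simp add: distribution_eq)
 qed
 define K :: "nat => (real^'n) set" where "K N = box (\<chi> i. - real N) (\<chi> i. real N)" for N
 have Kb: "bounded (K N)" "K N : sets borel" for N by (auto simp: K_def)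
 have bK: "bbs (indicator (A Int K N))" if "A : sets borel" for A N
  using that Kb by (intro bbs_indicator) (auto intro: bounded_subset)
 have all: "distribution u (indicator (A Int K N)) = 0" if "A : sets borel" for A N
 proof -
  have I: "integrable lborel (%x. indicator (A Int K N) x *R fn u x)" if "A : sets borel" for A
   by (rule bbs_integrable[OF bK[OF that] sqint_fn])
  have deq: "distribution u (indicator (A Int K N)) = (LI x. indicator (A Int K N) x *R fn u x)" if "A : sets borel" for A
   by (rule distribution_eq[OF bbs_measurable[OF bK[OF that]]])
  have bs: "sets borel = sigma_sets UNIV (range (%(a, b). box a b) :: (real^'n) set set)"
   unfolding borel_eq_box by (rule sets_measure_of) auto
  have st: "Int_stable (range (%(a, b). box a b) :: (real^'n) set set)"
  proof (rule Int_stableI)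
   fix P Q :: "(real^'n) set" assume "P : range (%(a, b). box a b)" "Q : range (%(a, b). box a b)"
   then obtain a b a' b' where "P = box a b" "Q = box a' b'" by auto
   then show "P Int Q : range (%(a, b). box a b)" by (auto simp: box_Int_box)
  qed
  have pow: "range (%(a, b). box a b) \<subseteq> Pow (UNIV :: (real^'n) set)" by auto
  from st pow that[unfolded bs] show ?thesis
  proof (induction rule: sigma_sets_induct_disjoint)
   case (basic A)
   then obtain a b where A: "A = box a b" by auto
   obtain a' b' where "A Int K N = box a' b'" unfolding A K_def box_Int_box by blast
   then show ?case using box0 by simp
  next
   case empty
   show ?case by (simp add: distribution_eq)
  next
   case (compl A)
   have A: "A : sets borel" using compl(1) bs by simp
   have "indicator ((UNIV - A) Int K N) x *R fn u x = indicator (UNIV Int K N) x *R fn u x - indicator (A Int K N) x *R fn u x" for x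
    by (auto simp: indicator_def)
   then have "distribution u (indicator ((UNIV - A) Int K N)) = distribution u (indicator (UNIV Int K N)) - distribution u (indicator (A Int K N))"
    using deq[of "UNIV - A"] deq[of UNIV] deq[OF A] I[of UNIV] I[OF A] A by simp
   then show ?case using compl(2) box0 by (simp add: K_def)
  next
   case (union A)
   have A: "A i : sets borel" for i using union(2) bs by auto
   have U: "(\<Union>i. A i) : sets borel" using A by auto
   have eq: "set_lebesgue_integral lborel (\<Union>i. A i Int K N) (fn u) = (\<Sum>i. set_lebesgue_integral lborel (A i Int K N) (fn u))"
   proof (rule lebesgue_integral_countable_add)
    show "(A i Int K N) Int (A j Int K N) = {}" if "i ~= j" for i j
     using union(1) that by (auto simp: disjoint_family_on_def)
    show "set_integrable lborel (\<Union>i. A i Int K N) (fn u)" using I[OF U] by (simp add: set_integrable_def)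
   qed (use A Kb in auto)
   have "set_lebesgue_integral lborel (A i Int K N) (fn u) = 0" for i
    using union(3)[of i] deq[OF A, of i] by (simp add: set_lebesgue_integral_def)
   then have "set_lebesgue_integral lborel (\<Union>i. A i Int K N) (fn u) = 0" using eq by simp
   moreover have "(\<Union>i. A i Int K N) = (\<Union>i. A i) Int K N" by blast
   ultimately show ?case using deq[OF U] by (simp add: set_lebesgue_integral_def)
  qed
 qed
 have neg: "AE x in lborel. \<not> w \<bullet> fn u x > 0" for w
 proof -
  define A where "A = {x. w \<bullet> fn u x > 0}"
  have A: "A : sets borel" unfolding A_def by measurable
  have "AE x in lborel. indicator (A Int K N) x * (w \<bullet> fn u x) = 0" for N
  proof -
   have i: "integrable lborel (%x. indicator (A Int K N) x *R fn u x)" by (rule bbs_integrable[OF bK[OF A] sqint_fn])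
   have i2: "integrable lborel (%x. w \<bullet> (indicator (A Int K N) x *R fn u x))" by (rule integrable_inner_right) (use i in simp)
   have "(LI x. w \<bullet> (indicator (A Int K N) x *R fn u x)) = w \<bullet> distribution u (indicator (A Int K N))"
    unfolding distribution_eq[OF bbs_measurable[OF bK[OF A]]] by (rule integral_inner_right) (use i in simp)
   also have "... = 0" using all[OF A] by simp
   finally have "AE x in lborel. w \<bullet> (indicator (A Int K N) x *R fn u x) = 0"
    by (subst (asm) integral_nonneg_eq_0_iff_AE[OF i2]) (auto simp: A_def indicator_def)
   then show ?thesis by simp
  qed
  then have "AE x in lborel. \<forall>N. indicator (A Int K N) x * (w \<bullet> fn u x) = 0" unfolding AE_all_countable ..
  then show ?thesis
  proof eventually_elim
   case (elim x)
   obtain N where N: "real N > norm x" using reals_Archimedean2 by blast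
   have "\<bar>x $ i\<bar> < real N" for i using component_le_norm_cart[of x i] N by linarith
   then have "- real N < x $ i \<and> x $ i < real N" for i by (metis abs_less_iff minus_less_iff)
   then have "x : K N" by (auto simp: K_def mem_box_cart)
   then show ?case using spec[OF elim, of N] by (auto simp: A_def indicator_def)
  qed
 qed
 have "AE x in lborel. \<forall>b\<in>Basis. \<not> b \<bullet> fn u x > 0 \<and> \<not> (- b) \<bullet> fn u x > 0"
  by (intro AE_finite_allI AE_conjI neg) auto
 then have "AE x in lborel. fn u x = 0"
 proof eventually_elim
  case (elim x)
  have "fn u x \<bullet> b = 0" if "b : Basis" for b using bspec[OF elim that] by (simp add: inner_commute)
  then show ?case by (intro euclidean_eqI[of "fn u x" 0]) simp
 qed
 then have "AE x in lborel. fn u x = fn 0 x" using fn_zero by eventually_elim simp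
 then show ?thesis by (rule L2_eqI)
qed

section \<open>Translation and integration by parts\<close>

lemma nn_integral_shift:
 fixes c :: "real^'n"
 assumes [measurable]: "f : bfun"
 shows "(NN x. f (x + c)) = (NN x. f x)"
proof -
 have "(NN x. f x) = (\<integral>\<^sup>+x. f x \<partial>distr lborel borel ((+) c))" by (simp add: lborel_distr_plus)
 also have "... = (NN x. f (x + c))" by (subst nn_integral_distr) (auto simp: add.commute)
 finally show ?thesis by simp
qed

lemma integral_shift:
 fixes c :: "real^'n" and f :: "real^'n => 'b::euclidean_space"
 assumes [measurable]: "f : bfun"
 shows "(LI x. f (x + c)) = (LI x. f x)"
proof -
 have "(LI x. f x) = (\<integral>x. f x \<partial>distr lborel borel ((+) c))" by (simp add: lborel_distr_plus)
 also have "... = (LI x. f (x + c))" by (subst integral_distr) (auto simp: add.commute)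
 finally show ?thesis by simp
qed

lemma nn_integral_reflect:
 assumes [measurable]: "f : borel_measurable (borel :: (real^'n) measure)"
 shows "(NN x. f (- x)) = (NN x. f x)"
proof -
 have l: "(lborel :: (real^'n) measure) = density (distr lborel borel (%x. 0 + (-1) *R x)) (%_. ennreal (\<bar>-1\<bar>^DIM(real^'n)))"
  by (rule lborel_affine) simp
 have "(NN x. f x) = (\<integral>\<^sup>+x. f x \<partial>distr lborel borel (%x. 0 + (-1) *R x))"
  by (subst l) (simp add: nn_integral_density)
 also have "... = (NN x. f (- x))" by (subst nn_integral_distr) auto
 finally show ?thesis by simp
qed

lemma nn_integral_scale:
 assumes [measurable]: "f : borel_measurable (borel :: (real^'n) measure)" and c: "c > 0"
 shows "(NN x. f x) = ennreal (c ^ CARD('n)) * (NN x. f (c *R x))"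
proof -
 have l: "(lborel :: (real^'n) measure) = density (distr lborel borel (%x. 0 + c *R x)) (%_. ennreal (\<bar>c\<bar>^DIM(real^'n)))"
  by (rule lborel_affine) (use c in simp)
 have "(NN x. f x) = ennreal (c ^ CARD('n)) * (\<integral>\<^sup>+x. f x \<partial>distr lborel borel (%x. 0 + c *R x))"
  by (subst l) (use c in "simp add: nn_integral_density nn_integral_cmult")
 also have "(\<integral>\<^sup>+x. f x \<partial>distr lborel borel (%x. 0 + c *R x)) = (NN x. f (c *R x))"
  by (subst nn_integral_distr) auto
 finally show ?thesis .
qed

definition lint :: "(real^'n => real) => bool" where
 "lint g \<longleftrightarrow> g : bfun \<and> (\<forall>R. integrable lborel (%x. indicator (cball 0 R) x * g x))"

lemma lint_inner: assumes "sqint f" shows "lint (%x. w \<bullet> f x)"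
proof -
 have [measurable]: "f : bfun" using assms by (auto simp: sqint_def)
 have "integrable lborel (%x. w \<bullet> (indicator (cball 0 R) x *R f x))" for R
  by (rule integrable_inner_right) (use bbs_integrable[OF bbs_indicator assms, of "cball 0 R"] in auto)
 then show ?thesis by (simp add: lint_def)
qed

lemma lint_const: "lint (%x. c)"
 unfolding lint_def by (auto intro!: integrable_mult_left integrable_real_indicator simp: emeasure_lborel_cball_finite[unfolded infinity_ennreal_def])

lemma bbs_lint_integrable:
 assumes "bbs \<phi>" "lint g"
 shows "integrable lborel (%x. \<phi> x * g x)"
proof -
 obtain M R where MR: "!!x. \<bar>\<phi> x\<bar> <= M" "!!x. norm x > R ==> \<phi> x = 0" and [measurable]: "\<phi> : bfun"
  using assms by (auto simp: bbs_def)
 have M0: "M >= 0" using MR(1)[of 0] by linarith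
 have [measurable]: "g : bfun" using assms by (simp add: lint_def)
 have b: "integrable lborel (%x. M * (indicator (cball 0 R) x * g x))"
  by (rule integrable_mult_right) (use assms in "auto simp: lint_def")
 show ?thesis
 proof (rule Bochner_Integration.integrable_bound[OF b])
  show "AE x in lborel. norm (\<phi> x * g x) <= norm (M * (indicator (cball 0 R) x * g x))"
  proof (rule AE_I2)
   fix x show "norm (\<phi> x * g x) <= norm (M * (indicator (cball 0 R) x * g x))"
    using MR(1)[of x] MR(2)[of x] M0 by (cases "norm x > R") (auto simp: abs_mult intro!: mult_right_mono)
  qed
 qed measurable
qed

text \<open>Differentiating the integral of a translate in the direction \<open>z\<close>. With \<open>g = 1\<close> the integral is constant,
so derivatives of test functions have integral zero.\<close>

lemma translate_derivative_0:
 fixes \<phi> :: "real^'n => real"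
 assumes t: "test_function \<phi>" and g: "lint g"
 shows "((%s. \<integral>x. \<phi> (x - s *R z) * g x \<partial>lborel) has_real_derivative
  (LI x. - (\<Sum>j\<in>UNIV. z $ j * partial_deriv j \<phi> x) * g x)) (at 0)"
proof -
 obtain L where L: "!!x y. \<bar>\<phi> x - \<phi> y\<bar> <= L * norm (x - y)" "L >= 0" by (rule test_lipschitz[OF t]) auto
 obtain R where R: "!!x. norm x > R ==> \<phi> x = 0" using t by (auto simp: test_function_iff)
 have [measurable]: "\<phi> : bfun" "g : bfun" "partial_deriv j \<phi> : bfun" for j
  using t g bbs_measurable[OF test_bbs[OF t]] bbs_measurable[OF test_bbs[OF test_partial[OF t, of j]]] by (auto simp: lint_def)
 have int: "integrable lborel (%x. \<phi> (x - s *R z) * g x)" for s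
  by (rule bbs_lint_integrable[OF _ g]) (use test_bbs[OF test_affine[OF t, of 1 "- s *R z"]] in simp)
 define F where "F s = (LI x. \<phi> (x - s *R z) * g x)" for s
 define d where "d x = - (\<Sum>j\<in>UNIV. z $ j * partial_deriv j \<phi> x)" for x
 have ptw: "((%s. \<phi> (x - s *R z)) has_real_derivative d x) (at 0)" for x
 proof -
  have "((%s :: real. x - s *R z) has_derivative (%h. - (h *R z))) (at 0)"
   by (auto intro!: derivative_eq_intros)
  moreover have "(\<phi> has_derivative frechet_derivative \<phi> (at x)) (at (x - 0 *R z))"
   using smooth_has_derivative[OF test_smooth[OF t]] by simp
  ultimately have "((%s. \<phi> (x - s *R z)) has_derivative (%h. frechet_derivative \<phi> (at x) (- (h *R z)))) (at 0)"
   by (rule has_derivative_compose)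
  moreover have "frechet_derivative \<phi> (at x) (- (h *R z)) = d x * h" for h
   unfolding frechet_sum[OF test_smooth[OF t]] d_def by (simp add: sum_distrib_left sum_negf mult_ac)
  ultimately show ?thesis by (simp add: has_field_derivative_def)
 qed
 have "((%h. (F (0 + h) - F 0) / h) \<longlongrightarrow> (LI x. d x * g x)) (at 0)"
  unfolding tendsto_at_iff_sequentially o_def
 proof (intro allI impI)
  fix X :: "nat => real" assume X0: "\<forall>i. X i : UNIV - {0}" and X: "X ----> 0"
  obtain K where K: "!!i. \<bar>X i\<bar> <= K" using convergent_imp_Bseq[OF convergentI[OF X]] unfolding Bseq_def by auto
  let ?q = "%i x. (\<phi> (x - X i *R z) - \<phi> x) / X i * g x"
  let ?w = "%x. L * norm z * (indicator (cball 0 (R + K * norm z)) x * \<bar>g x\<bar>)"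
  have "(%i. \<integral>x. ?q i x \<partial>lborel) ----> (LI x. d x * g x)"
  proof (rule integral_dominated_convergence[where w = ?w])
   have "integrable lborel (%x. norm (indicator (cball 0 (R + K * norm z)) x * g x))"
    by (rule integrable_norm) (use g in "auto simp: lint_def")
   then show "integrable lborel ?w" by (intro integrable_mult_right) (simp add: abs_mult)
   show "AE x in lborel. (%i. ?q i x) ----> d x * g x"
   proof (rule AE_I2)
    fix x
    have "((%h. (\<phi> (x - (0 + h) *R z) - \<phi> (x - 0 *R z)) / h) \<longlongrightarrow> d x) (at 0)"
     using ptw[of x] unfolding DERIV_def .
    then have "(%i. (\<phi> (x - X i *R z) - \<phi> x) / X i) ----> d x"
     unfolding tendsto_at_iff_sequentially using X X0 by (auto simp: o_def)
    then show "(%i. ?q i x) ----> d x * g x" by (intro tendsto_intros)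
   qed
   show "AE x in lborel. norm (?q i x) <= ?w x" for i
   proof (rule AE_I2)
    fix x
    have Xi: "X i ~= 0" using X0 by auto
    show "norm (?q i x) <= ?w x"
    proof (cases "norm x > R + K * norm z")
     case True
     have "norm (X i *R z) <= K * norm z" using K[of i] by (simp add: mult_right_mono)
     then have "norm (x - X i *R z) > R" using True norm_triangle_ineq2[of x "X i *R z"] by linarith
     moreover have "norm x > R" using True K[of i] by (smt (verit) mult_nonneg_nonneg norm_ge_zero)
     ultimately show ?thesis using R L by (simp add: mult_nonneg_nonneg)
    next
     case False
     have "\<bar>\<phi> (x - X i *R z) - \<phi> x\<bar> <= L * norm z * \<bar>X i\<bar>" using L(1)[of "x - X i *R z" x] by (simp add: mult_ac)
     then have "\<bar>(\<phi> (x - X i *R z) - \<phi> x) / X i\<bar> <= L * norm z" using Xi by (simp add: divide_le_eq)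
     then have "\<bar>(\<phi> (x - X i *R z) - \<phi> x) / X i\<bar> * \<bar>g x\<bar> <= L * norm z * \<bar>g x\<bar>" by (rule mult_right_mono) simp
     then show ?thesis using False by (simp add: abs_mult not_less)
    qed
   qed
  qed (auto simp: d_def)
  moreover have "(LI x. ?q i x) = (F (0 + X i) - F 0) / X i" for i
  proof -
   have "(LI x. ?q i x) = (LI x. (\<phi> (x - X i *R z) * g x - \<phi> x * g x) / X i)"
    by (rule Bochner_Integration.integral_cong) (auto simp: left_diff_distrib)
   also have "... = (F (X i) - F 0) / X i" using int[of "X i"] int[of 0] by (simp add: F_def)
   finally show ?thesis by simp
  qed
  ultimately show "(%i. (F (0 + X i) - F 0) / X i) ----> (LI x. d x * g x)" by (simp only:)
 qed
 then show ?thesis unfolding F_def d_def DERIV_def by simp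
qed

lemma translate_derivative:
 fixes \<phi> :: "real^'n => real"
 assumes t: "test_function \<phi>" and g: "lint g"
 shows "((%s. \<integral>x. \<phi> (x - s *R z) * g x \<partial>lborel) has_real_derivative
  (LI x. - (\<Sum>j\<in>UNIV. z $ j * partial_deriv j \<phi> (x - s *R z)) * g x)) (at s)"
proof -
 have t': "test_function (%x. \<phi> (x - s *R z))" using test_affine[OF t, of 1 "- s *R z"] by simp
 have p: "partial_deriv j (%x. \<phi> (x - s *R z)) x = partial_deriv j \<phi> (x - s *R z)" for j x
  using partial_affine[OF test_smooth[OF t], of j 1 "- s *R z" x] by simp
 have "((%h. \<integral>x. \<phi> (x - h *R z - s *R z) * g x \<partial>lborel) has_real_derivative
  (LI x. - (\<Sum>j\<in>UNIV. z $ j * partial_deriv j \<phi> (x - s *R z)) * g x)) (at 0)"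
  using translate_derivative_0[OF t' g, of z] unfolding p .
 then have "((%h. \<integral>x. \<phi> (x - (h + s) *R z) * g x \<partial>lborel) has_real_derivative
  (LI x. - (\<Sum>j\<in>UNIV. z $ j * partial_deriv j \<phi> (x - s *R z)) * g x)) (at 0)"
  by (simp add: scaleR_left_distrib diff_diff_eq)
 then show ?thesis using DERIV_shift[of "%h. \<integral>x. \<phi> (x - h *R z) * g x \<partial>lborel" _ 0 s] by simp
qed

lemma integral_partial_zero:
 assumes t: "test_function \<phi>"
 shows "(LI x. partial_deriv j \<phi> x) = 0"
proof -
 have [measurable]: "\<phi> : bfun" by (rule bbs_measurable[OF test_bbs[OF t]])
 have "((%s. \<integral>x. \<phi> (x - s *R axis j 1) * 1 \<partial>lborel) has_real_derivative
  (LI x. - (\<Sum>i\<in>UNIV. axis j 1 $ i * partial_deriv i \<phi> x) * 1)) (at 0)"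
  by (rule translate_derivative_0[OF t lint_const])
 moreover have "(LI x. \<phi> (x - s *R axis j 1) * 1) = (LI x. \<phi> x)" for s
  using integral_shift[of \<phi> "- s *R axis j 1"] by simp
 moreover have "(\<Sum>i\<in>UNIV. axis j 1 $ i * partial_deriv i \<phi> x) = partial_deriv j \<phi> x" for x
  by (simp add: axis_def if_distrib[of "%c. c * _"] cong: if_cong)
 ultimately have "((%s :: real. \<integral>x. \<phi> x \<partial>lborel) has_real_derivative (LI x. - partial_deriv j \<phi> x)) (at 0)"
  by simp
 from DERIV_unique[OF this DERIV_const] show ?thesis by simp
qed

lemma integration_by_parts:
 assumes t: "test_function \<phi>" "test_function \<psi>"
 shows "(LI x. partial_deriv j \<phi> x * \<psi> x) = - (LI x. \<phi> x * partial_deriv j \<psi> x)"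
proof -
 have "(LI x. partial_deriv j (%x. \<phi> x * \<psi> x) x) = 0"
  by (rule integral_partial_zero[OF test_mult_left[OF test_smooth[OF t(1)] t(2)]])
 then have "(LI x. \<phi> x * partial_deriv j \<psi> x + partial_deriv j \<phi> x * \<psi> x) = 0"
  by (simp add: partial_mult[OF test_smooth[OF t(1)] test_smooth[OF t(2)]])
 moreover have "integrable lborel (%x. \<phi> x * partial_deriv j \<psi> x)" "integrable lborel (%x. partial_deriv j \<phi> x * \<psi> x)"
  by (intro bbs_integrable_real bbs_mult test_bbs t test_partial)+
 ultimately show ?thesis by simp
qed

section \<open>Bounded multiplication and linear maps of the fibre\<close>

definition mult :: "(real^'n => real) => ('n::finite, 'm::finite) L2 => ('n, 'm) L2" where
 "mult \<omega> u = mk (%x. \<omega> x *R fn u x)"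

definition bm :: "(real^'n => real) => bool" where
 "bm \<omega> \<longleftrightarrow> \<omega> : bfun \<and> (\<exists>M. \<forall>x. \<bar>\<omega> x\<bar> <= M)"

lemma sqint_mult:
 assumes "bm \<omega>" "sqint f" shows "sqint (%x. \<omega> x *R f x)"
proof -
 obtain M where M: "!!x. \<bar>\<omega> x\<bar> <= M" and [measurable]: "\<omega> : bfun" using assms by (auto simp: bm_def)
 have [measurable]: "f : bfun" using assms by (auto simp: sqint_def)
 have b: "integrable lborel (%x. M\<^sup>2 * sq (f x))" using sqint_integrable[OF assms(2)] by simp
 have "integrable lborel (%x. sq (\<omega> x *R f x))"
 proof (rule Bochner_Integration.integrable_bound[OF b])
  show "AE x in lborel. norm (sq (\<omega> x *R f x)) <= norm (M\<^sup>2 * sq (f x))"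
  proof (rule AE_I2)
   fix x have "(\<omega> x)\<^sup>2 <= M\<^sup>2" using M[of x] by (simp add: abs_le_square_iff[symmetric])
   then show "norm (sq (\<omega> x *R f x)) <= norm (M\<^sup>2 * sq (f x))"
    by (simp add: power_mult_distrib mult_right_mono)
  qed
 qed measurable
 then show ?thesis by (simp add: sqint_def)
qed

lemma fn_mult: "bm \<omega> ==> AE x in lborel. fn (mult \<omega> u) x = \<omega> x *R fn u x"
 unfolding mult_def by (rule fn_mk[OF sqint_mult[OF _ sqint_fn]])

lemma bbs_bm: "bbs \<phi> ==> bm \<phi>" unfolding bbs_def bm_def by blast

lemma distribution_mult:
 assumes "bm \<omega>" "bbs \<phi>"
 shows "distribution (mult \<omega> u) \<phi> = distribution u (%x. \<omega> x * \<phi> x)"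
proof -
 have [measurable]: "\<omega> : bfun" "\<phi> : bfun" using assms by (auto simp: bm_def bbs_def)
 show ?thesis unfolding distribution_eq[OF \<open>\<phi> \<in> borel_measurable borel\<close>]
  by (subst distribution_eq, measurable)
   (rule integral_cong_AE, use fn_mult[OF assms(1), of u] in \<open>auto elim: eventually_mono\<close>)
qed

lemma norm_mult_nn:
 assumes "bm \<omega>"
 shows "esq (mult \<omega> u) = (NN x. ennreal ((\<omega> x)\<^sup>2 * sq (fn u x)))"
 unfolding mult_def norm_mk_nn[OF sqint_mult[OF assms sqint_fn]] by (simp add: power_mult_distrib)

definition fibre :: "(complex^'m => complex^'m) => ('n::finite, 'm::finite) L2 => ('n, 'm) L2" where
 "fibre A u = mk (%x. A (fn u x))"

lemma linear_fibre_bound: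
 fixes A :: "complex^'m => complex^'m" assumes "linear A"
 obtains C where "C >= 0" "!!v. norm (A v) <= C * norm v" using linear_bounded_pos[OF assms] by (metis less_imp_le)

lemma linear_measurable:
 fixes A :: "complex^'m => complex^'m" assumes "linear A" "f : borel_measurable M"
 shows "(%x. A (f x)) : borel_measurable M"
 by (rule borel_measurable_continuous_on[OF linear_continuous_on[OF linear_conv_bounded_linear[THEN iffD1, OF assms(1)]] assms(2)])

lemma sqint_fibre:
 fixes A :: "complex^'m => complex^'m"
 assumes A: "linear A" and f: "sqint f" shows "sqint (%x. A (f x))"
proof -
 obtain C where C: "C >= 0" "!!v. norm (A v) <= C * norm v" using linear_fibre_bound[OF A] by blast
 have [measurable]: "f : bfun" "(%x. A (f x)) : bfun" using f linear_measurable[OF A] by (auto simp: sqint_def)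
 have b: "integrable lborel (%x. C\<^sup>2 * sq (f x))" using sqint_integrable[OF f] by simp
 have "integrable lborel (%x. sq (A (f x)))"
 proof (rule Bochner_Integration.integrable_bound[OF b])
  show "AE x in lborel. norm (sq (A (f x))) <= norm (C\<^sup>2 * sq (f x))"
   using power_mono[OF C(2), of _ 2] by (intro AE_I2) (simp add: power_mult_distrib)
 qed measurable
 then show ?thesis by (simp add: sqint_def)
qed

lemma fn_fibre: "linear A ==> AE x in lborel. fn (fibre A u) x = A (fn u x)"
 unfolding fibre_def by (rule fn_mk[OF sqint_fibre[OF _ sqint_fn]])

lemma distribution_fibre:
 assumes A: "linear A" and "bbs \<phi>"
 shows "distribution (fibre A u) \<phi> = A (distribution u \<phi>)"
proof -
 have [measurable]: "\<phi> : bfun" using assms by (auto simp: bbs_def)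
 have [measurable]: "(%x. A (fn u x)) : bfun" by (rule linear_measurable[OF A]) simp
 have "distribution (fibre A u) \<phi> = (LI x. A (\<phi> x *R fn u x))"
  unfolding distribution_eq[OF \<open>\<phi> \<in> borel_measurable borel\<close>] linear_scale[OF A]
  by (rule integral_cong_AE) (use fn_fibre[OF A, of u] in "auto elim: eventually_mono")
 also have "... = A (distribution u \<phi>)" unfolding distribution_eq[OF \<open>\<phi> \<in> borel_measurable borel\<close>]
  by (rule integral_bounded_linear[OF linear_conv_bounded_linear[THEN iffD1, OF A] bbs_integrable[OF assms(2) sqint_fn]])
 finally show ?thesis .
qed

lemma norm_mono_AE:
 assumes C: "C >= 0" and le: "AE x in lborel. norm (fn u x) <= C * norm (fn v x)"
 shows "norm u <= C * norm v"
proof -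
 have "esq u <= (NN x. ennreal (C\<^sup>2) * esq (fn v x))" unfolding norm_L2_nn
 proof (rule nn_integral_mono_AE, use le in eventually_elim)
  case (elim x)
  have "sq (fn u x) <= (C * norm (fn v x))\<^sup>2" by (rule power_mono[OF elim]) simp
  then show ?case by (simp add: ennreal_mult[symmetric] power_mult_distrib del: ennreal_power)
 qed
 also have "... = ennreal ((C * norm v)\<^sup>2)"
  by (subst nn_integral_cmult) (auto simp: norm_L2_nn[symmetric] ennreal_mult power_mult_distrib simp del: ennreal_power)
 finally have "sq u <= (C * norm v)\<^sup>2" by (simp del: ennreal_power)
 then show ?thesis by (rule power2_le_imp_le) (use C in simp)
qed

section \<open>Density of test functions and mollification\<close>

definition tvecs :: "('n::finite, 'm::finite) L2 set" where
 "tvecs = {tw \<phi> w | \<phi> w. test_function \<phi>}"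

lemma tvecs_dense: "closure (span (tvecs :: ('n::finite, 'm::finite) L2 set)) = UNIV"
proof (rule dense_if_orthogonal_trivial[OF subspace_span])
 fix x :: "('n, 'm) L2" assume x: "!!s. s : span tvecs ==> x \<bullet> s = 0"
 show "x = 0"
 proof (rule zero_if_distribution_zero)
  fix \<phi> :: "real^'n => real" assume t: "test_function \<phi>"
  have "w \<bullet> distribution x \<phi> = w \<bullet> 0" for w
   using x[of "tw \<phi> w"] t by (auto simp: inner_tw[OF test_bbs[OF t], symmetric] tvecs_def intro!: span_base)
  then show "distribution x \<phi> = 0" using vector_eq_ldot by blast
 qed
qed

lemma dense_linear_bound:
 fixes x :: "'a::real_inner"
 assumes d: "closure S = UNIV" and b: "!!v. v : S ==> \<bar>x \<bullet> v\<bar> <= C * norm v" and C: "C >= 0"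
 shows "norm x <= C"
proof -
 have "x : closure S" using d by simp
 then obtain f where f: "!!n. f n : S" "f ----> x" by (auto simp: closure_sequential)
 have "(%n. \<bar>x \<bullet> f n\<bar>) ----> \<bar>x \<bullet> x\<bar>" "(%n. C * norm (f n)) ----> C * norm x"
  by (intro tendsto_intros f)+
 then have "\<bar>x \<bullet> x\<bar> <= C * norm x" by (rule LIMSEQ_le) (use b f in auto)
 then show ?thesis by (cases "x = 0") (auto simp: C power2_norm_eq_inner[symmetric] power2_eq_square)
qed

text \<open>The form \<open>(p * k, q)\<close>, the convolution being put on either factor. It mollifies without leaving
bilinear forms, so no smoothness of \<open>p * k\<close> has to be discussed.\<close>

definition Psi :: "(real^'n => real) => ('n::finite, 'm::finite) L2 => ('n, 'm) L2 => real" where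
 "Psi k p q = (LI y. fn p y \<bullet> distribution q (%x. k (x - y)))"

lemma bbs_shift: assumes "bbs k" shows "bbs (%x. k (x - y))"
proof -
 obtain M R where MR: "!!x. \<bar>k x\<bar> <= M" "!!x. norm x > R ==> k x = 0" and [measurable]: "k : bfun"
  using assms by (auto simp: bbs_def)
 have "norm (x - y) > R" if "norm x > R + norm y" for x using that norm_triangle_ineq2[of x y] by linarith
 then show ?thesis using MR unfolding bbs_def by (intro conjI exI[of _ M] exI[of _ "R + norm y"]) auto
qed

lemma bbs_reflect: assumes "bbs k" shows "bbs (%y. k (x - y))"
proof -
 obtain M R where MR: "!!x. \<bar>k x\<bar> <= M" "!!x. norm x > R ==> k x = 0" and [measurable]: "k : bfun"
  using assms by (auto simp: bbs_def)
 have "norm (x - y) > R" if "norm y > R + norm x" for y using that norm_triangle_ineq2[of y x] by (simp add: norm_minus_commute)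
 then show ?thesis using MR unfolding bbs_def by (intro conjI exI[of _ M] exI[of _ "R + norm x"]) auto
qed

lemma nn_integral_diff_left:
 fixes k :: "real^'n => ennreal" assumes [measurable]: "k : bfun"
 shows "(NN y. k (x - y)) = (NN y. k y)"
proof -
 have "(NN y. k (x - y)) = (NN y. k (x + y))" using nn_integral_reflect[of "%y. k (x + y)"] by simp
 also have "... = (NN y. k y)" using nn_integral_shift[of k x] by (simp add: add.commute)
 finally show ?thesis .
qed

text \<open>The convolution form is absolutely convergent; this is Young's inequality in the form needed.\<close>

lemma Psi_kernel:
 fixes k :: "real^'n => real" and p q :: "('n::finite, 'm::finite) L2"
 assumes k: "bbs k"
 defines "h \<equiv> %(x, y). k (x - y) * (fn p y \<bullet> fn q x)"
 shows "integrable (lborel \<Otimes>\<^sub>M lborel) h"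
  and "(\<integral>\<^sup>+z. ennreal \<bar>h z\<bar> \<partial>(lborel \<Otimes>\<^sub>M lborel)) <= ennreal ((LI x. \<bar>k x\<bar>) * (sq p + sq q))"
proof -
 have [measurable]: "k : bfun" by (rule bbs_measurable[OF k])
 have hm [measurable]: "h : borel_measurable (lborel \<Otimes>\<^sub>M lborel)" unfolding h_def by measurable
 define K where "K = (LI x. \<bar>k x\<bar>)"
 have ki: "integrable lborel (%x. \<bar>k x\<bar>)" using integrable_norm[OF bbs_integrable_real[OF k]] by simp
 have K: "(NN x. ennreal \<bar>k x\<bar>) = ennreal K" unfolding K_def by (rule nn_integral_eq_integral[OF ki]) auto
 have K0: "K >= 0" unfolding K_def by simp
 let ?H = "\<integral>\<^sup>+z. ennreal \<bar>h z\<bar> \<partial>(lborel \<Otimes>\<^sub>M lborel)" and ?A = "\<integral>\<^sup>+z. ennreal \<bar>k (fst z - snd z)\<bar> * esq (fn p (snd z)) \<partial>(lborel \<Otimes>\<^sub>M lborel)"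
  and ?B = "\<integral>\<^sup>+z. ennreal \<bar>k (fst z - snd z)\<bar> * esq (fn q (fst z)) \<partial>(lborel \<Otimes>\<^sub>M lborel)"
 have "?H <=
   (\<integral>\<^sup>+z. ennreal \<bar>k (fst z - snd z)\<bar> * esq (fn p (snd z)) + ennreal \<bar>k (fst z - snd z)\<bar> * esq (fn q (fst z)) \<partial>(lborel \<Otimes>\<^sub>M lborel))"
 proof (rule nn_integral_mono)
  fix z :: "(real^'n) \<times> (real^'n)"
  obtain x y where z: "z = (x, y)" by (cases z)
  have "\<bar>fn p y \<bullet> fn q x\<bar> <= sq (fn p y) + sq (fn q x)"
   using Cauchy_Schwarz_ineq2 norm_mult_le_sum_squares by (rule order_trans)
  then have "\<bar>h z\<bar> <= \<bar>k (x - y)\<bar> * (sq (fn p y) + sq (fn q x))"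
   unfolding h_def z by (simp add: abs_mult mult_left_mono)
  then have "ennreal \<bar>h z\<bar> <= ennreal (\<bar>k (x - y)\<bar> * (sq (fn p y) + sq (fn q x)))" by (rule ennreal_leI)
  then show "ennreal \<bar>h z\<bar> <= ennreal \<bar>k (fst z - snd z)\<bar> * esq (fn p (snd z)) + ennreal \<bar>k (fst z - snd z)\<bar> * esq (fn q (fst z))"
   unfolding z by (simp add: ennreal_mult distrib_left ennreal_plus del: ennreal_power)
 qed
 also have "... = ?A
   + ?B" by (rule nn_integral_add) measurable
 also have "?B = ennreal K * esq q"
 proof -
  have "?B
    = (NN x. \<integral>\<^sup>+y. ennreal \<bar>k (x - y)\<bar> * esq (fn q x) \<partial>lborel)"
   by (subst lborel.nn_integral_fst[symmetric]) auto
  also have "... = (NN x. ennreal K * esq (fn q x))"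
   by (rule nn_integral_cong) (simp add: nn_integral_multc nn_integral_diff_left[of "%x. ennreal \<bar>k x\<bar>"] K)
  also have "... = ennreal K * esq q" by (simp add: nn_integral_cmult norm_L2_nn)
  finally show ?thesis .
 qed
 also have "?A = ennreal K * esq p"
 proof -
  have "?A
    = (NN y. \<integral>\<^sup>+x. ennreal \<bar>k (x - y)\<bar> * esq (fn p y) \<partial>lborel)"
   by (subst lborel_pair.nn_integral_snd[symmetric]) auto
  also have "... = (NN y. ennreal K * esq (fn p y))"
  proof (rule nn_integral_cong)
   fix y
   have "(NN x. ennreal \<bar>k (x - y)\<bar>) = ennreal K"
    using nn_integral_shift[of "%x. ennreal \<bar>k x\<bar>" "- y"] K by simp
   then show "(NN x. ennreal \<bar>k (x - y)\<bar> * esq (fn p y)) = ennreal K * esq (fn p y)"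
    by (simp add: nn_integral_multc)
  qed
  also have "... = ennreal K * esq p" by (simp add: nn_integral_cmult norm_L2_nn)
  finally show ?thesis .
 qed
 also have "ennreal K * esq p + ennreal K * esq q = ennreal (K * (sq p + sq q))"
  using K0 by (simp add: ennreal_mult distrib_left ennreal_plus del: ennreal_power)
 finally have le: "?H <= ennreal (K * (sq p + sq q))" .
 then show "?H <= ennreal ((LI x. \<bar>k x\<bar>) * (sq p + sq q))" by (simp add: K_def)
 show "integrable (lborel \<Otimes>\<^sub>M lborel) h"
  by (rule integrableI_bounded[OF hm]) (use le_less_trans[OF le ennreal_less_top] in simp)
qed

lemma Psi_props:
 fixes p q :: "('n::finite, 'm::finite) L2"
 assumes k: "bbs k"
 shows Psi_integrable1: "integrable lborel (%y. fn p y \<bullet> distribution q (%x. k (x - y)))"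
  and Psi_integrable2: "integrable lborel (%x. distribution p (%y. k (x - y)) \<bullet> fn q x)"
  and Psi_swap: "Psi k p q = (LI x. distribution p (%y. k (x - y)) \<bullet> fn q x)"
  and Psi_bound: "\<bar>Psi k p q\<bar> <= (LI x. \<bar>k x\<bar>) * (sq p + sq q)"
proof -
 define h where "h = (%(x, y). k (x - y) * (fn p y \<bullet> fn q x))"
 have hi: "integrable (lborel \<Otimes>\<^sub>M lborel) h" unfolding h_def by (rule Psi_kernel(1)[OF k])
 have 1: "(LI x. h (x, y)) = fn p y \<bullet> distribution q (%x. k (x - y))" for y
 proof -
  have "fn p y \<bullet> distribution q (%x. k (x - y)) = (LI x. fn p y \<bullet> (k (x - y) *R fn q x))"
   unfolding distribution_eq[OF bbs_measurable[OF bbs_shift[OF k]]]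
   by (rule integral_inner_right[symmetric]) (rule bbs_integrable[OF bbs_shift[OF k] sqint_fn])
  then show ?thesis by (simp add: h_def)
 qed
 have 2: "(LI y. h (x, y)) = distribution p (%y. k (x - y)) \<bullet> fn q x" for x
 proof -
  have "fn q x \<bullet> distribution p (%y. k (x - y)) = (LI y. fn q x \<bullet> (k (x - y) *R fn p y))"
   unfolding distribution_eq[OF bbs_measurable[OF bbs_reflect[OF k]]]
   by (rule integral_inner_right[symmetric]) (rule bbs_integrable[OF bbs_reflect[OF k] sqint_fn])
  then show ?thesis by (simp add: h_def inner_commute)
 qed
 have hi': "integrable (lborel \<Otimes>\<^sub>M lborel) (%(x, y). h (x, y))" using hi by simp
 show "integrable lborel (%y. fn p y \<bullet> distribution q (%x. k (x - y)))"
  using lborel_pair.integrable_snd[OF hi'] unfolding 1 .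
 show "integrable lborel (%x. distribution p (%y. k (x - y)) \<bullet> fn q x)"
  using lborel_pair.integrable_fst[OF hi'] unfolding 2 .
 have "(LI y. (LI x. h (x, y))) = (LI x. (LI y. h (x, y)))" by (rule lborel_pair.Fubini_integral[OF hi'])
 then show "Psi k p q = (LI x. distribution p (%y. k (x - y)) \<bullet> fn q x)" unfolding 1 2 by (simp add: Psi_def)
 have "(LI y. (LI x. h (x, y))) = integral\<^sup>L (lborel \<Otimes>\<^sub>M lborel) h"
  using lborel_pair.integral_snd[OF hi'] by simp
 then have "Psi k p q = integral\<^sup>L (lborel \<Otimes>\<^sub>M lborel) h" unfolding 1 by (simp add: Psi_def)
 also have "ennreal \<bar>...\<bar> <= (\<integral>\<^sup>+z. ennreal \<bar>h z\<bar> \<partial>(lborel \<Otimes>\<^sub>M lborel))"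
  using integral_norm_bound_ennreal[OF hi] by simp
 also have "... <= ennreal ((LI x. \<bar>k x\<bar>) * (sq p + sq q))" unfolding h_def by (rule Psi_kernel(2)[OF k])
 finally show "\<bar>Psi k p q\<bar> <= (LI x. \<bar>k x\<bar>) * (sq p + sq q)"
  by (subst (asm) ennreal_le_iff) (auto intro!: mult_nonneg_nonneg)
qed

lemma distribution_scaleR: assumes "bbs \<phi>" shows "distribution (r *R u) \<phi> = r *R distribution u \<phi>"
proof -
 have "w \<bullet> distribution (r *R u) \<phi> = w \<bullet> (r *R distribution u \<phi>)" for w
  by (simp add: inner_tw[OF assms, symmetric])
 then show ?thesis using vector_eq_ldot by blast
qed

lemma Psi_add_right: "bbs k ==> Psi k p (q + r) = Psi k p q + Psi k p r"
 unfolding Psi_def using Psi_integrable1[of k p q] Psi_integrable1[of k p r]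
 by (simp add: distribution_add[OF bbs_shift] inner_add_right)

lemma Psi_scaleR_right: "bbs k ==> Psi k p (c *R q) = c * Psi k p q"
 unfolding Psi_def by (simp add: distribution_scaleR[OF bbs_shift])

lemma Psi_scaleR_left: "bbs k ==> Psi k (c *R p) q = c * Psi k p q"
 by (simp add: Psi_swap distribution_scaleR[OF bbs_reflect])

lemma Psi_bound2:
 assumes k: "bbs k"
 shows "\<bar>Psi k p q\<bar> <= 2 * (LI x. \<bar>k x\<bar>) * norm p * norm q"
proof (cases "p = 0 \<or> q = 0")
 case True
 then show ?thesis using Psi_scaleR_left[OF k, of 0 p q] Psi_scaleR_right[OF k, of p 0 q] by auto
next
 case False
 then have n: "norm p > 0" "norm q > 0" by auto
 have "\<bar>Psi k (inverse (norm p) *R p) (inverse (norm q) *R q)\<bar> <= (LI x. \<bar>k x\<bar>) * (1 + 1)"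
  using Psi_bound[OF k, of "inverse (norm p) *R p" "inverse (norm q) *R q"] n by simp
 then have "inverse (norm p) * inverse (norm q) * \<bar>Psi k p q\<bar> <= (LI x. \<bar>k x\<bar>) * 2"
  using n by (simp add: Psi_scaleR_left[OF k] Psi_scaleR_right[OF k] abs_mult mult_ac)
 then have "(norm p * norm q) * (inverse (norm p) * inverse (norm q) * \<bar>Psi k p q\<bar>) <= (norm p * norm q) * ((LI x. \<bar>k x\<bar>) * 2)"
  by (rule mult_left_mono) simp
 moreover have "(norm p * norm q) * (inverse (norm p) * inverse (norm q) * \<bar>Psi k p q\<bar>) = \<bar>Psi k p q\<bar>"
  using n by (simp add: field_simps)
 ultimately have "\<bar>Psi k p q\<bar> <= (norm p * norm q) * ((LI x. \<bar>k x\<bar>) * 2)" by (simp only:)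
 then show ?thesis by (simp add: mult_ac)
qed

definition moll :: "nat => real^'n => real" where
 "moll N = cutoff 0 (vec (1 / real (Suc N))) (1 / real (Suc N) / 4)"

lemma moll_test: "test_function (moll N)" unfolding moll_def by (rule test_cutoff) simp

lemma moll_nonneg: "moll N x >= 0" unfolding moll_def by (rule cutoff_range)

lemma moll_support: assumes "moll N x ~= 0" shows "norm (x :: real^'n) <= real CARD('n) / real (Suc N)"
proof -
 have "0 < x $ i \<and> x $ i < 1 / real (Suc N)" for i
  using cutoff_eq_0[of "1 / real (Suc N) / 4" x i 0 "vec (1 / real (Suc N))"] assms by (force simp: moll_def)
 then have "\<bar>x $ i\<bar> <= 1 / real (Suc N)" for i by (metis abs_of_pos less_imp_le)
 then have "(\<Sum>i\<in>UNIV. \<bar>x $ i\<bar>) <= (\<Sum>i\<in>(UNIV::'n set). 1 / real (Suc N))" by (rule sum_mono)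
 then show ?thesis using norm_le_l1_cart[of x] by simp
qed

lemma moll_mass: "(\<integral>x. moll N x \<partial>(lborel :: (real^'n) measure)) > 0"
proof -
 define e where "e = 1 / real (Suc N)"
 have e: "e > 0" by (simp add: e_def)
 let ?Q = "cbox (\<chi> i. e / 4) (\<chi> i. 3 * e / 4) :: (real^'n) set"
 have ind: "indicator ?Q x <= moll N x" for x :: "real^'n"
 proof (cases "x : ?Q")
  case True
  have "moll N x = 1" unfolding moll_def e_def[symmetric] by (rule cutoff_eq_1) (use True e in "auto simp: mem_box_cart")
  then show ?thesis by simp
 qed (simp add: moll_nonneg)
 have "(0::real) < (\<Prod>i\<in>(UNIV::'n set). 3 * e / 4 - e / 4)" by (rule prod_pos) (use e in simp)
 also have "... = measure lborel ?Q" by (subst content_cbox_cart) (use e in "auto simp: interval_ne_empty_cart")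
 also have "... = (LI x. indicator ?Q x)" by simp
 also have "... <= (\<integral>x. moll N x \<partial>(lborel :: (real^'n) measure))"
 proof (rule integral_mono)
  show "integrable lborel (indicat_real ?Q)" by (rule bbs_integrable_real[OF bbs_indicator]) auto
  show "integrable lborel (moll N :: real^'n => real)" by (rule bbs_integrable_real[OF test_bbs[OF moll_test]])
 qed (rule ind)
 finally show ?thesis .
qed

lemma Psi_moll_tw:
 assumes t: "test_function \<psi>"
 shows "(%N. Psi (moll N) p (tw \<psi> w) / (\<integral>x. moll N x \<partial>(lborel :: (real^'n) measure))) ----> p \<bullet> tw (\<psi> :: real^'n => real) w"
proof -
 obtain L where L: "!!x y. \<bar>\<psi> x - \<psi> y\<bar> <= L * norm (x - y)" "L >= 0" by (rule test_lipschitz[OF t]) auto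
 obtain R where R: "!!x. norm x > R ==> \<psi> x = 0" using t by (auto simp: test_function_iff)
 have [measurable]: "\<psi> : bfun" "moll N : bfun" for N
  using bbs_measurable[OF test_bbs[OF t]] bbs_measurable[OF test_bbs[OF moll_test]] by auto
 define n where "n = real CARD('n)"
 define Q :: "(real^'n) set" where "Q = cball 0 (R + n)"
 define I where "I = (LI y. indicator Q y * norm (fn p y))"
 have bQ: "bbs (indicator Q)" unfolding Q_def by (rule bbs_indicator) auto
 have Ii: "integrable lborel (%y. indicator Q y * norm (fn p y))"
  using integrable_norm[OF bbs_integrable[OF bQ sqint_fn[of p]]] by simp
 define m where "m N = (\<integral>x. moll N x \<partial>(lborel :: (real^'n) measure))" for N
 have m0: "m N > 0" for N unfolding m_def by (rule moll_mass)
 have main: "\<bar>Psi (moll N) p (tw \<psi> w) - m N * (p \<bullet> tw \<psi> w)\<bar> <= m N * (L * n * norm w * I / real (Suc N))" for N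
 proof -
  let ?k = "moll N :: real^'n => real"
  have kb: "bbs ?k" by (rule test_bbs[OF moll_test])
  have ksh: "integrable lborel (%x. ?k (x - y))" for y by (rule bbs_integrable_real[OF bbs_shift[OF kb]])
  have mass: "(LI x. ?k (x - y)) = m N" for y using integral_shift[of ?k "- y"] by (simp add: m_def)
  define c where "c y = (LI x. ?k (x - y) * \<psi> x)" for y
  have kp: "integrable lborel (%x. ?k (x - y) * \<psi> x)" for y
   by (rule bbs_integrable_real[OF bbs_mult[OF bbs_shift[OF kb] test_bbs[OF t]]])
  have cy: "\<bar>c y - m N * \<psi> y\<bar> <= m N * (L * n / real (Suc N)) * indicator Q y" for y
  proof -
   have pt: "\<bar>?k (x - y) * \<psi> x - ?k (x - y) * \<psi> y\<bar> <= ?k (x - y) * (L * n / real (Suc N) * indicator Q y)" for x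
   proof (cases "?k (x - y) = 0")
    case False
    then have xy: "norm (x - y) <= n / real (Suc N)" using moll_support by (auto simp: n_def)
    have "n / real (Suc N) <= n / 1" by (rule divide_left_mono) (auto simp: n_def)
    with xy have xyn: "norm (x - y) <= n" by simp
    show ?thesis
    proof (cases "y : Q")
     case True
     have "\<bar>\<psi> x - \<psi> y\<bar> <= L * (n / real (Suc N))"
      using L(1)[of x y] mult_left_mono[OF xy L(2)] by linarith
     then have "?k (x - y) * \<bar>\<psi> x - \<psi> y\<bar> <= ?k (x - y) * (L * (n / real (Suc N)))"
      by (rule mult_left_mono[OF _ moll_nonneg])
     moreover have "\<bar>?k (x - y) * \<psi> x - ?k (x - y) * \<psi> y\<bar> = ?k (x - y) * \<bar>\<psi> x - \<psi> y\<bar>"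
      unfolding right_diff_distrib[symmetric] abs_mult using moll_nonneg[of N "x - y"] by simp
     ultimately show ?thesis using True by simp
    next
     case False
     then have y: "norm y > R + n" by (simp add: Q_def)
     then have "norm x > R" using norm_triangle_ineq2[of y x] xyn by (simp add: norm_minus_commute)
     moreover have "norm y > R" using y by (simp add: n_def)
     ultimately show ?thesis using R False by simp
    qed
   qed simp
   have "c y - m N * \<psi> y = (LI x. ?k (x - y) * \<psi> x - ?k (x - y) * \<psi> y)"
    unfolding c_def mass[of y, symmetric] using kp[of y] ksh[of y] by simp
   also have "\<bar>...\<bar> <= (LI x. ?k (x - y) * (L * n / real (Suc N) * indicator Q y))" using pt kp[of y] ksh[of y]
    by (intro order_trans[OF integral_abs_bound] integral_mono integrable_abs Bochner_Integration.integrable_diff integrable_mult_left) auto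
   also have "... = m N * (L * n / real (Suc N)) * indicator Q y" using mass[of y] by simp
   finally show ?thesis .
  qed
  have dtw: "distribution (tw \<psi> w) (%x. ?k (x - y)) = c y *R w" for y
   unfolding c_def by (rule distribution_tw[OF bbs_shift[OF kb] test_bbs[OF t]])
  have ptw: "p \<bullet> tw \<psi> w = (LI y. fn p y \<bullet> (\<psi> y *R w))"
   unfolding tw_def by (rule inner_mk2[OF bbs_sqint[OF test_bbs[OF t]]])
  have i1: "integrable lborel (%y. fn p y \<bullet> (c y *R w))" using Psi_integrable1[OF kb, of p "tw \<psi> w"] by (simp add: dtw)
  have i2: "integrable lborel (%y. fn p y \<bullet> (\<psi> y *R w))"
   by (rule sqint_inner_integrable[OF sqint_fn bbs_sqint[OF test_bbs[OF t]]])
  have "Psi (moll N) p (tw \<psi> w) - m N * (p \<bullet> tw \<psi> w) = (LI y. fn p y \<bullet> (c y *R w) - m N * (fn p y \<bullet> (\<psi> y *R w)))"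
   unfolding Psi_def dtw ptw using i1 i2 by simp
  also have "\<bar>...\<bar> <= (LI y. (m N * (L * n / real (Suc N)) * norm w) * (indicator Q y * norm (fn p y)))"
  proof (rule order_trans[OF integral_abs_bound integral_mono])
   show "integrable lborel (%y. \<bar>fn p y \<bullet> (c y *R w) - m N * (fn p y \<bullet> (\<psi> y *R w))\<bar>)" using i1 i2 by simp
   show "integrable lborel (%y. (m N * (L * n / real (Suc N)) * norm w) * (indicator Q y * norm (fn p y)))"
    by (rule integrable_mult_right) (use Ii in simp)
   fix y
   have "\<bar>fn p y \<bullet> (c y *R w) - m N * (fn p y \<bullet> (\<psi> y *R w))\<bar> = \<bar>c y - m N * \<psi> y\<bar> * \<bar>fn p y \<bullet> w\<bar>"
    by (simp add: abs_mult[symmetric] left_diff_distrib)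
   also have "... <= (m N * (L * n / real (Suc N)) * indicator Q y) * (norm (fn p y) * norm w)"
    by (rule mult_mono[OF cy Cauchy_Schwarz_ineq2]) (use m0[of N] L in "auto simp: n_def")
   finally show "\<bar>fn p y \<bullet> (c y *R w) - m N * (fn p y \<bullet> (\<psi> y *R w))\<bar> <= (m N * (L * n / real (Suc N)) * norm w) * (indicator Q y * norm (fn p y))"
    by (simp add: mult_ac)
  qed
  also have "... = m N * (L * n * norm w * I / real (Suc N))" unfolding I_def using Ii by simp
  finally show ?thesis .
 qed
 have "(%N. Psi (moll N) p (tw \<psi> w) / m N - p \<bullet> tw \<psi> w) ----> 0"
 proof (rule Lim_null_comparison)
  show "\<forall>\<^sub>F N in sequentially. norm (Psi (moll N) p (tw \<psi> w) / m N - p \<bullet> tw \<psi> w) <= (L * n * norm w * I) * inverse (real (Suc N))"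
  proof (rule always_eventually, rule allI)
   fix N
   have "Psi (moll N) p (tw \<psi> w) / m N - p \<bullet> tw \<psi> w = (Psi (moll N) p (tw \<psi> w) - m N * (p \<bullet> tw \<psi> w)) / m N"
    using m0[of N] by (simp add: diff_divide_distrib)
   also have "norm ... <= L * n * norm w * I / real (Suc N)"
    using main[of N] m0[of N] by (simp add: abs_divide pos_divide_le_eq mult.commute)
   finally show "norm (Psi (moll N) p (tw \<psi> w) / m N - p \<bullet> tw \<psi> w) <= (L * n * norm w * I) * inverse (real (Suc N))"
    by (simp add: divide_inverse)
  qed
  show "(%N. (L * n * norm w * I) * inverse (real (Suc N))) ----> 0"
   by (rule tendsto_mult_right_zero[OF LIMSEQ_inverse_real_of_nat])
 qed
 then show ?thesis unfolding m_def by (rule LIM_zero_cancel)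
qed

text \<open>Approximate identity: clear for test vectors, and the general case follows from the uniform bound and density.\<close>

lemma Psi_moll_limit:
 fixes p q :: "('n::finite, 'm::finite) L2"
 shows "(%N. Psi (moll N) p q / (\<integral>x. moll N x \<partial>(lborel :: (real^'n) measure))) ----> p \<bullet> q"
proof -
 define m where "m N = (\<integral>x. moll N x \<partial>(lborel :: (real^'n) measure))" for N
 have m0: "m N > 0" for N unfolding m_def by (rule moll_mass)
 have kb: "bbs (moll N)" for N by (rule test_bbs[OF moll_test])
 have sp: "(%N. Psi (moll N) p r / m N) ----> p \<bullet> r" if "r : span tvecs" for r using that
 proof (induction rule: span_induct_alt)
  case base
  have "Psi (moll N) p 0 = 0" for N using Psi_scaleR_right[OF kb, of N p 0 0] by simp
  then show ?case by simp
 next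
  case (step c x y)
  then obtain \<psi> w where x: "x = tw \<psi> w" "test_function \<psi>" by (auto simp: tvecs_def)
  have "(%N. c * (Psi (moll N) p x / m N) + Psi (moll N) p y / m N) ----> c * (p \<bullet> x) + p \<bullet> y"
   using Psi_moll_tw[OF x(2), of p w] step.IH unfolding x(1) m_def by (intro tendsto_intros)
  then show ?case by (simp add: Psi_add_right[OF kb] Psi_scaleR_right[OF kb] inner_simps add_divide_distrib)
 qed
 have "(%N. Psi (moll N) p q / m N) ----> p \<bullet> q"
 proof (rule LIMSEQ_I)
  fix e :: real assume e: "e > 0"
  define d where "d = (e / 6) / (norm p + 1)"
  have d: "d > 0" using e by (simp add: d_def add_nonneg_pos)
  obtain r where r: "r : span tvecs" "dist r q < d" using closure_approachable[of q "span tvecs"] tvecs_dense d by auto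
  obtain N0 where N0: "!!N. N >= N0 ==> norm (Psi (moll N) p r / m N - p \<bullet> r) < e / 2"
   using LIMSEQ_D[OF sp[OF r(1)], of "e/2"] e by auto
  show "\<exists>N0. \<forall>N\<ge>N0. norm (Psi (moll N) p q / m N - p \<bullet> q) < e"
  proof (intro exI[of _ N0] allI impI)
   fix N assume "N >= N0"
   have nq: "norm (q - r) < d" using r(2) by (simp add: dist_norm norm_minus_commute)
   have "Psi (moll N) p q = Psi (moll N) p r + Psi (moll N) p (q - r)" using Psi_add_right[OF kb, of N p r "q - r"] by simp
   then have "Psi (moll N) p q / m N - p \<bullet> q = (Psi (moll N) p r / m N - p \<bullet> r) + Psi (moll N) p (q - r) / m N - p \<bullet> (q - r)"
    by (simp add: add_divide_distrib inner_diff_right)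
   moreover have "\<bar>Psi (moll N) p (q - r) / m N\<bar> <= 2 * (norm p * norm (q - r))"
   proof -
    have "(\<integral>x. \<bar>moll N x\<bar> \<partial>(lborel :: (real^'n) measure)) = m N"
     unfolding m_def by (rule Bochner_Integration.integral_cong) (auto simp: moll_nonneg)
    then have "\<bar>Psi (moll N) p (q - r)\<bar> <= 2 * m N * norm p * norm (q - r)" using Psi_bound2[OF kb, of N p "q - r"] by simp
    then show ?thesis using m0[of N] by (simp add: abs_divide pos_divide_le_eq mult_ac)
   qed
   moreover have "\<bar>p \<bullet> (q - r)\<bar> <= norm p * norm (q - r)" by (rule Cauchy_Schwarz_ineq2)
   moreover have "norm p * norm (q - r) <= (norm p + 1) * d" using nq by (intro mult_mono) auto
   moreover have "(norm p + 1) * d = e / 6" 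
   proof -
    have "norm p + 1 ~= 0" using norm_ge_zero[of p] by linarith
    from nonzero_eq_divide_eq[OF this, THEN iffD1, OF d_def] show ?thesis by (simp add: mult.commute)
   qed
   ultimately show "norm (Psi (moll N) p q / m N - p \<bullet> q) < e"
    using N0[OF \<open>N \<ge> N0\<close>] by (simp only: real_norm_def)
  qed
 qed
 then show ?thesis by (simp add: m_def)
qed

section \<open>Self-adjoint first order operators with constant coefficients\<close>

locale diffop =
 fixes dom :: "('n::finite, 'm::finite) L2 set" and D :: "('n, 'm) L2 => ('n, 'm) L2"
  and a :: "'n => complex^'m => complex^'m" and a0 :: "complex^'m => complex^'m"
 assumes a_lin: "linear (a j)" and a0_lin: "linear a0"
  and D_formula: "u : dom ==> test_function \<phi> ==>
   distribution (D u) \<phi> = (\<Sum>j\<in>UNIV. a j (distribution_partial j u \<phi>)) + a0 (distribution u \<phi>)"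
  and sym: "u : dom ==> v : dom ==> D u \<bullet> v = u \<bullet> D v"
  and adj: "(!!u. u : dom ==> D u \<bullet> v = u \<bullet> w) ==> v : dom \<and> D v = w"
begin

definition as :: "'n => complex^'m => complex^'m" where "as j = adjoint (a j)"
definition as0 :: "complex^'m => complex^'m" where "as0 = adjoint a0"

lemma as_works: "x \<bullet> as j y = a j x \<bullet> y" "x \<bullet> as0 y = a0 x \<bullet> y"
 and as_lin: "linear (as j)" and as0_lin: "linear as0"
 using adjoint_works[OF a_lin] adjoint_works[OF a0_lin] adjoint_linear[OF a_lin] adjoint_linear[OF a0_lin]
 by (auto simp: as_def as0_def)

lemma as_works': "as j y \<bullet> x = y \<bullet> a j x" "as0 y \<bullet> x = y \<bullet> a0 x"
 by (simp_all add: inner_commute as_works)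

lemma D_formula': "u : dom ==> test_function \<phi> ==>
  distribution (D u) \<phi> = a0 (distribution u \<phi>) - (\<Sum>j\<in>UNIV. a j (distribution u (partial_deriv j \<phi>)))"
 by (simp add: D_formula distribution_partial_def linear_neg[OF a_lin] sum_negf)

lemma tw_in_dom:
 assumes t: "test_function \<psi>"
 shows "tw \<psi> w : dom" and "D (tw \<psi> w) = tw \<psi> (a0 w) + (\<Sum>j\<in>UNIV. tw (partial_deriv j \<psi>) (a j w))"
proof -
 have b: "bbs \<psi>" "bbs (partial_deriv j \<psi>)" for j by (intro test_bbs t test_partial)+
 have "D v \<bullet> tw \<psi> w = v \<bullet> (tw \<psi> (as0 w) - (\<Sum>j\<in>UNIV. tw (partial_deriv j \<psi>) (as j w)))" if v: "v : dom" for v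
  by (simp add: inner_tw b D_formula'[OF v t] inner_simps inner_sum_right as_works as_works')
 from adj[OF this] show d: "tw \<psi> w : dom" by blast
 define E where "E = tw \<psi> (a0 w) + (\<Sum>j\<in>UNIV. tw (partial_deriv j \<psi>) (a j w))"
 have "D (tw \<psi> w) - E = 0"
 proof (rule zero_if_distribution_zero)
  fix \<phi> :: "real^'n => real" assume t2: "test_function \<phi>"
  have b2: "bbs \<phi>" "bbs (partial_deriv j \<phi>)" for j by (intro test_bbs t2 test_partial)+
  have "distribution (D (tw \<psi> w)) \<phi> = distribution E \<phi>" unfolding D_formula'[OF d t2] E_def
   by (simp add: distribution_add[OF b2(1)] distribution_sum[OF b2(1)] distribution_tw b b2
     linear_neg[OF a_lin] linear_scale[OF a_lin] linear_scale[OF a0_lin] integration_by_parts[OF t2 t] sum_negf)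
  then show "distribution (D (tw \<psi> w) - E) \<phi> = 0" by (simp add: distribution_diff[OF b2(1)])
 qed
 then show "D (tw \<psi> w) = tw \<psi> (a0 w) + (\<Sum>j\<in>UNIV. tw (partial_deriv j \<psi>) (a j w))" by (simp add: E_def)
qed

text \<open>By symmetry \<open>D\<close> is also given by its formal adjoint.\<close>

lemma D_formula_adjoint:
 assumes u: "u : dom" and t: "test_function \<psi>"
 shows "distribution (D u) \<psi> = as0 (distribution u \<psi>) + (\<Sum>j\<in>UNIV. as j (distribution u (partial_deriv j \<psi>)))"
proof -
 have b: "bbs \<psi>" "bbs (partial_deriv j \<psi>)" for j by (intro test_bbs t test_partial)+
 have "w \<bullet> distribution (D u) \<psi> = w \<bullet> (as0 (distribution u \<psi>) + (\<Sum>j\<in>UNIV. as j (distribution u (partial_deriv j \<psi>))))" for w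
  using sym[OF u tw_in_dom(1)[OF t, of w]] by (simp add: inner_tw[OF b(1), symmetric] tw_in_dom(2)[OF t])
   (simp add: inner_simps inner_sum_right inner_tw b as_works)
 then show ?thesis using vector_eq_ldot by blast
qed

text \<open>If \<open>Du\<close> exists in \<open>L\<^sup>2\<close> in the sense of distributions then \<open>u\<close> belongs to the domain: convolution commutes with
constant coefficient operators, so \<open>Psi k u (D v) = Psi k f v\<close> for \<open>v\<close> in the domain; in the limit \<open>(u, Dv) = (f, v)\<close>,
and \<open>D\<close> is self-adjoint.\<close>

lemma maximal_domain:
 assumes f: "!!\<psi>. test_function \<psi> ==>
  distribution f \<psi> = as0 (distribution u \<psi>) + (\<Sum>j\<in>UNIV. as j (distribution u (partial_deriv j \<psi>)))"
 shows "u : dom \<and> D u = f"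
proof (rule adj)
 fix v assume v: "v : dom"
 have key: "Psi k u (D v) = Psi k f v" if k: "test_function k" for k
 proof -
  have kb: "bbs k" "bbs (partial_deriv j k)" for j by (intro test_bbs k test_partial)+
  have ky: "test_function (%x. k (x - y))" "partial_deriv j (%x. k (x - y)) = (%x. partial_deriv j k (x - y))" for y j
   using test_affine[OF k, of 1 "- y"] partial_affine[OF test_smooth[OF k], of j 1 "- y"] by auto
  have kx: "test_function (%y. k (x - y))" "partial_deriv j (%y. k (x - y)) = (%y. - partial_deriv j k (x - y))" for x j
   using test_affine[OF k, of "-1" x] partial_affine[OF test_smooth[OF k], of j "-1" x] by (auto simp: fun_eq_iff)
  define A where "A j = fibre (as j) u" for j
  define A0 where "A0 = fibre as0 u"
  have AEA: "AE y in lborel. fn (A j) y = as j (fn u y)" "AE y in lborel. fn A0 y = as0 (fn u y)" for j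
   unfolding A_def A0_def by (intro fn_fibre as_lin as0_lin)+
  have "AE y in lborel. \<forall>j. fn (A j) y = as j (fn u y)" using AEA(1) by (simp add: AE_all_countable)
  then have "AE y in lborel. fn u y \<bullet> distribution (D v) (%x. k (x - y)) =
    fn A0 y \<bullet> distribution v (%x. k (x - y)) - (\<Sum>j\<in>UNIV. fn (A j) y \<bullet> distribution v (%x. partial_deriv j k (x - y)))"
   using AEA(2) by eventually_elim (simp add: D_formula'[OF v ky(1)] ky(2) inner_simps inner_sum_right as_works as_works')
  then have "Psi k u (D v) = (LI y. fn A0 y \<bullet> distribution v (%x. k (x - y)) - (\<Sum>j\<in>UNIV. fn (A j) y \<bullet> distribution v (%x. partial_deriv j k (x - y))))"
   unfolding Psi_def
  proof (rule integral_cong_AE[rotated 2])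
   show "(%y. fn u y \<bullet> distribution (D v) (%x. k (x - y))) : borel_measurable lborel"
    by (rule borel_measurable_integrable[OF Psi_integrable1[OF kb(1)]])
   show "(%y. fn A0 y \<bullet> distribution v (%x. k (x - y)) - (\<Sum>j\<in>UNIV. fn (A j) y \<bullet> distribution v (%x. partial_deriv j k (x - y)))) : borel_measurable lborel"
    by (intro borel_measurable_diff borel_measurable_sum borel_measurable_integrable Psi_integrable1 kb)
  qed
  also have "... = Psi k A0 v - (\<Sum>j\<in>UNIV. Psi (partial_deriv j k) (A j) v)"
   unfolding Psi_def by (subst Bochner_Integration.integral_diff)
    (auto intro!: Psi_integrable1 kb Bochner_Integration.integrable_sum simp: Bochner_Integration.integral_sum Psi_integrable1[OF kb(2)])
  also have "... = (LI x. distribution A0 (%y. k (x - y)) \<bullet> fn v x - (\<Sum>j\<in>UNIV. distribution (A j) (%y. partial_deriv j k (x - y)) \<bullet> fn v x))"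
   unfolding Psi_swap[OF kb(1)] Psi_swap[OF kb(2)] by (subst Bochner_Integration.integral_diff)
    (auto intro!: Psi_integrable2 kb Bochner_Integration.integrable_sum simp: Bochner_Integration.integral_sum Psi_integrable2[OF kb(2)])
  also have "... = (LI x. distribution f (%y. k (x - y)) \<bullet> fn v x)"
  proof (rule Bochner_Integration.integral_cong[OF refl])
   fix x
   have neg: "distribution u (%y. - partial_deriv j k (x - y)) = - distribution u (%y. partial_deriv j k (x - y))" for j
    using bbs_measurable[OF bbs_reflect[OF kb(2)]] by (simp add: distribution_eq)
   show "distribution A0 (%y. k (x - y)) \<bullet> fn v x - (\<Sum>j\<in>UNIV. distribution (A j) (%y. partial_deriv j k (x - y)) \<bullet> fn v x)
     = distribution f (%y. k (x - y)) \<bullet> fn v x" unfolding f[OF kx(1)] kx(2) neg A_def A0_def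
    by (simp add: distribution_fibre[OF as_lin bbs_reflect[OF kb(2)]] distribution_fibre[OF as0_lin bbs_reflect[OF kb(1)]]
      inner_simps inner_sum_left linear_neg[OF as_lin] sum_negf)
  qed
  also have "... = Psi k f v" by (rule Psi_swap[OF kb(1), symmetric])
  finally show ?thesis .
 qed
 have "u \<bullet> D v = f \<bullet> v"
  using LIMSEQ_unique[OF Psi_moll_limit[of u "D v"]] Psi_moll_limit[of f v] unfolding key[OF moll_test] by blast
 then show "D v \<bullet> u = v \<bullet> f" by (simp add: inner_commute)
qed

text \<open>The Leibniz rule. The commutator of \<open>D\<close> with a smooth bounded function is multiplication by
 a matrix which is dominated by the gradient.\<close>

lemma leibniz:
 assumes s: "smooth \<omega>" and b: "bm \<omega>" "!!j. bm (partial_deriv j \<omega>)" and u: "u : dom"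
 shows "mult \<omega> u : dom" "D (mult \<omega> u) = mult \<omega> (D u) - (\<Sum>j\<in>UNIV. mult (partial_deriv j \<omega>) (fibre (as j) u))"
proof -
 define f where "f = mult \<omega> (D u) - (\<Sum>j\<in>UNIV. mult (partial_deriv j \<omega>) (fibre (as j) u))"
 have "mult \<omega> u : dom \<and> D (mult \<omega> u) = f"
 proof (rule maximal_domain)
  fix \<psi> :: "real^'n => real" assume t: "test_function \<psi>"
  have tb: "bbs \<psi>" "bbs (partial_deriv j \<psi>)" for j by (intro test_bbs t test_partial)+
  have t2: "test_function (%x. \<omega> x * \<psi> x)" by (rule test_mult_left[OF s t])
  have t3: "test_function (%x. partial_deriv j \<omega> x * \<psi> x)" "test_function (%x. \<omega> x * partial_deriv j \<psi> x)" for j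
   by (intro test_mult_left smooth_partial s t test_partial)+
  have p: "partial_deriv j (%x. \<omega> x * \<psi> x) = (%x. \<omega> x * partial_deriv j \<psi> x + partial_deriv j \<omega> x * \<psi> x)" for j
   using partial_mult[OF s test_smooth[OF t]] by auto
  have split: "distribution u (partial_deriv j (%x. \<omega> x * \<psi> x)) =
    distribution u (%x. \<omega> x * partial_deriv j \<psi> x) + distribution u (%x. partial_deriv j \<omega> x * \<psi> x)" for j
  proof -
   have i: "integrable lborel (%x. (\<omega> x * partial_deriv j \<psi> x) *R fn u x)" "integrable lborel (%x. (partial_deriv j \<omega> x * \<psi> x) *R fn u x)"
    by (rule bbs_integrable[OF test_bbs[OF t3(2)] sqint_fn], rule bbs_integrable[OF test_bbs[OF t3(1)] sqint_fn])
   have "distribution u (partial_deriv j (%x. \<omega> x * \<psi> x)) = (LI x. (\<omega> x * partial_deriv j \<psi> x) *R fn u x + (partial_deriv j \<omega> x * \<psi> x) *R fn u x)"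
    unfolding distribution_eq[OF bbs_measurable[OF test_bbs[OF test_partial[OF t2]]]] unfolding p by (simp add: scaleR_left_distrib)
   then show ?thesis
    unfolding distribution_eq[OF bbs_measurable[OF test_bbs[OF t3(1)]]] distribution_eq[OF bbs_measurable[OF test_bbs[OF t3(2)]]]
    using i by simp
  qed
  have "distribution f \<psi> = distribution (D u) (%x. \<omega> x * \<psi> x) - (\<Sum>j\<in>UNIV. as j (distribution u (%x. partial_deriv j \<omega> x * \<psi> x)))"
   unfolding f_def by (simp add: distribution_diff[OF tb(1)] distribution_sum[OF tb(1)] distribution_mult[OF b(1) tb(1)] distribution_mult[OF b(2) tb(1)]
     distribution_fibre[OF as_lin test_bbs[OF t3(1)]])
  also have "... = as0 (distribution u (%x. \<omega> x * \<psi> x)) + (\<Sum>j\<in>UNIV. as j (distribution u (%x. \<omega> x * partial_deriv j \<psi> x)))"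
   unfolding D_formula_adjoint[OF u t2] split by (simp add: linear_add[OF as_lin] sum.distrib)
  also have "... = as0 (distribution (mult \<omega> u) \<psi>) + (\<Sum>j\<in>UNIV. as j (distribution (mult \<omega> u) (partial_deriv j \<psi>)))"
   by (simp add: distribution_mult[OF b(1) tb(1)] distribution_mult[OF b(1) tb(2)])
  finally show "distribution f \<psi> = as0 (distribution (mult \<omega> u) \<psi>) + (\<Sum>j\<in>UNIV. as j (distribution (mult \<omega> u) (partial_deriv j \<psi>)))" .
 qed
 then show "mult \<omega> u : dom" "D (mult \<omega> u) = mult \<omega> (D u) - (\<Sum>j\<in>UNIV. mult (partial_deriv j \<omega>) (fibre (as j) u))"
  by (auto simp: f_def)
qed

lemma commutator_bound:
 "\<exists>C\<ge>0. \<forall>\<omega> \<kappa> u. smooth \<omega> --> (\<forall>x. 0 <= \<omega> x \<and> \<omega> x <= 1) --> \<kappa> >= 0 \<longrightarrow>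
  (\<forall>j x. \<bar>partial_deriv j \<omega> x\<bar> <= \<kappa> * \<omega> x) --> u : dom \<longrightarrow>
  mult \<omega> u : dom \<and> norm (D (mult \<omega> u) - mult \<omega> (D u)) <= C * \<kappa> * norm (mult \<omega> u)"
proof -
 have "\<exists>C\<ge>0. \<forall>v. norm (as j v) <= C * norm v" for j using linear_fibre_bound[OF as_lin[of j]] by metis
 then obtain c where c: "!!j. c j >= 0" "!!j v. norm (as j v) <= c j * norm v" by metis
 define C where "C = (\<Sum>j\<in>UNIV. c j)"
 have "mult \<omega> u : dom \<and> norm (D (mult \<omega> u) - mult \<omega> (D u)) <= C * \<kappa> * norm (mult \<omega> u)"
  if s: "smooth \<omega>" and r: "\<forall>x. 0 <= \<omega> x \<and> \<omega> x <= 1" and k: "\<kappa> >= 0" and p: "\<forall>j x. \<bar>partial_deriv j \<omega> x\<bar> <= \<kappa> * \<omega> x" and u: "u : dom" for \<omega> \<kappa> u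
 proof -
  have b: "bm \<omega>" unfolding bm_def using smooth_measurable[OF s] r by (intro conjI exI[of _ 1]) auto
  have bp: "bm (partial_deriv j \<omega>)" for j
  proof -
   have "\<bar>partial_deriv j \<omega> x\<bar> <= \<kappa>" for x
   proof -
    have "\<kappa> * \<omega> x <= \<kappa> * 1" using r k by (intro mult_left_mono) auto
    then show ?thesis using p[rule_format, of j x] by linarith
   qed
   then show ?thesis unfolding bm_def using smooth_measurable[OF smooth_partial[OF s]] by (intro conjI exI[of _ \<kappa>]) auto
  qed
  note L = leibniz[OF s b bp u]
  have each: "norm (mult (partial_deriv j \<omega>) (fibre (as j) u)) <= (\<kappa> * c j) * norm (mult \<omega> u)" for j
  proof (rule norm_mono_AE)
   show "AE x in lborel. norm (fn (mult (partial_deriv j \<omega>) (fibre (as j) u)) x) <= (\<kappa> * c j) * norm (fn (mult \<omega> u) x)"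
    using fn_mult[OF bp, of j "fibre (as j) u"] fn_fibre[OF as_lin, of j u] fn_mult[OF b, of u]
   proof eventually_elim
    case (elim x)
    have "\<bar>partial_deriv j \<omega> x\<bar> * norm (as j (fn u x)) <= (\<kappa> * \<omega> x) * (c j * norm (fn u x))"
     using p c r k by (intro mult_mono) auto
    then show ?case using elim r by (simp add: mult_ac)
   qed
  qed (use k c in auto)
  have "norm (D (mult \<omega> u) - mult \<omega> (D u)) = norm (\<Sum>j\<in>UNIV. mult (partial_deriv j \<omega>) (fibre (as j) u))"
   unfolding L(2) by simp
  also have "... <= (\<Sum>j\<in>UNIV. (\<kappa> * c j) * norm (mult \<omega> u))" by (rule sum_norm_le) (rule each)
  also have "... = C * \<kappa> * norm (mult \<omega> u)" by (simp add: C_def sum_distrib_left sum_distrib_right mult_ac)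
  finally show ?thesis using L(1) by simp
 qed
 moreover have "C >= 0" unfolding C_def by (rule sum_nonneg) (use c in auto)
 ultimately show ?thesis by blast
qed

end

section \<open>Averages over cubes\<close>

definition cube :: "real^'n => real => (real^'n) set" where
 "cube a l = {x. \<forall>i. a $ i <= x $ i \<and> x $ i < a $ i + l}"

lemma cube_borel [measurable]: "cube a l : sets borel"
proof -
 have "cube a l = (\<Inter>i. {x. a $ i <= x $ i} Int {x. x $ i < a $ i + l})" by (auto simp: cube_def)
 also have "... : sets borel"
  by (intro sets.countable_INT'' sets.Int borel_closed borel_open closed_Collect_le open_Collect_less continuous_intros) auto
 finally show ?thesis .
qed

lemma cube_subset_cbox: "cube a l \<subseteq> cbox a (a + vec l)" by (auto simp: cube_def mem_box_cart less_imp_le)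

lemma bounded_cube: "bounded (cube a l)" by (rule bounded_subset[OF bounded_cbox cube_subset_cbox])

lemma bbs_cube: "bbs (indicator (cube a l))" by (rule bbs_indicator[OF cube_borel bounded_cube])

lemma emeasure_cube:
 fixes a :: "real^'n"
 assumes l: "l >= 0"
 shows "emeasure lborel (cube a l) = ennreal (l ^ CARD('n))"
proof -
 have b: "(vec l :: real^'n) \<bullet> b = l" if "b : Basis" for b using that by (auto simp: Basis_vec_def inner_axis)
 then have p: "(\<Prod>b\<in>(Basis :: (real^'n) set). (vec l :: real^'n) \<bullet> b) = l ^ CARD('n)" by simp
 have "emeasure lborel (box a (a + vec l)) = ennreal (l ^ CARD('n))" "emeasure lborel (cbox a (a + vec l)) = ennreal (l ^ CARD('n))"
  using b l by (auto simp: emeasure_lborel_box_eq emeasure_lborel_cbox_eq inner_simps p)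
 moreover have "emeasure lborel (box a (a + vec l)) <= emeasure lborel (cube a l)"
  by (rule emeasure_mono) (auto simp: cube_def mem_box_cart less_imp_le)
 moreover have "emeasure lborel (cube a l) <= emeasure lborel (cbox a (a + vec l))"
  by (rule emeasure_mono[OF cube_subset_cbox]) auto
 ultimately show ?thesis by (simp add: antisym)
qed

lemma measure_cube:
 fixes a :: "real^'n"
 assumes l: "l >= 0"
 shows "(LI x. indicator (cube a l) x) = l ^ CARD('n)"
 using emeasure_cube[OF l, of a] l by (simp add: measure_def)

lemma distribution_local_bound:
 assumes b: "bbs \<phi>" and Q: "Q : sets borel" and z: "!!x. x \<notin> Q ==> \<phi> x = 0"
 shows "norm (distribution v \<phi>) <= sqrt (LI x. (\<phi> x)\<^sup>2) * norm (mult (indicator Q) v)"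
proof -
 define w where "w = distribution v \<phi>"
 have bQ: "bm (indicator Q)" unfolding bm_def using Q by (intro conjI exI[of _ 1]) auto
 have "(%x. indicator Q x * \<phi> x) = \<phi>" using z by (auto simp: indicator_def fun_eq_iff)
 then have "w \<bullet> w = mult (indicator Q) v \<bullet> tw \<phi> w"
  by (simp add: inner_tw[OF b] distribution_mult[OF bQ b] w_def)
 also have "... <= norm (mult (indicator Q) v) * norm (tw \<phi> w :: ('a, 'b) L2)" by (rule norm_cauchy_schwarz)
 also have "norm (tw \<phi> w :: ('a, 'b) L2) = sqrt (LI x. (\<phi> x)\<^sup>2) * norm w"
 proof -
  have "sq (tw \<phi> w :: ('a, 'b) L2) = (LI x. (\<phi> x)\<^sup>2 * (w \<bullet> w))"
   unfolding power2_norm_eq_inner tw_def inner_mk[OF bbs_sqint[OF b] bbs_sqint[OF b]] by (simp add: power2_eq_square mult_ac)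
  also have "... = (LI x. (\<phi> x)\<^sup>2) * sq w" by (simp add: power2_norm_eq_inner)
  finally show ?thesis by (metis norm_ge_zero real_sqrt_abs real_sqrt_mult abs_of_nonneg)
 qed
 finally have "norm w * norm w <= (sqrt (LI x. (\<phi> x)\<^sup>2) * norm (mult (indicator Q) v)) * norm w"
  by (simp add: power2_norm_eq_inner[symmetric] power2_eq_square mult_ac)
 moreover have "0 <= (LI x. (\<phi> x)\<^sup>2)" by simp
 ultimately have "norm w <= sqrt (LI x. (\<phi> x)\<^sup>2) * norm (mult (indicator Q) v)"
  by (cases "w = 0") (auto intro!: mult_nonneg_nonneg dest: mult_right_le_imp_le)
 then show ?thesis by (simp add: w_def)
qed

lemma distribution_minus_test:
 assumes "bbs \<phi>" "bbs \<psi>"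
 shows "bbs (%x. \<phi> x - \<psi> x)" "distribution u (%x. \<phi> x - \<psi> x) = distribution u \<phi> - distribution u \<psi>"
proof -
 obtain M R where MR: "!!x. \<bar>\<phi> x\<bar> <= M" "!!x. norm x > R ==> \<phi> x = 0" using assms(1) by (auto simp: bbs_def)
 obtain M' R' where MR': "!!x. \<bar>\<psi> x\<bar> <= M'" "!!x. norm x > R' ==> \<psi> x = 0" using assms(2) by (auto simp: bbs_def)
 have [measurable]: "\<phi> : bfun" "\<psi> : bfun" using assms by (auto simp: bbs_def)
 have "\<bar>\<phi> x - \<psi> x\<bar> <= M + M'" for x using MR(1)[of x] MR'(1)[of x] by linarith
 then show "bbs (%x. \<phi> x - \<psi> x)" unfolding bbs_def using MR(2) MR'(2)
  by (intro conjI exI[of _ "M + M'"] exI[of _ "max R R'"]) auto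
 show "distribution u (%x. \<phi> x - \<psi> x) = distribution u \<phi> - distribution u \<psi>"
  using bbs_integrable[OF assms(1) sqint_fn[of u]] bbs_integrable[OF assms(2) sqint_fn[of u]]
  by (simp add: distribution_eq scaleR_left_diff_distrib)
qed

lemma cutoff_partial_support:
 assumes e: "\<epsilon> > 0" and x: "x \<notin> cube a l"
 shows "partial_deriv j (cutoff a (vec l) \<epsilon>) x = 0"
proof -
 obtain i where "x $ i <= a $ i \<or> a $ i + (vec l :: real^'a) $ i <= x $ i" using x by (auto simp: cube_def not_le not_less intro: less_imp_le)
 then have 0: "cutoff a (vec l) \<epsilon> x = 0" by (rule cutoff_eq_0[OF e])
 let ?f = "%s. cutoff a (vec l) \<epsilon> (x + s *R axis j 1)"
 have "((%s :: real. x + s *R axis j 1) has_derivative (%h. h *R axis j 1)) (at 0)"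
  by (auto intro!: derivative_eq_intros)
 moreover have "(cutoff a (vec l) \<epsilon> has_derivative frechet_derivative (cutoff a (vec l) \<epsilon>) (at x)) (at (x + 0 *R axis j 1))"
  using smooth_has_derivative[OF smooth_cutoff] by simp
 ultimately have "(?f has_derivative (%h. frechet_derivative (cutoff a (vec l) \<epsilon>) (at x) (h *R axis j 1))) (at 0)"
  by (rule has_derivative_compose)
 then have d: "(?f has_real_derivative partial_deriv j (cutoff a (vec l) \<epsilon>) x) (at 0)"
  using linear_scale[OF has_derivative_linear[OF smooth_has_derivative[OF smooth_cutoff[of a "vec l" \<epsilon>], of x]]]
  by (simp add: has_field_derivative_def partial_deriv_def mult.commute[of _ "frechet_derivative _ _ (axis j 1)"] fun_eq_iff)
 show ?thesis by (rule DERIV_local_min[OF d zero_less_one]) (simp add: 0 cutoff_range)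
qed

context diffop
begin

text \<open>The average of \<open>D g\<close> over a cube is small when \<open>g\<close> is small compared to \<open>D g\<close>: away from a
 boundary layer of relative width \<open>\<tau>\<close> one integrates by parts.\<close>

lemma average_bound:
 "\<exists>C\<ge>0. \<forall>g\<in>dom. \<forall>a l \<tau>. 0 < l --> l <= 1 --> 0 < \<tau> --> \<tau> <= 1/2 \<longrightarrow>
  sq (distribution (D g) (indicator (cube a l))) <=
   C * l ^ CARD('n) * (\<tau> * sq (mult (indicator (cube a l)) (D g)) + sq (mult (indicator (cube a l)) g) / (\<tau> * l)\<^sup>2)"
proof -
 have "\<exists>C\<ge>0. \<forall>v. norm (a j v) <= C * norm v" for j using linear_fibre_bound[OF a_lin[of j]] by metis
 then obtain c where c: "!!j. c j >= 0" "!!j v. norm (a j v) <= c j * norm v" by metis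
 obtain c0 where c0: "c0 >= 0" "!!v. norm (a0 v) <= c0 * norm v" using linear_fibre_bound[OF a0_lin] by metis
 obtain L where L: "L >= 0" "!!(b :: real^'n) l \<epsilon> x j. \<epsilon> > 0 ==> \<bar>partial_deriv j (cutoff b l \<epsilon>) x\<bar> <= L / \<epsilon>"
  using cutoff_partial[where 'n = 'n] by blast
 define n where "n = CARD('n)"
 define K where "K = c0 + (\<Sum>j\<in>UNIV. c j * L)"
 have K0: "K >= 0" unfolding K_def by (intro add_nonneg_nonneg sum_nonneg mult_nonneg_nonneg c c0 L)
 show ?thesis
 proof (intro exI[of _ "4 * real n + 2 * K\<^sup>2"] conjI ballI allI impI)
  fix g and b :: "real^'n" and l \<tau> :: real
  assume g: "g : dom" and l: "0 < l" "l <= 1" and \<tau>: "0 < \<tau>" "\<tau> <= 1/2"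
  define Q where "Q = cube b l"
  define X where "X = norm (mult (indicator Q) (D g))"
  define Y where "Y = norm (mult (indicator Q) g)"
  define \<eta> where "\<eta> = cutoff b (vec l) (\<tau> * l)"
  have e: "\<tau> * l > 0" using \<tau> l by simp
  have e1: "\<tau> * l <= 1" using \<tau> l by (intro mult_le_one) auto
  have t: "test_function \<eta>" unfolding \<eta>_def by (rule test_cutoff[OF e])
  have tb: "bbs \<eta>" "bbs (partial_deriv j \<eta>)" for j by (intro test_bbs t test_partial)+
  have Qb: "bbs (indicator Q)" "Q : sets borel" unfolding Q_def by (rule bbs_cube) simp
  have \<eta>Q: "\<eta> x = 0" if x: "x \<notin> Q" for x
  proof -
   obtain i where "x $ i <= b $ i \<or> b $ i + (vec l :: real^'n) $ i <= x $ i" using x by (auto simp: Q_def cube_def not_le not_less intro: less_imp_le)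
   then show ?thesis unfolding \<eta>_def by (rule cutoff_eq_0[OF e])
  qed
  have \<eta>r: "0 <= \<eta> x" "\<eta> x <= 1" for x unfolding \<eta>_def by (rule cutoff_range)+
  define P where "P = cube (b + vec (\<tau> * l)) ((1 - 2 * \<tau>) * l)"
  have Pb: "bbs (indicator P)" unfolding P_def by (rule bbs_cube)
  have P1: "\<eta> x = 1" "x : Q" if "x : P" for x
  proof -
   have x: "b $ i + \<tau> * l <= x $ i" "x $ i < b $ i + \<tau> * l + (1 - 2 * \<tau>) * l" for i
    using that by (auto simp: P_def cube_def)
   have x': "x $ i < b $ i + l - \<tau> * l" for i using x(2)[of i] by (simp add: algebra_simps)
   show "\<eta> x = 1" unfolding \<eta>_def by (rule cutoff_eq_1[OF e]) (use x x' in "auto intro: less_imp_le")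
   show "x : Q" unfolding Q_def cube_def using x(1) x' e by (auto intro: order_trans less_imp_le dest: less_le_trans) (smt (verit) x(1) x' e)+
  qed
  have sq1: "(LI x. (indicator Q x - \<eta> x)\<^sup>2) <= 2 * real n * \<tau> * l ^ n"
  proof -
   have "(LI x. (indicator Q x - \<eta> x)\<^sup>2) <= (LI x. indicator Q x - indicator P x)"
   proof (rule integral_mono)
    show "integrable lborel (%x. (indicator Q x - \<eta> x)\<^sup>2)" by (rule bbs_square_integrable[OF distribution_minus_test(1)[OF Qb(1) tb(1)]])
    show "integrable lborel (%x. indicat_real Q x - indicator P x)" by (intro Bochner_Integration.integrable_diff bbs_integrable_real Qb Pb)
    fix x
    show "(indicator Q x - \<eta> x)\<^sup>2 <= indicat_real Q x - indicator P x"
     using P1[of x] \<eta>Q[of x] \<eta>r[of x] by (cases "x : P"; cases "x : Q") (auto intro: power_le_one)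
   qed
   also have "... = l ^ n - ((1 - 2 * \<tau>) * l) ^ n"
    using bbs_integrable_real[OF Qb(1)] bbs_integrable_real[OF Pb] measure_cube[of l b] measure_cube[of "(1 - 2 * \<tau>) * l" "b + vec (\<tau> * l)"] l \<tau>
    by (simp add: Q_def P_def n_def)
   also have "... = l ^ n * (1 - (1 - 2 * \<tau>) ^ n)" unfolding power_mult_distrib right_diff_distrib by (simp add: mult.commute)
   also have "... <= l ^ n * (2 * real n * \<tau>)"
   proof (rule mult_left_mono)
    show "1 - (1 - 2 * \<tau>) ^ n <= 2 * real n * \<tau>" using Bernoulli_inequality[of "- 2 * \<tau>" n] \<tau> by simp
   qed (use l in simp)
   finally show ?thesis by (simp add: mult_ac)
  qed
  have sq2: "(LI x. (\<eta> x)\<^sup>2) <= l ^ n"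
  proof -
   have "(LI x. (\<eta> x)\<^sup>2) <= (LI x. indicator Q x)"
    by (rule integral_mono[OF bbs_square_integrable[OF tb(1)] bbs_integrable_real[OF Qb(1)]])
     (use \<eta>Q \<eta>r in "auto simp: indicator_def intro: power_le_one")
   then show ?thesis using measure_cube[of l b] l by (simp add: Q_def n_def)
  qed
  have pz: "partial_deriv j \<eta> x = 0" if "x \<notin> Q" for x j
   using that unfolding Q_def \<eta>_def by (rule cutoff_partial_support[OF e])
  have sq3: "(LI x. (partial_deriv j \<eta> x)\<^sup>2) <= (L / (\<tau> * l))\<^sup>2 * l ^ n" for j
  proof -
   have "(LI x. (partial_deriv j \<eta> x)\<^sup>2) <= (LI x. (L / (\<tau> * l))\<^sup>2 * indicator Q x)"
   proof (rule integral_mono[OF bbs_square_integrable[OF tb(2)]])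
    show "integrable lborel (%x. (L / (\<tau> * l))\<^sup>2 * indicat_real Q x)" by (rule integrable_mult_right) (rule bbs_integrable_real[OF Qb(1)])
    fix x
    have "\<bar>partial_deriv j \<eta> x\<bar> <= L / (\<tau> * l)" unfolding \<eta>_def by (rule L(2)[OF e])
    then have "(partial_deriv j \<eta> x)\<^sup>2 <= (L / (\<tau> * l))\<^sup>2" using power_mono[of "\<bar>partial_deriv j \<eta> x\<bar>" "L / (\<tau> * l)" 2] by simp
    then show "(partial_deriv j \<eta> x)\<^sup>2 <= (L / (\<tau> * l))\<^sup>2 * indicat_real Q x" using pz[of x j] by (cases "x : Q") auto
   qed
   then show ?thesis using measure_cube[of l b] l by (simp add: Q_def n_def)
  qed
  define r where "r = sqrt (l ^ n)"
  have r: "r >= 0" "r\<^sup>2 = l ^ n" using l by (auto simp: r_def)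
  have Y0: "Y >= 0" by (simp add: Y_def)
  have T1: "norm (distribution (D g) (%x. indicator Q x - \<eta> x)) <= sqrt (2 * real n * \<tau> * l ^ n) * X"
   unfolding X_def using \<eta>Q
   by (intro order_trans[OF distribution_local_bound[OF distribution_minus_test(1)[OF Qb(1) tb(1)] Qb(2)]] mult_right_mono real_sqrt_le_mono sq1) auto
  have d0: "norm (distribution g \<eta>) <= r * Y" unfolding Y_def r_def using \<eta>Q
   by (intro order_trans[OF distribution_local_bound[OF tb(1) Qb(2)]] mult_right_mono real_sqrt_le_mono sq2) auto
  have dj: "norm (distribution g (partial_deriv j \<eta>)) <= L / (\<tau> * l) * (r * Y)" for j
  proof -
   have "norm (distribution g (partial_deriv j \<eta>)) <= sqrt ((L / (\<tau> * l))\<^sup>2 * l ^ n) * Y"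
    unfolding Y_def using pz
    by (intro order_trans[OF distribution_local_bound[OF tb(2) Qb(2)]] mult_right_mono real_sqrt_le_mono sq3) auto
   also have "sqrt ((L / (\<tau> * l))\<^sup>2 * l ^ n) = L / (\<tau> * l) * r" using L(1) e by (simp add: real_sqrt_mult r_def)
   finally show ?thesis by (simp add: mult_ac)
  qed
  have T2: "norm (distribution (D g) \<eta>) <= K / (\<tau> * l) * (r * Y)"
  proof -
   have "norm (distribution (D g) \<eta>) <= norm (a0 (distribution g \<eta>)) + norm (\<Sum>j\<in>UNIV. a j (distribution g (partial_deriv j \<eta>)))"
    unfolding D_formula'[OF g t] by (rule norm_triangle_ineq4)
   also have "norm (a0 (distribution g \<eta>)) <= c0 / (\<tau> * l) * (r * Y)"
   proof -
    have "norm (a0 (distribution g \<eta>)) <= c0 * (r * Y)"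
     using c0(2)[of "distribution g \<eta>"] mult_left_mono[OF d0 c0(1)] by linarith
    also have "... <= c0 / (\<tau> * l) * (r * Y)"
    proof (rule mult_right_mono)
     show "c0 <= c0 / (\<tau> * l)" using e e1 c0(1) by (simp add: pos_le_divide_eq mult_left_le)
    qed (use r Y0 in simp)
    finally show ?thesis .
   qed
   also have "norm (\<Sum>j\<in>UNIV. a j (distribution g (partial_deriv j \<eta>))) <= (\<Sum>j\<in>UNIV. c j * (L / (\<tau> * l) * (r * Y)))"
    by (rule sum_norm_le) (rule order_trans[OF c(2) mult_left_mono[OF dj c(1)]])
   also have "c0 / (\<tau> * l) * (r * Y) + (\<Sum>j\<in>UNIV. c j * (L / (\<tau> * l) * (r * Y))) = K / (\<tau> * l) * (r * Y)"
   proof -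
    have "(\<Sum>j\<in>UNIV. c j * (L / (\<tau> * l) * (r * Y))) = (\<Sum>j\<in>UNIV. (c j * L) * (r * Y / (\<tau> * l)))" by (simp add: mult_ac)
    also have "... = (\<Sum>j\<in>UNIV. c j * L) * (r * Y / (\<tau> * l))" by (rule sum_distrib_right[symmetric])
    finally show ?thesis by (simp add: K_def add_divide_distrib distrib_right)
   qed
   finally show ?thesis by simp
  qed
  have "distribution (D g) (indicator Q) = distribution (D g) (%x. indicator Q x - \<eta> x) + distribution (D g) \<eta>"
   using distribution_minus_test(2)[OF Qb(1) tb(1), of "D g"] by simp
  then have "norm (distribution (D g) (indicator Q)) <= sqrt (2 * real n * \<tau> * l ^ n) * X + K / (\<tau> * l) * (r * Y)"
   using norm_triangle_mono[OF T1 T2] by simp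
  then have "sq (distribution (D g) (indicator Q)) <= (sqrt (2 * real n * \<tau> * l ^ n) * X + K / (\<tau> * l) * (r * Y))\<^sup>2"
   by (rule power_mono) simp
  also have "... <= 2 * (sqrt (2 * real n * \<tau> * l ^ n) * X)\<^sup>2 + 2 * (K / (\<tau> * l) * (r * Y))\<^sup>2"
   using sum_squares_bound[of "sqrt (2 * real n * \<tau> * l ^ n) * X" "K / (\<tau> * l) * (r * Y)"] by (simp add: power2_sum)
  also have "... = l ^ n * ((4 * real n) * (\<tau> * X\<^sup>2) + (2 * K\<^sup>2) * (Y\<^sup>2 / (\<tau> * l)\<^sup>2))"
   using \<tau> l r by (simp add: power_mult_distrib power_divide algebra_simps)
  also have "... <= l ^ n * ((4 * real n + 2 * K\<^sup>2) * (\<tau> * X\<^sup>2) + (4 * real n + 2 * K\<^sup>2) * (Y\<^sup>2 / (\<tau> * l)\<^sup>2))"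
   using \<tau> l by (intro mult_left_mono add_mono mult_right_mono) auto
  also have "... = (4 * real n + 2 * K\<^sup>2) * l ^ n * (\<tau> * X\<^sup>2 + Y\<^sup>2 / (\<tau> * l)\<^sup>2)" by (simp add: distrib_left mult_ac)
  finally show "sq (distribution (D g) (indicator (cube b l))) <=
   (4 * real n + 2 * K\<^sup>2) * l ^ CARD('n) * (\<tau> * sq (mult (indicator (cube b l)) (D g)) + sq (mult (indicator (cube b l)) g) / (\<tau> * l)\<^sup>2)"
   by (simp add: Q_def X_def Y_def n_def)
 qed simp
qed

end

section \<open>Translation and weak gradients\<close>

definition trans :: "real^'n => ('n::finite, 'm::finite) L2 => ('n, 'm) L2" where
 "trans c u = mk (%x. fn u (x + c))"

lemma sqint_shift: assumes "sqint f" shows "sqint (%x. f (x + c))"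
proof -
 have [measurable]: "f : bfun" using assms by (simp add: sqint_def)
 show ?thesis using assms nn_integral_shift[of "%x. esq (f x)" c] by (simp add: sqint_iff_nn)
qed

lemma norm_trans: "norm (trans c u) = norm u"
proof -
 have "esq (trans c u) = esq u" unfolding trans_def norm_mk_nn[OF sqint_shift[OF sqint_fn]]
  using nn_integral_shift[of "%x. esq (fn u x)" c] by (simp add: norm_L2_nn)
 then show ?thesis by (simp del: ennreal_power)
qed

lemma trans_0: "trans 0 u = u" by (simp add: trans_def)

lemma trans_tw:
 assumes t: "test_function \<psi>"
 shows "trans c u \<bullet> tw \<psi> w = (LI x. \<psi> (x - c) * (w \<bullet> fn u x))"
proof -
 have [measurable]: "\<psi> : bfun" by (rule bbs_measurable[OF test_bbs[OF t]])
 have "trans c u \<bullet> tw \<psi> w = (LI x. fn u (x + c) \<bullet> (\<psi> x *R w))"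
  unfolding trans_def tw_def by (rule inner_mk[OF sqint_shift[OF sqint_fn] bbs_sqint[OF test_bbs[OF t]]])
 also have "... = (LI x. (%x. \<psi> (x - c) * (w \<bullet> fn u x)) (x + c))" by (simp add: inner_commute)
 also have "... = (LI x. \<psi> (x - c) * (w \<bullet> fn u x))" by (rule integral_shift) measurable
 finally show ?thesis .
qed

text \<open>The fundamental theorem of calculus along the segment from \<open>0\<close> to \<open>z\<close>, tested against a dense set of vectors.\<close>

lemma translation_bound:
 fixes g :: "('n::finite, 'm::finite) L2"
 assumes wg: "has_weak_gradient g G"
 shows "norm (trans z g - g) <= norm z * (\<Sum>j\<in>UNIV. norm (G $ j))"
proof -
 have tw_case: "((%s. trans (s *R z) g \<bullet> tw \<psi> w) has_real_derivative (\<Sum>j\<in>UNIV. z $ j * (trans (s *R z) (G $ j) \<bullet> tw \<psi> w))) (at s)"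
  if t: "test_function \<psi>" for \<psi> w s
 proof -
  have ts: "test_function (%x. \<psi> (x - s *R z))" using test_affine[OF t, of 1 "- s *R z"] by simp
  have p: "partial_deriv j (%x. \<psi> (x - s *R z)) = (%x. partial_deriv j \<psi> (x - s *R z))" for j
   using partial_affine[OF test_smooth[OF t], of j 1 "- s *R z"] by auto
  have tp: "test_function (%x. partial_deriv j \<psi> (x - s *R z))" for j using test_partial[OF ts, of j] unfolding p .
  have int_eq: "(LI x. \<phi> x * (w \<bullet> fn u x)) = w \<bullet> distribution u \<phi>" if "bbs \<phi>" for \<phi> and u :: "('n, 'm) L2"
  proof -
   have "w \<bullet> distribution u \<phi> = (LI x. w \<bullet> (\<phi> x *R fn u x))"
    unfolding distribution_eq[OF bbs_measurable[OF that]]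
    by (rule integral_inner_right[symmetric]) (rule bbs_integrable[OF that sqint_fn])
   then show ?thesis by simp
  qed
  have "z $ j * (trans (s *R z) (G $ j) \<bullet> tw \<psi> w) = - (z $ j * (LI x. partial_deriv j \<psi> (x - s *R z) * (w \<bullet> fn g x)))" for j
  proof -
   have "distribution (G $ j) (%x. \<psi> (x - s *R z)) = - distribution g (%x. partial_deriv j \<psi> (x - s *R z))"
    using wg ts unfolding has_weak_gradient_def distribution_partial_def by (simp add: p)
   then show ?thesis unfolding trans_tw[OF t] int_eq[OF test_bbs[OF ts]] int_eq[OF test_bbs[OF tp]] by simp
  qed
  then have "(\<Sum>j\<in>UNIV. z $ j * (trans (s *R z) (G $ j) \<bullet> tw \<psi> w))
   = (\<Sum>j\<in>UNIV. \<integral>x. - (z $ j * (partial_deriv j \<psi> (x - s *R z) * (w \<bullet> fn g x))) \<partial>lborel)" by simp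
  also have "... = (LI x. (\<Sum>j\<in>UNIV. - (z $ j * (partial_deriv j \<psi> (x - s *R z) * (w \<bullet> fn g x)))))"
   by (rule Bochner_Integration.integral_sum[symmetric])
    (intro Bochner_Integration.integrable_minus integrable_mult_right bbs_lint_integrable[OF test_bbs[OF tp] lint_inner[OF sqint_fn]])
  also have "... = (LI x. - (\<Sum>j\<in>UNIV. z $ j * partial_deriv j \<psi> (x - s *R z)) * (w \<bullet> fn g x))"
   by (simp add: sum_distrib_right sum_distrib_left sum_negf mult_ac)
  finally have eq: "(\<Sum>j\<in>UNIV. z $ j * (trans (s *R z) (G $ j) \<bullet> tw \<psi> w)) = (LI x. - (\<Sum>j\<in>UNIV. z $ j * partial_deriv j \<psi> (x - s *R z)) * (w \<bullet> fn g x))" .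
  show ?thesis unfolding eq unfolding trans_tw[OF t] by (rule translate_derivative[OF t lint_inner[OF sqint_fn]])
 qed
 have sp: "((%s. trans (s *R z) g \<bullet> v) has_real_derivative (\<Sum>j\<in>UNIV. z $ j * (trans (s *R z) (G $ j) \<bullet> v))) (at s)"
  if "v : span tvecs" for v s using that
 proof (induction rule: span_induct_alt)
  case base
  then show ?case by simp
 next
  case (step c x y)
  then obtain \<psi> w where x: "x = tw \<psi> w" "test_function \<psi>" by (auto simp: tvecs_def)
  have "((%s. c * (trans (s *R z) g \<bullet> x) + trans (s *R z) g \<bullet> y) has_real_derivative
   c * (\<Sum>j\<in>UNIV. z $ j * (trans (s *R z) (G $ j) \<bullet> x)) + (\<Sum>j\<in>UNIV. z $ j * (trans (s *R z) (G $ j) \<bullet> y))) (at s)"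
   by (rule DERIV_add[OF DERIV_cmult[OF tw_case[OF x(2), of w s, folded x(1)]] step.IH])
  then show ?case by (simp add: inner_simps sum_distrib_left sum.distrib distrib_left mult_ac)
 qed
 show ?thesis
 proof (rule dense_linear_bound[OF tvecs_dense])
  show "0 <= norm z * (\<Sum>j\<in>UNIV. norm (G $ j))" by (intro mult_nonneg_nonneg sum_nonneg) auto
  fix v :: "('n, 'm) L2" assume v: "v : span tvecs"
  obtain \<xi> :: real where \<xi>: "trans (1 *R z) g \<bullet> v - trans (0 *R z) g \<bullet> v = (1 - 0) * (\<Sum>j\<in>UNIV. z $ j * (trans (\<xi> *R z) (G $ j) \<bullet> v))"
   using MVT2[of 0 1 "%s. trans (s *R z) g \<bullet> v", OF zero_less_one sp[OF v]] by blast
  have "\<bar>(trans z g - g) \<bullet> v\<bar> = \<bar>\<Sum>j\<in>UNIV. z $ j * (trans (\<xi> *R z) (G $ j) \<bullet> v)\<bar>"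
   using \<xi> by (simp add: trans_0 inner_diff_left)
  also have "... <= (\<Sum>j\<in>UNIV. norm z * (norm (G $ j) * norm v))"
  proof (rule order_trans[OF sum_abs sum_mono])
   fix j
   have "\<bar>trans (\<xi> *R z) (G $ j) \<bullet> v\<bar> <= norm (G $ j) * norm v"
    using Cauchy_Schwarz_ineq2[of "trans (\<xi> *R z) (G $ j)" v] by (simp add: norm_trans)
   then show "\<bar>z $ j * (trans (\<xi> *R z) (G $ j) \<bullet> v)\<bar> <= norm z * (norm (G $ j) * norm v)"
    unfolding abs_mult by (intro mult_mono component_le_norm_cart) auto
  qed
  also have "... = norm z * (\<Sum>j\<in>UNIV. norm (G $ j)) * norm v" by (simp add: sum_distrib_left sum_distrib_right mult_ac)
  finally show "\<bar>(trans z g - g) \<bullet> v\<bar> <= norm z * (\<Sum>j\<in>UNIV. norm (G $ j)) * norm v" .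
 qed
qed

section \<open>Dyadic cubes\<close>

definition idx :: "nat => real^'n => int^'n" where
 "idx k x = (\<chi> i. \<lfloor>2^k * x $ i\<rfloor>)"

definition corner :: "nat => int^'n => real^'n" where
 "corner k z = (\<chi> i. tk k * real_of_int (z $ i))"

definition cell :: "nat => int^'n => (real^'n) set" where
 "cell k z = cube (corner k z) (tk k)"

definition vol :: "'n itself => nat => real" where
 "vol _ k = tk k ^ CARD('n)"

abbreviation ic :: "nat => int^'n => real^'n => 'b::zero_neq_one" where
 "ic k z == indicator (cell k z)"

lemma tk_inv: "2^k * tk k = 1" "tk k * 2^k = 1" by (simp_all add: tk_def power_one_over)

lemma mem_cell: "x : cell k z \<longleftrightarrow> idx k x = z"
proof -
 have "x : cell k z \<longleftrightarrow> (\<forall>i. tk k * real_of_int (z $ i) <= x $ i \<and> x $ i < tk k * real_of_int (z $ i) + tk k)"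
  by (simp add: cell_def cube_def corner_def)
 also have "... \<longleftrightarrow> (\<forall>i. \<lfloor>2^k * x $ i\<rfloor> = z $ i)"
 proof (intro iff_allI)
  fix i
  have "tk k * real_of_int (z $ i) <= x $ i \<longleftrightarrow> real_of_int (z $ i) <= 2^k * x $ i"
   by (simp add: tk_def power_one_over field_simps)
  moreover have "x $ i < tk k * real_of_int (z $ i) + tk k \<longleftrightarrow> 2^k * x $ i < real_of_int (z $ i) + 1"
   by (simp add: tk_def power_one_over field_simps)
  ultimately show "(tk k * real_of_int (z $ i) <= x $ i \<and> x $ i < tk k * real_of_int (z $ i) + tk k) \<longleftrightarrow> \<lfloor>2^k * x $ i\<rfloor> = z $ i"
   by (simp add: floor_eq_iff)
 qed
 also have "... \<longleftrightarrow> idx k x = z" by (auto simp: idx_def vec_eq_iff)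
 finally show ?thesis .
qed

lemma cell_borel [measurable]: "cell k z : sets borel" by (simp add: cell_def)

lemma bbs_cell: "bbs (ic k z)" unfolding cell_def by (rule bbs_cube)

lemma vol_pos: "vol TYPE('n::finite) k > 0" by (simp add: vol_def)

lemma emeasure_cell: "emeasure lborel (cell k (z :: int^'n)) = ennreal (vol TYPE('n) k)"
 unfolding cell_def vol_def by (rule emeasure_cube) (simp add: less_imp_le)

lemma integral_cell: "(LI x. indicator (cell k (z :: int^'n)) x) = vol TYPE('n) k"
 unfolding cell_def vol_def by (rule measure_cube) (simp add: less_imp_le)

lemma idx_measurable: "idx k : borel \<rightarrow>\<^sub>M count_space (UNIV :: (int^'n) set)"
proof (subst measurable_count_space_eq_countable)
 show "countable (UNIV :: (int^'n) set)" by simp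
 have "idx k -` {z} Int space borel = cell k z" for z :: "int^'n" by (auto simp: mem_cell)
 then show "idx k : space borel \<rightarrow> UNIV \<and> (\<forall>z\<in>UNIV :: (int^'n) set. idx k -` {z} Int space borel : sets borel)" by simp
qed

lemma idx_fun_measurable [measurable]: "(%x. \<phi> (idx k (x :: real^'n))) : bfun"
 by (rule measurable_compose[OF idx_measurable]) simp

lemma idx_pred_measurable [measurable]: "{x :: real^'n. P (idx k x)} : sets borel"
proof -
 have "{x :: real^'n. P (idx k x)} = (idx k -` {z. P z}) Int space borel" by auto
 also have "... : sets borel" by (rule measurable_sets[OF idx_measurable]) simp
 finally show ?thesis .
qed

lemma idx_family_measurable:
 assumes "!!z. f z : bfun"
 shows "(%x :: real^'n. f (idx k x) x) : bfun"
 by (rule measurable_compose_countable'[OF _ idx_measurable]) (use assms in auto)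

definition par :: "nat => int^'n => int^'n" where
 "par m z = (\<chi> i. (z $ i) div 2^m)"

lemma idx_par: "j <= k ==> idx j x = par (k - j) (idx k x)"
proof -
 assume jk: "j <= k"
 have "\<lfloor>2^j * y\<rfloor> = \<lfloor>2^k * y\<rfloor> div 2^(k-j)" for y :: real
 proof -
  have "2^j * y = 2^k * y / real_of_int (2^(k-j))"
  proof -
   have "(2::real)^k = 2^j * 2^(k-j)" using jk by (simp flip: power_add)
   then show ?thesis by simp
  qed
  then show ?thesis by (metis floor_divide_real_eq_div zero_le_numeral zero_le_power)
 qed
 then show ?thesis by (simp add: idx_def par_def vec_eq_iff)
qed

lemma idx_refine: "j <= k ==> idx k x = idx k y ==> idx j x = idx j y" using idx_par[of j k x] idx_par[of j k y] by simp

lemma cell_norm: assumes "x : cell k (z :: int^'n)" shows "norm (x - corner k z) <= real CARD('n) * tk k"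
proof -
 have "\<bar>(x - corner k z) $ i\<bar> <= tk k" for i
  using assms unfolding cell_def cube_def by (auto simp: abs_le_iff less_imp_le algebra_simps)
 then have "(\<Sum>i\<in>UNIV. \<bar>(x - corner k z) $ i\<bar>) <= (\<Sum>i\<in>(UNIV :: 'n set). tk k)" by (rule sum_mono)
 then show ?thesis using norm_le_l1_cart[of "x - corner k z"] by simp
qed

lemma cells_sum:
 assumes [measurable]: "F : borel_measurable (borel :: (real^'n) measure)"
 shows "(NN x. F x) = (\<integral>\<^sup>+z. (NN x. F x * ic k z x) \<partial>count_space UNIV)"
proof -
 have "(\<integral>\<^sup>+z. (NN x. F x * ic k z x) \<partial>count_space UNIV)
   = (NN x. (\<integral>\<^sup>+z. F x * ic k z x \<partial>count_space UNIV))"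
  by (rule nn_integral_count_space_nn_integral[symmetric]) auto
 also have "... = (NN x. F x)"
 proof (rule nn_integral_cong)
  fix x :: "real^'n"
  have "(\<integral>\<^sup>+z. F x * ic k z x \<partial>count_space UNIV) = (\<integral>\<^sup>+z. F x * indicator {idx k x} z \<partial>count_space UNIV)"
   by (rule nn_integral_cong) (auto simp: indicator_def mem_cell)
  also have "... = F x" by (subst nn_integral_cmult_indicator) (auto simp: one_ennreal_def[symmetric])
  finally show "(\<integral>\<^sup>+z. F x * ic k z x \<partial>count_space UNIV) = F x" .
 qed
 finally show ?thesis ..
qed

lemma cellwise_mono:
 assumes [measurable]: "F : borel_measurable (borel :: (real^'n) measure)" "G : bfun"
  and le: "!!z. \<phi> z ~= 0 ==> (NN x. F x * ic k z x) <= (NN x. G x * ic k z x)"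
 shows "(NN x. \<phi> (idx k x) * F x) <= (NN x. \<phi> (idx k x) * G x)"
proof -
 have pull: "(NN x. (\<phi> (idx k x) * H x) * ic k z x) = \<phi> z * (NN x. H x * ic k z x)"
  if [measurable]: "H : bfun" for H z
 proof -
  have "(NN x. (\<phi> (idx k x) * H x) * ic k z x) = (NN x. \<phi> z * (H x * ic k z x))"
   by (rule nn_integral_cong) (auto simp: indicator_def mem_cell mult.assoc)
  then show ?thesis by (simp add: nn_integral_cmult)
 qed
 have "(NN x. \<phi> (idx k x) * F x) = (\<integral>\<^sup>+z. \<phi> z * (NN x. F x * ic k z x) \<partial>count_space UNIV)"
  by (subst cells_sum[of _ k]) (auto simp: pull)
 also have "... <= (\<integral>\<^sup>+z. \<phi> z * (NN x. G x * ic k z x) \<partial>count_space UNIV)"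
 proof (rule nn_integral_mono)
  fix z show "\<phi> z * (NN x. F x * ic k z x) <= \<phi> z * (NN x. G x * ic k z x)"
   using le[of z] by (cases "\<phi> z = 0") (auto intro: mult_left_mono)
 qed
 also have "... = (NN x. \<phi> (idx k x) * G x)" by (subst (2) cells_sum[of _ k]) (auto simp: pull)
 finally show ?thesis .
qed

section \<open>Dyadic averages\<close>

definition avgv :: "nat => int^'n => ('n::finite, 'm::finite) L2 => complex^'m" where
 "avgv k z u = inverse (vol TYPE('n) k) *R distribution u (ic k z)"

definition Ek :: "nat => ('n::finite, 'm::finite) L2 => real^'n => complex^'m" where
 "Ek k u x = avgv k (idx k x) u"

lemma avgv_add: "avgv k z (u + v) = avgv k z u + avgv k z v"
 and avgv_diff: "avgv k z (u - v) = avgv k z u - avgv k z v"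
 by (simp_all add: avgv_def distribution_add[OF bbs_cell] distribution_diff[OF bbs_cell] distribution_scaleR[OF bbs_cell]
   scaleR_add_right scaleR_diff_right)

lemma Ek_measurable [measurable]: "Ek k u : bfun" unfolding Ek_def[abs_def] by (rule idx_fun_measurable)

lemma norm_mult_indicator:
 assumes "Q : sets borel"
 shows "esq (mult (indicator Q) u) = (NN x. esq (fn u x) * indicator Q x)"
proof -
 have "bm (indicator Q)" unfolding bm_def using assms by (intro conjI exI[of _ 1]) auto
 from norm_mult_nn[OF this, of u] show ?thesis by (auto intro!: nn_integral_cong simp: indicator_def)
qed

lemma avgv_bound: "vol TYPE('n) k * sq (avgv k z u) <= sq (mult (indicator (cell k (z :: int^'n))) u)"
proof -
 let ?v = "vol TYPE('n) k"
 have v: "?v > 0" by (rule vol_pos)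
 have "norm (distribution u (ic k z)) <= sqrt (LI x. (ic k z x)\<^sup>2) * norm (mult (ic k z) u)"
  by (rule distribution_local_bound[OF bbs_cell cell_borel]) simp
 also have "(LI x. (ic k z x)\<^sup>2) = ?v"
 proof -
  have "(ic k z x)\<^sup>2 = (ic k z x :: real)" for x by (simp add: indicator_def)
  then show ?thesis using integral_cell[of k z] by simp
 qed
 finally have "sq (distribution u (ic k z)) <= (sqrt ?v * norm (mult (ic k z) u))\<^sup>2" by (rule power_mono) simp
 then have "sq (distribution u (ic k z)) <= ?v * sq (mult (ic k z) u)" using v by (simp add: power_mult_distrib)
 then show ?thesis using v by (simp add: avgv_def power_mult_distrib power2_eq_square field_simps)
qed

lemma Ek_cell:
 "(NN x. esq (Ek k u x) * indicator (cell k (z :: int^'n)) x) = ennreal (vol TYPE('n) k * sq (avgv k z u))"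
proof -
 have "(NN x. esq (Ek k u x) * ic k z x) = (NN x. esq (avgv k z u) * ic k z x)"
  by (rule nn_integral_cong) (auto simp: indicator_def mem_cell Ek_def)
 also have "... = esq (avgv k z u) * ennreal (vol TYPE('n) k)"
  by (subst nn_integral_cmult_indicator) (auto simp: emeasure_cell)
 finally show ?thesis using vol_pos[where 'n = 'n, of k] by (simp add: ennreal_mult'[symmetric] mult.commute)
qed

lemma Ek_cell_le:
 "(NN x. esq (Ek k u x) * ic k z x)
  <= (NN x. esq (fn u x) * ic k z x)"
 unfolding Ek_cell norm_mult_indicator[OF cell_borel, symmetric] by (rule ennreal_leI[OF avgv_bound])

lemma Ek_le: "(NN x. esq (Ek k u x)) <= esq u"
 using cellwise_mono[of "%x. esq (Ek k u x)" "%x. esq (fn u x)" "%_. 1" k, OF _ _ Ek_cell_le] by (simp add: norm_L2_nn)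

lemma Ek_sqint: "sqint (Ek k u)" using le_less_trans[OF Ek_le ennreal_less_top] by (subst sqint_iff_nn) auto

definition Eop :: "nat => ('n::finite, 'm::finite) L2 => ('n, 'm) L2" where
 "Eop k u = mk (Ek k u)"

lemma Eop_norm_nn: "esq (Eop k u) = (NN x. esq (Ek k u x))" unfolding Eop_def by (rule norm_mk_nn[OF Ek_sqint])

lemma Eop_contraction: "norm (Eop k u) <= norm u"
proof -
 have "esq (Eop k u) <= esq u" unfolding Eop_norm_nn by (rule Ek_le)
 then have "sq (Eop k u) <= sq u" by (simp del: ennreal_power)
 then show ?thesis by (rule power2_le_imp_le) simp
qed

lemma Eop_add: "Eop k (u + v) = Eop k u + Eop k v"
proof (rule L2_eqI)
 show "AE x in lborel. fn (Eop k (u + v)) x = fn (Eop k u + Eop k v) x"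
  unfolding Eop_def using fn_mk[OF Ek_sqint, of k "u + v"] fn_mk[OF Ek_sqint, of k u] fn_mk[OF Ek_sqint, of k v]
   fn_add[of "mk (Ek k u)" "mk (Ek k v)"] by eventually_elim (simp add: Ek_def avgv_add)
qed

section \<open>The dyadic Carleson embedding theorem\<close>

text \<open>The scalar field of local means of \<open>norm (fn u x)\<close>, realised as the averages of a function
 with values in a fixed direction.\<close>

lemma scalar_means:
 fixes u :: "('n::finite, 'm::finite) L2"
 obtains X :: "nat => real^'n => real" where "!!k. X k : bfun" "!!k x. X k x >= 0"
  "!!k x y. idx k x = idx k y ==> X k x = X k y" "!!k x. norm (Ek k u x) <= X k x"
  "!!k z. (NN x. ennreal (X k x) * ic k z x) = (NN x. ennreal (norm (fn u x)) * ic k z x)"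
  "!!k. (NN x. ennreal ((X k x)\<^sup>2)) <= esq u"
proof -
 define e :: "complex^'m" where "e = (SOME b. b : Basis)"
 have eB: "e : Basis" unfolding e_def by (rule someI_ex) (use nonempty_Basis in blast)
 then have e: "norm e = 1" "e \<bullet> e = 1" by (auto simp: inner_Basis)
 define f where "f x = norm (fn u x) *R e" for x
 have nf: "norm (f x) = norm (fn u x)" for x by (simp add: f_def e)
 have fs: "sqint f" using sqint_fn[of u] by (auto simp: sqint_def nf) (auto simp: f_def[abs_def])
 define U where "U = mk f"
 have Uf: "AE x in lborel. fn U x = f x" unfolding U_def by (rule fn_mk[OF fs])
 have nU: "norm U = norm u"
 proof -
  have "esq U = esq u" unfolding U_def norm_mk_nn[OF fs] nf norm_L2_nn[of u] ..
  then show ?thesis by (simp del: ennreal_power)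
 qed
 define I where "I k z = (LI x. ic k z x * norm (fn u x))" for k and z :: "int^'n"
 have Ii: "integrable lborel (%x. ic k z x * norm (fn u x))" for k z
  using integrable_norm[OF bbs_integrable[OF bbs_cell sqint_fn[of u]]] by simp
 have I0: "I k z >= 0" for k z unfolding I_def by (rule integral_nonneg_AE) simp
 have dU: "distribution U (ic k z) = I k z *R e" for k z
 proof -
  have [measurable]: "f : bfun" using fs by (simp add: sqint_def)
  have "distribution U (ic k z) = (LI x. (ic k z x * norm (fn u x)) *R e)"
   unfolding distribution_eq[OF bbs_measurable[OF bbs_cell]]
   by (rule integral_cong_AE) (use Uf in "auto simp: f_def elim: eventually_mono")
  also have "... = I k z *R e" unfolding I_def by (rule integral_scaleR_left) (use Ii in simp)
  finally show ?thesis .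
 qed
 define X where "X k x = norm (Ek k U x)" for k x
 have Xeq: "X k x = inverse (vol TYPE('n) k) * I k (idx k x)" for k x
  using I0[of k "idx k x"] vol_pos[where 'n = 'n, of k] by (simp add: X_def Ek_def avgv_def dU e less_imp_le)
 show thesis
 proof (rule that[of X])
  show "X k : bfun" for k unfolding X_def[abs_def] by measurable
  show "X k x >= 0" for k x by (simp add: X_def)
  show "X k x = X k y" if "idx k x = idx k y" for k x y using that by (simp add: Xeq)
  show "norm (Ek k u x) <= X k x" for k x
  proof -
   have "norm (distribution u (indicator (cell k (idx k x)))) <= (LI y. norm (indicator (cell k (idx k x)) y *R fn u y))"
    unfolding distribution_eq[OF bbs_measurable[OF bbs_cell]] by (rule integral_norm_bound)
   also have "... = I k (idx k x)" by (simp add: I_def)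
   finally show ?thesis using vol_pos[where 'n = 'n, of k] by (simp add: Xeq Ek_def avgv_def)
  qed
  show "(NN x. ennreal ((X k x)\<^sup>2)) <= esq u" for k using Ek_le[of k U] by (simp add: X_def nU)
  show "(NN x. ennreal (X k x) * ic k z x) = (NN x. ennreal (norm (fn u x)) * ic k z x)" for k z
  proof -
   have "(NN x. ennreal (X k x) * ic k z x) = (NN x. ennreal (inverse (vol TYPE('n) k) * I k z) * ic k z x)"
    by (rule nn_integral_cong) (auto simp: indicator_def mem_cell Xeq)
   also have "... = ennreal (inverse (vol TYPE('n) k) * I k z) * ennreal (vol TYPE('n) k)"
    by (subst nn_integral_cmult_indicator) (auto simp: emeasure_cell)
   also have "... = ennreal (I k z)"
    using vol_pos[where 'n = 'n, of k] I0[of k z] by (simp add: ennreal_mult'[symmetric] less_imp_le)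
   also have "... = (NN x. ennreal (ic k z x * norm (fn u x)))"
    unfolding I_def by (rule nn_integral_eq_integral[symmetric, OF Ii]) simp
   also have "... = (NN x. ennreal (norm (fn u x)) * ic k z x)" by (rule nn_integral_cong) (auto simp: indicator_def)
   finally show ?thesis .
  qed
 qed
qed

text \<open>Pathwise form of Doob's \<open>L\<^sup>2\<close> inequality: integrated, the sums on both sides cancel for a
 martingale.\<close>

lemma doob_pathwise:
 fixes X :: "nat => real"
 assumes "!!k. X k >= 0"
 defines "M \<equiv> %k. Max (X ` {..k})"
 shows "(M n)\<^sup>2 / 4 + (\<Sum>k<n. M k * X (Suc k)) <= (X n)\<^sup>2 + (\<Sum>k<n. M k * X k)"
proof -
 have M0: "M 0 = X 0" by (simp add: M_def)
 have MS: "M (Suc k) = max (X (Suc k)) (M k)" for k unfolding M_def by (simp add: atMost_Suc)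
 have "(M n)\<^sup>2 / 2 + (\<Sum>k<n. M k * X (Suc k)) <= M n * X n + (\<Sum>k<n. M k * X k)"
 proof (induction n)
  case 0
  then show ?case by (simp add: M0 power2_eq_square)
 next
  case (Suc n)
  show ?case
  proof (cases "X (Suc n) <= M n")
   case True
   then have "M (Suc n) = M n" by (simp add: MS)
   then show ?thesis using Suc by simp
  next
   case False
   then have eq: "M (Suc n) = X (Suc n)" by (simp add: MS)
   have "0 <= (X (Suc n) - M n)\<^sup>2" by simp
   then have "(X (Suc n))\<^sup>2 / 2 - (M n)\<^sup>2 / 2 + M n * X (Suc n) <= X (Suc n) * X (Suc n)"
    by (simp add: power2_eq_square algebra_simps)
   then show ?thesis using Suc unfolding eq by simp
  qed
 qed
 moreover have "M n * X n <= (M n)\<^sup>2 / 4 + (X n)\<^sup>2"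
  using zero_le_power2[of "M n / 2 - X n"] by (simp add: power2_eq_square algebra_simps)
 ultimately show ?thesis by linarith
qed

lemma sum_triangle_swap:
 fixes a :: "nat => nat => 'a::comm_monoid_add"
 shows "(\<Sum>k\<le>K. \<Sum>i\<le>k. a k i) = (\<Sum>i\<le>K. \<Sum>k\<in>{i..K}. a k i)"
proof (induction K)
 case (Suc K)
 have "(\<Sum>i\<le>K. \<Sum>k\<in>{i..Suc K}. a k i) = (\<Sum>i\<le>K. (\<Sum>k\<in>{i..K}. a k i) + a (Suc K) i)"
  by (rule sum.cong) (auto simp: atLeastAtMostSuc_conv add.commute)
 then show ?case using Suc by (simp add: sum.distrib add.assoc)
qed simp

text \<open>The maximal function \<open>M\<^sub>k\<close> of the means up to level \<open>k\<close> increases in \<open>k\<close>. Writing \<open>M\<^sub>k\<^sup>2\<close> as the sum of its increments, which are constant on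
cubes, the packing condition replaces \<open>\<Sum> c\<^sub>k\<close> by \<open>A\<close>, and Doob's inequality bounds the result.\<close>

theorem carleson_embedding:
 fixes c :: "nat => real^'n => ennreal" and u :: "('n::finite, 'm::finite) L2"
 assumes cm [measurable]: "!!k. c k : bfun" and A: "A >= 0"
  and packing: "!!j z. j <= K ==> (NN x. (\<Sum>k\<in>{j..K}. c k x) * ic j z x) <= ennreal (A * vol TYPE('n) j)"
 shows "(\<Sum>k\<le>K. \<integral>\<^sup>+x. c k x * esq (Ek k u x) \<partial>lborel) <= ennreal (4 * A * sq u)"
proof -
 obtain X :: "nat => real^'n => real" where Xm [measurable]: "!!k. X k : bfun" and X0: "!!k x. X k x >= 0"
  and Xi: "!!k x y. idx k x = idx k y ==> X k x = X k y" and XE: "!!k x. norm (Ek k u x) <= X k x"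
  and Xc: "!!k z. (NN x. ennreal (X k x) * ic k z x) = (NN x. ennreal (norm (fn u x)) * ic k z x)"
  and X2: "!!k. (NN x. ennreal ((X k x)\<^sup>2)) <= esq u"
  by (rule scalar_means[of u]) (rule that, assumption+)
 define M where "M k x = Max ((%i. X i x) ` {..k})" for k x
 have M0: "M 0 x = X 0 x" for x by (simp add: M_def)
 have MS: "M (Suc k) x = max (X (Suc k) x) (M k x)" for k x by (simp add: M_def atMost_Suc)
 have Mm [measurable]: "M k : bfun" for k
 proof (induction k)
  case 0
  have "M 0 = X 0" using M0 by auto
  then show ?case by simp
 next
  case (Suc k)
  have "M (Suc k) = (%x. max (X (Suc k) x) (M k x))" using MS by auto
  then show ?case using Suc by simp
 qed
 have XM: "X i x <= M k x" if "i <= k" for i k x unfolding M_def using that by (intro Max_ge) auto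
 have Mnn: "M k x >= 0" for k x using XM[of 0 k x] X0[of 0 x] by linarith
 have Mi: "M k x = M k y" if "idx k x = idx k y" for k x y
 proof -
  have "X i x = X i y" if "i <= k" for i by (rule Xi[OF idx_refine[OF that \<open>idx k x = idx k y\<close>]])
  then show ?thesis unfolding M_def by (intro arg_cong[where f = Max] image_cong) auto
 qed
 have lev: "\<exists>\<phi>. \<forall>x. f x = \<phi> (idx k x)" if "!!x y. idx k x = idx k y ==> f x = f y" for f :: "real^'n => ennreal" and k
  by (rule exI[of _ "%z. f (SOME x. idx k x = z)"]) (metis (mono_tags, lifting) someI that)
 have fin: "(NN x. ennreal (M k x * X k x)) < \<infinity>" for k
 proof -
  have "(M k x * X k x) <= (\<Sum>i\<le>k. (X i x)\<^sup>2)" for x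
  proof -
   have "M k x : (%i. X i x) ` {..k}" unfolding M_def by (rule Max_in) auto
   then obtain i where i: "i <= k" "M k x = X i x" by auto
   have "M k x * X k x <= M k x * M k x" by (rule mult_left_mono[OF XM Mnn]) simp
   also have "... = (X i x)\<^sup>2" by (simp add: i power2_eq_square)
   also have "... <= (\<Sum>i\<le>k. (X i x)\<^sup>2)" by (rule member_le_sum) (use i in auto)
   finally show ?thesis .
  qed
  then have "(NN x. ennreal (M k x * X k x)) <= (NN x. (\<Sum>i\<le>k. ennreal ((X i x)\<^sup>2)))"
   by (intro nn_integral_mono) (auto simp: sum_ennreal intro!: ennreal_leI)
  also have "... = (\<Sum>i\<le>k. \<integral>\<^sup>+x. ennreal ((X i x)\<^sup>2) \<partial>lborel)" by (rule nn_integral_sum) measurable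
  also have "... <= (\<Sum>i\<le>k. esq u)" by (rule sum_mono) (rule X2)
  also have "... = ennreal (\<Sum>i\<le>k. sq u)" by (rule sum_ennreal) simp
  also have "... < \<infinity>" by (simp only: infinity_ennreal_def ennreal_less_top)
  finally show ?thesis .
 qed
 have mart: "(NN x. ennreal (M k x * X k x)) <= (NN x. ennreal (M k x * X (Suc k) x))" for k
 proof -
  obtain \<phi> where \<phi>: "!!x. ennreal (M k x) = \<phi> (idx k x)" using lev[of k "%x. ennreal (M k x)"] Mi by metis
  have "(NN x. \<phi> (idx k x) * ennreal (X k x)) <= (NN x. \<phi> (idx k x) * ennreal (X (Suc k) x))"
  proof (rule cellwise_mono)
   fix z :: "int^'n"
   define \<psi> where "\<psi> w = (if par 1 w = z then 1 else 0 :: ennreal)" for w :: "int^'n"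
   have \<psi>: "\<psi> (idx (Suc k) x) = ic k z x" for x
    using idx_par[of k "Suc k" x] by (auto simp: \<psi>_def indicator_def mem_cell)
   have "(NN x. ennreal (X k x) * ic k z x) = (NN x. \<psi> (idx (Suc k) x) * ennreal (norm (fn u x)))"
    unfolding Xc \<psi> by (simp add: mult.commute)
   also have "... <= (NN x. \<psi> (idx (Suc k) x) * ennreal (X (Suc k) x))" by (rule cellwise_mono) (auto simp: Xc)
   also have "... = (NN x. ennreal (X (Suc k) x) * ic k z x)" unfolding \<psi> by (simp add: mult.commute)
   finally show "(NN x. ennreal (X k x) * ic k z x) <= (NN x. ennreal (X (Suc k) x) * ic k z x)" .
  qed auto
  then show ?thesis by (simp add: \<phi>[symmetric] ennreal_mult Mnn X0)
 qed
 have doob: "(NN x. ennreal ((M n x)\<^sup>2)) <= ennreal (4 * sq u)" for n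
 proof -
  define S where "S = (\<Sum>k<n. \<integral>\<^sup>+x. ennreal (M k x * X k x) \<partial>lborel)"
  have Sfin: "S < \<infinity>" unfolding S_def using fin by (simp add: less_top)
  have "(NN x. ennreal ((M n x)\<^sup>2 / 4)) + S <= (NN x. ennreal ((M n x)\<^sup>2 / 4)) + (\<Sum>k<n. \<integral>\<^sup>+x. ennreal (M k x * X (Suc k) x) \<partial>lborel)"
   unfolding S_def by (intro add_left_mono sum_mono mart)
  also have "... = (NN x. ennreal ((M n x)\<^sup>2 / 4) + (\<Sum>k<n. ennreal (M k x * X (Suc k) x)))"
   by (subst nn_integral_add) (auto simp: nn_integral_sum)
  also have "... <= (NN x. ennreal ((X n x)\<^sup>2) + (\<Sum>k<n. ennreal (M k x * X k x)))"
  proof (rule nn_integral_mono)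
   fix x
   have "(M n x)\<^sup>2 / 4 + (\<Sum>k<n. M k x * X (Suc k) x) <= (X n x)\<^sup>2 + (\<Sum>k<n. M k x * X k x)"
    using doob_pathwise[of "%k. X k x" n, OF X0] by (simp add: M_def)
   then have "ennreal ((M n x)\<^sup>2 / 4 + (\<Sum>k<n. M k x * X (Suc k) x)) <= ennreal ((X n x)\<^sup>2 + (\<Sum>k<n. M k x * X k x))"
    by (rule ennreal_leI)
   then show "ennreal ((M n x)\<^sup>2 / 4) + (\<Sum>k<n. ennreal (M k x * X (Suc k) x)) <= ennreal ((X n x)\<^sup>2) + (\<Sum>k<n. ennreal (M k x * X k x))"
    by (simp add: sum_ennreal Mnn X0 ennreal_plus sum_nonneg del: ennreal_power)
  qed
  also have "... = (NN x. ennreal ((X n x)\<^sup>2)) + S"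
   unfolding S_def by (subst nn_integral_add) (auto simp: nn_integral_sum)
  also have "... <= esq u + S" by (intro add_right_mono X2)
  finally have "(NN x. ennreal ((M n x)\<^sup>2 / 4)) <= esq u"
   using Sfin ennreal_add_left_cancel_le[of S] by (simp add: add.commute[of _ S] less_top[symmetric])
  then have "ennreal 4 * (NN x. ennreal ((M n x)\<^sup>2 / 4)) <= ennreal 4 * esq u" by (rule mult_left_mono) simp
  also have "ennreal 4 * (NN x. ennreal ((M n x)\<^sup>2 / 4)) = (NN x. ennreal ((M n x)\<^sup>2))"
   by (subst nn_integral_cmult[symmetric]) (auto simp: ennreal_mult[symmetric] simp del: ennreal_power ennreal_numeral)
  finally show ?thesis by (simp add: ennreal_mult del: ennreal_power ennreal_numeral)
 qed
 define d where "d i x = (if i = 0 then (M 0 x)\<^sup>2 else (M i x)\<^sup>2 - (M (i - 1) x)\<^sup>2)" for i x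
 have d0: "d i x >= 0" for i x
 proof (cases i)
  case (Suc i')
  have "M i' x <= M (Suc i') x" by (simp add: MS)
  then have "(M i' x)\<^sup>2 <= (M (Suc i') x)\<^sup>2" by (rule power_mono) (rule Mnn)
  then show ?thesis by (simp add: d_def Suc)
 qed (simp add: d_def)
 have dsum: "(\<Sum>i\<le>k. d i x) = (M k x)\<^sup>2" for k x by (induction k) (auto simp: d_def)
 have dm [measurable]: "d i : bfun" for i unfolding d_def[abs_def] by (cases "i = 0") auto
 have dle: "(NN x. ennreal (d i x) * (\<Sum>k\<in>{i..K}. c k x)) <= (NN x. ennreal (d i x) * ennreal A)" if i: "i <= K" for i
 proof -
  have "d i x = d i y" if "idx i x = idx i y" for x y
  proof -
   have "idx (i - 1) x = idx (i - 1) y" by (rule idx_refine[OF _ that]) simp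
   then show ?thesis using Mi[OF that] Mi[of "i - 1" x y] by (auto simp: d_def)
  qed
  then obtain \<phi> where \<phi>: "!!x. ennreal (d i x) = \<phi> (idx i x)" using lev[of i "%x. ennreal (d i x)"] by metis
  show ?thesis unfolding \<phi>
  proof (rule cellwise_mono)
   fix z :: "int^'n"
   have "(NN x. ennreal A * ic i z x) = ennreal (A * vol TYPE('n) i)"
    using A by (subst nn_integral_cmult_indicator) (auto simp: emeasure_cell ennreal_mult')
   then show "(NN x. (\<Sum>k\<in>{i..K}. c k x) * ic i z x) <= (NN x. ennreal A * ic i z x)" using packing[OF i] by simp
  qed auto
 qed
 have "(\<Sum>k\<le>K. \<integral>\<^sup>+x. c k x * esq (Ek k u x) \<partial>lborel) <= (\<Sum>k\<le>K. \<integral>\<^sup>+x. c k x * (\<Sum>i\<le>k. ennreal (d i x)) \<partial>lborel)"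
 proof (intro sum_mono nn_integral_mono mult_left_mono)
  fix k x
  have "norm (Ek k u x) <= M k x" using XE[of k x] XM[of k k x] by simp
  then have "sq (Ek k u x) <= (M k x)\<^sup>2" by (rule power_mono) simp
  then show "esq (Ek k u x) <= (\<Sum>i\<le>k. ennreal (d i x))"
   by (simp add: sum_ennreal d0 dsum ennreal_leI del: ennreal_power)
 qed simp
 also have "... = (NN x. (\<Sum>k\<le>K. c k x * (\<Sum>i\<le>k. ennreal (d i x))))"
  by (rule nn_integral_sum[symmetric]) measurable
 also have "... = (NN x. (\<Sum>i\<le>K. ennreal (d i x) * (\<Sum>k\<in>{i..K}. c k x)))"
 proof (rule nn_integral_cong)
  fix x
  have "(\<Sum>k\<le>K. c k x * (\<Sum>i\<le>k. ennreal (d i x))) = (\<Sum>k\<le>K. \<Sum>i\<le>k. ennreal (d i x) * c k x)"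
   by (simp add: sum_distrib_left mult.commute)
  also have "... = (\<Sum>i\<le>K. \<Sum>k\<in>{i..K}. ennreal (d i x) * c k x)" by (rule sum_triangle_swap)
  also have "... = (\<Sum>i\<le>K. ennreal (d i x) * (\<Sum>k\<in>{i..K}. c k x))" by (simp add: sum_distrib_left)
  finally show "(\<Sum>k\<le>K. c k x * (\<Sum>i\<le>k. ennreal (d i x))) = (\<Sum>i\<le>K. ennreal (d i x) * (\<Sum>k\<in>{i..K}. c k x))" .
 qed
 also have "... = (\<Sum>i\<le>K. \<integral>\<^sup>+x. ennreal (d i x) * (\<Sum>k\<in>{i..K}. c k x) \<partial>lborel)"
  by (rule nn_integral_sum) measurable
 also have "... <= (\<Sum>i\<le>K. \<integral>\<^sup>+x. ennreal (d i x) * ennreal A \<partial>lborel)"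
  by (rule sum_mono) (use dle in auto)
 also have "... = (NN x. (\<Sum>i\<le>K. ennreal (d i x)) * ennreal A)"
  unfolding sum_distrib_right by (rule nn_integral_sum[symmetric]) measurable
 also have "... = (NN x. ennreal ((M K x)\<^sup>2)) * ennreal A"
  by (simp add: sum_ennreal d0 dsum nn_integral_multc del: ennreal_power)
 also have "... <= ennreal (4 * sq u) * ennreal A" by (rule mult_right_mono[OF doob]) simp
 also have "... = ennreal (4 * A * sq u)" using A by (simp add: ennreal_mult'[symmetric] mult_ac del: ennreal_power)
 finally show ?thesis .
qed

section \<open>Stopping times and Carleson measures\<close>

text \<open>Points lying in a cube of one of the levels \<open>j + 1, ..., K\<close> with property \<open>P\<close>; \<open>first_hit j P i\<close> is the union of
those cubes of level \<open>i\<close> that are maximal.\<close>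

definition hits :: "nat => nat => (nat => int^'n => bool) => (real^'n) set" where
 "hits j K P = {x. \<exists>i. j < i \<and> i <= K \<and> P i (idx i x)}"

definition first_hit :: "nat => (nat => int^'n => bool) => nat => (real^'n) set" where
 "first_hit j P i = {x. P i (idx i x) \<and> (\<forall>k. j < k \<and> k < i --> \<not> P k (idx k x))}"

lemma hits_borel [measurable]: "hits j K P : sets borel"
proof -
 have "hits j K P = (\<Union>i\<in>{j<..K}. {x. P i (idx i x)})" by (auto simp: hits_def)
 then show ?thesis by auto
qed

lemma first_hit_borel [measurable]: "first_hit j P i : sets borel"
proof -
 have "first_hit j P i = {x. P i (idx i x)} - (\<Union>k\<in>{j<..<i}. {x. P k (idx k x)})" by (auto simp: first_hit_def)
 then show ?thesis by auto
qed

lemma hits_first_hit: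
 assumes "x : hits j K P"
 obtains i where "j < i" "i <= K" "x : first_hit j P i"
proof -
 define i where "i = (LEAST i. j < i \<and> i <= K \<and> P i (idx i x))"
 have ex: "\<exists>i. j < i \<and> i <= K \<and> P i (idx i x)" using assms by (simp add: hits_def)
 have i: "j < i \<and> i <= K \<and> P i (idx i x)" unfolding i_def by (rule LeastI_ex[OF ex])
 have "\<not> P k (idx k x)" if "j < k" "k < i" for k
  using not_less_Least[of k "%i. j < i \<and> i <= K \<and> P i (idx i x)"] that i unfolding i_def[symmetric] by auto
 with i show ?thesis using that by (auto simp: first_hit_def)
qed

lemma first_hit_unique:
 assumes "x : first_hit j P i" "x : first_hit j P i'" "j < i" "j < i'"
 shows "i = i'"
 using assms by (auto simp: first_hit_def) (metis linorder_neqE_nat)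

lemma sum_first_hit: "(\<Sum>i\<in>{j<..K}. indicator (first_hit j P i) x) = (indicator (hits j K P) x :: ennreal)"
proof (cases "x : hits j K P")
 case True
 obtain i where i: "j < i" "i <= K" "x : first_hit j P i" using hits_first_hit[OF True] .
 have "(\<Sum>k\<in>{j<..K}. indicator (first_hit j P k) x) = (\<Sum>k\<in>{j<..K}. if k = i then 1 else (0::ennreal))"
 proof (rule sum.cong)
  fix k assume k: "k : {j<..K}"
  show "indicator (first_hit j P k) x = (if k = i then 1 else (0::ennreal))"
  proof (cases "k = i")
   case False
   then have "x \<notin> first_hit j P k" using first_hit_unique[OF _ i(3) _ i(1)] k by auto
   then show ?thesis using False by simp
  qed (use i in simp)
 qed simp
 then show ?thesis using True i by simp
next
 case False
 then show ?thesis by (auto simp: hits_def first_hit_def intro!: sum.neutral)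
qed

text \<open>The sets \<open>first_hit j P i\<close> are disjoint unions of cubes with property \<open>P\<close>, so estimates on the single cubes add up.\<close>

lemma stopping_mono:
 fixes F :: "nat => real^'n => ennreal"
 assumes [measurable]: "!!i. F i : bfun" "G : bfun"
  and le: "!!i z'. j < i ==> i <= K ==> P i z' ==>
   (NN x. F i x * ic i z' x) <= (NN x. G x * ic i z' x)"
 shows "(NN x. (\<Sum>i\<in>{j<..K}. F i x * indicator (first_hit j P i) x) * ic j z x)
  <= (NN x. G x * indicator (hits j K P Int cell j z) x)"
proof -
 have each: "(NN x. F i x * indicator (first_hit j P i Int cell j z) x) <= (NN x. G x * indicator (first_hit j P i Int cell j z) x)"
  if i: "j < i" "i <= K" for i
 proof -
  define \<phi> :: "int^'n => ennreal" where "\<phi> w = (if P i w \<and> (\<forall>k. j < k \<and> k < i --> \<not> P k (par (i - k) w)) \<and> par (i - j) w = z then 1 else 0)" for w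
  have \<phi>: "indicator (first_hit j P i Int cell j z) x = \<phi> (idx i x)" for x :: "real^'n"
  proof -
   have "(\<forall>k. j < k \<and> k < i --> \<not> P k (idx k x)) \<longleftrightarrow> (\<forall>k. j < k \<and> k < i --> \<not> P k (par (i - k) (idx i x)))"
    using idx_par[of _ i x] by (metis less_imp_le)
   moreover have "idx j x = par (i - j) (idx i x)" using idx_par[of j i x] i by simp
   ultimately show ?thesis by (auto simp: \<phi>_def indicator_def first_hit_def mem_cell)
  qed
  have "(NN x. \<phi> (idx i x) * F i x) <= (NN x. \<phi> (idx i x) * G x)"
  proof (rule cellwise_mono)
   fix z' assume "\<phi> z' ~= 0"
   then have "P i z'" by (auto simp: \<phi>_def split: if_splits)
   from le[OF i this] show "(NN x. F i x * ic i z' x) <= (NN x. G x * ic i z' x)" .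
  qed auto
  then show ?thesis unfolding \<phi> by (simp add: mult.commute)
 qed
 have "(NN x. (\<Sum>i\<in>{j<..K}. F i x * indicator (first_hit j P i) x) * ic j z x)
   = (NN x. (\<Sum>i\<in>{j<..K}. F i x * indicator (first_hit j P i Int cell j z) x))"
  by (rule nn_integral_cong) (simp only: sum_distrib_right indicator_inter_arith mult.assoc)
 also have "... = (\<Sum>i\<in>{j<..K}. \<integral>\<^sup>+x. F i x * indicator (first_hit j P i Int cell j z) x \<partial>lborel)"
  by (rule nn_integral_sum) measurable
 also have "... <= (\<Sum>i\<in>{j<..K}. \<integral>\<^sup>+x. G x * indicator (first_hit j P i Int cell j z) x \<partial>lborel)"
  by (rule sum_mono) (use each in auto)
 also have "... = (NN x. (\<Sum>i\<in>{j<..K}. G x * indicator (first_hit j P i Int cell j z) x))"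
  by (rule nn_integral_sum[symmetric]) measurable
 also have "... = (NN x. G x * indicator (hits j K P Int cell j z) x)"
 proof (rule nn_integral_cong)
  fix x
  have "(\<Sum>i\<in>{j<..K}. G x * indicator (first_hit j P i Int cell j z) x) = G x * ((\<Sum>i\<in>{j<..K}. indicator (first_hit j P i) x) * ic j z x)"
   by (simp only: sum_distrib_left sum_distrib_right indicator_inter_arith)
  then show "(\<Sum>i\<in>{j<..K}. G x * indicator (first_hit j P i Int cell j z) x) = G x * indicator (hits j K P Int cell j z) x"
   by (simp only: sum_first_hit indicator_inter_arith)
 qed
 finally show ?thesis .
qed

lemma stopping_mono_const:
 fixes F :: "real^'n => ennreal"
 assumes [measurable]: "F : bfun" "G : bfun"
  and le: "!!i z'. j < i ==> i <= K ==> P i z' ==>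
   (NN x. F x * ic i z' x) <= (NN x. G x * ic i z' x)"
 shows "(NN x. F x * indicator (hits j K P Int cell j z) x) <= (NN x. G x * indicator (hits j K P Int cell j z) x)"
proof -
 have "(NN x. F x * indicator (hits j K P Int cell j z) x)
   = (NN x. (\<Sum>i\<in>{j<..K}. F x * indicator (first_hit j P i) x) * ic j z x)"
  by (rule nn_integral_cong) (simp only: sum_distrib_left[symmetric] sum_first_hit indicator_inter_arith mult.assoc)
 also have "... <= (NN x. G x * indicator (hits j K P Int cell j z) x)" by (rule stopping_mono) (use le in auto)
 finally show ?thesis .
qed

lemma cell_subset_measure:
 assumes "A : sets borel"
 shows "bbs (indicator (A Int cell j z))" "emeasure lborel (A Int cell j z) = ennreal (LI x. indicator (A Int cell j z) x)"
  "(LI x. indicator (A Int cell j (z :: int^'n)) x) <= vol TYPE('n) j"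
proof -
 show b: "bbs (indicator (A Int cell j z))"
  by (rule bbs_indicator) (use assms bounded_cube in "auto simp: cell_def intro: bounded_subset")
 have "emeasure lborel (A Int cell j z) <= emeasure lborel (cell j z)" by (rule emeasure_mono) auto
 then have "emeasure lborel (A Int cell j z) ~= \<infinity>" unfolding emeasure_cell by (auto simp: top_unique)
 then show "emeasure lborel (A Int cell j z) = ennreal (LI x. indicator (A Int cell j z) x)"
  by (simp add: emeasure_eq_ennreal_measure)
 have "(LI x. indicator (A Int cell j z) x) <= (LI x. indicat_real (cell j z) x)"
  by (rule integral_mono[OF bbs_integrable_real[OF b] bbs_integrable_real[OF bbs_cell]]) (auto simp: indicator_def)
 then show "(LI x. indicator (A Int cell j z) x) <= vol TYPE('n) j" by (simp only: integral_cell)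
qed

text \<open>The cubes on which the mean of \<open>f\<close> in direction \<open>\<nu>\<close> drops below \<open>1/2\<close> leave a fixed proportion of
 the cube uncovered, because \<open>f\<close> has mean close to \<open>\<nu>\<close> and controlled \<open>L\<^sup>2\<close> norm.\<close>

lemma low_mean_set:
 fixes f :: "('n::finite, 'm::finite) L2" and j K :: nat and z :: "int^'n"
 assumes \<nu>: "norm \<nu> = 1" and C1: "C1 >= 1" and f: "sq f <= C1 * vol TYPE('n) j"
  and av: "norm (avgv j z f - \<nu>) <= 1/4"
 defines "S \<equiv> hits j K (%k z'. \<nu> \<bullet> avgv k z' f < 1/2) Int cell j z"
 shows "(LI x. indicator S x) <= (1 - 1 / (16 * C1)) * vol TYPE('n) j"
proof -
 define v where "v = vol TYPE('n) j"
 have v: "v > 0" unfolding v_def by (rule vol_pos)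
 let ?P = "%k z'. \<nu> \<bullet> avgv k z' f < 1/2"
 have S: "S : sets borel" unfolding S_def by auto
 have Sb: "bbs (indicator S)" "(LI x. indicator S x) <= v"
  unfolding S_def v_def by (rule cell_subset_measure[OF hits_borel])+
 define s where "s = (LI x. indicat_real S x)"
 have s0: "s >= 0" unfolding s_def by simp
 define h where "h x = \<nu> \<bullet> fn f x" for x
 have [measurable]: "h : bfun" unfolding h_def by measurable
 have hi: "integrable lborel (%x. \<phi> x * h x)" if "bbs \<phi>" for \<phi>
  unfolding h_def by (rule bbs_lint_integrable[OF that lint_inner[OF sqint_fn]])
 have hd: "(LI x. \<phi> x * h x) = \<nu> \<bullet> distribution f \<phi>" if "bbs \<phi>" for \<phi>
 proof -
  have "\<nu> \<bullet> distribution f \<phi> = (LI x. \<nu> \<bullet> (\<phi> x *R fn f x))"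
   unfolding distribution_eq[OF bbs_measurable[OF that]]
   by (rule integral_inner_right[symmetric]) (rule bbs_integrable[OF that sqint_fn])
  then show ?thesis by (simp add: h_def)
 qed
 have ipos: "integrable lborel (%x. indicator A x * max (h x) 0)" "integrable lborel (%x. indicator A x * max (- h x) 0)" if "bbs (indicator A)" for A
 proof -
  have e: "indicator A x * max (h x) 0 = max (indicator A x * h x) 0" "indicator A x * max (- h x) 0 = max (- (indicator A x * h x)) 0" for x
   by (auto simp: indicator_def)
  show "integrable lborel (%x. indicator A x * max (h x) 0)" "integrable lborel (%x. indicator A x * max (- h x) 0)"
   unfolding e using hi[OF that] by (auto intro!: integrable_max)
 qed
 have nnp: "(NN x. ennreal (max (h x) 0) * indicator A x) = ennreal (LI x. indicator A x * max (h x) 0)" if "bbs (indicator A)" for A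
 proof -
  have "(NN x. ennreal (max (h x) 0) * indicator A x) = (NN x. ennreal (indicator A x * max (h x) 0))"
   by (rule nn_integral_cong) (auto simp: indicator_def)
  then show ?thesis using nn_integral_eq_integral[OF ipos(1)[OF that]] by simp
 qed
 have nnm: "(NN x. ennreal (1/2 + max (- h x) 0) * indicator A x) = ennreal ((1/2) * (LI x. indicator A x) + (LI x. indicator A x * max (- h x) 0))" if b: "bbs (indicator A)" for A
 proof -
  have i: "integrable lborel (%x. (1/2) * indicator A x + indicator A x * max (- h x) 0)"
   using bbs_integrable_real[OF b] ipos(2)[OF b] by auto
  have "(NN x. ennreal (1/2 + max (- h x) 0) * indicator A x) = (NN x. ennreal ((1/2) * indicator A x + indicator A x * max (- h x) 0))"
   by (rule nn_integral_cong) (auto simp: indicator_def)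
  also have "... = ennreal (LI x. (1/2) * indicator A x + indicator A x * max (- h x) 0)"
   by (rule nn_integral_eq_integral[OF i]) (auto simp: indicator_def)
  also have "(LI x. (1/2) * indicator A x + indicator A x * max (- h x) 0) = (1/2) * (LI x. indicator A x) + (LI x. indicator A x * max (- h x) 0)"
   using bbs_integrable_real[OF b] ipos(2)[OF b] by simp
  finally show ?thesis .
 qed
 have split: "(LI x. indicator A x * h x) = (LI x. indicator A x * max (h x) 0) - (LI x. indicator A x * max (- h x) 0)" if b: "bbs (indicator A)" for A
 proof -
  have "(LI x. indicator A x * h x) = (LI x. indicator A x * max (h x) 0 - indicator A x * max (- h x) 0)"
   by (rule Bochner_Integration.integral_cong) (auto simp: max_def algebra_simps)
  then show ?thesis using ipos[OF b] by simp
 qed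
 have "(NN x. ennreal (max (h x) 0) * indicator S x) <= (NN x. ennreal (1/2 + max (- h x) 0) * indicator S x)"
  unfolding S_def
 proof (rule stopping_mono_const)
  fix i and z' :: "int^'n" assume P: "?P i z'"
  have "(LI x. ic i z' x * h x) <= (1/2) * vol TYPE('n) i"
  proof -
   have "\<nu> \<bullet> distribution f (ic i z') = vol TYPE('n) i * (\<nu> \<bullet> avgv i z' f)"
    using vol_pos[where 'n = 'n, of i] by (simp add: avgv_def)
   also have "... <= vol TYPE('n) i * (1/2)" by (rule mult_left_mono) (use P vol_pos[where 'n = 'n, of i] in auto)
   finally show ?thesis using hd[OF bbs_cell] by simp
  qed
  then have "(LI x. ic i z' x * max (h x) 0) <= (1/2) * (LI x. ic i z' x) + (LI x. ic i z' x * max (- h x) 0)"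
   unfolding split[OF bbs_cell] integral_cell by linarith
  then show "(NN x. ennreal (max (h x) 0) * ic i z' x) <= (NN x. ennreal (1/2 + max (- h x) 0) * ic i z' x)"
   unfolding nnp[OF bbs_cell] nnm[OF bbs_cell] by (rule ennreal_leI)
 qed auto
 then have "(LI x. indicator S x * max (h x) 0) <= (1/2) * s + (LI x. indicator S x * max (- h x) 0)"
  unfolding nnp[OF Sb(1)] nnm[OF Sb(1)] s_def[symmetric]
  by (subst (asm) ennreal_le_iff) (use s0 in "auto intro!: add_nonneg_nonneg integral_nonneg_AE")
 then have S1: "(LI x. indicator S x * h x) <= (1/2) * s" unfolding split[OF Sb(1)] by linarith
 have Q1: "(3/4) * v <= (LI x. ic j z x * h x)"
 proof -
  have "\<nu> \<bullet> avgv j z f = \<nu> \<bullet> \<nu> + \<nu> \<bullet> (avgv j z f - \<nu>)" by (simp add: inner_simps)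
  moreover have "\<bar>\<nu> \<bullet> (avgv j z f - \<nu>)\<bar> <= norm \<nu> * norm (avgv j z f - \<nu>)" by (rule Cauchy_Schwarz_ineq2)
  moreover have "\<nu> \<bullet> \<nu> = 1" using \<nu> by (simp add: power2_norm_eq_inner[symmetric])
  ultimately have "3/4 <= \<nu> \<bullet> avgv j z f" using av \<nu> by simp
  then have "(3/4) * v <= (\<nu> \<bullet> avgv j z f) * v" by (rule mult_right_mono) (use v in simp)
  also have "... = \<nu> \<bullet> distribution f (ic j z)" using v by (simp add: avgv_def v_def)
  finally show ?thesis using hd[OF bbs_cell] by simp
 qed
 define R where "R = (- hits j K ?P) Int cell j z"
 have Rb: "bbs (indicator R)" "R : sets borel" unfolding R_def by (rule cell_subset_measure(1)) auto
 have dec: "ic j z x = indicator S x + (indicator R x :: real)" for x by (auto simp: S_def R_def indicator_def)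
 have R1: "(LI x. indicator R x * h x) >= v / 4 + (v - s) / 2"
 proof -
  have "(LI x. ic j z x * h x) = (LI x. indicator S x * h x) + (LI x. indicator R x * h x)"
   unfolding dec distrib_right using hi[OF Sb(1)] hi[OF Rb(1)] by simp
  then show ?thesis using S1 Q1 by (simp add: field_simps)
 qed
 have Rm: "(LI x. indicator R x) = v - s"
 proof -
  have "(LI x. indicat_real (cell j z) x) = s + (LI x. indicator R x)"
   unfolding dec s_def using bbs_integrable_real[OF Sb(1)] bbs_integrable_real[OF Rb(1)] by simp
  then show ?thesis unfolding integral_cell v_def by simp
 qed
 have "(LI x. indicator R x * h x) <= sqrt (v - s) * norm f"
 proof -
  have "(LI x. indicator R x * h x) <= norm \<nu> * norm (distribution f (indicator R))"
   unfolding hd[OF Rb(1)] by (rule norm_cauchy_schwarz)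
  also have "... <= sqrt (LI x. (indicator R x)\<^sup>2) * norm (mult (indicator UNIV) f)"
   using distribution_local_bound[OF Rb(1), of UNIV f] \<nu> by simp
  also have "mult (indicator UNIV) f = f" by (simp add: mult_def)
  also have "(LI x. (indicator R x)\<^sup>2) = (LI x. indicat_real R x)"
   by (rule Bochner_Integration.integral_cong) (auto simp: indicator_def)
  finally show ?thesis unfolding Rm .
 qed
 with R1 have up: "v / 4 + (v - s) / 2 <= sqrt (v - s) * norm f" by linarith
 have vs: "v - s >= 0" using Sb(2) by (simp add: s_def)
 then have "v / 4 <= v / 4 + (v - s) / 2" by simp
 then have "v / 4 <= sqrt (v - s) * norm f" using up by (rule order_trans)
 then have "(v / 4)\<^sup>2 <= (sqrt (v - s) * norm f)\<^sup>2" by (rule power_mono) (use v in simp)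
 also have "... = (v - s) * sq f" using vs by (simp add: power_mult_distrib)
 also have "... <= (v - s) * (C1 * v)" by (rule mult_left_mono) (use f vs in "auto simp: v_def")
 finally have "v * v <= (16 * (v - s) * C1) * v" by (simp add: power2_eq_square power_divide mult_ac)
 then have "v <= 16 * (v - s) * C1" using v by (rule mult_right_le_imp_le)
 then have "v / (16 * C1) <= v - s" using C1 by (simp add: pos_divide_le_eq mult_ac)
 then have "s <= v - v / (16 * C1)" by linarith
 then show ?thesis unfolding s_def v_def by (simp add: left_diff_distrib)
qed

lemma norm_mean_le:
 "(NN x. ennreal (norm (Ek k f x)) * ic k z x) <= (NN x. ennreal (norm (fn f x)) * ic k z x)"
proof -
 obtain X where X: "!!k x. norm (Ek k f x) <= X k x"
   "!!k z. (NN x. ennreal (X k x) * ic k z x) = (NN x. ennreal (norm (fn f x)) * ic k z x)"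
  by (rule scalar_means[of f]) (rule that, assumption+)
 have "(NN x. ennreal (norm (Ek k f x)) * ic k z x) <= (NN x. ennreal (X k x) * ic k z x)"
  by (intro nn_integral_mono mult_right_mono ennreal_leI X) simp
 then show ?thesis unfolding X(2) .
qed

text \<open>A weak type estimate for the dyadic maximal function. The threshold is such that the set takes up half of the
proportion which \<open>low_mean_set\<close> leaves.\<close>

lemma large_mean_set:
 fixes f :: "('n::finite, 'm::finite) L2" and j K :: nat and z :: "int^'n"
 assumes C1: "C1 >= 1" and f: "sq f <= C1 * vol TYPE('n) j"
 defines "S \<equiv> hits j K (%k z'. norm (avgv k z' f) > 64 * C1\<^sup>2) Int cell j z"
 shows "(LI x. indicator S x) <= 1 / (32 * C1) * vol TYPE('n) j"
proof -
 define v where "v = vol TYPE('n) j"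
 have v: "v > 0" unfolding v_def by (rule vol_pos)
 have Se: "emeasure lborel S = ennreal (LI x. indicator S x)" unfolding S_def by (rule cell_subset_measure(2)[OF hits_borel])
 have [measurable]: "S : sets borel" unfolding S_def by auto
 define s where "s = (LI x. indicat_real S x)"
 have s0: "s >= 0" unfolding s_def by simp
 have "(NN x. ennreal (64 * C1\<^sup>2) * indicator S x) <= (NN x. ennreal (norm (fn f x)) * indicator S x)" unfolding S_def
 proof (rule stopping_mono_const)
  fix i and z' :: "int^'n" assume P: "norm (avgv i z' f) > 64 * C1\<^sup>2"
  have "(NN x. ennreal (64 * C1\<^sup>2) * ic i z' x) <= (NN x. ennreal (norm (Ek i f x)) * ic i z' x)"
   by (rule nn_integral_mono) (use P in "auto simp: indicator_def mem_cell Ek_def intro!: ennreal_leI")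
  also have "... <= (NN x. ennreal (norm (fn f x)) * ic i z' x)" by (rule norm_mean_le)
  finally show "(NN x. ennreal (64 * C1\<^sup>2) * ic i z' x) <= (NN x. ennreal (norm (fn f x)) * ic i z' x)" .
 qed auto
 also have "... <= (NN x. esq (fn f x) + ic j z x)"
 proof (rule nn_integral_mono)
  fix x
  have "norm (fn f x) <= sq (fn f x) + 1" using sum_squares_bound[of "norm (fn f x)" 1] by (simp add: power2_eq_square) (smt (verit) mult_nonneg_nonneg norm_ge_zero zero_le_square)
  then have "ennreal (norm (fn f x)) <= ennreal (sq (fn f x) + 1)" by (rule ennreal_leI)
  also have "... = esq (fn f x) + 1" by (simp add: ennreal_plus del: ennreal_power)
  finally show "ennreal (norm (fn f x)) * indicator S x <= esq (fn f x) + ic j z x" by (auto simp: S_def indicator_def)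
 qed
 also have "... = esq f + emeasure lborel (cell j z)" by (subst nn_integral_add) (auto simp: norm_L2_nn)
 also have "... = ennreal (sq f + v)" using v by (simp add: emeasure_cell v_def ennreal_plus del: ennreal_power)
 also have "(NN x. ennreal (64 * C1\<^sup>2) * indicator S x) = ennreal (64 * C1\<^sup>2 * s)"
  using s0 by (subst nn_integral_cmult_indicator) (auto simp: Se s_def ennreal_mult' ennreal_mult'')
 finally have "64 * C1\<^sup>2 * s <= sq f + v" using v by (subst (asm) ennreal_le_iff) auto
 also have "... <= C1 * v + C1 * v" using f C1 v by (intro add_mono) (auto simp: v_def)
 finally have "(32 * C1 * s) * (2 * C1) <= v * (2 * C1)" by (simp add: power2_eq_square mult_ac)
 then have "32 * C1 * s <= v" by (rule mult_right_le_imp_le) (use C1 in simp)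
 then show ?thesis using C1 unfolding s_def v_def by (simp add: pos_le_divide_eq mult_ac)
qed

lemma cone_measurable:
 fixes r :: "real^'n => complex^'m"
 assumes [measurable]: "r : bfun"
 shows "(%x. esq (r x) * indicator {x. norm (r x - norm (r x) *R \<nu>) <= \<epsilon> * norm (r x)} x) : bfun"
proof -
 have m: "(%x. norm (r x - norm (r x) *R \<nu>)) : bfun" "(%x. \<epsilon> * norm (r x)) : bfun" by measurable
 have "{x. norm (r x - norm (r x) *R \<nu>) <= \<epsilon> * norm (r x)} : sets borel"
  using borel_measurable_le[OF m] by (simp only: space_borel UNIV_I simp_thms)
 moreover have "(%x. esq (r x) * indicator S x) : bfun" if "S : sets borel" for S using that by measurable
 ultimately show ?thesis by blast
qed

text \<open>Downward induction on the level of the cube. Outside the stopping cubes the mean of \<open>f\<close> has a large component along \<open>\<nu>\<close>,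
hence \<open>|r| \<le> 4|r \<bullet> E f|\<close> for \<open>r\<close> in the cone around \<open>\<nu>\<close>, and the hypothesis on \<open>f\<close> applies. The stopping cubes cover a
proportion at most \<open>1 - 1/(32 C1)\<close>, and the induction hypothesis on them leaves a geometric series.\<close>

theorem carleson_from_tests:
 fixes r :: "nat => real^'n => complex^'m"
 assumes rm [measurable]: "!!k. r k : bfun"
  and C: "C1 >= 1" "C2 >= 0" "C3 >= 0" and \<nu>: "norm \<nu> = 1"
  and tests: "!!j z. j <= K ==> \<exists>f :: ('n::finite, 'm::finite) L2. sq f <= C1 * vol TYPE('n) j \<and> norm (avgv j z f - \<nu>) <= 1/4 \<and>
   (NN x. (\<Sum>k\<in>{j..K}. ennreal ((r k x \<bullet> Ek k f x)\<^sup>2)) * ic j z x) <= ennreal (C2 * vol TYPE('n) j)"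
  and loc: "!!k z. k <= K ==> (NN x. esq (r k x) * ic k z x) <= ennreal (C3 * vol TYPE('n) k)"
 defines "c \<equiv> %k x. esq (r k x) * indicator {x. norm (r k x - norm (r k x) *R \<nu>) <= 1 / (256 * C1\<^sup>2) * norm (r k x)} x"
 assumes jK: "j <= K"
 shows "(NN x. (\<Sum>k\<in>{j..K}. c k x) * ic j z x) <= ennreal (32 * C1 * (C3 + 16 * C2) * vol TYPE('n) j)"
 using jK
proof (induction "K - j" arbitrary: j z rule: less_induct)
 case less
 define A where "A = 32 * C1 * (C3 + 16 * C2)"
 have A0: "A >= 0" using C by (simp add: A_def)
 define v where "v = vol TYPE('n) j"
 have v: "v > 0" unfolding v_def by (rule vol_pos)
 have cm [measurable]: "c k : bfun" for k unfolding c_def by (rule cone_measurable[OF rm])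
 obtain f :: "('n, 'm) L2" where f: "sq f <= C1 * vol TYPE('n) j" "norm (avgv j z f - \<nu>) <= 1/4"
   "(NN x. (\<Sum>k\<in>{j..K}. ennreal ((r k x \<bullet> Ek k f x)\<^sup>2)) * ic j z x) <= ennreal (C2 * v)"
  using tests[OF less.prems, of z] unfolding v_def by (elim exE conjE)
 define P where "P k z' \<longleftrightarrow> \<nu> \<bullet> avgv k z' f < 1/2 \<or> norm (avgv k z' f) > 64 * C1\<^sup>2" for k z'
 have good: "c k x <= ennreal (16 * (r k x \<bullet> Ek k f x)\<^sup>2)" if nP: "\<not> P k (idx k x)" for k x
 proof (cases "norm (r k x - norm (r k x) *R \<nu>) <= 1 / (256 * C1\<^sup>2) * norm (r k x)")
  case True
  let ?r = "r k x" and ?E = "Ek k f x"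
  have E: "\<nu> \<bullet> ?E >= 1/2" "norm ?E <= 64 * C1\<^sup>2" using nP by (auto simp: P_def Ek_def)
  have "\<bar>(?r - norm ?r *R \<nu>) \<bullet> ?E\<bar> <= norm (?r - norm ?r *R \<nu>) * norm ?E" by (rule Cauchy_Schwarz_ineq2)
  also have "... <= (1 / (256 * C1\<^sup>2) * norm ?r) * (64 * C1\<^sup>2)" by (rule mult_mono[OF True E(2)]) (use C in auto)
  also have "... = norm ?r / 4" using C by (simp add: field_simps)
  finally have 1: "\<bar>?r \<bullet> ?E - norm ?r * (\<nu> \<bullet> ?E)\<bar> <= norm ?r / 4" by (simp add: inner_simps)
  have "norm ?r * (1/2) <= norm ?r * (\<nu> \<bullet> ?E)" by (rule mult_left_mono[OF E(1)]) simp
  with 1 have "norm ?r <= 4 * \<bar>?r \<bullet> ?E\<bar>" by linarith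
  then have "(norm ?r)\<^sup>2 <= (4 * \<bar>?r \<bullet> ?E\<bar>)\<^sup>2" by (rule power_mono) simp
  then have "(norm ?r)\<^sup>2 <= 16 * (?r \<bullet> ?E)\<^sup>2" by (simp add: power_mult_distrib)
  then show ?thesis using True unfolding c_def by (simp add: ennreal_leI del: ennreal_power)
 qed (simp add: c_def)
 define G where "G x = (\<Sum>k\<in>{j..K}. ennreal (16 * (r k x \<bullet> Ek k f x)\<^sup>2))" for x
 let ?T = "%x. \<Sum>i\<in>{j<..K}. (\<Sum>k\<in>{i..K}. c k x) * indicator (first_hit j P i) x"
 let ?e = "%k x. (r k x \<bullet> Ek k f x)\<^sup>2"
 have ptw: "(\<Sum>k\<in>{j..K}. c k x) <= c j x + G x + ?T x" for x
 proof (cases "x : hits j K P")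
  case False
  have "(\<Sum>k\<in>{j..K}. c k x) = c j x + (\<Sum>k\<in>{j<..K}. c k x)" using less.prems by (simp add: sum.head)
  also have "(\<Sum>k\<in>{j<..K}. c k x) <= (\<Sum>k\<in>{j<..K}. ennreal (16 * ?e k x))"
   by (rule sum_mono) (rule good, use False in \<open>auto simp: hits_def\<close>)
  also have "... <= G x" unfolding G_def by (rule sum_mono2) auto
  finally show ?thesis by (auto intro: order_trans add_increasing2)
 next
  case True
  obtain i where i: "j < i" "i <= K" "x : first_hit j P i" using hits_first_hit[OF True] .
  have "{j..K} = insert j ({j<..<i} \<union> {i..K})" using i by auto
  moreover have "(\<Sum>k\<in>{j<..<i} \<union> {i..K}. c k x) = (\<Sum>k\<in>{j<..<i}. c k x) + (\<Sum>k\<in>{i..K}. c k x)"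
   by (rule sum.union_disjoint) auto
  ultimately have "(\<Sum>k\<in>{j..K}. c k x) = c j x + ((\<Sum>k\<in>{j<..<i}. c k x) + (\<Sum>k\<in>{i..K}. c k x))"
   using i by simp
  also have "(\<Sum>k\<in>{j<..<i}. c k x) <= (\<Sum>k\<in>{j<..<i}. ennreal (16 * ?e k x))"
   by (rule sum_mono) (rule good, use i in \<open>auto simp: first_hit_def\<close>)
  also have "... <= G x" unfolding G_def by (rule sum_mono2) (use i in auto)
  also have "(\<Sum>k\<in>{i..K}. c k x) = (\<Sum>k\<in>{i..K}. c k x) * indicator (first_hit j P i) x" using i by simp
  also have "... <= ?T x"
   by (rule member_le_sum[where f = "%i. (\<Sum>k\<in>{i..K}. c k x) * indicator (first_hit j P i) x"]) (use i in auto)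
  finally show ?thesis by (simp add: add.assoc)
 qed
 define S where "S = hits j K P Int cell j z"
 have Sm: "(LI x. indicat_real S x) <= (1 - 1 / (32 * C1)) * v"
 proof -
  define S1 where "S1 = hits j K (%k z'. \<nu> \<bullet> avgv k z' f < 1/2) Int cell j z"
  define S2 where "S2 = hits j K (%k z'. norm (avgv k z' f) > 64 * C1\<^sup>2) Int cell j z"
  have b: "bbs (indicator S)" "bbs (indicator S1)" "bbs (indicator S2)"
   unfolding S_def S1_def S2_def by (rule cell_subset_measure(1)[OF hits_borel])+
  have "(LI x. indicat_real S x) <= (LI x. indicat_real S1 x + indicat_real S2 x)"
  proof (rule integral_mono[OF bbs_integrable_real[OF b(1)] Bochner_Integration.integrable_add[OF bbs_integrable_real[OF b(2)] bbs_integrable_real[OF b(3)]]])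
   fix x
   have "S \<subseteq> S1 \<union> S2" unfolding S_def S1_def S2_def P_def hits_def by blast
   then show "indicat_real S x <= indicat_real S1 x + indicat_real S2 x" by (auto simp: indicator_def)
  qed
  also have "... = (LI x. indicat_real S1 x) + (LI x. indicat_real S2 x)"
   using bbs_integrable_real[OF b(2)] bbs_integrable_real[OF b(3)] by simp
  also have "... <= (1 - 1 / (16 * C1)) * v + 1 / (32 * C1) * v"
   unfolding S1_def S2_def v_def by (intro add_mono low_mean_set[OF \<nu> C(1) f(1,2)] large_mean_set[OF C(1) f(1)])
  also have "... = (1 - 1 / (32 * C1)) * v" using C(1) by (simp add: field_simps)
  finally show ?thesis .
 qed
 have Se: "emeasure lborel S = ennreal (LI x. indicator S x)" unfolding S_def by (rule cell_subset_measure(2)[OF hits_borel])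
 have [measurable]: "S : sets borel" unfolding S_def by auto
 have Gm [measurable]: "G : bfun" unfolding G_def[abs_def] by measurable
 have T1: "(NN x. c j x * ic j z x) <= ennreal (C3 * v)"
 proof -
  have "(NN x. c j x * ic j z x) <= (NN x. esq (r j x) * ic j z x)"
   by (rule nn_integral_mono) (auto simp: c_def indicator_def)
  also have "... <= ennreal (C3 * v)" unfolding v_def by (rule loc[OF less.prems])
  finally show ?thesis .
 qed
 have T2: "(NN x. G x * ic j z x) <= ennreal (16 * C2 * v)"
 proof -
  have "(NN x. G x * ic j z x) = (NN x. ennreal 16 * ((\<Sum>k\<in>{j..K}. ennreal (?e k x)) * ic j z x))"
   by (rule nn_integral_cong) (simp only: G_def ennreal_mult zero_le_numeral zero_le_power2 sum_distrib_left mult.assoc[symmetric])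
  also have "... = ennreal 16 * (NN x. (\<Sum>k\<in>{j..K}. ennreal (?e k x)) * ic j z x)"
   by (rule nn_integral_cmult) measurable
  also have "... <= ennreal 16 * ennreal (C2 * v)" by (rule mult_left_mono[OF f(3)]) simp
  also have "... = ennreal (16 * C2 * v)" using C v by (simp add: ennreal_mult[symmetric] mult.assoc del: ennreal_numeral)
  finally show ?thesis .
 qed
 have T3: "(NN x. ?T x * ic j z x) <= ennreal (A * ((1 - 1 / (32 * C1)) * v))"
 proof -
  have "(NN x. ?T x * ic j z x)
   <= (NN x. ennreal A * indicator (hits j K P Int cell j z) x)"
  proof (rule stopping_mono)
   fix i and z' :: "int^'n" assume i: "j < i" "i <= K"
   have "(NN x. (\<Sum>k\<in>{i..K}. c k x) * ic i z' x) <= ennreal (A * vol TYPE('n) i)"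
    unfolding A_def by (rule less.hyps) (use i in auto)
   also have "... = (NN x. ennreal A * ic i z' x)"
    using A0 by (subst nn_integral_cmult_indicator) (auto simp: emeasure_cell ennreal_mult')
   finally show "(NN x. (\<Sum>k\<in>{i..K}. c k x) * ic i z' x) <= (NN x. ennreal A * ic i z' x)" .
  qed auto
  also have "... = ennreal A * emeasure lborel S" unfolding S_def[symmetric] by (rule nn_integral_cmult_indicator) simp
  also have "... <= ennreal A * ennreal ((1 - 1 / (32 * C1)) * v)" unfolding Se by (rule mult_left_mono[OF ennreal_leI[OF Sm]]) simp
  also have "... = ennreal (A * ((1 - 1 / (32 * C1)) * v))" using A0 by (rule ennreal_mult'[symmetric])
  finally show ?thesis .
 qed
 have "(NN x. (\<Sum>k\<in>{j..K}. c k x) * ic j z x)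
  <= (NN x. c j x * ic j z x + G x * ic j z x + ?T x * ic j z x)"
  by (rule nn_integral_mono) (use ptw in "auto simp: indicator_def")
 also have "... = (NN x. c j x * ic j z x) + (NN x. G x * ic j z x)
   + (NN x. ?T x * ic j z x)" by (subst nn_integral_add, measurable, subst nn_integral_add, measurable)
 also have "... <= ennreal (C3 * v) + ennreal (16 * C2 * v) + ennreal (A * ((1 - 1 / (32 * C1)) * v))"
  by (intro add_mono T1 T2 T3)
 also have "... = ennreal (C3 * v + 16 * C2 * v + A * ((1 - 1 / (32 * C1)) * v))" using C v A0 by (simp add: ennreal_plus)
 also have "C3 * v + 16 * C2 * v + A * ((1 - 1 / (32 * C1)) * v) = A * v" using C(1) by (simp add: A_def field_simps)
 finally show ?case by (simp add: A_def v_def)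
qed

section \<open>Polynomial weights\<close>

lemma decay_integral:
 "\<exists>I\<ge>0. (NN x. ennreal (inverse ((1 + sq (x :: real^'n)) ^ Suc CARD('n)))) <= ennreal I"
proof -
 let ?n = "CARD('n)"
 define C where "C j = 4 ^ Suc ?n * ((tk j)\<^sup>2) ^ Suc ?n" for j
 have C0: "C j >= 0" for j by (simp add: C_def)
 define Q where "Q j = cube (- vec (2^j) :: real^'n) (2 * 2^j)" for j :: nat
 have pt: "ennreal (inverse ((1 + sq x) ^ Suc ?n)) <= (\<Sum>j. ennreal (C j) * indicator (Q j) x)" for x :: "real^'n"
 proof -
  have ex: "\<exists>j. norm x < 2^j" using real_arch_pow[of 2 "norm x"] by auto
  define j where "j = (LEAST j. norm x < 2^j)"
  have j: "norm x < 2^j" unfolding j_def by (rule LeastI_ex[OF ex])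
  have "inverse ((1 + sq x) ^ Suc ?n) <= C j"
  proof (cases j)
   case 0
   have "inverse ((1 + sq x) ^ Suc ?n) <= 1" by (simp add: inverse_le_1_iff one_le_power del: power_Suc)
   also have "... <= 4 ^ Suc ?n" by (rule one_le_power) simp
   finally show ?thesis by (simp add: 0 C_def tk_def)
  next
   case (Suc i)
   have i: "norm x >= 2^i" using not_less_Least[of i "%j. norm x < 2^j"] Suc unfolding j_def[symmetric] by simp
   have b: "4 * (tk j)\<^sup>2 = inverse ((2^i)\<^sup>2)"
    by (simp add: Suc tk_def power_divide power_mult_distrib field_simps power2_eq_square)
   have "(2^i)\<^sup>2 <= sq x" by (rule power_mono[OF i]) simp
   then have "(2^i)\<^sup>2 <= 1 + sq x" by linarith
   then have "inverse (1 + sq x) <= inverse ((2^i)\<^sup>2)" by (rule le_imp_inverse_le) simp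
   then have "inverse (1 + sq x) ^ Suc ?n <= (4 * (tk j)\<^sup>2) ^ Suc ?n" unfolding b by (rule power_mono) simp
   then show ?thesis unfolding C_def power_mult_distrib power_inverse .
  qed
  moreover have "x : Q j"
  proof -
   have "\<bar>x $ i\<bar> < 2^j" for i using component_le_norm_cart[of x i] j by linarith
   then have "- (2^j) <= x $ i \<and> x $ i < - (2^j) + 2 * 2^j" for i
    using abs_less_iff[of "x $ i" "2^j"] by (metis add.commute add_le_cancel_left add_uminus_conv_diff less_eq_real_def minus_less_iff mult_2 add_diff_cancel_right')
   then show ?thesis by (simp add: Q_def cube_def)
  qed
  ultimately have "ennreal (inverse ((1 + sq x) ^ Suc ?n)) <= ennreal (C j) * indicator (Q j) x" by (simp add: ennreal_leI)
  also have "... <= (\<Sum>j. ennreal (C j) * indicator (Q j) x)"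
  proof -
   define T where "T j = ennreal (C j) * indicator (Q j) x" for j
   have "T j <= (\<Sum>j. T j)" using sum_le_suminf[OF summableI, of "{j}" T] by simp
   then show ?thesis by (simp only: T_def)
  qed
  finally show ?thesis .
 qed
 define A where "A = 4 ^ Suc ?n * (2::real) ^ ?n"
 have A0: "A >= 0" by (simp add: A_def)
 have "(NN x. ennreal (inverse ((1 + sq (x :: real^'n)) ^ Suc ?n))) <= (NN (x :: real^'n). (\<Sum>j. ennreal (C j) * indicator (Q j) x))"
  by (rule nn_integral_mono) (rule pt)
 also have "... = (\<Sum>j. \<integral>\<^sup>+(x :: real^'n). ennreal (C j) * indicator (Q j) x \<partial>lborel)"
  by (rule nn_integral_suminf) (simp add: Q_def)
 also have "... <= (\<Sum>j. ennreal (A * (1/2)^j))"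
 proof (rule suminf_le)
  fix j
  have "(NN (x :: real^'n). ennreal (C j) * indicator (Q j) x) = ennreal (C j) * ennreal ((2 * 2^j) ^ ?n)"
   unfolding Q_def by (subst nn_integral_cmult_indicator) (auto simp: emeasure_cube)
  also have "... = ennreal (C j * (2 * 2^j) ^ ?n)" using C0 by (simp add: ennreal_mult')
  also have "C j * (2 * 2^j) ^ ?n = A * (tk j * (tk j * (tk j * 2^j) ^ ?n * tk j ^ ?n))"
   by (simp add: C_def A_def power_mult_distrib power2_eq_square mult_ac)
  also have "... <= A * (tk j * 1)"
  proof (intro mult_left_mono)
   have "tk j * tk j ^ ?n <= 1 * 1" by (rule mult_mono) (auto simp: tk_le_1 power_le_one less_imp_le)
   then show "tk j * (tk j * 2^j) ^ ?n * tk j ^ ?n <= 1" by (simp add: tk_inv)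
  qed (use A0 in "auto simp: less_imp_le")
  finally show "(NN (x :: real^'n). ennreal (C j) * indicator (Q j) x) <= ennreal (A * (1/2)^j)"
   by (simp add: tk_def ennreal_leI)
 qed auto
 also have "... = ennreal (A * 2)"
  by (rule suminf_ennreal_eq) (use A0 geometric_sums[of "1/2 :: real"] in \<open>auto intro!: sums_mult\<close>)
 finally show ?thesis using A0 by (intro exI[of _ "A * 2"]) simp
qed

lemma weight_integral:
 assumes c: "0 < c" "c <= 1"
 shows "\<exists>I\<ge>0. \<forall>t>0. \<forall>a. (NN x. ennreal ((1 + (norm (x - a) / t)\<^sup>2) * (weight (c / t) (Suc CARD('n)) a (x :: real^'n))\<^sup>2)) <= ennreal (I * t ^ CARD('n))"
proof -
 let ?n = "CARD('n)"
 obtain I where I: "I >= 0" "(NN x. ennreal (inverse ((1 + sq (x :: real^'n)) ^ Suc ?n))) <= ennreal I"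
  using decay_integral by blast
 define q where "q x = inverse ((1 + sq (x :: real^'n)) ^ Suc ?n)" for x
 have [measurable]: "q : bfun" unfolding q_def[abs_def] by measurable
 define M where "M = inverse ((c\<^sup>2) ^ Suc ?n)"
 have "(NN x. ennreal ((1 + (norm (x - a) / t)\<^sup>2) * (weight (c / t) (Suc ?n) a x)\<^sup>2)) <= ennreal (M\<^sup>2 * I * t ^ ?n)"
  if t: "t > 0" for t and a :: "real^'n"
 proof -
  have pt: "(1 + (norm (x - a) / t)\<^sup>2) * (weight (c / t) (Suc ?n) a x)\<^sup>2 <= M\<^sup>2 * q ((1 / t) *R (x + (- a)))" for x
  proof -
   define r where "r = (norm (x - a) / t)\<^sup>2"
   have r0: "r >= 0" by (simp add: r_def)
   have qr: "q ((1 / t) *R (x + (- a))) = inverse ((1 + r) ^ Suc ?n)" using t by (simp add: q_def r_def power_divide)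
   have w: "weight (c / t) (Suc ?n) a x = inverse ((1 + c\<^sup>2 * r) ^ Suc ?n)"
    by (simp add: weight_def r_def power_divide)
   have "c\<^sup>2 <= 1" using c by (simp add: power_le_one)
   then have "c\<^sup>2 * (1 + r) <= 1 + c\<^sup>2 * r" by (simp add: distrib_left)
   then have "(c\<^sup>2 * (1 + r)) ^ Suc ?n <= (1 + c\<^sup>2 * r) ^ Suc ?n" by (rule power_mono) (use r0 in simp)
   then have "inverse ((1 + c\<^sup>2 * r) ^ Suc ?n) <= inverse ((c\<^sup>2 * (1 + r)) ^ Suc ?n)"
    by (rule le_imp_inverse_le) (use c r0 in simp)
   also have "... = M * inverse ((1 + r) ^ Suc ?n)" by (simp only: M_def power_mult_distrib inverse_mult_distrib)
   finally have "(weight (c / t) (Suc ?n) a x)\<^sup>2 <= (M * inverse ((1 + r) ^ Suc ?n))\<^sup>2"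
    unfolding w by (rule power_mono) (use r0 in simp)
   then have "(1 + r) * (weight (c / t) (Suc ?n) a x)\<^sup>2 <= (1 + r) * (M * inverse ((1 + r) ^ Suc ?n))\<^sup>2"
    by (rule mult_left_mono) (use r0 in simp)
   also have "... = M\<^sup>2 * inverse ((1 + r) ^ Suc ?n) * ((1 + r) * inverse ((1 + r) ^ Suc ?n))"
    by (simp only: power2_eq_square mult_ac)
   also have "... <= M\<^sup>2 * inverse ((1 + r) ^ Suc ?n) * 1"
   proof (rule mult_left_mono)
    have "(1 + r) * inverse ((1 + r) ^ Suc ?n) = inverse ((1 + r) ^ ?n)"
     unfolding power_Suc inverse_mult_distrib mult.assoc[symmetric] using r0 by simp
    also have "... <= 1" using r0 by (simp add: inverse_le_1_iff one_le_power)
    finally show "(1 + r) * inverse ((1 + r) ^ Suc ?n) <= 1" .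
   qed (use r0 in simp)
   finally show ?thesis unfolding qr r_def by simp
  qed
  have "(NN x. ennreal ((1 + (norm (x - a) / t)\<^sup>2) * (weight (c / t) (Suc ?n) a x)\<^sup>2))
    <= (NN x. ennreal (M\<^sup>2 * q ((1 / t) *R (x + (- a)))))" by (intro nn_integral_mono ennreal_leI pt)
  also have "... = (NN x. ennreal (M\<^sup>2 * q ((1 / t) *R x)))" by (rule nn_integral_shift) measurable
  also have "... = ennreal (t ^ ?n) * (NN x. ennreal (M\<^sup>2 * q x))" using t by (subst nn_integral_scale[of _ t]) auto
  also have "(NN x. ennreal (M\<^sup>2 * q x)) = ennreal (M\<^sup>2) * (NN x. ennreal (q x))"
   by (subst nn_integral_cmult[symmetric]) (auto simp: ennreal_mult' simp del: ennreal_power)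
  also have "ennreal (t ^ ?n) * (ennreal (M\<^sup>2) * (NN x. ennreal (q x))) <= ennreal (t ^ ?n) * (ennreal (M\<^sup>2) * ennreal I)"
   by (intro mult_left_mono) (use I(2) in "auto simp: q_def")
  also have "... = ennreal (M\<^sup>2 * I * t ^ ?n)"
   using I(1) t by (simp add: ennreal_mult[symmetric] mult_ac del: ennreal_power)
  finally show ?thesis .
 qed
 then show ?thesis using I(1) by (intro exI[of _ "M\<^sup>2 * I"]) auto
qed

lemma weight_compare:
 assumes c: "0 <= c" "c <= 1" and t: "t > 0" and d: "norm (y - a) <= M * t"
 shows "weight (c / t) N a x <= (2 + 2 * M\<^sup>2) ^ N * weight (c / t) N y x"
proof -
 define A where "A = 1 + (c / t)\<^sup>2 * sq (x - a)"
 define Y where "Y = 1 + (c / t)\<^sup>2 * sq (x - y)"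
 have A: "A >= 1" and Y: "Y >= 1" by (simp_all add: A_def Y_def)
 have "norm (x - y) <= norm (x - a) + norm (y - a)" using norm_triangle_ineq4[of "x - a" "y - a"] by simp
 then have "sq (x - y) <= (norm (x - a) + norm (y - a))\<^sup>2" by (rule power_mono) simp
 also have "... <= 2 * sq (x - a) + 2 * sq (y - a)"
  using sum_squares_bound[of "norm (x - a)" "norm (y - a)"] by (simp add: power2_sum)
 also have "sq (y - a) <= (M * t)\<^sup>2" by (rule power_mono[OF d]) simp
 finally have "(c / t)\<^sup>2 * sq (x - y) <= (c / t)\<^sup>2 * (2 * sq (x - a) + 2 * (M * t)\<^sup>2)"
  by (intro mult_left_mono) auto
 also have "... = 2 * ((c / t)\<^sup>2 * sq (x - a)) + 2 * (c\<^sup>2 * M\<^sup>2)"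
  using t by (simp add: power_divide power_mult_distrib field_simps)
 also have "c\<^sup>2 * M\<^sup>2 <= 1 * M\<^sup>2" by (rule mult_right_mono) (use c in "auto simp: power_le_one")
 finally have "Y <= 1 + 2 * ((c / t)\<^sup>2 * sq (x - a)) + 2 * M\<^sup>2" by (simp add: Y_def)
 also have "... <= (2 + 2 * M\<^sup>2) * A" by (simp add: A_def distrib_left distrib_right)
 finally have "Y ^ N <= ((2 + 2 * M\<^sup>2) * A) ^ N" by (rule power_mono) (use Y in simp)
 then have "Y ^ N <= (2 + 2 * M\<^sup>2) ^ N * A ^ N" by (simp add: power_mult_distrib)
 moreover have "A ^ N > 0" "Y ^ N > 0" using A Y by auto
 ultimately have "inverse (A ^ N) <= (2 + 2 * M\<^sup>2) ^ N * inverse (Y ^ N)" by (simp add: field_simps)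
 then show ?thesis by (simp add: weight_def A_def Y_def)
qed

lemma weight_center: "weight c N y x = weight c N 0 (x - y)" by (simp add: weight_def)

lemma mult_linear:
 assumes b: "bm \<omega>"
 shows mult_add: "mult \<omega> (u + v) = mult \<omega> u + mult \<omega> v" and mult_diff: "mult \<omega> (u - v) = mult \<omega> u - mult \<omega> v"
  and mult_scaleR: "mult \<omega> (r *R u) = r *R mult \<omega> u"
proof -
 show "mult \<omega> (u + v) = mult \<omega> u + mult \<omega> v"
 by (rule L2_eqI, use fn_mult[OF b, of "u + v"] fn_add[of u v] fn_add[of "mult \<omega> u" "mult \<omega> v"] fn_mult[OF b, of u] fn_mult[OF b, of v] in eventually_elim) (simp add: scaleR_add_right)
 show "mult \<omega> (u - v) = mult \<omega> u - mult \<omega> v"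
 by (rule L2_eqI, use fn_mult[OF b, of "u - v"] fn_diff[of u v] fn_diff[of "mult \<omega> u" "mult \<omega> v"] fn_mult[OF b, of u] fn_mult[OF b, of v] in eventually_elim) (simp add: scaleR_diff_right)
 show "mult \<omega> (r *R u) = r *R mult \<omega> u"
 by (rule L2_eqI, use fn_mult[OF b, of "r *R u"] fn_scaleR[of r u] fn_scaleR[of r "mult \<omega> u"] fn_mult[OF b, of u] in eventually_elim) simp
qed

lemma weight_bm: "bm (weight c N a)" unfolding bm_def
proof
 show "weight c N a : bfun" by (rule smooth_measurable[OF smooth_weight])
 show "\<exists>M. \<forall>x. \<bar>weight c N a x\<bar> <= M"
  using weight_range[of c N a] by (intro exI[of _ 1]) (simp add: abs_of_pos)
qed

lemma fn_tw: "bbs \<phi> ==> AE x in lborel. fn (tw \<phi> w) x = \<phi> x *R w"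
 unfolding tw_def by (rule fn_mk[OF bbs_sqint])

lemma avgv_tw:
 assumes A: "A : sets borel" "bounded A" "cell k z \<subseteq> A"
 shows "avgv k z (tw (indicator A) w :: ('n::finite, 'm::finite) L2) = w"
proof -
 have "(LI x. indicat_real (cell k z) x * indicat_real A x) = (LI x. indicat_real (cell k z) x)"
  by (rule Bochner_Integration.integral_cong) (use A(3) in "auto simp: indicator_def")
 then have "distribution (tw (indicator A) w :: ('n, 'm) L2) (ic k z) = vol TYPE('n) k *R w"
  unfolding distribution_tw[OF bbs_cell bbs_indicator[OF A(1,2)]] integral_cell by simp
 then show ?thesis using vol_pos[where 'n = 'n, of k] by (simp add: avgv_def)
qed

text \<open>The oscillation of \<open>g\<close> around its dyadic means, measured with weights decaying away from the
 cube: Jensen's inequality bounds it by differences \<open>g(y + h) - g(y)\<close>, which the gradient controls.\<close>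

lemma oscillation_bound:
 assumes c: "0 < c" "c <= 1"
 shows "\<exists>C\<ge>0. \<forall>k (g :: ('n::finite, 'm::finite) L2) G. has_weak_gradient g G \<longrightarrow>
  (\<integral>\<^sup>+z. (NN x. ennreal ((weight (c / tk k) (Suc CARD('n)) (corner k z) x)\<^sup>2 *
    sq (fn g x - indicator (ball (corner k z) (1 + real CARD('n))) x *R avgv k z g))) \<partial>count_space UNIV)
   <= ennreal (C * (tk k)\<^sup>2 * ((\<Sum>j\<in>UNIV. norm (G $ j))\<^sup>2 + sq g))"
proof -
 let ?N = "Suc CARD('n)" and ?n = "CARD('n)"
 obtain I where I: "I >= 0" "!!t a. t > 0 ==> (NN x. ennreal ((1 + (norm (x - a) / t)\<^sup>2) * (weight (c / t) ?N a (x :: real^'n))\<^sup>2)) <= ennreal (I * t ^ ?n)"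
  using weight_integral[OF c, where 'n = 'n] by blast
 define M where "M = (2 + 2 * (real ?n)\<^sup>2) ^ ?N"
 have M0: "M >= 0" by (simp add: M_def)
 have "(\<integral>\<^sup>+z. (NN x. ennreal ((weight (c / tk k) ?N (corner k z) x)\<^sup>2 *
    sq (fn g x - indicator (ball (corner k z) (1 + real ?n)) x *R avgv k z g))) \<partial>count_space UNIV)
   <= ennreal (M\<^sup>2 * I * (tk k)\<^sup>2 * ((\<Sum>j\<in>UNIV. norm (G $ j))\<^sup>2 + sq g))"
  if wg: "has_weak_gradient g G" for k and g :: "('n, 'm) L2" and G
 proof -
  let ?d = "%z x. sq (fn g x - indicator (ball (corner k z) (1 + real ?n)) x *R avgv k z g)"
  define t where "t = tk k"
  have t: "t > 0" "t <= 1" by (simp_all add: t_def tk_le_1)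
  define v where "v = vol TYPE('n) k"
  have v: "v > 0" unfolding v_def by (rule vol_pos)
  have vt: "v = t ^ ?n" by (simp add: v_def vol_def t_def)
  define V where "V = (\<Sum>j\<in>UNIV. norm (G $ j))\<^sup>2 + sq g"
  have V0: "V >= 0" by (simp add: V_def)
  define w where "w = weight (c / t) ?N (0 :: real^'n)"
  have [measurable]: "w : bfun" unfolding w_def by (rule smooth_measurable[OF smooth_weight])
  have [measurable]: "weight (c / t) ?N a : bfun" for a :: "real^'n" by (rule smooth_measurable[OF smooth_weight])
  have [measurable]: "ball a r : sets borel" for a :: "real^'n" and r by (rule borel_open[OF open_ball])
  define F where "F x y = sq (fn g x - fn g y) + indicator {h. norm h >= 1} (x - y) * sq (fn g x)" for x y
  have F0: "F x y >= 0" for x y by (simp add: F_def)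
  have [measurable]: "{h :: real^'n. norm h >= 1} : sets borel" by measurable
  have Fm [measurable]: "(%p. F (fst p) (snd p)) : borel_measurable (lborel \<Otimes>\<^sub>M lborel)" unfolding F_def by measurable
  have Fm1 [measurable]: "F x : bfun" for x unfolding F_def[abs_def] by measurable
  have Fm2 [measurable]: "(%x. F x y) : bfun" for y unfolding F_def[abs_def] by measurable
  define H where "H y = (NN x. ennreal ((w (x - y))\<^sup>2 * F x y))" for y
  have Hm [measurable]: "H : bfun"
  proof -
   have "(%y. \<integral>\<^sup>+x. ennreal ((w (x - y))\<^sup>2 * F (fst (x, y)) (snd (x, y))) \<partial>lborel) : borel_measurable lborel" by measurable
   then show ?thesis by (simp add: H_def[abs_def])
  qed
  have jensen: "ennreal (v * (?d z x))
    <= (NN y. ennreal (F x y) * ic k z y)" for x and z :: "int^'n"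
  proof (cases "x : ball (corner k z) (1 + real ?n)")
   case True
   define u where "u = tw (ic k z) (fn g x) - g"
   have "bounded (cell k z)" unfolding cell_def by (rule bounded_cube)
   then have "avgv k z u = fn g x - avgv k z g" unfolding u_def avgv_diff by (subst avgv_tw) auto
   then have "ennreal (v * sq (fn g x - avgv k z g)) <= esq (mult (ic k z) u)"
    using avgv_bound[of k z u] unfolding v_def by (metis ennreal_leI)
   also have "... = (NN y. esq (fn u y) * ic k z y)" by (rule norm_mult_indicator) simp
   also have "... = (NN y. esq (fn g x - fn g y) * ic k z y)"
   proof (rule nn_integral_cong_AE)
    show "AE y in lborel. esq (fn u y) * ic k z y = esq (fn g x - fn g y) * ic k z y"
     using fn_diff[of "tw (ic k z) (fn g x)" g] fn_tw[OF bbs_cell, of k z "fn g x"]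
     unfolding u_def by eventually_elim (auto simp: indicator_def)
   qed
   also have "... <= (NN y. ennreal (F x y) * ic k z y)"
    by (intro nn_integral_mono mult_right_mono ennreal_leI) (auto simp: F_def)
   finally show ?thesis using True by simp
  next
   case False
   have far: "norm (x - y) >= 1" if y: "y : cell k z" for y
   proof -
    have "norm (x - corner k z) >= 1 + real ?n" using False by (simp add: dist_norm norm_minus_commute)
    moreover have "norm (y - corner k z) <= real ?n * t" unfolding t_def by (rule cell_norm[OF y])
    moreover have "real ?n * t <= real ?n * 1" by (rule mult_left_mono) (use t in auto)
    moreover have "norm (x - corner k z) <= norm (x - y) + norm (y - corner k z)"
     using norm_triangle_ineq[of "x - y" "y - corner k z"] by simp
    ultimately show ?thesis by linarith
   qed
   have "ennreal (v * sq (fn g x)) = esq (fn g x) * emeasure lborel (cell k z)"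
    using v by (simp add: emeasure_cell v_def ennreal_mult' mult.commute del: ennreal_power)
   also have "... = (NN y. esq (fn g x) * ic k z y)" by (rule nn_integral_cmult_indicator[symmetric]) simp
   also have "... <= (NN y. ennreal (F x y) * ic k z y)"
    by (rule nn_integral_mono) (use far in "auto simp: F_def indicator_def intro!: ennreal_leI")
   finally show ?thesis using False by simp
  qed
  define L where "L z = (NN x. ennreal ((weight (c / t) ?N (corner k z) x)\<^sup>2 *
    (?d z x)))" for z :: "int^'n"
  let ?k = "%x y. ennreal ((w (x - y))\<^sup>2 * F (fst (x, y)) (snd (x, y)))"
  have Lz: "ennreal v * L z <= ennreal (M\<^sup>2) * (NN y. H y * ic k z y)" for z
  proof -
   have "ennreal v * L z = (NN x. ennreal v * ennreal ((weight (c / t) ?N (corner k z) x)\<^sup>2 *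
    (?d z x)))" unfolding L_def
   proof (rule nn_integral_cmult[symmetric])
    have "(%x. indicat_real (ball (corner k z) (1 + real ?n)) x *R avgv k z g) : bfun"
     by (intro borel_measurable_scaleR borel_measurable_indicator borel_measurable_const borel_open open_ball)
    then show "(%x. ennreal ((weight (c / t) ?N (corner k z) x)\<^sup>2 *
     (?d z x))) : borel_measurable lborel" by measurable
   qed
   also have "... <= (NN x. (NN y. ennreal (M\<^sup>2) * (?k x y * ic k z y)))"
   proof (rule nn_integral_mono)
    fix x :: "real^'n"
    let ?W = "weight (c / t) ?N (corner k z) x"
    let ?d = "(?d z x)"
    have "ennreal v * ennreal (?W\<^sup>2 * ?d) = ennreal (?W\<^sup>2) * ennreal (v * ?d)"
     using v by (simp add: ennreal_mult[symmetric] mult_ac del: ennreal_power)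
    also have "... <= ennreal (?W\<^sup>2) * (NN y. ennreal (F x y) * ic k z y)" by (rule mult_left_mono[OF jensen]) simp
    also have "... = (NN y. ennreal (?W\<^sup>2) * (ennreal (F x y) * ic k z y))"
     by (rule nn_integral_cmult[symmetric]) measurable
    also have "... <= (NN y. ennreal (M\<^sup>2) * (ennreal ((w (x - y))\<^sup>2 * F x y) * ic k z y))"
    proof (rule nn_integral_mono)
     fix y :: "real^'n"
     show "ennreal (?W\<^sup>2) * (ennreal (F x y) * ic k z y) <= ennreal (M\<^sup>2) * (ennreal ((w (x - y))\<^sup>2 * F x y) * ic k z y)"
     proof (cases "y : cell k z")
      case True
      have "?W <= M * weight (c / t) ?N y x"
       unfolding M_def by (rule weight_compare) (use c t cell_norm[OF True] in "auto simp: t_def")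
      also have "weight (c / t) ?N y x = w (x - y)" unfolding w_def by (rule weight_center)
      finally have "?W\<^sup>2 <= (M * w (x - y))\<^sup>2" by (rule power_mono) (simp add: weight_range less_imp_le)
      then have "?W\<^sup>2 * F x y <= M\<^sup>2 * ((w (x - y))\<^sup>2 * F x y)"
       using mult_right_mono[OF _ F0[of x y]] by (simp add: power_mult_distrib mult.assoc[symmetric])
      then have "ennreal (?W\<^sup>2 * F x y) <= ennreal (M\<^sup>2 * ((w (x - y))\<^sup>2 * F x y))" by (rule ennreal_leI)
      then show ?thesis using True F0[of x y] by (simp add: ennreal_mult' del: ennreal_power)
     qed simp
    qed
    finally show "ennreal v * ennreal (?W\<^sup>2 * ?d) <= (NN y. ennreal (M\<^sup>2) * (?k x y * ic k z y))" by simp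
   qed
   also have "... = (NN y. (NN x. ennreal (M\<^sup>2) * (?k x y * ic k z y)))" by (rule lborel_pair.Fubini') measurable
   also have "... = (NN y. ennreal (M\<^sup>2) * (H y * ic k z y))"
   proof (rule nn_integral_cong)
    fix y :: "real^'n"
    have "(NN x. (ennreal (M\<^sup>2) * ic k z y) * ennreal ((w (x - y))\<^sup>2 * F x y)) = (ennreal (M\<^sup>2) * ic k z y) * H y"
     unfolding H_def by (rule nn_integral_cmult) measurable
    then show "(NN x. ennreal (M\<^sup>2) * (?k x y * ic k z y)) = ennreal (M\<^sup>2) * (H y * ic k z y)"
     by (simp add: mult_ac)
   qed
   also have "... = ennreal (M\<^sup>2) * (NN y. H y * ic k z y)" by (rule nn_integral_cmult) measurable
   finally show ?thesis .
  qed
  have diff: "(NN y. ennreal (F (y + h) y)) <= ennreal (sq h * V)" for h :: "real^'n"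
  proof -
   have "(NN y. ennreal (F (y + h) y)) = (NN y. esq (fn g (y + h) - fn g y) + indicator {h. norm h >= 1} h * esq (fn g (y + h)))"
    by (rule nn_integral_cong) (auto simp: F_def indicator_def ennreal_plus simp del: ennreal_power)
   also have "... = (NN y. esq (fn g (y + h) - fn g y)) + (NN y. indicator {h. norm h >= 1} h * esq (fn g (y + h)))"
    by (rule nn_integral_add) measurable
   also have "(NN y. esq (fn g (y + h) - fn g y)) = esq (trans h g - g)" unfolding norm_L2_nn
   proof (rule nn_integral_cong_AE)
    show "AE y in lborel. esq (fn g (y + h) - fn g y) = esq (fn (trans h g - g) y)"
     using fn_diff[of "trans h g" g] fn_mk[OF sqint_shift[OF sqint_fn, of g h]] unfolding trans_def by eventually_elim simp
   qed
   also have "(NN y. indicator {h. norm h >= 1} h * esq (fn g (y + h))) = indicator {h. norm h >= 1} h * (NN y. esq (fn g (y + h)))"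
    by (rule nn_integral_cmult) measurable
   also have "(NN y. esq (fn g (y + h))) = esq g" using nn_integral_shift[of "%x. esq (fn g x)" h] by (simp add: norm_L2_nn)
   also have "esq (trans h g - g) + indicator {h. norm h >= 1} h * esq g
     <= ennreal (sq h * (\<Sum>j\<in>UNIV. norm (G $ j))\<^sup>2) + ennreal (sq h * sq g)"
   proof (rule add_mono)
    have "sq (trans h g - g) <= (norm h * (\<Sum>j\<in>UNIV. norm (G $ j)))\<^sup>2"
     by (rule power_mono[OF translation_bound[OF wg]]) simp
    then show "esq (trans h g - g) <= ennreal (sq h * (\<Sum>j\<in>UNIV. norm (G $ j))\<^sup>2)"
     unfolding power_mult_distrib by (rule ennreal_leI)
    show "indicator {h. norm h >= 1} h * esq g <= ennreal (sq h * sq g)"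
    proof (cases "norm h >= 1")
     case True
     then have "1 * sq g <= sq h * sq g" by (intro mult_right_mono) (auto simp: one_le_power)
     then show ?thesis using True by (simp add: ennreal_leI del: ennreal_power)
    qed simp
   qed
   also have "... = ennreal (sq h * V)" by (simp add: V_def distrib_left)
   finally show ?thesis .
  qed
  let ?F = "%h y. ennreal (F (fst (h + y, y)) (snd (h + y, y)))"
  have HI: "(NN y. H y) <= ennreal (V * t\<^sup>2 * (I * v))"
  proof -
   have "(NN y. H y) = (NN y. (NN h. ennreal ((w h)\<^sup>2) * ?F h y))"
   proof (rule nn_integral_cong)
    fix y :: "real^'n"
    have "H y = (NN h. ennreal ((w (h + y - y))\<^sup>2 * F (h + y) y))"
     unfolding H_def by (rule nn_integral_shift[symmetric]) measurable
    then show "H y = (NN h. ennreal ((w h)\<^sup>2) * ?F h y)" using F0 by (simp add: ennreal_mult' del: ennreal_power)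
   qed
   also have "... = (NN h. (NN y. ennreal ((w h)\<^sup>2) * ?F h y))"
    by (rule lborel_pair.Fubini'[symmetric]) (unfold F_def fst_conv snd_conv, measurable)
   also have "... <= (NN (h :: real^'n). ennreal (V * t\<^sup>2) * ennreal ((1 + (norm (h - 0) / t)\<^sup>2) * (weight (c / t) ?N 0 h)\<^sup>2))"
   proof (rule nn_integral_mono)
    fix h :: "real^'n"
    have "(NN y. ennreal ((w h)\<^sup>2) * ?F h y) = ennreal ((w h)\<^sup>2) * (NN y. ennreal (F (y + h) y))"
     unfolding fst_conv snd_conv add.commute[of h] by (rule nn_integral_cmult) (unfold F_def, measurable)
    also have "... <= ennreal ((w h)\<^sup>2) * ennreal (sq h * V)" by (rule mult_left_mono[OF diff]) simp
    also have "... = ennreal ((w h)\<^sup>2 * (sq h * V))" by (rule ennreal_mult'[symmetric]) simp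
    also have "... <= ennreal ((V * t\<^sup>2) * ((1 + (norm (h - 0) / t)\<^sup>2) * (w h)\<^sup>2))"
    proof (rule ennreal_leI)
     have "sq h <= t\<^sup>2 * (1 + (norm (h - 0) / t)\<^sup>2)" using t by (simp add: power_divide distrib_left)
     then have "((w h)\<^sup>2 * V) * sq h <= ((w h)\<^sup>2 * V) * (t\<^sup>2 * (1 + (norm (h - 0) / t)\<^sup>2))"
      by (rule mult_left_mono) (use V0 in simp)
     then show "(w h)\<^sup>2 * (sq h * V) <= (V * t\<^sup>2) * ((1 + (norm (h - 0) / t)\<^sup>2) * (w h)\<^sup>2)"
      by (simp only: mult_ac)
    qed
    also have "... = ennreal (V * t\<^sup>2) * ennreal ((1 + (norm (h - 0) / t)\<^sup>2) * (w h)\<^sup>2)"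
     by (rule ennreal_mult') (use V0 in simp)
    finally show "(NN y. ennreal ((w h)\<^sup>2) * ?F h y)
      <= ennreal (V * t\<^sup>2) * ennreal ((1 + (norm (h - 0) / t)\<^sup>2) * (weight (c / t) ?N 0 h)\<^sup>2)" unfolding w_def .
   qed
   also have "... = ennreal (V * t\<^sup>2) * (NN h. ennreal ((1 + (norm (h - 0) / t)\<^sup>2) * (weight (c / t) ?N 0 (h :: real^'n))\<^sup>2))"
    by (rule nn_integral_cmult) measurable
   also have "... <= ennreal (V * t\<^sup>2) * ennreal (I * v)" unfolding vt by (rule mult_left_mono[OF I(2)]) (use t in auto)
   also have "... = ennreal (V * t\<^sup>2 * (I * v))" by (rule ennreal_mult'[symmetric]) (use V0 in simp)
   finally show ?thesis .
  qed
  have "ennreal v * (\<integral>\<^sup>+z. L z \<partial>count_space UNIV) = (\<integral>\<^sup>+z. ennreal v * L z \<partial>count_space UNIV)"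
   by (rule nn_integral_cmult[symmetric]) simp
  also have "... <= (\<integral>\<^sup>+z. ennreal (M\<^sup>2) * (NN y. H y * ic k z y) \<partial>count_space UNIV)"
   by (rule nn_integral_mono) (rule Lz)
  also have "... = ennreal (M\<^sup>2) * (\<integral>\<^sup>+z. (NN y. H y * ic k z y) \<partial>count_space UNIV)"
   by (rule nn_integral_cmult) simp
  also have "... = ennreal (M\<^sup>2) * (NN y. H y)" by (subst cells_sum[OF Hm, of k]) simp
  also have "... <= ennreal (M\<^sup>2) * ennreal (V * t\<^sup>2 * (I * v))" by (rule mult_left_mono[OF HI]) simp
  also have "... = ennreal v * ennreal (M\<^sup>2 * I * t\<^sup>2 * V)"
   using v V0 I(1) by (simp add: ennreal_mult[symmetric] mult_ac del: ennreal_power)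
  finally have "(\<integral>\<^sup>+z. L z \<partial>count_space UNIV) <= ennreal (M\<^sup>2 * I * t\<^sup>2 * V)"
   using v by (subst (asm) ennreal_mult_le_mult_iff) auto
  then show ?thesis unfolding L_def t_def V_def .
 qed
 then show ?thesis using I(1) M0 by (intro exI[of _ "M\<^sup>2 * I"]) auto
qed

section \<open>Principal part approximation\<close>

lemma tw_linear: "bbs \<phi> ==> linear (tw \<phi> :: complex^'m => ('n::finite, 'm::finite) L2)"
proof (rule linearI)
 assume b: "bbs \<phi>"
 fix v w :: "complex^'m" and r :: real
 show "tw \<phi> (v + w) = (tw \<phi> v + tw \<phi> w :: ('n, 'm) L2)"
 by (rule L2_eqI, use fn_tw[OF b, of "v + w"] fn_tw[OF b, of v] fn_tw[OF b, of w] fn_add[of "tw \<phi> v" "tw \<phi> w"] in eventually_elim) (simp add: scaleR_add_right)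
 show "tw \<phi> (r *R w) = (r *R tw \<phi> w :: ('n, 'm) L2)"
 by (rule L2_eqI, use fn_tw[OF b, of "r *R w"] fn_tw[OF b, of w] fn_scaleR[of r "tw \<phi> w"] in eventually_elim) simp
qed

text \<open>Locality of \<open>B\<close> is expressed by its commuting with multiplication by scalar functions.\<close>

locale kato = dirac J dom D B \<delta> + diffop dom D a a0
 for J :: "('n::finite, 'm::finite) L2 => ('n, 'm) L2" and dom D B \<delta> a a0 +
 fixes Cc :: real
 assumes B_mult: "bm \<omega> ==> B (mult \<omega> u) = mult \<omega> (B u)"
  and J_mult: "bm \<omega> ==> J (mult \<omega> u) = mult \<omega> (J u)"
  and Cc_nonneg: "Cc >= 0"
  and gradient: "u : dom ==> u : closure (D ` dom) ==>
   \<exists>G. has_weak_gradient u G \<and> norm u + (\<Sum>j\<in>UNIV. norm (G $ j)) <= Cc * norm (D u)"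
begin

text \<open>Off-diagonal decay: conjugating the resolvent with a slowly varying weight costs only the
 commutator of \<open>D\<close> with the weight, which is absorbed.\<close>

lemma weighted_QQ:
 "\<exists>c. 0 < c \<and> c <= 1 \<and> (\<forall>t a u. t > 0 \<longrightarrow>
  norm (mult (weight (c / t) (Suc CARD('n)) a) (QQ t u)) <= 2 * C0 * norm (mult (weight (c / t) (Suc CARD('n)) a) u))"
proof -
 let ?N = "Suc CARD('n)"
 obtain C where C: "C >= 0" and comm: "!!\<omega> \<kappa> u. smooth \<omega> ==> (!!x. 0 <= \<omega> x \<and> \<omega> x <= 1) ==> \<kappa> >= 0 ==>
  (!!j x. \<bar>partial_deriv j \<omega> x\<bar> <= \<kappa> * \<omega> x) ==> u : dom ==>
  mult \<omega> u : dom \<and> norm (D (mult \<omega> u) - mult \<omega> (D u)) <= C * \<kappa> * norm (mult \<omega> u)"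
  using commutator_bound by blast
 define E where "E = 2 * (C0 * (Bn * (C * real ?N)))"
 have E0: "E >= 0" unfolding E_def using C0_ge_1 Bn_nonneg C by simp
 \<comment> \<open>for this slope the commutator is at most half of the weighted norm\<close>
 define c where "c = 1 / (1 + E)"
 have c: "0 < c" "c <= 1" "c * E <= 1" using E0 by (auto simp: c_def field_simps)
 have resb: "norm (mult (weight (c / t) ?N a) (res s u)) <= 2 * C0 * norm (mult (weight (c / t) ?N a) u)"
  if t: "t > 0" "\<bar>s\<bar> = t" for t s a u
 proof -
  define \<omega> :: "real^'n => real" where "\<omega> = weight (c / t) ?N a"
  have b: "bm \<omega>" unfolding \<omega>_def by (rule weight_bm)
  have s: "s ~= 0" using t by auto
  define w where "w = res s u"
  have w: "w : dom" "w + s *R J (B (D w)) = u" unfolding w_def by (rule res[OF s])+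
  define \<kappa> where "\<kappa> = real ?N * (c / t)"
  have k0: "\<kappa> >= 0" unfolding \<kappa>_def using c t by simp
  have "mult \<omega> w : dom \<and> norm (D (mult \<omega> w) - mult \<omega> (D w)) <= C * \<kappa> * norm (mult \<omega> w)"
  proof (rule comm[OF _ _ k0 _ w(1)])
   show "smooth \<omega>" unfolding \<omega>_def by (rule smooth_weight)
   show "0 <= \<omega> x \<and> \<omega> x <= 1" for x unfolding \<omega>_def by (simp add: weight_range less_imp_le)
   show "\<bar>partial_deriv j \<omega> x\<bar> <= \<kappa> * \<omega> x" for j x
    unfolding \<omega>_def \<kappa>_def using weight_partial[of "c / t" j ?N a x] c t by simp
  qed
  then have md: "mult \<omega> w : dom" and e: "norm (D (mult \<omega> w) - mult \<omega> (D w)) <= C * \<kappa> * norm (mult \<omega> w)" by auto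
  define err where "err = D (mult \<omega> w) - mult \<omega> (D w)"
  have "B (D (mult \<omega> w)) = mult \<omega> (B (D w)) + B err"
   unfolding err_def linear_diff[OF bounded_linear.linear[OF B_bl]] B_mult[OF b] by simp
  then have "mult \<omega> w + s *R J (B (D (mult \<omega> w))) = mult \<omega> w + s *R mult \<omega> (J (B (D w))) + s *R J (B err)"
   by (simp add: J_add J_mult[OF b] scaleR_add_right)
  also have "mult \<omega> w + s *R mult \<omega> (J (B (D w))) = mult \<omega> u"
   unfolding w(2)[symmetric] mult_add[OF b] mult_scaleR[OF b] ..
  finally have "norm (mult \<omega> w) <= C0 * norm (mult \<omega> u + s *R J (B err))"
   using resolvent_bound[OF md, of s] by simp
  also have "... <= C0 * (norm (mult \<omega> u) + t * (Bn * (C * \<kappa> * norm (mult \<omega> w))))"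
  proof (rule mult_left_mono)
   have "norm (mult \<omega> u + s *R J (B err)) <= norm (mult \<omega> u) + t * norm (B err)"
    using norm_triangle_ineq[of "mult \<omega> u" "s *R J (B err)"] t by simp
   also have "norm (B err) <= Bn * norm err" by (rule B_bound)
   also have "Bn * norm err <= Bn * (C * \<kappa> * norm (mult \<omega> w))"
    unfolding err_def by (rule mult_left_mono[OF e Bn_nonneg])
   finally show "norm (mult \<omega> u + s *R J (B err)) <= norm (mult \<omega> u) + t * (Bn * (C * \<kappa> * norm (mult \<omega> w)))"
    using t by (simp add: mult_left_mono)
  qed (use C0_ge_1 in simp)
  also have "... = C0 * norm (mult \<omega> u) + (c * E) * (norm (mult \<omega> w) / 2)"
   using t by (simp add: E_def \<kappa>_def field_simps)
  also have "... <= C0 * norm (mult \<omega> u) + 1 * (norm (mult \<omega> w) / 2)"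
   by (intro add_left_mono mult_right_mono c) simp
  finally show ?thesis unfolding \<omega>_def w_def by simp
 qed
 have "norm (mult (weight (c / t) ?N a) (QQ t u)) <= 2 * C0 * norm (mult (weight (c / t) ?N a) u)" if t: "t > 0" for t a u
 proof -
  define \<omega> :: "real^'n => real" where "\<omega> = weight (c / t) ?N a"
  have b: "bm \<omega>" unfolding \<omega>_def by (rule weight_bm)
  have "mult \<omega> (QQ t u) = (1/2) *R J (mult \<omega> (res t u) - mult \<omega> (res (- t) u))"
   unfolding QQ_def mult_scaleR[OF b] J_mult[OF b, symmetric] mult_diff[OF b] ..
  then have "norm (mult \<omega> (QQ t u)) = norm (mult \<omega> (res t u) - mult \<omega> (res (- t) u)) / 2" by simp
  also have "... <= (norm (mult \<omega> (res t u)) + norm (mult \<omega> (res (- t) u))) / 2"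
   by (intro divide_right_mono norm_triangle_ineq4) simp
  also have "... <= (2 * C0 * norm (mult \<omega> u) + 2 * C0 * norm (mult \<omega> u)) / 2"
   unfolding \<omega>_def by (intro divide_right_mono add_mono resb) (use t in auto)
  finally show ?thesis unfolding \<omega>_def by simp
 qed
 with c show ?thesis by blast
qed

definition c1 :: real where
 "c1 = (SOME c. 0 < c \<and> c <= 1 \<and> (\<forall>t a u. t > 0 \<longrightarrow>
  norm (mult (weight (c / t) (Suc CARD('n)) a) (QQ t u)) <= 2 * C0 * norm (mult (weight (c / t) (Suc CARD('n)) a) u)))"

lemma c1: "0 < c1" "c1 <= 1"
 "t > 0 ==> norm (mult (weight (c1 / t) (Suc CARD('n)) p) (QQ t u)) <= 2 * C0 * norm (mult (weight (c1 / t) (Suc CARD('n)) p) u)"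
 using someI_ex[OF weighted_QQ, folded c1_def] by blast+

text \<open>Weights adapted to the scale \<open>k\<close>; the slope \<open>c1\<close> is chosen so small that \<open>weighted_QQ\<close> holds.\<close>

definition wt :: "nat => real^'n => real^'n => real" where
 "wt k p = weight (c1 / tk k) (Suc CARD('n)) p"

lemma wt_bm: "bm (wt k p)" unfolding wt_def by (rule weight_bm)

lemma wt_borel [measurable]: "wt k p : bfun" using wt_bm by (simp add: bm_def)

lemma wt_cell:
 assumes "x : cell k z"
 shows "1 <= (1 + (real CARD('n))\<^sup>2) ^ Suc CARD('n) * wt k (corner k z) x"
proof -
 have "norm (x - corner k z) <= real CARD('n) * tk k" by (rule cell_norm[OF assms])
 then have "c1 / tk k * norm (x - corner k z) <= c1 / tk k * (real CARD('n) * tk k)"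
  by (rule mult_left_mono) (simp add: c1 less_imp_le)
 also have "... = c1 * real CARD('n)" by simp
 also have "... <= 1 * real CARD('n)" by (rule mult_right_mono) (use c1 in auto)
 finally have "(c1 / tk k * norm (x - corner k z))\<^sup>2 <= (real CARD('n))\<^sup>2"
  unfolding mult_1 by (rule power_mono) (simp add: c1(1) less_imp_le)
 then have "1 + (c1 / tk k)\<^sup>2 * sq (x - corner k z) <= 1 + (real CARD('n))\<^sup>2"
  unfolding power_mult_distrib by simp
 then have "(1 + (c1 / tk k)\<^sup>2 * sq (x - corner k z)) ^ Suc CARD('n) <= (1 + (real CARD('n))\<^sup>2) ^ Suc CARD('n)"
  by (rule power_mono) simp
 moreover have "(1 + (c1 / tk k)\<^sup>2 * sq (x - corner k z)) ^ Suc CARD('n) > 0"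
  by (rule zero_less_power) (simp add: add_pos_nonneg)
 ultimately show ?thesis unfolding wt_def weight_def by (simp only: divide_inverse[symmetric] pos_le_divide_eq mult_1)
qed

text \<open>The operator \<open>\<Theta>\<^sub>k = Q\<^sub>tB\<close> at \<open>t = 2\<^sup>-\<^sup>k\<close>.\<close>

definition Th :: "nat => ('n, 'm) L2 => ('n, 'm) L2" where "Th k u = QQ (tk k) (B u)"

lemma Th_linear: "linear (Th k)"
 unfolding Th_def[abs_def] using linear_compose[OF bounded_linear.linear[OF B_bl] QQ_linear[of "tk k"]] by (simp add: o_def)

definition CL :: real where "CL = (1 + (real CARD('n))\<^sup>2) ^ Suc CARD('n) * (2 * C0 * Bn)"

lemma CL_nonneg: "CL >= 0" unfolding CL_def using C0_ge_1 Bn_nonneg by simp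

lemma Th_cell: "norm (mult (ic k z) (Th k u)) <= CL * norm (mult (wt k (corner k z)) u)"
proof -
 let ?A = "(1 + (real CARD('n))\<^sup>2) ^ Suc CARD('n)" and ?w = "wt k (corner k z)"
 have A: "?A >= 0" by simp
 have "norm (mult (ic k z) (Th k u)) <= ?A * norm (mult ?w (Th k u))"
 proof (rule norm_mono_AE[OF A])
  show "AE x in lborel. norm (fn (mult (ic k z) (Th k u)) x) <= ?A * norm (fn (mult ?w (Th k u)) x)"
   using fn_mult[OF bbs_bm[OF bbs_cell], of k z "Th k u"] fn_mult[OF wt_bm, of k "corner k z" "Th k u"]
  proof eventually_elim
   case (elim x)
   have w0: "?w x >= 0" by (simp add: wt_def weight_range less_imp_le)
   show ?case
   proof (cases "x : cell k z")
    case True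
    have "1 * norm (fn (Th k u) x) <= (?A * ?w x) * norm (fn (Th k u) x)" by (rule mult_right_mono[OF wt_cell[OF True]]) simp
    then show ?thesis using True w0 by (simp add: elim mult.assoc del: power_Suc)
   qed (simp add: elim)
  qed
 qed
 also have "norm (mult ?w (Th k u)) <= 2 * C0 * norm (mult ?w (B u))" unfolding wt_def Th_def by (rule c1(3)) simp
 also have "norm (mult ?w (B u)) <= Bn * norm (mult ?w u)" unfolding B_mult[OF wt_bm, symmetric] by (rule B_bound)
 finally show ?thesis using A C0_ge_1 unfolding CL_def by (simp add: mult_left_mono mult.assoc del: power_Suc)
qed

definition CI :: real where
 "CI = (SOME I. I >= 0 \<and> (\<forall>t>0. \<forall>a. (NN x. ennreal ((1 + (norm (x - a) / t)\<^sup>2) * (weight (c1 / t) (Suc CARD('n)) a (x :: real^'n))\<^sup>2)) <= ennreal (I * t ^ CARD('n))))"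

lemma CI_nonneg: "CI >= 0"
 and wt_integral: "(NN x. ennreal ((1 + (norm (x - p) / tk k)\<^sup>2) * (wt k p x)\<^sup>2)) <= ennreal (CI * vol TYPE('n) k)"
 using someI_ex[OF weight_integral[OF c1(1,2), where 'n = 'n], folded CI_def] unfolding wt_def vol_def by simp_all

lemma mult_tw_nn:
 assumes b: "bm \<omega>" and \<phi>: "bbs \<phi>"
 shows "esq (mult \<omega> (tw \<phi> w :: ('n, 'm) L2)) = (NN x. ennreal ((\<omega> x * \<phi> x)\<^sup>2 * sq w))"
 unfolding norm_mult_nn[OF b]
by (rule nn_integral_cong_AE, use fn_tw[OF \<phi>, of w] in eventually_elim) (simp add: power_mult_distrib mult.assoc)

lemma mult_tw_bound:
 assumes A: "A : sets borel" "bounded A"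
 shows "sq (mult (wt k p) (tw (indicator A) w :: ('n, 'm) L2)) <= CI * vol TYPE('n) k * sq w"
proof -
 have "esq (mult (wt k p) (tw (indicator A) w :: ('n, 'm) L2)) = (NN x. ennreal ((wt k p x * indicator A x)\<^sup>2 * sq w))"
  by (rule mult_tw_nn[OF wt_bm bbs_indicator[OF A]])
 also have "... <= (NN x. esq w * ennreal ((1 + (norm (x - p) / tk k)\<^sup>2) * (wt k p x)\<^sup>2))"
 proof (rule nn_integral_mono)
  fix x
  have "(wt k p x * indicator A x)\<^sup>2 <= 1 * (wt k p x)\<^sup>2" by (auto simp: indicator_def)
  also have "... <= (1 + (norm (x - p) / tk k)\<^sup>2) * (wt k p x)\<^sup>2" by (rule mult_right_mono) auto
  finally have "(wt k p x * indicator A x)\<^sup>2 * sq w <= (1 + (norm (x - p) / tk k)\<^sup>2) * (wt k p x)\<^sup>2 * sq w"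
   by (rule mult_right_mono) simp
  then show "ennreal ((wt k p x * indicator A x)\<^sup>2 * sq w) <= esq w * ennreal ((1 + (norm (x - p) / tk k)\<^sup>2) * (wt k p x)\<^sup>2)"
   by (simp add: ennreal_mult'[symmetric] ennreal_leI mult.commute del: ennreal_power)
 qed
 also have "... = esq w * (NN x. ennreal ((1 + (norm (x - p) / tk k)\<^sup>2) * (wt k p x)\<^sup>2))"
  by (rule nn_integral_cmult) measurable
 also have "... <= esq w * ennreal (CI * vol TYPE('n) k)" by (rule mult_left_mono[OF wt_integral]) simp
 also have "... = ennreal (CI * vol TYPE('n) k * sq w)" by (simp add: ennreal_mult'[symmetric] mult.commute del: ennreal_power)
 finally show ?thesis using CI_nonneg vol_pos[where 'n = 'n, of k] by (subst (asm) ennreal_le_iff) auto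
qed

text \<open>Constants are not square integrable, so they are cut off at a distance of order one, which is at
least the scale of every cube in use.\<close>

definition reach :: "nat => int^'n => (real^'n) set" where
 "reach k z = ball (corner k z) (1 + real CARD('n))"

lemma reach_bbs: "reach k z : sets borel" "bounded (reach k z)" "bbs (indicator (reach k z))"
 unfolding reach_def by (auto intro: bbs_indicator)

text \<open>The row \<open>b\<close> of the matrix \<open>\<gamma>\<^sub>k(x)\<close>, whose columns are the images under \<open>Th k\<close> of the coordinate vectors.\<close>

definition row :: "nat => complex^'m => real^'n => complex^'m" where
 "row k b x = (\<Sum>e\<in>Basis. (fn (Th k (tw (indicator (reach k (idx k x))) e)) x \<bullet> b) *R e)"

text \<open>The principal part \<open>\<gamma>\<^sub>kE\<^sub>ku\<close>, as a function and as an element of \<open>L\<^sup>2\<close>.\<close>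

definition Gfun :: "nat => ('n, 'm) L2 => real^'n => complex^'m" where
 "Gfun k u x = (\<Sum>b\<in>Basis. (row k b x \<bullet> Ek k u x) *R b)"

definition Gam :: "nat => ('n, 'm) L2 => ('n, 'm) L2" where "Gam k u = mk (Gfun k u)"

lemma row_borel [measurable]: "row k b : bfun"
proof -
 have "(%x. (%z x. \<Sum>e\<in>Basis. (fn (Th k (tw (indicator (reach k z)) e)) x \<bullet> b) *R e) (idx k x) x) : bfun"
  by (rule idx_family_measurable) measurable
 then show ?thesis by (simp add: row_def[abs_def])
qed

lemma Gfun_borel [measurable]: "Gfun k u : bfun" unfolding Gfun_def[abs_def] by measurable

lemma Gfun_cell:
 "AE x in lborel. x : cell k z --> Gfun k u x = fn (Th k (tw (indicator (reach k z)) (avgv k z u))) x"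
proof -
 define L where "L w = Th k (tw (indicator (reach k z)) w)" for w
 define w where "w = avgv k z u"
 have lin: "linear L" unfolding L_def[abs_def]
  using linear_compose[OF tw_linear[OF reach_bbs(3)] Th_linear] by (simp add: o_def)
 have "L w = L (\<Sum>e\<in>Basis. (w \<bullet> e) *R e)" by (simp add: euclidean_representation)
 also have "... = (\<Sum>e\<in>Basis. (w \<bullet> e) *R L e)" by (simp add: linear_sum[OF lin] linear_scale[OF lin])
 finally have Lw: "L w = (\<Sum>e\<in>Basis. (w \<bullet> e) *R L e)" .
 have "AE x in lborel. fn (L w) x = (\<Sum>e\<in>Basis. fn ((w \<bullet> e) *R L e) x)"
  unfolding Lw by (rule fn_sum) simp
 moreover have "AE x in lborel. \<forall>e\<in>Basis. fn ((w \<bullet> e) *R L e) x = (w \<bullet> e) *R fn (L e) x"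
  by (rule AE_finite_allI) (auto intro: fn_scaleR)
 ultimately have "AE x in lborel. fn (L w) x = (\<Sum>e\<in>Basis. (w \<bullet> e) *R fn (L e) x)"
  by eventually_elim simp
 then show ?thesis
 proof eventually_elim
  case (elim x)
  show ?case
  proof
   assume x: "x : cell k z"
   have "Gfun k u x = (\<Sum>b\<in>Basis. ((\<Sum>e\<in>Basis. (fn (L e) x \<bullet> b) *R e) \<bullet> w) *R b)"
    using x by (simp add: Gfun_def row_def Ek_def mem_cell w_def L_def)
   also have "... = (\<Sum>b\<in>Basis. (fn (L w) x \<bullet> b) *R b)"
    unfolding elim inner_sum_left inner_scaleR_left by (simp add: inner_commute mult.commute)
   finally show "Gfun k u x = fn (Th k (tw (indicator (reach k z)) (avgv k z u))) x"
    by (simp add: euclidean_representation L_def w_def)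
  qed
 qed
qed

lemma Gfun_cell_nn:
 "(NN x. esq (Gfun k u x) * ic k z x)
  = esq (mult (ic k z) (Th k (tw (indicator (reach k z)) (avgv k z u))))" unfolding norm_mult_indicator[OF cell_borel]
by (rule nn_integral_cong_AE, use Gfun_cell[of k z u] in eventually_elim) (auto simp: indicator_def)

lemma Th_reach_bound:
 "sq (mult (ic k z) (Th k (tw (indicator (reach k z)) w))) <= CL\<^sup>2 * CI * (vol TYPE('n) k * sq w)"
proof -
 have "sq (mult (ic k z) (Th k (tw (indicator (reach k z)) w))) <= (CL * norm (mult (wt k (corner k z)) (tw (indicator (reach k z)) w :: ('n, 'm) L2)))\<^sup>2"
  by (rule power_mono[OF Th_cell]) simp
 also have "... = CL\<^sup>2 * sq (mult (wt k (corner k z)) (tw (indicator (reach k z)) w :: ('n, 'm) L2))" by (rule power_mult_distrib)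
 also have "... <= CL\<^sup>2 * (CI * vol TYPE('n) k * sq w)"
  by (rule mult_left_mono[OF mult_tw_bound[OF reach_bbs(1,2)]]) simp
 finally show ?thesis by (simp add: mult.assoc)
qed

lemma Gfun_nn: "(NN x. esq (Gfun k u x)) <= ennreal (CL\<^sup>2 * CI * sq (Eop k u))"
proof -
 have "(NN x. esq (Gfun k u x)) = (\<integral>\<^sup>+z. (NN x. esq (Gfun k u x) * ic k z x) \<partial>count_space UNIV)"
  by (rule cells_sum) measurable
 also have "... <= (\<integral>\<^sup>+z. ennreal (CL\<^sup>2 * CI) * (NN x. esq (Ek k u x) * ic k z x) \<partial>count_space UNIV)"
 proof (rule nn_integral_mono)
  fix z :: "int^'n"
  have "(NN x. esq (Gfun k u x) * ic k z x) <= ennreal (CL\<^sup>2 * CI * (vol TYPE('n) k * sq (avgv k z u)))"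
   unfolding Gfun_cell_nn by (rule ennreal_leI[OF Th_reach_bound])
  also have "... = ennreal (CL\<^sup>2 * CI) * ennreal (vol TYPE('n) k * sq (avgv k z u))"
   by (rule ennreal_mult') (use CI_nonneg in simp)
  finally show "(NN x. esq (Gfun k u x) * ic k z x) <= ennreal (CL\<^sup>2 * CI) * (NN x. esq (Ek k u x) * ic k z x)"
   unfolding Ek_cell .
 qed
 also have "... = ennreal (CL\<^sup>2 * CI) * (\<integral>\<^sup>+z. (NN x. esq (Ek k u x) * ic k z x) \<partial>count_space UNIV)"
  by (rule nn_integral_cmult) simp
 also have "(\<integral>\<^sup>+z. (NN x. esq (Ek k u x) * ic k z x) \<partial>count_space UNIV) = (NN x. esq (Ek k u x))"
  by (rule cells_sum[symmetric]) measurable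
 also have "... = esq (Eop k u)" by (rule Eop_norm_nn[symmetric])
 also have "ennreal (CL\<^sup>2 * CI) * esq (Eop k u) = ennreal (CL\<^sup>2 * CI * sq (Eop k u))"
  by (rule ennreal_mult'[symmetric]) (use CI_nonneg in simp)
 finally show ?thesis .
qed

lemma Gfun_sqint: "sqint (Gfun k u)"
 unfolding sqint_iff_nn[OF Gfun_borel] using Gfun_nn[of k u] by (auto intro: le_less_trans)

lemma fn_Gam: "AE x in lborel. fn (Gam k u) x = Gfun k u x" unfolding Gam_def by (rule fn_mk[OF Gfun_sqint])

lemma Gam_norm: "sq (Gam k u) <= CL\<^sup>2 * CI * sq (Eop k u)"
proof -
 have "esq (Gam k u) <= ennreal (CL\<^sup>2 * CI * sq (Eop k u))"
  unfolding Gam_def norm_mk_nn[OF Gfun_sqint] by (rule Gfun_nn)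
 then show ?thesis using CI_nonneg by (subst (asm) ennreal_le_iff) auto
qed

lemma Gam_diff: "Gam k (u - v) = Gam k u - Gam k v"
proof (rule L2_eqI)
 have G: "Gfun k (u - v) x = Gfun k u x - Gfun k v x" for x
  by (simp add: Gfun_def Ek_def avgv_diff inner_diff_right scaleR_diff_left sum_subtractf)
 show "AE x in lborel. fn (Gam k (u - v)) x = fn (Gam k u - Gam k v) x"
  using fn_Gam[of k "u - v"] fn_Gam[of k u] fn_Gam[of k v] fn_diff[of "Gam k u" "Gam k v"] by eventually_elim (simp add: G)
qed

text \<open>On a cube, \<open>\<Theta>\<^sub>kg - \<Gamma>\<^sub>kg\<close> is \<open>\<Theta>\<^sub>k\<close> applied to the deviation of \<open>g\<close> from its mean over that cube.\<close>

lemma principal_part: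
 "\<exists>C\<ge>0. \<forall>k g G. has_weak_gradient g G \<longrightarrow>
  sq (Th k g - Gam k g) <= C * (tk k)\<^sup>2 * ((\<Sum>j\<in>UNIV. norm (G $ j))\<^sup>2 + sq g)"
proof -
 obtain C where C: "C >= 0" and osc: "!!k (g :: ('n, 'm) L2) G. has_weak_gradient g G ==>
  (\<integral>\<^sup>+z. (NN x. ennreal ((wt k (corner k z) x)\<^sup>2 *
    sq (fn g x - indicator (reach k z) x *R avgv k z g))) \<partial>count_space UNIV)
   <= ennreal (C * (tk k)\<^sup>2 * ((\<Sum>j\<in>UNIV. norm (G $ j))\<^sup>2 + sq g))"
  using oscillation_bound[OF c1(1,2), where 'n = 'n and 'm = 'm] unfolding wt_def reach_def by blast
 have "sq (Th k g - Gam k g) <= CL\<^sup>2 * C * (tk k)\<^sup>2 * ((\<Sum>j\<in>UNIV. norm (G $ j))\<^sup>2 + sq g)"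
  if wg: "has_weak_gradient g G" for k g G
 proof -
  let ?d = "%z x. sq (fn g x - indicator (reach k z) x *R avgv k z g)"
  let ?R = "C * (tk k)\<^sup>2 * ((\<Sum>j\<in>UNIV. norm (G $ j))\<^sup>2 + sq g)"
  have R0: "?R >= 0" using C by simp
  have "esq (Th k g - Gam k g) = (\<integral>\<^sup>+z. (NN x. esq (fn (Th k g - Gam k g) x) * ic k z x) \<partial>count_space UNIV)"
   unfolding norm_L2_nn by (rule cells_sum) measurable
  also have "... <= (\<integral>\<^sup>+z. ennreal (CL\<^sup>2) * (NN x. ennreal ((wt k (corner k z) x)\<^sup>2 *
    ?d z x)) \<partial>count_space UNIV)"
  proof (rule nn_integral_mono)
   fix z :: "int^'n"
   define h where "h = tw (indicator (reach k z)) (avgv k z g)"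
   have "(NN x. esq (fn (Th k g - Gam k g) x) * ic k z x)
     = (NN x. esq (fn (Th k (g - h)) x) * ic k z x)"
   proof (rule nn_integral_cong_AE)
    have e: "Th k (g - h) = Th k g - Th k h" by (rule linear_diff[OF Th_linear])
    show "AE x in lborel. esq (fn (Th k g - Gam k g) x) * ic k z x = esq (fn (Th k (g - h)) x) * ic k z x"
     unfolding e using fn_diff[of "Th k g" "Gam k g"] fn_diff[of "Th k g" "Th k h"] fn_Gam[of k g] Gfun_cell[of k z g]
     unfolding h_def by eventually_elim (auto simp: indicator_def)
   qed
   also have "... = esq (mult (ic k z) (Th k (g - h)))" by (rule norm_mult_indicator[symmetric]) simp
   also have "... <= ennreal ((CL * norm (mult (wt k (corner k z)) (g - h)))\<^sup>2)"
    by (intro ennreal_leI power_mono Th_cell) simp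
   also have "... = ennreal (CL\<^sup>2) * esq (mult (wt k (corner k z)) (g - h))"
    by (simp add: power_mult_distrib ennreal_mult' del: ennreal_power)
   also have "esq (mult (wt k (corner k z)) (g - h)) = (NN x. ennreal ((wt k (corner k z) x)\<^sup>2 *
    ?d z x))" unfolding norm_mult_nn[OF wt_bm]
   proof (rule nn_integral_cong_AE)
    show "AE x in lborel. ennreal ((wt k (corner k z) x)\<^sup>2 * sq (fn (g - h) x)) = ennreal ((wt k (corner k z) x)\<^sup>2 *
     ?d z x)" using fn_diff[of g h] fn_tw[OF reach_bbs(3), of k z "avgv k z g"] unfolding h_def by eventually_elim simp
   qed
   finally show "(NN x. esq (fn (Th k g - Gam k g) x) * ic k z x) <= ennreal (CL\<^sup>2) * (NN x. ennreal ((wt k (corner k z) x)\<^sup>2 *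
    ?d z x))" .
  qed
  also have "... = ennreal (CL\<^sup>2) * (\<integral>\<^sup>+z. (NN x. ennreal ((wt k (corner k z) x)\<^sup>2 *
    ?d z x)) \<partial>count_space UNIV)" by (rule nn_integral_cmult) simp
  also have "... <= ennreal (CL\<^sup>2) * ennreal ?R" by (rule mult_left_mono[OF osc[OF wg]]) simp
  also have "... = ennreal (CL\<^sup>2 * ?R)" by (rule ennreal_mult'[symmetric]) simp
  finally have "sq (Th k g - Gam k g) <= CL\<^sup>2 * ?R" using R0 by (subst (asm) ennreal_le_iff) auto
  then show ?thesis by (simp add: mult.assoc)
 qed
 then show ?thesis using C by (intro exI[of _ "CL\<^sup>2 * C"]) auto
qed

end

section \<open>The difference between the operators and their principal part\<close>

lemma geometric_bound: "0 <= \<rho> ==> \<rho> < 1 ==> (\<Sum>i<n. \<rho> ^ i) <= 1 / (1 - \<rho> :: real)"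
 by (simp add: sum_gp_strict divide_right_mono)

lemma schur_bound:
 fixes b :: "nat => real"
 assumes \<rho>: "0 <= \<rho>" "\<rho> < 1"
 shows "(\<Sum>k\<le>K. (\<Sum>j\<in>{k..<J}. \<rho> ^ (j - k) * b j)\<^sup>2) <= (1 / (1 - \<rho>))\<^sup>2 * (\<Sum>j<J. (b j)\<^sup>2)"
proof -
 let ?s = "%k. \<Sum>j\<in>{k..<J}. \<rho> ^ (j - k) * b j" and ?w = "%k j. if k <= j then \<rho> ^ (j - k) else 0"
 let ?G = "1 / (1 - \<rho>)"
 have G0: "?G >= 0" using \<rho> by simp
 have row: "(?s k)\<^sup>2 <= ?G * (\<Sum>j<J. ?w k j * (b j)\<^sup>2)" for k
 proof -
  have sq: "(sqrt (\<rho> ^ i))\<^sup>2 = \<rho> ^ i" "sqrt (\<rho> ^ i) * sqrt (\<rho> ^ i) = \<rho> ^ i" for i using \<rho> by simp_all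
  have "?s k = (\<Sum>j\<in>{k..<J}. sqrt (\<rho> ^ (j - k)) * (sqrt (\<rho> ^ (j - k)) * b j))"
   by (simp only: mult.assoc[symmetric] sq)
  then have "(?s k)\<^sup>2 <= (\<Sum>j\<in>{k..<J}. (sqrt (\<rho> ^ (j - k)))\<^sup>2) * (\<Sum>j\<in>{k..<J}. (sqrt (\<rho> ^ (j - k)) * b j)\<^sup>2)"
   using Cauchy_Schwarz_ineq_sum[of "%j. sqrt (\<rho> ^ (j - k))" "%j. sqrt (\<rho> ^ (j - k)) * b j" "{k..<J}"] by simp
  also have "... = (\<Sum>j\<in>{k..<J}. \<rho> ^ (j - k)) * (\<Sum>j\<in>{k..<J}. \<rho> ^ (j - k) * (b j)\<^sup>2)"
   by (simp only: power_mult_distrib sq)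
  also have "... <= ?G * (\<Sum>j<J. ?w k j * (b j)\<^sup>2)"
  proof (rule mult_mono)
   have "(\<Sum>j\<in>{k..<J}. \<rho> ^ (j - k)) = (\<Sum>i<J - k. \<rho> ^ i)"
    by (rule sum.reindex_bij_witness[of _ "%i. i + k" "%j. j - k"]) auto
   then show "(\<Sum>j\<in>{k..<J}. \<rho> ^ (j - k)) <= ?G" using geometric_bound[OF \<rho>] by simp
   have "(\<Sum>j\<in>{k..<J}. \<rho> ^ (j - k) * (b j)\<^sup>2) = (\<Sum>j\<in>{k..<J}. ?w k j * (b j)\<^sup>2)"
    by (rule sum.cong) auto
   also have "... <= (\<Sum>j<J. ?w k j * (b j)\<^sup>2)" by (rule sum_mono2) (use \<rho> in auto)
   finally show "(\<Sum>j\<in>{k..<J}. \<rho> ^ (j - k) * (b j)\<^sup>2) <= (\<Sum>j<J. ?w k j * (b j)\<^sup>2)" .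
  qed (use G0 \<rho> in "auto intro!: sum_nonneg")
  finally show ?thesis .
 qed
 have col: "(\<Sum>k\<le>K. ?w k j) <= ?G" for j
 proof -
  have "(\<Sum>k\<le>K. ?w k j) = (\<Sum>k\<in>{..K} Int {..j}. \<rho> ^ (j - k))" by (simp add: sum.If_cases atMost_def)
  also have "... <= (\<Sum>k\<le>j. \<rho> ^ (j - k))" by (rule sum_mono2) (use \<rho> in auto)
  also have "... = (\<Sum>i<Suc j. \<rho> ^ i)" by (rule sum.reindex_bij_witness[of _ "%i. j - i" "%i. j - i"]) auto
  also have "... <= ?G" by (rule geometric_bound[OF \<rho>])
  finally show ?thesis .
 qed
 have "(\<Sum>k\<le>K. (?s k)\<^sup>2) <= (\<Sum>k\<le>K. ?G * (\<Sum>j<J. ?w k j * (b j)\<^sup>2))"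
  by (rule sum_mono) (rule row)
 also have "... = ?G * (\<Sum>j<J. (\<Sum>k\<le>K. ?w k j) * (b j)\<^sup>2)"
  unfolding sum_distrib_left[symmetric] sum_distrib_right by (subst sum.swap) (rule refl)
 also have "... <= ?G * (\<Sum>j<J. ?G * (b j)\<^sup>2)" by (intro mult_left_mono sum_mono mult_right_mono col G0) simp
 also have "... = ?G\<^sup>2 * (\<Sum>j<J. (b j)\<^sup>2)"
  by (simp only: sum_distrib_left[symmetric] power2_eq_square mult.assoc)
 finally show ?thesis .
qed

lemma square_add3_le: "(x + y + z)\<^sup>2 <= 3 * x\<^sup>2 + 3 * y\<^sup>2 + 3 * (z::real)\<^sup>2"
proof -
 have "0 <= (x - y)\<^sup>2 + (y - z)\<^sup>2 + (x - z)\<^sup>2" by simp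
 then show ?thesis by (simp add: power2_eq_square algebra_simps)
qed

lemma norm_split3: "x = p + q - r ==> norm x <= norm p + norm q + norm (r :: 'a::real_normed_vector)"
 by (metis norm_triangle_ineq norm_triangle_ineq4 order_trans add_right_mono)

context diffop
begin

text \<open>The mean of a derivative over a cube is small; \<open>\<tau>\<close> is the width of the boundary layer, to be optimised later.\<close>

lemma avgv_D_bound:
 "\<exists>C\<ge>0. \<forall>k z g \<tau>. g : dom --> 0 < \<tau> --> \<tau> <= 1/2 \<longrightarrow>
  vol TYPE('n) k * sq (avgv k z (D g)) <=
   C * (\<tau> * sq (mult (ic k z) (D g)) + sq (mult (ic k z) g) / (\<tau> * tk k)\<^sup>2)"
proof -
 obtain C where C: "C >= 0" and av: "!!g p l \<tau>. g : dom ==> 0 < l ==> l <= 1 ==> 0 < \<tau> ==> \<tau> <= 1/2 ==>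
  sq (distribution (D g) (indicator (cube p l))) <=
   C * l ^ CARD('n) * (\<tau> * sq (mult (indicator (cube p l)) (D g)) + sq (mult (indicator (cube p l)) g) / (\<tau> * l)\<^sup>2)"
  using average_bound by blast
 have "vol TYPE('n) k * sq (avgv k z (D g)) <=
   C * (\<tau> * sq (mult (ic k z) (D g)) + sq (mult (ic k z) g) / (\<tau> * tk k)\<^sup>2)"
  if g: "g : dom" and \<tau>: "0 < \<tau>" "\<tau> <= 1/2" for k z g \<tau>
 proof -
  let ?R = "\<tau> * sq (mult (ic k z) (D g)) + sq (mult (ic k z) g) / (\<tau> * tk k)\<^sup>2"
  define v where "v = vol TYPE('n) k"
  have v: "v > 0" unfolding v_def by (rule vol_pos)
  have d: "sq (distribution (D g) (ic k z)) <= v * (C * ?R)"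
   using av[OF g _ tk_le_1[of k] \<tau>, of "corner k z"] unfolding cell_def[symmetric] v_def vol_def by (simp add: mult_ac)
  have "v * sq (avgv k z (D g)) = inverse v * sq (distribution (D g) (ic k z))"
   using v by (simp add: avgv_def v_def[symmetric] power_mult_distrib field_simps power2_eq_square)
  also have "... <= inverse v * (v * (C * ?R))" by (rule mult_left_mono[OF d]) (use v in simp)
  also have "... = C * ?R" using v by simp
  finally show ?thesis unfolding v_def .
 qed
 with C show ?thesis by blast
qed

lemma Eop_D_bound:
 "\<exists>C\<ge>0. \<forall>k g \<tau>. g : dom --> 0 < \<tau> --> \<tau> <= 1/2 \<longrightarrow>
  sq (Eop k (D g)) <= C * (\<tau> * sq (D g) + sq g / (\<tau> * tk k)\<^sup>2)"
proof -
 obtain C where C: "C >= 0" and av: "!!k z g \<tau>. g : dom ==> 0 < \<tau> ==> \<tau> <= 1/2 ==>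
  vol TYPE('n) k * sq (avgv k z (D g)) <=
   C * (\<tau> * sq (mult (ic k z) (D g)) + sq (mult (ic k z) g) / (\<tau> * tk k)\<^sup>2)" using avgv_D_bound by blast
 have "sq (Eop k (D g)) <= C * (\<tau> * sq (D g) + sq g / (\<tau> * tk k)\<^sup>2)"
  if g: "g : dom" and \<tau>: "0 < \<tau>" "\<tau> <= 1/2" for k g \<tau>
 proof -
  define p q where "p = C * \<tau>" and "q = C / (\<tau> * tk k)\<^sup>2"
  have pq: "p >= 0" "q >= 0" using C \<tau> by (auto simp: p_def q_def)
  define F where "F x = ennreal p * esq (fn (D g) x) + ennreal q * esq (fn g x)" for x
  have [measurable]: "F : bfun" unfolding F_def[abs_def] by measurable
  have "esq (Eop k (D g)) = (\<integral>\<^sup>+z. (NN x. esq (Ek k (D g) x) * ic k z x) \<partial>count_space UNIV)"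
   unfolding Eop_norm_nn by (rule cells_sum) measurable
  also have "... <= (\<integral>\<^sup>+z. (NN x. F x * ic k z x) \<partial>count_space UNIV)"
  proof (rule nn_integral_mono)
   fix z :: "int^'n"
   have "(NN x. esq (Ek k (D g) x) * ic k z x) <= ennreal (p * sq (mult (ic k z) (D g)) + q * sq (mult (ic k z) g))"
    unfolding Ek_cell by (rule ennreal_leI) (use av[OF g \<tau>, of k z] in "simp add: p_def q_def distrib_left mult.assoc")
   also have "... = ennreal p * esq (mult (ic k z) (D g)) + ennreal q * esq (mult (ic k z) g)"
    using pq by (simp add: ennreal_plus ennreal_mult' del: ennreal_power)
   also have "... = ennreal p * (NN x. esq (fn (D g) x) * ic k z x) + ennreal q * (NN x. esq (fn g x) * ic k z x)"
    unfolding norm_mult_indicator[OF cell_borel] ..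
   also have "... = (NN x. ennreal p * (esq (fn (D g) x) * ic k z x)) + (NN x. ennreal q * (esq (fn g x) * ic k z x))"
    by (simp add: nn_integral_cmult)
   also have "... = (NN x. ennreal p * (esq (fn (D g) x) * ic k z x) + ennreal q * (esq (fn g x) * ic k z x))"
    by (rule nn_integral_add[symmetric]) measurable
   also have "... = (NN x. F x * ic k z x)" by (rule nn_integral_cong) (simp only: F_def distrib_right mult.assoc)
   finally show "(NN x. esq (Ek k (D g) x) * ic k z x) <= (NN x. F x * ic k z x)" .
  qed
  also have "... = (NN x. F x)" by (rule cells_sum[symmetric]) measurable
  also have "... = ennreal p * esq (D g) + ennreal q * esq g"
   unfolding F_def norm_L2_nn by (subst nn_integral_add, measurable) (simp add: nn_integral_cmult)
  also have "... = ennreal (p * sq (D g) + q * sq g)" using pq by (simp add: ennreal_plus ennreal_mult' del: ennreal_power)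
  finally have "sq (Eop k (D g)) <= p * sq (D g) + q * sq g" using pq by (subst (asm) ennreal_le_iff) auto
  then show ?thesis by (simp add: p_def q_def distrib_left mult.assoc)
 qed
 with C show ?thesis by blast
qed

end

context kato
begin

text \<open>The rate of almost orthogonality: optimising the boundary layer \<open>\<tau>\<close> in \<open>Eop_D_bound\<close> gives a power of the
ratio of scales, for which \<open>1/4\<close> is a convenient exponent.\<close>

definition \<rho> :: real where "\<rho> = sqrt (sqrt (1/2))"

lemma rho: "0 < \<rho>" "\<rho> < 1" "\<rho> ^ 4 = 1/2"
proof -
 show "0 < \<rho>" "\<rho> < 1" by (simp_all add: \<rho>_def)
 have "\<rho> ^ 4 = (\<rho>\<^sup>2)\<^sup>2" by (simp only: power_mult[symmetric]) simp
 moreover have "\<rho>\<^sup>2 = sqrt (1/2)" unfolding \<rho>_def by (rule real_sqrt_pow2) simp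
 ultimately show "\<rho> ^ 4 = 1/2" by simp
qed

text \<open>Almost orthogonality of averaging at scale \<open>k\<close> and the frequency blocks at finer scales.\<close>

lemma Eop_block:
 "\<exists>C\<ge>0. \<forall>k j v. k <= j \<longrightarrow>
  norm (Eop k (S.PP (tk (Suc j)) v - S.PP (tk j) v)) <= C * (\<rho> ^ (j - k) * norm (S.QQ (tk j) v))"
proof -
 obtain C where C: "C >= 0" and Eb: "!!k g \<tau>. g : dom ==> 0 < \<tau> ==> \<tau> <= 1/2 ==>
  sq (Eop k (D g)) <= C * (\<tau> * sq (D g) + sq g / (\<tau> * tk k)\<^sup>2)" using Eop_D_bound by blast
 have "norm (Eop k (S.PP (tk (Suc j)) v - S.PP (tk j) v)) <= sqrt (6 * C) * (\<rho> ^ (j - k) * norm (S.QQ (tk j) v))"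
  if kj: "k <= j" for k j v
 proof -
  define t where "t = tk j"
  have t: "t > 0" by (simp add: t_def)
  define q where "q = S.QQ t v"
  define x where "x = \<rho> ^ (j - k)"
  have x: "0 < x" "x <= 1" unfolding x_def using rho by (auto intro: power_le_one less_imp_le)
  have tx: "t = x ^ 4 * tk k"
  proof -
   have "x ^ 4 = (1/2) ^ (j - k)" unfolding x_def power_mult[symmetric] mult.commute[of "j - k"] unfolding power_mult rho ..
   moreover have "tk j = (1/2) ^ (j - k) * tk k" using kj by (simp add: tk_def power_add[symmetric])
   ultimately show ?thesis by (simp add: t_def)
  qed
  define g where "g = (3/4 * t) *R S.PP (t/2) q"
  have gd: "g : dom" unfolding g_def by (intro dom_scaleR S.PP_dom) (use t in simp)
  have "S.PP (tk (Suc j)) v - S.PP (tk j) v = (3/2) *R S.QQ (t/2) q"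
   unfolding tk_Suc t_def[symmetric] q_def by (rule S_telescope(1)[OF t])
  also have "S.QQ (t/2) q = (t/2) *R D (S.PP (t/2) q)" using S.QQ_eq[of "t/2" q] t by simp
  also have "(3/2) *R (t/2) *R D (S.PP (t/2) q) = D g"
   unfolding g_def using D_scaleR[OF S.PP_dom[of "t/2" q], of "3/4 * t"] t by simp
  finally have psi: "S.PP (tk (Suc j)) v - S.PP (tk j) v = D g" .
  have n1: "norm (D g) <= (3/2) * norm q"
  proof -
   have "D g = (3/2) *R S.QQ (t/2) q" using psi \<open>S.PP (tk (Suc j)) v - S.PP (tk j) v = (3/2) *R S.QQ (t/2) q\<close> by simp
   then show ?thesis using SQ_norm[of "t/2" q] t by simp
  qed
  have n2: "norm g <= t * norm q"
  proof -
   have "norm g = (3/4 * t) * norm (S.PP (t/2) q)" using t by (simp add: g_def)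
   also have "... <= (1 * t) * norm q" by (intro mult_mono S_norm) (use t in auto)
   finally show ?thesis by simp
  qed
  \<comment> \<open>with this width both terms of \<open>Eb\<close> are of order \<open>x\<^sup>2\<close>\<close>
  define \<tau> where "\<tau> = x\<^sup>2 / 2"
  have \<tau>: "0 < \<tau>" "\<tau> <= 1/2" unfolding \<tau>_def using x by (auto simp: power_le_one)
  have "sq (Eop k (D g)) <= C * (\<tau> * sq (D g) + sq g / (\<tau> * tk k)\<^sup>2)" by (rule Eb[OF gd \<tau>])
  also have "... <= C * (x\<^sup>2 * (9/8) * sq q + x\<^sup>2 * 4 * sq q)"
  proof (intro mult_left_mono add_mono)
   have "sq (D g) <= ((3/2) * norm q)\<^sup>2" by (rule power_mono[OF n1]) simp
   then have "\<tau> * sq (D g) <= \<tau> * ((3/2) * norm q)\<^sup>2" by (rule mult_left_mono) (use \<tau> in simp)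
   then show "\<tau> * sq (D g) <= x\<^sup>2 * (9/8) * sq q" by (simp add: \<tau>_def power_mult_distrib power_divide)
   have "sq g <= (t * norm q)\<^sup>2" by (rule power_mono[OF n2]) simp
   then have "sq g / (\<tau> * tk k)\<^sup>2 <= (t * norm q)\<^sup>2 / (\<tau> * tk k)\<^sup>2" by (rule divide_right_mono) simp
   also have "t * norm q = (\<tau> * tk k) * (2 * x\<^sup>2 * norm q)"
    unfolding tx \<tau>_def by (simp add: power2_eq_square power4_eq_xxxx)
   also have "((\<tau> * tk k) * (2 * x\<^sup>2 * norm q))\<^sup>2 / (\<tau> * tk k)\<^sup>2 = (2 * x\<^sup>2 * norm q)\<^sup>2"
    unfolding power_mult_distrib using \<tau> by simp
   also have "... = x\<^sup>2 * (x\<^sup>2 * 4 * sq q)" by (simp only: power_mult_distrib power2_eq_square) simp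
   also have "... <= 1 * (x\<^sup>2 * 4 * sq q)" by (rule mult_right_mono) (use x in "auto simp: power_le_one")
   finally show "sq g / (\<tau> * tk k)\<^sup>2 <= x\<^sup>2 * 4 * sq q" by simp
  qed (rule C)
  also have "... <= C * (6 * (x * norm q)\<^sup>2)" by (rule mult_left_mono[OF _ C]) (simp add: power_mult_distrib)
  also have "... = (sqrt (6 * C) * (x * norm q))\<^sup>2" using C by (simp add: power_mult_distrib)
  finally have "norm (Eop k (D g)) <= sqrt (6 * C) * (x * norm q)" by (rule power2_le_imp_le) (use C x in simp)
  then show ?thesis unfolding psi x_def q_def t_def .
 qed
 then show ?thesis using C by (intro exI[of _ "sqrt (6 * C)"]) auto
qed

lemma S_range:
 assumes v: "v : D ` dom" and t: "t > 0"
 shows "S.PP t v : D ` dom"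
proof -
 obtain y where y: "y : dom" "v = D y" using v by blast
 have "S.PP t (t *R D y) = t *R D (S.PP t y)" using S.PQ_BD(1)[OF _ y(1), of t] S.QQ_eq[of t y] t by simp
 moreover have "S.PP t (t *R D y) = t *R S.PP t (D y)" using linear_scale[OF S.PP_linear[of t]] t by simp
 ultimately have "S.PP t v = D (S.PP t y)" using t y by simp
 then show ?thesis using S.PP_dom[of t y] t by auto
qed

text \<open>\<open>v - S\<^sub>tv = tDq\<close> with \<open>q = tDS\<^sub>tv\<close>, and \<open>Q\<^sub>t(tBDq) = q - P\<^sub>tq\<close>.\<close>

lemma Th_high: "norm (Th k (v - S.PP (tk k) v)) <= (1 + C0) * norm (S.QQ (tk k) v)"
proof -
 define t where "t = tk k"
 have t: "t > 0" "t ~= 0" by (simp_all add: t_def)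
 define q where "q = S.QQ t v"
 have q: "q : dom" unfolding q_def by (rule S.QQ_dom[OF t(2)])
 have "v - S.PP t v = t *R D q" using S.PQ_sum[OF t(2), of v] unfolding q_def by (metis add_diff_cancel_left')
 then have "Th k (v - S.PP t v) = q - PP t q"
  unfolding Th_def t_def[symmetric] using PQ_BD(2)[OF t(2) q] linear_scale[OF bounded_linear.linear[OF B_bl]] by simp
 also have "norm ... <= norm q + norm (PP t q)" by (rule norm_triangle_ineq4)
 also have "... <= norm q + C0 * norm q" by (intro add_left_mono PP_norm t)
 finally show ?thesis unfolding q_def t_def by (simp add: distrib_right)
qed

text \<open>Here the gradient hypothesis enters: it bounds \<open>\<nabla>S\<^sub>tv\<close> by \<open>DS\<^sub>tv\<close>.\<close>

lemma principal_low:
 "\<exists>C\<ge>0. \<forall>k v. v : D ` dom --> norm (Th k (S.PP (tk k) v) - Gam k (S.PP (tk k) v)) <= C * norm (S.QQ (tk k) v)"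
proof -
 obtain C where C: "C >= 0" and pp: "!!k g G. has_weak_gradient g G ==>
  sq (Th k g - Gam k g) <= C * (tk k)\<^sup>2 * ((\<Sum>j\<in>UNIV. norm (G $ j))\<^sup>2 + sq g)"
  using principal_part by blast
 have "norm (Th k (S.PP (tk k) v) - Gam k (S.PP (tk k) v)) <= sqrt C * Cc * norm (S.QQ (tk k) v)" if v: "v : D ` dom" for k v
 proof -
  define t where "t = tk k"
  have t: "t > 0" "t ~= 0" by (simp_all add: t_def)
  define g where "g = S.PP t v"
  have gd: "g : dom" unfolding g_def by (rule S.PP_dom[OF t(2)])
  have gc: "g : closure (D ` dom)" unfolding g_def by (rule subsetD[OF closure_subset S_range[OF v t(1)]])
  obtain G where G: "has_weak_gradient g G" "norm g + (\<Sum>j\<in>UNIV. norm (G $ j)) <= Cc * norm (D g)"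
   using gradient[OF gd gc] by (elim exE conjE)
  define s where "s = (\<Sum>j\<in>UNIV. norm (G $ j))"
  have s0: "s >= 0" unfolding s_def by (intro sum_nonneg) simp
  have q: "t * norm (D g) = norm (S.QQ t v)"
  proof -
   have "S.QQ t v = t *R D g" unfolding g_def using S.QQ_eq[OF t(2), of v] by simp
   then show ?thesis using t by simp
  qed
  have "sq (Th k g - Gam k g) <= C * t\<^sup>2 * (s\<^sup>2 + sq g)" using pp[OF G(1), of k] unfolding s_def t_def .
  also have "s\<^sup>2 + sq g <= (norm g + s)\<^sup>2" using s0 by (simp add: power2_sum)
  also have "(norm g + s)\<^sup>2 <= (Cc * norm (D g))\<^sup>2" unfolding s_def by (rule power_mono[OF G(2)]) (simp add: sum_nonneg)
  also have "C * t\<^sup>2 * (Cc * norm (D g))\<^sup>2 = C * (Cc * (t * norm (D g)))\<^sup>2" by (simp add: power_mult_distrib)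
  also have "... = (sqrt C * Cc * norm (S.QQ t v))\<^sup>2" unfolding q using C by (simp add: power_mult_distrib)
  finally have "sq (Th k g - Gam k g) <= (sqrt C * Cc * norm (S.QQ t v))\<^sup>2" using C by (simp add: mult_left_mono)
  then have "norm (Th k g - Gam k g) <= sqrt C * Cc * norm (S.QQ t v)" by (rule power2_le_imp_le) (use C Cc_nonneg in simp)
  then show ?thesis unfolding g_def t_def .
 qed
 then show ?thesis using C Cc_nonneg by (intro exI[of _ "sqrt C * Cc"]) auto
qed

text \<open>The approximation \<open>S.PP (tk J) v\<close> of \<open>v\<close> makes the sum of frequency blocks finite; the error disappears as \<open>J\<close> grows.\<close>

theorem difference_sum:
 "\<exists>C\<ge>0. \<forall>K v. v : D ` dom --> (\<Sum>k\<le>K. sq (Th k v - Gam k v)) <= C * sq v"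
proof -
 obtain C2 where C2: "C2 >= 0" and low: "!!k v. v : D ` dom ==> norm (Th k (S.PP (tk k) v) - Gam k (S.PP (tk k) v)) <= C2 * norm (S.QQ (tk k) v)"
  using principal_low by blast
 obtain C3 where C3: "C3 >= 0" and block: "!!k j v. k <= j ==>
  norm (Eop k (S.PP (tk (Suc j)) v - S.PP (tk j) v)) <= C3 * (\<rho> ^ (j - k) * norm (S.QQ (tk j) v))"
  using Eop_block by blast
 define Cg where "Cg = CL * sqrt CI"
 have Cg: "Cg >= 0" using CL_nonneg CI_nonneg by (simp add: Cg_def)
 have Gn: "norm (Gam k u) <= Cg * norm (Eop k u)" for k u
 proof (rule power2_le_imp_le)
  show "sq (Gam k u) <= (Cg * norm (Eop k u))\<^sup>2"
   using Gam_norm[of k u] CI_nonneg by (simp add: Cg_def power_mult_distrib)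
 qed (use Cg in simp)
 define A where "A = 1 + C0 + C2"
 have A: "A >= 0" using C0_ge_1 C2 by (simp add: A_def)
 define M where "M = 3 * A\<^sup>2 * (4/3) + 3 * (Cg * C3)\<^sup>2 * ((1 / (1 - \<rho>))\<^sup>2 * (4/3))"
 have "(\<Sum>k\<le>K. sq (Th k v - Gam k v)) <= M * sq v" if v: "v : D ` dom" for K v
 proof -
  define b where "b k = norm (S.QQ (tk k) v)" for k
  define r where "r J = norm (v - S.PP (tk J) v)" for J
  have bs: "(\<Sum>k<J. (b k)\<^sup>2) <= (4/3) * sq v" for J unfolding b_def by (rule S_square_sum)
  let ?s = "%k J. \<Sum>j\<in>{k..<J}. \<rho> ^ (j - k) * b j"
  have tel: "norm (Eop k (S.PP (tk J) v - S.PP (tk k) v)) <= (\<Sum>j\<in>{k..<J}. C3 * (\<rho> ^ (j - k) * b j))" if kJ: "k <= J" for k J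
   using kJ
  proof (induction J rule: dec_induct)
   case base
   have "Eop k (0 :: ('n, 'm) L2) = 0" using Eop_add[of k 0 0] by simp
   then show ?case by simp
  next
   case (step J)
   have "S.PP (tk (Suc J)) v - S.PP (tk k) v = (S.PP (tk J) v - S.PP (tk k) v) + (S.PP (tk (Suc J)) v - S.PP (tk J) v)" by simp
   then have "norm (Eop k (S.PP (tk (Suc J)) v - S.PP (tk k) v)) <= norm (Eop k (S.PP (tk J) v - S.PP (tk k) v)) + norm (Eop k (S.PP (tk (Suc J)) v - S.PP (tk J) v))"
    unfolding Eop_add by (metis Eop_add norm_triangle_ineq)
   also have "... <= (\<Sum>j\<in>{k..<J}. C3 * (\<rho> ^ (j - k) * b j)) + C3 * (\<rho> ^ (J - k) * b J)"
    unfolding b_def by (intro add_mono step.IH[unfolded b_def] block step.hyps)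
   finally show ?case using step.hyps by simp
  qed
  have each: "norm (Th k v - Gam k v) <= A * b k + (Cg * C3) * ?s k J + Cg * r J" if kJ: "k <= J" for k J
  proof -
   define s where "s = S.PP (tk k) v"
   have "Th k v = Th k (v - s) + Th k s" by (simp add: linear_add[OF Th_linear, symmetric])
   moreover have "Gam k v = Gam k (v - s) + Gam k s" by (simp add: Gam_diff)
   ultimately have "Th k v - Gam k v = Th k (v - s) + (Th k s - Gam k s) - Gam k (v - s)" by simp
   then have "norm (Th k v - Gam k v) <= norm (Th k (v - s)) + norm (Th k s - Gam k s) + norm (Gam k (v - s))"
    by (rule norm_split3)
   also have "... <= (1 + C0) * b k + C2 * b k + Cg * norm (Eop k (v - s))"
    unfolding s_def b_def by (intro add_mono Th_high low[OF v] Gn)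
   also have "norm (Eop k (v - s)) <= (\<Sum>j\<in>{k..<J}. C3 * (\<rho> ^ (j - k) * b j)) + r J"
   proof -
    have "v - s = (S.PP (tk J) v - s) + (v - S.PP (tk J) v)" by simp
    then have "norm (Eop k (v - s)) <= norm (Eop k (S.PP (tk J) v - s)) + norm (Eop k (v - S.PP (tk J) v))"
     by (metis Eop_add norm_triangle_ineq)
    also have "... <= (\<Sum>j\<in>{k..<J}. C3 * (\<rho> ^ (j - k) * b j)) + r J"
     unfolding r_def s_def by (intro add_mono tel[OF kJ] Eop_contraction)
    finally show ?thesis .
   qed
   also have "(\<Sum>j\<in>{k..<J}. C3 * (\<rho> ^ (j - k) * b j)) = C3 * ?s k J" by (rule sum_distrib_left[symmetric])
   finally show ?thesis using Cg by (simp add: A_def distrib_left distrib_right mult_left_mono mult.assoc)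
  qed
  have sumJ: "(\<Sum>k\<le>K. sq (Th k v - Gam k v)) <= M * sq v + 3 * Cg\<^sup>2 * real (Suc K) * (r J)\<^sup>2" if J: "K < J" for J
  proof -
   have "(\<Sum>k\<le>K. sq (Th k v - Gam k v)) <= (\<Sum>k\<le>K. 3 * A\<^sup>2 * (b k)\<^sup>2 + 3 * (Cg * C3)\<^sup>2 * (?s k J)\<^sup>2 + 3 * Cg\<^sup>2 * (r J)\<^sup>2)"
   proof (rule sum_mono)
    fix k assume "k : {..K}"
    then have "sq (Th k v - Gam k v) <= (A * b k + (Cg * C3) * ?s k J + Cg * r J)\<^sup>2"
     by (intro power_mono each) (use J in auto)
    also have "... <= 3 * (A * b k)\<^sup>2 + 3 * ((Cg * C3) * ?s k J)\<^sup>2 + 3 * (Cg * r J)\<^sup>2"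
     by (rule square_add3_le)
    finally show "sq (Th k v - Gam k v) <= 3 * A\<^sup>2 * (b k)\<^sup>2 + 3 * (Cg * C3)\<^sup>2 * (?s k J)\<^sup>2 + 3 * Cg\<^sup>2 * (r J)\<^sup>2"
     by (simp only: power_mult_distrib mult.assoc)
   qed
   also have "... = 3 * A\<^sup>2 * (\<Sum>k\<le>K. (b k)\<^sup>2) + 3 * (Cg * C3)\<^sup>2 * (\<Sum>k\<le>K. (?s k J)\<^sup>2) + 3 * Cg\<^sup>2 * real (Suc K) * (r J)\<^sup>2"
    unfolding sum.distrib sum_distrib_left[symmetric] by simp
   also have "... <= 3 * A\<^sup>2 * ((4/3) * sq v) + 3 * (Cg * C3)\<^sup>2 * ((1 / (1 - \<rho>))\<^sup>2 * ((4/3) * sq v)) + 3 * Cg\<^sup>2 * real (Suc K) * (r J)\<^sup>2"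
   proof (intro add_mono mult_left_mono order_refl)
    show "(\<Sum>k\<le>K. (b k)\<^sup>2) <= (4/3) * sq v" using bs[of "Suc K"] by (simp only: lessThan_Suc_atMost)
    have "(\<Sum>k\<le>K. (?s k J)\<^sup>2) <= (1 / (1 - \<rho>))\<^sup>2 * (\<Sum>j<J. (b j)\<^sup>2)"
     by (rule schur_bound) (use rho in auto)
    also have "... <= (1 / (1 - \<rho>))\<^sup>2 * ((4/3) * sq v)" by (rule mult_left_mono[OF bs]) simp
    finally show "(\<Sum>k\<le>K. (?s k J)\<^sup>2) <= (1 / (1 - \<rho>))\<^sup>2 * ((4/3) * sq v)" .
   qed auto
   also have "... = M * sq v + 3 * Cg\<^sup>2 * real (Suc K) * (r J)\<^sup>2" by (simp only: M_def distrib_right mult.assoc)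
   finally show ?thesis .
  qed
  have "(%J. v - S.PP (tk J) v) ----> v - v" by (intro tendsto_intros S_tendsto)
  then have "r ----> 0" unfolding r_def by (simp add: tendsto_norm_zero_iff)
  then have "(%J. M * sq v + 3 * Cg\<^sup>2 * real (Suc K) * (r J)\<^sup>2) ----> M * sq v + 3 * Cg\<^sup>2 * real (Suc K) * 0\<^sup>2"
   by (intro tendsto_intros)
  then have "(%J. M * sq v + 3 * Cg\<^sup>2 * real (Suc K) * (r J)\<^sup>2) ----> M * sq v" by simp
  then show ?thesis by (rule tendsto_lowerbound[OF _ eventually_mono[OF eventually_gt_at_top[of K] sumJ] sequentially_bot])
 qed
 then show ?thesis by (intro exI[of _ M]) (auto simp: M_def)
qed

end

section \<open>Test functions for the Carleson measure\<close>

lemma norm_mult_indicator_le: "A : sets borel ==> norm (mult (indicator A) u) <= norm u"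
proof -
 assume A: "A : sets borel"
 have "esq (mult (indicator A) u) <= esq u" unfolding norm_mult_indicator[OF A] norm_L2_nn[of u]
  by (rule nn_integral_mono) (auto simp: indicator_def)
 then have "sq (mult (indicator A) u) <= sq u" by (subst (asm) ennreal_le_iff) auto
 then show ?thesis by (rule power2_le_imp_le) simp
qed

lemma norm_tw_nn:
 assumes A: "A : sets borel" "bounded A"
 shows "esq (tw (indicator A) w :: ('n::finite, 'm::finite) L2) = esq w * emeasure lborel A"
proof -
 have "esq (tw (indicator A) w :: ('n, 'm) L2) = (NN x. esq w * indicator A x)"
  unfolding tw_def norm_mk_nn[OF bbs_sqint[OF bbs_indicator[OF A]]] by (rule nn_integral_cong) (auto simp: indicator_def)
 also have "... = esq w * emeasure lborel A" by (rule nn_integral_cmult_indicator) (use A in simp)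
 finally show ?thesis .
qed

lemma norm_tw_ball:
 fixes p :: "real^'n"
 assumes r: "r >= 0"
 shows "sq (tw (indicator (ball p r)) w :: ('n::finite, 'm::finite) L2) <= (2 * r) ^ CARD('n) * sq w"
proof -
 have b: "ball p r : sets borel" "bounded (ball p r)" by auto
 have "ball p r \<subseteq> cube (p - vec r) (2 * r)"
 proof
  fix x assume "x : ball p r"
  then have n: "norm (x - p) < r" by (simp add: dist_norm norm_minus_commute)
  have "\<bar>x $ i - p $ i\<bar> < r" for i using component_le_norm_cart[of "x - p" i] n by simp
  then have "x $ i - p $ i < r \<and> - (x $ i - p $ i) < r" for i by (simp add: abs_less_iff)
  then have "p $ i - r <= x $ i \<and> x $ i < p $ i - r + 2 * r" for i by (smt (verit))
  then show "x : cube (p - vec r) (2 * r)" by (simp add: cube_def)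
 qed
 then have "emeasure lborel (ball p r) <= emeasure lborel (cube (p - vec r) (2 * r))" by (rule emeasure_mono) simp
 also have "... = ennreal ((2 * r) ^ CARD('n))" by (rule emeasure_cube) (use r in simp)
 finally have "esq (tw (indicator (ball p r)) w :: ('n, 'm) L2) <= esq w * ennreal ((2 * r) ^ CARD('n))"
  unfolding norm_tw_nn[OF b] by (rule mult_left_mono) simp
 also have "... = ennreal ((2 * r) ^ CARD('n) * sq w)" by (simp add: ennreal_mult'[symmetric] mult.commute del: ennreal_power)
 finally show ?thesis using r by (subst (asm) ennreal_le_iff) auto
qed

lemma corner_in_cell: "corner k z : cell k z" by (simp add: cell_def cube_def)

lemma child_cell_subset: "j <= k ==> par (k - j) z' = z ==> cell k z' \<subseteq> cell j z"
 using idx_par[of j k] by (auto simp: mem_cell)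

lemma scale_square_sum: "(\<Sum>k\<in>{j..K}. (tk k / tk j)\<^sup>2) <= 4/3"
proof -
 have "(tk k / tk j)\<^sup>2 = (1/4) ^ (k - j)" if "k : {j..K}" for k
 proof -
  have "tk k = tk j * (1/2) ^ (k - j)" using that by (simp add: tk_def power_add[symmetric])
  then have "(tk k / tk j)\<^sup>2 = ((1/2) ^ (k - j))\<^sup>2" by simp
  also have "... = ((1/2)\<^sup>2) ^ (k - j)" by (simp only: power_mult[symmetric] mult.commute)
  finally show ?thesis by (simp add: power2_eq_square)
 qed
 then have "(\<Sum>k\<in>{j..K}. (tk k / tk j)\<^sup>2) = (\<Sum>k\<in>{j..K}. (1/4) ^ (k - j))" by (rule sum.cong[OF refl])
 also have "... = (\<Sum>i<Suc K - j. (1/4) ^ i)" by (rule sum.reindex_bij_witness[of _ "%i. i + j" "%k. k - j"]) auto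
 also have "... <= 1 / (1 - 1/4)" by (rule geometric_bound) auto
 finally show ?thesis by simp
qed

lemma cell_subset_ball: "cell j (z :: int^'n) \<subseteq> ball (corner j z) ((1 + real CARD('n)) * tk j)"
proof
 fix x assume "x : cell j z"
 then have "norm (x - corner j z) <= real CARD('n) * tk j" by (rule cell_norm)
 also have "real CARD('n) * tk j < (1 + real CARD('n)) * tk j" by (simp add: distrib_right)
 finally show "x : ball (corner j z) ((1 + real CARD('n)) * tk j)" by (simp add: dist_norm norm_minus_commute)
qed

context kato
begin

text \<open>Two different cutoffs of a constant agree near the small cube, so the off-diagonal decay gains the square of
the ratio of scales.\<close>

lemma Th_const_local:
 fixes w :: "complex^'m"
 assumes jk: "j <= k" and sub: "cell k z' \<subseteq> cell j z"
 defines "A \<equiv> ball (corner j z) ((1 + real CARD('n)) * tk j)"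
 shows "sq (mult (ic k z') (Th k (tw (indicator (reach k z')) w - tw (indicator A) w)))
  <= CL\<^sup>2 * CI * (tk k / tk j)\<^sup>2 * sq w * vol TYPE('n) k"
proof -
 let ?n = "real CARD('n)" and ?p = "corner k z'"
 define t l where "t = tk k" and "l = tk j"
 have t: "t > 0" "l > 0" "l <= 1" by (simp_all add: t_def l_def tk_le_1)
 have Ab: "A : sets borel" "bounded A" unfolding A_def by auto
 have pc: "norm (?p - corner j z) <= ?n * l" unfolding l_def by (rule cell_norm) (use sub corner_in_cell in blast)
 have far: "norm (x - ?p) >= l" if "indicator (reach k z') x ~= (indicator A x :: real)" for x
 proof -
  have "x \<notin> reach k z' \<or> x \<notin> A" using that by (auto simp: indicator_def split: if_splits)
  then show ?thesis
  proof
   assume "x \<notin> reach k z'"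
   then have "norm (x - ?p) >= 1 + ?n" by (simp add: reach_def dist_norm norm_minus_commute)
   then show ?thesis using t by linarith
  next
   assume "x \<notin> A"
   then have "norm (x - corner j z) >= (1 + ?n) * l" by (simp add: A_def l_def dist_norm norm_minus_commute)
   moreover have "norm (x - corner j z) <= norm (x - ?p) + norm (?p - corner j z)"
    using norm_triangle_ineq[of "x - ?p" "?p - corner j z"] by simp
   ultimately show ?thesis using pc by (simp add: distrib_right)
  qed
 qed
 define d where "d = tw (indicator (reach k z')) w - (tw (indicator A) w :: ('n, 'm) L2)"
 let ?q = "%x. ennreal ((1 + (norm (x - ?p) / tk k)\<^sup>2) * (wt k ?p x)\<^sup>2)"
 have "esq (mult (wt k ?p) d) <= (NN x. ennreal ((t / l)\<^sup>2 * sq w) * ?q x)" unfolding norm_mult_nn[OF wt_bm]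
 proof (rule nn_integral_mono_AE)
  show "AE x in lborel. ennreal ((wt k ?p x)\<^sup>2 * sq (fn d x)) <= ennreal ((t / l)\<^sup>2 * sq w) * ?q x"
   using fn_diff[of "tw (indicator (reach k z')) w" "tw (indicator A) w"] fn_tw[OF reach_bbs(3), of k z' w] fn_tw[OF bbs_indicator[OF Ab], of w]
   unfolding d_def[symmetric]
  proof eventually_elim
   case (elim x)
   have fd: "fn d x = (indicator (reach k z') x - indicator A x) *R w" unfolding elim by (simp add: scaleR_diff_left)
   have "sq (fn d x) <= (t / l)\<^sup>2 * (1 + (norm (x - ?p) / t)\<^sup>2) * sq w"
   proof (cases "indicator (reach k z') x = (indicator A x :: real)")
    case True
    then show ?thesis by (simp add: fd)
   next
    case False
    have "\<bar>indicator (reach k z') x - indicator A x :: real\<bar> <= 1" by (auto simp: indicator_def)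
    then have "norm (fn d x) <= 1 * norm w" unfolding fd norm_scaleR real_norm_def by (rule mult_right_mono) simp
    then have "sq (fn d x) <= (1 * norm w)\<^sup>2" by (rule power_mono) simp
    then have 1: "sq (fn d x) <= 1 * sq w" by simp
    have "1 <= (norm (x - ?p) / l)\<^sup>2" using far[OF False] t by (simp add: one_le_power)
    also have "... = (t / l)\<^sup>2 * (norm (x - ?p) / t)\<^sup>2" using t by (simp add: power_divide)
    also have "... <= (t / l)\<^sup>2 * (1 + (norm (x - ?p) / t)\<^sup>2)" by (rule mult_left_mono) auto
    finally have "1 * sq w <= (t / l)\<^sup>2 * (1 + (norm (x - ?p) / t)\<^sup>2) * sq w" by (rule mult_right_mono) simp
    with 1 show ?thesis by (rule order_trans)
   qed
   then have "(wt k ?p x)\<^sup>2 * sq (fn d x) <= (wt k ?p x)\<^sup>2 * ((t / l)\<^sup>2 * (1 + (norm (x - ?p) / t)\<^sup>2) * sq w)"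
    by (rule mult_left_mono) simp
   also have "... = ((t / l)\<^sup>2 * sq w) * ((1 + (norm (x - ?p) / tk k)\<^sup>2) * (wt k ?p x)\<^sup>2)" by (simp only: mult_ac t_def)
   finally have "ennreal ((wt k ?p x)\<^sup>2 * sq (fn d x)) <= ennreal (((t / l)\<^sup>2 * sq w) * ((1 + (norm (x - ?p) / tk k)\<^sup>2) * (wt k ?p x)\<^sup>2))"
    by (rule ennreal_leI)
   also have "... = ennreal ((t / l)\<^sup>2 * sq w) * ?q x" by (rule ennreal_mult') simp
   finally show ?case .
  qed
 qed
 also have "... = ennreal ((t / l)\<^sup>2 * sq w) * (NN x. ?q x)" by (rule nn_integral_cmult) measurable
 also have "... <= ennreal ((t / l)\<^sup>2 * sq w) * ennreal (CI * vol TYPE('n) k)" by (rule mult_left_mono[OF wt_integral]) simp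
 also have "... = ennreal ((t / l)\<^sup>2 * sq w * (CI * vol TYPE('n) k))" by (rule ennreal_mult'[symmetric]) simp
 finally have d2: "sq (mult (wt k ?p) d) <= (t / l)\<^sup>2 * sq w * (CI * vol TYPE('n) k)"
  using CI_nonneg vol_pos[where 'n = 'n, of k] by (subst (asm) ennreal_le_iff) auto
 have "sq (mult (ic k z') (Th k d)) <= (CL * norm (mult (wt k ?p) d))\<^sup>2" by (rule power_mono[OF Th_cell]) simp
 also have "... = CL\<^sup>2 * sq (mult (wt k ?p) d)" by (rule power_mult_distrib)
 also have "... <= CL\<^sup>2 * ((t / l)\<^sup>2 * sq w * (CI * vol TYPE('n) k))" by (rule mult_left_mono[OF d2]) simp
 finally show ?thesis unfolding d_def t_def l_def by (simp add: mult_ac)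
qed

lemma Gam_const:
 fixes w :: "complex^'m" and j k :: nat and z :: "int^'n"
 assumes jk: "j <= k" and w: "norm w = 1"
 defines "u0 \<equiv> tw (indicator (ball (corner j z) ((1 + real CARD('n)) * tk j))) w"
 shows "(NN x. esq (Gfun k u0 x - fn (Th k u0) x) * ic j z x)
  <= ennreal (CL\<^sup>2 * CI * (tk k / tk j)\<^sup>2 * vol TYPE('n) j)"
proof -
 define c where "c = CL\<^sup>2 * CI * (tk k / tk j)\<^sup>2"
 have c0: "c >= 0" using CI_nonneg by (simp add: c_def)
 define A where "A = ball (corner j z) ((1 + real CARD('n)) * tk j)"
 define \<phi> :: "int^'n => ennreal" where "\<phi> z' = indicator {z'. par (k - j) z' = z} z'" for z'
 have ind: "ic j z x = \<phi> (idx k x)" for x :: "real^'n"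
  using idx_par[OF jk, of x] by (simp add: \<phi>_def indicator_def mem_cell)
 have QA: "cell j z \<subseteq> A" unfolding A_def by (rule cell_subset_ball)
 have Ab: "A : sets borel" "bounded A" unfolding A_def by auto
 have "(NN x. \<phi> (idx k x) * esq (Gfun k u0 x - fn (Th k u0) x)) <= (NN (x :: real^'n). \<phi> (idx k x) * ennreal c)"
 proof (rule cellwise_mono)
  fix z' assume "\<phi> z' ~= 0"
  then have "par (k - j) z' = z" by (auto simp: \<phi>_def indicator_def split: if_splits)
  then have sub: "cell k z' \<subseteq> cell j z" by (rule child_cell_subset[OF jk])
  have av: "avgv k z' u0 = w" unfolding u0_def A_def[symmetric] by (rule avgv_tw[OF Ab]) (use sub QA in blast)
  have lin: "Th k (tw (indicator (reach k z')) w - u0) = Th k (tw (indicator (reach k z')) w) - Th k u0" by (rule linear_diff[OF Th_linear])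
  have "(NN x. esq (Gfun k u0 x - fn (Th k u0) x) * ic k z' x)
    = (NN x. esq (fn (Th k (tw (indicator (reach k z')) w - u0)) x) * ic k z' x)"
  proof (rule nn_integral_cong_AE)
   show "AE x in lborel. esq (Gfun k u0 x - fn (Th k u0) x) * ic k z' x = esq (fn (Th k (tw (indicator (reach k z')) w - u0)) x) * ic k z' x"
    unfolding lin using Gfun_cell[of k z' u0] fn_diff[of "Th k (tw (indicator (reach k z')) w)" "Th k u0"]
    unfolding av by eventually_elim (auto simp: indicator_def)
  qed
  also have "... = esq (mult (ic k z') (Th k (tw (indicator (reach k z')) w - u0)))"
   by (rule norm_mult_indicator[symmetric]) simp
  also have "... <= ennreal (c * vol TYPE('n) k)"
   using Th_const_local[OF jk sub, of w] w unfolding u0_def c_def by (intro ennreal_leI) simp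
  also have "... = (NN x. ennreal c * ic k z' x)"
   using c0 by (subst nn_integral_cmult_indicator) (auto simp: emeasure_cell ennreal_mult')
  finally show "(NN x. esq (Gfun k u0 x - fn (Th k u0) x) * ic k z' x) <= (NN x. ennreal c * ic k z' x)" .
 qed auto
 also have "... = (NN x. ennreal c * ic j z x)" unfolding ind by (simp add: mult.commute)
 also have "... = ennreal (c * vol TYPE('n) j)"
  using c0 by (subst nn_integral_cmult_indicator) (auto simp: emeasure_cell ennreal_mult')
 finally show ?thesis unfolding ind c_def by (simp add: mult.commute)
qed

text \<open>For \<open>f = u0 - sDQ\<^sub>sBu0\<close> one has \<open>Bf = P\<^sub>sBu0\<close>, so \<open>\<Theta>\<^sub>kf\<close> gains \<open>t/s\<close>. The principal part of \<open>f\<close> differs from \<open>\<Theta>\<^sub>kf\<close> by the error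
for the constant \<open>u0\<close>, and by that for \<open>sDQ\<^sub>sBu0\<close>, which lies in the range of \<open>D\<close>.\<close>

theorem test_functions:
 "\<exists>C1 C2. C1 >= 1 \<and> C2 >= 0 \<and> (\<forall>j z \<nu> K. norm \<nu> = 1 --> (\<exists>f.
   sq f <= C1 * vol TYPE('n) j \<and> norm (avgv j z f - \<nu>) <= 1/4 \<and>
   (NN x. (\<Sum>k\<in>{j..K}. esq (Gfun k f x)) * ic j z x) <= ennreal (C2 * vol TYPE('n) j)))"
proof -
 obtain CA where CA: "CA >= 0" and av: "!!k z g \<tau>. g : dom ==> 0 < \<tau> ==> \<tau> <= 1/2 ==>
  vol TYPE('n) k * sq (avgv k z (D g)) <=
   CA * (\<tau> * sq (mult (ic k z) (D g)) + sq (mult (ic k z) g) / (\<tau> * tk k)\<^sup>2)" using avgv_D_bound by blast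
 obtain CD where CD: "CD >= 0" and dif: "!!K v. v : D ` dom ==> (\<Sum>k\<le>K. sq (Th k v - Gam k v)) <= CD * sq v"
  using difference_sum by blast
 let ?n = "CARD('n)"
 define Cn where "Cn = (2 * (1 + real ?n)) ^ ?n"
 have Cn: "Cn >= 1" unfolding Cn_def by (rule one_le_power) simp
 define V where "V = Bn\<^sup>2 * Cn"
 have V: "V >= 0" using Cn by (simp add: V_def)
 define X where "X = CA * V"
 have X: "X >= 0" using CA V by (simp add: X_def)
 \<comment> \<open>first \<open>\<tau>\<close>, then \<open>\<epsilon>\<close>: each of the two terms of the averaging estimate contributes at most \<open>1/32\<close> to the squared mean\<close>
 define \<tau> where "\<tau> = 1 / (2 + 32 * (X / \<delta>\<^sup>2))"
 have \<tau>: "0 < \<tau>" "\<tau> <= 1/2" "X * (\<tau> / \<delta>\<^sup>2) <= 1/32"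
 proof -
  define Y where "Y = X / \<delta>\<^sup>2"
  have Y: "Y >= 0" using X by (simp add: Y_def)
  show "0 < \<tau>" "\<tau> <= 1/2" using Y by (auto simp: \<tau>_def Y_def[symmetric] field_simps)
  have "X * (\<tau> / \<delta>\<^sup>2) = Y * \<tau>" by (simp add: Y_def)
  also have "... <= 1/32" using Y by (simp add: \<tau>_def Y_def[symmetric] field_simps)
  finally show "X * (\<tau> / \<delta>\<^sup>2) <= 1/32" .
 qed
 define \<epsilon> where "\<epsilon> = \<tau> / (C0 * (1 + 32 * X))"
 have d0: "C0 * (1 + 32 * X) > 0" using C0_ge_1 X by (intro mult_pos_pos) auto
 have \<epsilon>: "0 < \<epsilon>" unfolding \<epsilon>_def using \<tau> d0 by simp
 have \<epsilon>2: "X * (\<epsilon>\<^sup>2 * C0\<^sup>2 / \<tau>\<^sup>2) <= 1/32"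
 proof -
  have "\<epsilon> * C0 / \<tau> = 1 / (1 + 32 * X)" using \<tau> C0_ge_1 by (simp add: \<epsilon>_def)
  then have "X * (\<epsilon>\<^sup>2 * C0\<^sup>2 / \<tau>\<^sup>2) = X * (1 / (1 + 32 * X))\<^sup>2" by (metis power_divide power_mult_distrib)
  also have "... <= X * (1 / (1 + 32 * X))"
  proof (rule mult_left_mono[OF _ X])
   have "(1 / (1 + 32 * X))\<^sup>2 = (1 / (1 + 32 * X)) * (1 / (1 + 32 * X))" by (rule power2_eq_square)
   also have "... <= (1 / (1 + 32 * X)) * 1" by (rule mult_left_mono) (use X in auto)
   finally show "(1 / (1 + 32 * X))\<^sup>2 <= 1 / (1 + 32 * X)" by simp
  qed
  also have "... <= 1/32" using X by (simp add: pos_divide_le_eq)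
  finally show ?thesis .
 qed
 define C1 where "C1 = 2 * (Cn + V / \<delta>\<^sup>2)"
 have C1: "C1 >= 1"
 proof -
  have "V / \<delta>\<^sup>2 >= 0" using V by simp
  then show ?thesis using Cn by (simp add: C1_def distrib_left)
 qed
 define C2 where "C2 = 3 * (CL\<^sup>2 * CI * (4/3)) + 3 * (C0^4 / \<epsilon>\<^sup>2 * V * (4/3)) + 3 * (CD * (V / \<delta>\<^sup>2))"
 have C2: "C2 >= 0" unfolding C2_def using CI_nonneg V CD by simp
 have "\<exists>f. sq f <= C1 * vol TYPE('n) j \<and> norm (avgv j z f - \<nu>) <= 1/4 \<and>
   (NN x. (\<Sum>k\<in>{j..K}. esq (Gfun k f x)) * ic j z x) <= ennreal (C2 * vol TYPE('n) j)"
  if \<nu>: "norm \<nu> = 1" for j z \<nu> K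
 proof -
  define l where "l = tk j"
  have l: "l > 0" by (simp add: l_def)
  define v where "v = vol TYPE('n) j"
  have v: "v > 0" unfolding v_def by (rule vol_pos)
  define u0 :: "('n, 'm) L2" where "u0 = tw (indicator (ball (corner j z) ((1 + real ?n) * tk j))) \<nu>"
  have u0: "sq u0 <= Cn * v"
  proof -
   have "sq u0 <= (2 * ((1 + real ?n) * tk j)) ^ ?n * sq \<nu>"
    unfolding u0_def by (rule norm_tw_ball) (simp add: less_imp_le)
   then show ?thesis unfolding mult.assoc[symmetric] Cn_def v_def vol_def power_mult_distrib[of "2 * (1 + real ?n)" "tk j"] \<nu> by simp
  qed
  define v0 where "v0 = B u0"
  have v0: "sq v0 <= V * v"
  proof -
   have "sq v0 <= (Bn * norm u0)\<^sup>2" unfolding v0_def by (rule power_mono[OF B_bound]) simp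
   also have "... = Bn\<^sup>2 * sq u0" by (rule power_mult_distrib)
   also have "... <= Bn\<^sup>2 * (Cn * v)" by (rule mult_left_mono[OF u0]) simp
   finally show ?thesis by (simp add: V_def mult.assoc)
  qed
  define s where "s = \<epsilon> * l"
  have s: "s > 0" "s ~= 0" using \<epsilon> l by (auto simp: s_def)
  define g where "g = s *R QQ s v0"
  have gd: "g : dom" unfolding g_def by (intro dom_scaleR QQ_dom s)
  define h where "h = D g"
  have hr: "h : D ` dom" unfolding h_def using gd by blast
  have hD: "h = s *R D (QQ s v0)" unfolding h_def g_def by (rule D_scaleR[OF QQ_dom[OF s(2)]])
  have hn: "sq h <= V / \<delta>\<^sup>2 * v"
  proof -
   have "\<delta> * norm h <= norm v0" using DQQ_norm[OF s(2), of v0] s by (simp add: hD mult.assoc)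
   then have "norm h <= norm v0 / \<delta>" using \<delta>_pos by (simp add: pos_le_divide_eq mult.commute)
   then have "sq h <= (norm v0 / \<delta>)\<^sup>2" by (rule power_mono) simp
   also have "... = sq v0 / \<delta>\<^sup>2" by (rule power_divide)
   also have "... <= V * v / \<delta>\<^sup>2" by (rule divide_right_mono[OF v0]) simp
   finally show ?thesis by simp
  qed
  have gn: "sq g <= (\<epsilon>\<^sup>2 * C0\<^sup>2) * l\<^sup>2 * (V * v)"
  proof -
   have "norm g <= s * (C0 * norm v0)" using QQ_norm[OF s(2), of v0] s by (simp add: g_def)
   then have "sq g <= (s * (C0 * norm v0))\<^sup>2" by (rule power_mono) simp
   also have "... = (\<epsilon>\<^sup>2 * C0\<^sup>2) * l\<^sup>2 * sq v0" by (simp add: s_def power_mult_distrib)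
   also have "... <= (\<epsilon>\<^sup>2 * C0\<^sup>2) * l\<^sup>2 * (V * v)" by (rule mult_left_mono[OF v0]) simp
   finally show ?thesis .
  qed
  define f where "f = u0 - h"
  have Bf: "B f = PP s v0"
  proof -
   have "B f = v0 - B h" unfolding f_def v0_def by (rule linear_diff[OF bounded_linear.linear[OF B_bl]])
   also have "B h = s *R B (D (QQ s v0))" unfolding hD by (rule linear_scale[OF bounded_linear.linear[OF B_bl]])
   finally show ?thesis using PQ_sum[OF s(2), of v0] by (metis add_diff_cancel_right')
  qed
  have P1: "sq f <= C1 * v"
  proof -
   have "sq f <= (norm u0 + norm h)\<^sup>2" unfolding f_def by (rule power_mono[OF norm_triangle_ineq4]) simp
   also have "... <= 2 * sq u0 + 2 * sq h" using sum_squares_bound[of "norm u0" "norm h"] by (simp add: power2_sum)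
   also have "... <= 2 * (Cn * v) + 2 * (V / \<delta>\<^sup>2 * v)" by (intro add_mono mult_left_mono u0 hn) auto
   finally show ?thesis by (simp add: C1_def distrib_right distrib_left mult.assoc)
  qed
  have P2: "norm (avgv j z f - \<nu>) <= 1/4"
  proof -
   have "cell j z \<subseteq> ball (corner j z) ((1 + real ?n) * tk j)" by (rule cell_subset_ball)
   then have "avgv j z u0 = \<nu>" unfolding u0_def by (intro avgv_tw) auto
   then have e: "norm (avgv j z f - \<nu>) = norm (avgv j z (D g))" unfolding f_def avgv_diff h_def by simp
   have "v * sq (avgv j z (D g)) <= CA * (\<tau> * sq (mult (ic j z) (D g)) + sq (mult (ic j z) g) / (\<tau> * tk j)\<^sup>2)"
    unfolding v_def by (rule av[OF gd \<tau>(1,2)])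
   also have "... <= CA * (\<tau> * sq h + sq g / (\<tau> * tk j)\<^sup>2)"
    unfolding h_def using \<tau> by (intro mult_left_mono add_mono divide_right_mono power_mono norm_mult_indicator_le CA) auto
   also have "... <= CA * (\<tau> * (V / \<delta>\<^sup>2 * v) + ((\<epsilon>\<^sup>2 * C0\<^sup>2) * l\<^sup>2 * (V * v)) / (\<tau> * tk j)\<^sup>2)"
    using \<tau> by (intro mult_left_mono add_mono divide_right_mono hn gn CA) auto
   also have "... = (X * (\<tau> / \<delta>\<^sup>2) + X * (\<epsilon>\<^sup>2 * C0\<^sup>2 / \<tau>\<^sup>2)) * v"
   proof -
    have e: "((\<epsilon>\<^sup>2 * C0\<^sup>2) * l\<^sup>2 * (V * v)) / (\<tau> * tk j)\<^sup>2 = (\<epsilon>\<^sup>2 * C0\<^sup>2 / \<tau>\<^sup>2) * (V * v)"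
     using l \<tau> by (simp add: l_def[symmetric] power_mult_distrib)
    have "CA * (\<tau> * (V / \<delta>\<^sup>2 * v) + q * (V * v)) = (X * (\<tau> / \<delta>\<^sup>2) + X * q) * v" for q
     by (simp add: X_def algebra_simps)
    then show ?thesis unfolding e .
   qed
   also have "... <= (1/32 + 1/32) * v" by (intro mult_right_mono add_mono \<tau> \<epsilon>2) (use v in simp)
   finally have "sq (avgv j z (D g)) * v <= (1/4)\<^sup>2 * v" by (simp add: power2_eq_square mult.commute)
   then have "sq (avgv j z (D g)) <= (1/4)\<^sup>2" using v by (rule mult_right_le_imp_le)
   then have "norm (avgv j z (D g)) <= 1/4" by (rule power2_le_imp_le) simp
   then show ?thesis unfolding e .
  qed
  have P3: "(NN x. (\<Sum>k\<in>{j..K}. esq (Gfun k f x)) * ic j z x) <= ennreal (C2 * v)"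
  proof -
   define a1 a2 a3 where "a1 k = CL\<^sup>2 * CI * (tk k / tk j)\<^sup>2 * v" and "a2 k = sq (Th k f)" and "a3 k = sq (Th k h - Gam k h)" for k
   have a0: "a1 k >= 0" "a2 k >= 0" "a3 k >= 0" for k using CI_nonneg v by (auto simp: a1_def a2_def a3_def)
   have each: "(NN x. esq (Gfun k f x) * ic j z x) <= ennreal (3 * a1 k + 3 * a2 k + 3 * a3 k)"
    if jk: "j <= k" for k
   proof -
    define F1 where "F1 x = esq (Gfun k u0 x - fn (Th k u0) x) * ic j z x" for x
    define F2 where "F2 x = esq (fn (Th k f) x)" for x
    define F3 where "F3 x = esq (fn (Th k h - Gam k h) x)" for x
    have [measurable]: "F1 : bfun" "F2 : bfun" "F3 : bfun"
     unfolding F1_def[abs_def] F2_def[abs_def] F3_def[abs_def] by measurable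
    have G: "Gfun k f x = Gfun k u0 x - Gfun k h x" for x
     by (simp add: f_def Gfun_def Ek_def avgv_diff inner_diff_right scaleR_diff_left sum_subtractf)
    have T: "Th k f = Th k u0 - Th k h" unfolding f_def by (rule linear_diff[OF Th_linear])
    have "(NN x. esq (Gfun k f x) * ic j z x) <= (NN x. ennreal 3 * F1 x + ennreal 3 * F2 x + ennreal 3 * F3 x)"
    proof (rule nn_integral_mono_AE)
     show "AE x in lborel. esq (Gfun k f x) * ic j z x <= ennreal 3 * F1 x + ennreal 3 * F2 x + ennreal 3 * F3 x"
      using fn_Gam[of k h] fn_diff[of "Th k h" "Gam k h"] fn_diff[of "Th k u0" "Th k h"]
     proof eventually_elim
      case (elim x)
      define d1 d2 d3 where "d1 = Gfun k u0 x - fn (Th k u0) x" and "d2 = fn (Th k f) x" and "d3 = fn (Th k h - Gam k h) x"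
      have "Gfun k f x = d1 + d2 - (- d3)" unfolding d1_def d2_def d3_def T elim G by simp
      then have "norm (Gfun k f x) <= norm d1 + norm d2 + norm (- d3)" by (rule norm_split3)
      then have "sq (Gfun k f x) <= (norm d1 + norm d2 + norm d3)\<^sup>2" by (intro power_mono) auto
      also have "... <= 3 * sq d1 + 3 * sq d2 + 3 * sq d3" by (rule square_add3_le)
      finally have "esq (Gfun k f x) <= ennreal (3 * sq d1 + 3 * sq d2 + 3 * sq d3)" by (rule ennreal_leI)
      also have "... = ennreal 3 * esq d1 + ennreal 3 * esq d2 + ennreal 3 * esq d3"
       by (simp add: ennreal_plus ennreal_mult' del: ennreal_power ennreal_numeral)
      finally show ?case unfolding F1_def F2_def F3_def d1_def d2_def d3_def by (auto simp: indicator_def)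
     qed
    qed
    also have "... = ennreal 3 * (NN x. F1 x) + ennreal 3 * (NN x. F2 x) + ennreal 3 * (NN x. F3 x)"
     by (simp add: nn_integral_add nn_integral_cmult del: ennreal_numeral)
    also have "... <= ennreal 3 * ennreal (a1 k) + ennreal 3 * ennreal (a2 k) + ennreal 3 * ennreal (a3 k)"
    proof (intro add_mono mult_left_mono)
     show "(NN x. F1 x) <= ennreal (a1 k)" unfolding F1_def u0_def a1_def v_def by (rule Gam_const[OF jk \<nu>])
     show "(NN x. F2 x) <= ennreal (a2 k)" unfolding F2_def a2_def norm_L2_nn by simp
     show "(NN x. F3 x) <= ennreal (a3 k)" unfolding F3_def a3_def norm_L2_nn by simp
    qed auto
    also have "... = ennreal (3 * a1 k + 3 * a2 k + 3 * a3 k)"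
     using a0[of k] by (simp add: ennreal_plus ennreal_mult' del: ennreal_power ennreal_numeral)
    finally show ?thesis .
   qed
   have s1: "(\<Sum>k\<in>{j..K}. a1 k) <= CL\<^sup>2 * CI * (4/3) * v"
   proof -
    have "(\<Sum>k\<in>{j..K}. a1 k) = CL\<^sup>2 * CI * (\<Sum>k\<in>{j..K}. (tk k / tk j)\<^sup>2) * v"
     by (simp only: a1_def sum_distrib_left sum_distrib_right)
    also have "... <= CL\<^sup>2 * CI * (4/3) * v"
     by (intro mult_right_mono mult_left_mono scale_square_sum) (use CI_nonneg v in auto)
    finally show ?thesis .
   qed
   have s2: "(\<Sum>k\<in>{j..K}. a2 k) <= C0^4 / \<epsilon>\<^sup>2 * V * (4/3) * v"
   proof -
    have "a2 k <= (C0^4 / \<epsilon>\<^sup>2 * (V * v)) * (tk k / tk j)\<^sup>2" for k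
    proof -
     have "norm (Th k f) <= (tk k / s) * C0\<^sup>2 * norm v0" unfolding Th_def Bf by (rule QQ_PP_norm) (use s in auto)
     then have "a2 k <= ((tk k / s) * C0\<^sup>2 * norm v0)\<^sup>2" unfolding a2_def by (rule power_mono) simp
     also have "... = (C0^4 / \<epsilon>\<^sup>2 * (tk k / tk j)\<^sup>2) * sq v0"
      by (simp add: s_def l_def power_mult_distrib power_divide power_mult[symmetric])
     also have "... <= (C0^4 / \<epsilon>\<^sup>2 * (tk k / tk j)\<^sup>2) * (V * v)" by (rule mult_left_mono[OF v0]) simp
     finally show ?thesis by (simp only: mult_ac)
    qed
    then have "(\<Sum>k\<in>{j..K}. a2 k) <= (\<Sum>k\<in>{j..K}. (C0^4 / \<epsilon>\<^sup>2 * (V * v)) * (tk k / tk j)\<^sup>2)" by (rule sum_mono)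
    also have "... = (C0^4 / \<epsilon>\<^sup>2 * (V * v)) * (\<Sum>k\<in>{j..K}. (tk k / tk j)\<^sup>2)" by (rule sum_distrib_left[symmetric])
    also have "... <= (C0^4 / \<epsilon>\<^sup>2 * (V * v)) * (4/3)" by (rule mult_left_mono[OF scale_square_sum]) (use V v in simp)
    finally show ?thesis by (simp only: mult_ac)
   qed
   have s3: "(\<Sum>k\<in>{j..K}. a3 k) <= CD * (V / \<delta>\<^sup>2) * v"
   proof -
    have "(\<Sum>k\<in>{j..K}. a3 k) <= (\<Sum>k\<le>K. a3 k)" by (rule sum_mono2) (use a0 in auto)
    also have "... <= CD * sq h" unfolding a3_def by (rule dif[OF hr])
    also have "... <= CD * (V / \<delta>\<^sup>2 * v)" by (rule mult_left_mono[OF hn CD])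
    finally show ?thesis by (simp only: mult.assoc)
   qed
   have "(NN x. (\<Sum>k\<in>{j..K}. esq (Gfun k f x)) * ic j z x)
     = (NN x. (\<Sum>k\<in>{j..K}. esq (Gfun k f x) * ic j z x))" by (rule nn_integral_cong) (rule sum_distrib_right)
   also have "... = (\<Sum>k\<in>{j..K}. \<integral>\<^sup>+x. esq (Gfun k f x) * ic j z x \<partial>lborel)"
    by (rule nn_integral_sum) measurable
   also have "... <= (\<Sum>k\<in>{j..K}. ennreal (3 * a1 k + 3 * a2 k + 3 * a3 k))" by (rule sum_mono) (rule each, simp)
   also have "... = ennreal (\<Sum>k\<in>{j..K}. 3 * a1 k + 3 * a2 k + 3 * a3 k)" by (rule sum_ennreal) (use a0 in simp)
   also have "... <= ennreal (C2 * v)"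
   proof (rule ennreal_leI)
    have "(\<Sum>k\<in>{j..K}. 3 * a1 k + 3 * a2 k + 3 * a3 k) = 3 * (\<Sum>k\<in>{j..K}. a1 k) + 3 * (\<Sum>k\<in>{j..K}. a2 k) + 3 * (\<Sum>k\<in>{j..K}. a3 k)"
     by (simp only: sum.distrib sum_distrib_left)
    also have "... <= 3 * (CL\<^sup>2 * CI * (4/3) * v) + 3 * (C0^4 / \<epsilon>\<^sup>2 * V * (4/3) * v) + 3 * (CD * (V / \<delta>\<^sup>2) * v)"
     by (intro add_mono mult_left_mono s1 s2 s3) auto
    also have "... = C2 * v" by (simp only: C2_def distrib_right mult.assoc)
    finally show "(\<Sum>k\<in>{j..K}. 3 * a1 k + 3 * a2 k + 3 * a3 k) <= C2 * v" .
   qed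
   finally show ?thesis .
  qed
  show ?thesis using P1 P2 P3 unfolding v_def by blast
 qed
 with C1 C2 show ?thesis by blast
qed

end

section \<open>The square function estimate\<close>

context kato
begin

lemma row_inner: "b : Basis ==> row k b x \<bullet> Ek k u x = Gfun k u x \<bullet> b"
 by (simp add: Gfun_def inner_sum_left inner_Basis if_distrib cong: if_cong)

lemma row_local:
 "(NN x. esq (row k b x) * ic k z x)
  <= ennreal (real DIM(complex^'m) * (CL\<^sup>2 * CI) * sq b * vol TYPE('n) k)"
proof -
 define L where "L e = Th k (tw (indicator (reach k z)) e)" for e
 have "(NN x. esq (row k b x) * ic k z x)
   <= (NN x. (\<Sum>e\<in>Basis. esq b * (esq (fn (L e) x) * ic k z x)))"
 proof (rule nn_integral_mono)
  fix x
  show "esq (row k b x) * ic k z x <= (\<Sum>e\<in>Basis. esq b * (esq (fn (L e) x) * ic k z x))"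
  proof (cases "x : cell k z")
   case True
   have r: "row k b x = (\<Sum>e\<in>Basis. (fn (L e) x \<bullet> b) *R e)" using True by (simp add: row_def L_def mem_cell)
   have "sq (row k b x) = (\<Sum>e\<in>Basis. (row k b x \<bullet> e) * (row k b x \<bullet> e))"
    unfolding power2_norm_eq_inner by (rule euclidean_inner)
   also have "... = (\<Sum>e\<in>Basis. (fn (L e) x \<bullet> b)\<^sup>2)"
    by (rule sum.cong) (simp_all add: r inner_sum_left inner_Basis if_distrib power2_eq_square cong: if_cong)
   also have "... <= (\<Sum>e\<in>Basis. sq b * sq (fn (L e) x))"
   proof (rule sum_mono)
    fix e :: "complex^'m"
    have "\<bar>fn (L e) x \<bullet> b\<bar> <= norm (fn (L e) x) * norm b" by (rule Cauchy_Schwarz_ineq2)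
    then have "\<bar>fn (L e) x \<bullet> b\<bar>\<^sup>2 <= (norm (fn (L e) x) * norm b)\<^sup>2" by (rule power_mono) simp
    then show "(fn (L e) x \<bullet> b)\<^sup>2 <= sq b * sq (fn (L e) x)" by (simp add: power_mult_distrib mult.commute)
   qed
   finally have "esq (row k b x) <= ennreal (\<Sum>e\<in>Basis. sq b * sq (fn (L e) x))" by (rule ennreal_leI)
   also have "... = (\<Sum>e\<in>Basis. ennreal (sq b * sq (fn (L e) x)))" by (rule sum_ennreal[symmetric]) simp
   also have "... = (\<Sum>e\<in>Basis. esq b * esq (fn (L e) x))" by (simp only: ennreal_mult' zero_le_power2)
   finally show ?thesis using True by simp
  qed simp
 qed
 also have "... = (\<Sum>e\<in>Basis. \<integral>\<^sup>+x. esq b * (esq (fn (L e) x) * ic k z x) \<partial>lborel)"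
  by (rule nn_integral_sum) measurable
 also have "... = (\<Sum>e\<in>Basis. esq b * esq (mult (ic k z) (L e)))"
  unfolding norm_mult_indicator[OF cell_borel] by (intro sum.cong refl nn_integral_cmult) measurable
 also have "... <= (\<Sum>e\<in>(Basis :: (complex^'m) set). ennreal (sq b * (CL\<^sup>2 * CI * vol TYPE('n) k)))"
 proof (rule sum_mono)
  fix e :: "complex^'m" assume e: "e : Basis"
  have "sq (mult (ic k z) (L e)) <= CL\<^sup>2 * CI * vol TYPE('n) k"
   using Th_reach_bound[of k z e] e unfolding L_def by simp
  then have "esq b * esq (mult (ic k z) (L e)) <= esq b * ennreal (CL\<^sup>2 * CI * vol TYPE('n) k)"
   by (intro mult_left_mono ennreal_leI) auto
  then show "esq b * esq (mult (ic k z) (L e)) <= ennreal (sq b * (CL\<^sup>2 * CI * vol TYPE('n) k))"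
   by (simp only: ennreal_mult' zero_le_power2)
 qed
 also have "... = ennreal (\<Sum>e\<in>(Basis :: (complex^'m) set). sq b * (CL\<^sup>2 * CI * vol TYPE('n) k))"
  by (rule sum_ennreal) (use CI_nonneg vol_pos[where 'n = 'n, of k] in simp)
 also have "(\<Sum>e\<in>(Basis :: (complex^'m) set). sq b * (CL\<^sup>2 * CI * vol TYPE('n) k)) = real DIM(complex^'m) * (CL\<^sup>2 * CI) * sq b * vol TYPE('n) k"
  by (simp only: sum_constant mult_ac)
 finally show ?thesis .
qed

text \<open>The cones around a finite \<open>\<epsilon>\<close>-net of unit vectors cover all rows, and each cone satisfies the packing condition.\<close>

theorem Gam_square_sum:
 "\<exists>C\<ge>0. \<forall>K v. (\<Sum>k\<le>K. sq (Gam k v)) <= C * sq v"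
proof -
 obtain C1 C2 where C: "C1 >= 1" "C2 >= 0" and tests: "!!j z (\<nu> :: complex^'m) K. norm \<nu> = 1 ==> \<exists>f.
   sq f <= C1 * vol TYPE('n) j \<and> norm (avgv j z f - \<nu>) <= 1/4 \<and>
   (NN x. (\<Sum>k\<in>{j..K}. esq (Gfun k f x)) * ic j z x) <= ennreal (C2 * vol TYPE('n) j)" using test_functions by blast
 define C3 where "C3 = real DIM(complex^'m) * (CL\<^sup>2 * CI)"
 have C3: "C3 >= 0" unfolding C3_def using CI_nonneg by simp
 define A where "A = 32 * C1 * (C3 + 16 * C2)"
 have A: "A >= 0" using C C3 by (simp add: A_def)
 define \<epsilon> where "\<epsilon> = 1 / (256 * C1\<^sup>2)"
 have \<epsilon>: "\<epsilon> > 0" using C by (simp add: \<epsilon>_def)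
 have "\<exists>U. finite U \<and> U \<subseteq> sphere (0 :: complex^'m) 1 \<and> sphere 0 1 \<subseteq> (\<Union>\<nu>\<in>U. ball \<nu> \<epsilon>)"
  using seq_compact_imp_totally_bounded[OF compact_imp_seq_compact[OF compact_sphere[of "0 :: complex^'m" 1]]] \<epsilon> by blast
 then obtain U where U: "finite U" "U \<subseteq> sphere (0 :: complex^'m) 1" "sphere 0 1 \<subseteq> (\<Union>\<nu>\<in>U. ball \<nu> \<epsilon>)" by blast
 define c where "c b \<nu> k x = esq (row k b x) * indicator {x. norm (row k b x - norm (row k b x) *R \<nu>) <= 1 / (256 * C1\<^sup>2) * norm (row k b x)} x" for b \<nu> k x
 have cm [measurable]: "c b \<nu> k : bfun" for b \<nu> k unfolding c_def[abs_def] by (rule cone_measurable) simp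
 have carl: "(\<Sum>k\<le>K. \<integral>\<^sup>+x. c b \<nu> k x * esq (Ek k v x) \<partial>lborel) <= ennreal (4 * A * sq v)"
  if b: "b : Basis" and \<nu>: "\<nu> : U" for b \<nu> K and v :: "('n, 'm) L2"
 proof (rule carleson_embedding[OF cm A])
  fix j and z :: "int^'n" assume jK: "j <= K"
  have n1: "norm \<nu> = 1" using U(2) \<nu> by auto
  show "(NN x. (\<Sum>k\<in>{j..K}. c b \<nu> k x) * ic j z x) <= ennreal (A * vol TYPE('n) j)" unfolding c_def A_def
  proof (rule carleson_from_tests[OF row_borel C C3 n1 _ _ jK])
   fix j :: nat and z :: "int^'n"
   obtain f where f: "sq f <= C1 * vol TYPE('n) j" "norm (avgv j z f - \<nu>) <= 1/4"
    "(NN x. (\<Sum>k\<in>{j..K}. esq (Gfun k f x)) * ic j z x) <= ennreal (C2 * vol TYPE('n) j)"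
    using tests[OF n1, of j z K] by blast
   have "(NN x. (\<Sum>k\<in>{j..K}. ennreal ((row k b x \<bullet> Ek k f x)\<^sup>2)) * ic j z x)
     <= (NN x. (\<Sum>k\<in>{j..K}. esq (Gfun k f x)) * ic j z x)"
   proof (intro nn_integral_mono mult_right_mono sum_mono ennreal_leI)
    fix x k
    have "\<bar>Gfun k f x \<bullet> b\<bar>\<^sup>2 <= sq (Gfun k f x)" by (rule power_mono[OF Basis_le_norm[OF b]]) simp
    then show "(row k b x \<bullet> Ek k f x)\<^sup>2 <= sq (Gfun k f x)" unfolding row_inner[OF b] by simp
   qed simp
   then have "(NN x. (\<Sum>k\<in>{j..K}. ennreal ((row k b x \<bullet> Ek k f x)\<^sup>2)) * ic j z x) <= ennreal (C2 * vol TYPE('n) j)"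
    using f(3) by (rule order_trans)
   with f(1,2) show "\<exists>f :: ('n, 'm) L2. sq f <= C1 * vol TYPE('n) j \<and> norm (avgv j z f - \<nu>) <= 1 / 4 \<and>
     (NN x. (\<Sum>k\<in>{j..K}. ennreal ((row k b x \<bullet> Ek k f x)\<^sup>2)) * ic j z x) <= ennreal (C2 * vol TYPE('n) j)"
    by blast
  next
   fix k :: nat and z :: "int^'n"
   show "(NN x. esq (row k b x) * ic k z x) <= ennreal (C3 * vol TYPE('n) k)"
    using row_local[of k b z] b unfolding C3_def by simp
  qed
 qed
 have ptw: "esq (Gfun k v x) <= (\<Sum>b\<in>Basis. \<Sum>\<nu>\<in>U. c b \<nu> k x * esq (Ek k v x))" for k x v
 proof -
  have cone: "esq (row k b x) <= (\<Sum>\<nu>\<in>U. c b \<nu> k x)" for b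
  proof (cases "row k b x = 0")
   case False
   define r where "r = row k b x"
   have r: "norm r > 0" using False by (simp add: r_def)
   have "r /\<^sub>R norm r : sphere 0 1" using r by simp
   then obtain \<nu> where \<nu>: "\<nu> : U" "r /\<^sub>R norm r : ball \<nu> \<epsilon>" using U(3) by blast
   have "r - norm r *R \<nu> = norm r *R (r /\<^sub>R norm r - \<nu>)" using r by (simp add: scaleR_diff_right)
   then have "norm (r - norm r *R \<nu>) = norm r * norm (r /\<^sub>R norm r - \<nu>)" using r by simp
   also have "... <= norm r * \<epsilon>" by (rule mult_left_mono) (use \<nu>(2) in "auto simp: dist_norm norm_minus_commute")
   finally have "c b \<nu> k x = esq r" by (simp add: c_def r_def \<epsilon>_def mult.commute)
   then show ?thesis using member_le_sum[OF \<nu>(1), of "%\<nu>. c b \<nu> k x"] U(1) by (simp add: r_def)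
  qed simp
  have "sq (Gfun k v x) = (\<Sum>b\<in>Basis. (Gfun k v x \<bullet> b) * (Gfun k v x \<bullet> b))"
   unfolding power2_norm_eq_inner by (rule euclidean_inner)
  also have "... <= (\<Sum>b\<in>Basis. sq (row k b x) * sq (Ek k v x))"
  proof (rule sum_mono)
   fix b :: "complex^'m" assume b: "b : Basis"
   have "\<bar>row k b x \<bullet> Ek k v x\<bar> <= norm (row k b x) * norm (Ek k v x)" by (rule Cauchy_Schwarz_ineq2)
   then have "\<bar>row k b x \<bullet> Ek k v x\<bar>\<^sup>2 <= (norm (row k b x) * norm (Ek k v x))\<^sup>2" by (rule power_mono) simp
   then show "(Gfun k v x \<bullet> b) * (Gfun k v x \<bullet> b) <= sq (row k b x) * sq (Ek k v x)"
    unfolding row_inner[OF b] by (simp add: power_mult_distrib power2_eq_square mult_ac)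
  qed
  finally have "esq (Gfun k v x) <= ennreal (\<Sum>b\<in>Basis. sq (row k b x) * sq (Ek k v x))" by (rule ennreal_leI)
  also have "... = (\<Sum>b\<in>Basis. ennreal (sq (row k b x) * sq (Ek k v x)))" by (rule sum_ennreal[symmetric]) simp
  also have "... = (\<Sum>b\<in>Basis. esq (row k b x) * esq (Ek k v x))" by (simp only: ennreal_mult' zero_le_power2)
  also have "... <= (\<Sum>b\<in>Basis. (\<Sum>\<nu>\<in>U. c b \<nu> k x) * esq (Ek k v x))"
   by (intro sum_mono mult_right_mono cone) simp
  finally show ?thesis unfolding sum_distrib_right .
 qed
 have "(\<Sum>k\<le>K. sq (Gam k v)) <= real (DIM(complex^'m) * card U) * (4 * A) * sq v" for K and v :: "('n, 'm) L2"
 proof -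
  have "ennreal (\<Sum>k\<le>K. sq (Gam k v)) = (\<Sum>k\<le>K. esq (Gam k v))" by (rule sum_ennreal[symmetric]) simp
  also have "... = (\<Sum>k\<le>K. \<integral>\<^sup>+x. esq (Gfun k v x) \<partial>lborel)"
   unfolding Gam_def norm_mk_nn[OF Gfun_sqint] ..
  also have "... <= (\<Sum>k\<le>K. \<integral>\<^sup>+x. (\<Sum>b\<in>Basis. \<Sum>\<nu>\<in>U. c b \<nu> k x * esq (Ek k v x)) \<partial>lborel)"
   by (intro sum_mono nn_integral_mono ptw)
  also have "... = (\<Sum>k\<le>K. \<Sum>b\<in>Basis. \<Sum>\<nu>\<in>U. \<integral>\<^sup>+x. c b \<nu> k x * esq (Ek k v x) \<partial>lborel)"
  proof (rule sum.cong[OF refl])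
   fix k
   have "(NN x. (\<Sum>b\<in>(Basis :: (complex^'m) set). \<Sum>\<nu>\<in>U. c b \<nu> k x * esq (Ek k v x)))
     = (\<Sum>b\<in>Basis. \<integral>\<^sup>+x. (\<Sum>\<nu>\<in>U. c b \<nu> k x * esq (Ek k v x)) \<partial>lborel)"
    by (rule nn_integral_sum) measurable
   also have "... = (\<Sum>b\<in>Basis. \<Sum>\<nu>\<in>U. \<integral>\<^sup>+x. c b \<nu> k x * esq (Ek k v x) \<partial>lborel)"
    by (intro sum.cong refl nn_integral_sum) measurable
   finally show "(NN x. (\<Sum>b\<in>(Basis :: (complex^'m) set). \<Sum>\<nu>\<in>U. c b \<nu> k x * esq (Ek k v x)))
     = (\<Sum>b\<in>Basis. \<Sum>\<nu>\<in>U. \<integral>\<^sup>+x. c b \<nu> k x * esq (Ek k v x) \<partial>lborel)" .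
  qed
  also have "... = (\<Sum>b\<in>Basis. \<Sum>\<nu>\<in>U. \<Sum>k\<le>K. \<integral>\<^sup>+x. c b \<nu> k x * esq (Ek k v x) \<partial>lborel)"
   by (subst sum.swap) (intro sum.cong refl sum.swap)
  also have "... <= (\<Sum>b\<in>(Basis :: (complex^'m) set). \<Sum>\<nu>\<in>U. ennreal (4 * A * sq v))"
   by (intro sum_mono carl)
  also have "... = ennreal (\<Sum>b\<in>(Basis :: (complex^'m) set). \<Sum>\<nu>\<in>U. 4 * A * sq v)"
   using A by (simp add: sum_ennreal sum_nonneg del: sum_constant)
  also have "(\<Sum>b\<in>(Basis :: (complex^'m) set). \<Sum>\<nu>\<in>U. 4 * A * sq v) = real (DIM(complex^'m) * card U) * (4 * A) * sq v"
   by (simp only: sum_constant of_nat_mult mult_ac)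
  finally show ?thesis using A by (subst (asm) ennreal_le_iff) auto
 qed
 then show ?thesis using A by (intro exI[of _ "real (DIM(complex^'m) * card U) * (4 * A)"]) auto
qed

theorem dyadic_square_function:
 "\<exists>C\<ge>0. \<forall>K u. (\<Sum>k\<le>K. sq (QQ (tk k) u)) <= C * sq u"
proof -
 obtain CG where CG: "CG >= 0" "!!K v. (\<Sum>k\<le>K. sq (Gam k v)) <= CG * sq v" using Gam_square_sum by blast
 obtain CD where CD: "CD >= 0" "!!K v. v : D ` dom ==> (\<Sum>k\<le>K. sq (Th k v - Gam k v)) <= CD * sq v"
  using difference_sum by blast
 have two: "sq (p + q) <= 2 * sq p + 2 * sq q" for p q :: "('n, 'm) L2"
 proof -
  have "sq (p + q) <= (norm p + norm q)\<^sup>2" by (rule power_mono[OF norm_triangle_ineq]) simp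
  also have "... <= 2 * sq p + 2 * sq q" using sum_squares_bound[of "norm p" "norm q"] by (simp add: power2_sum)
  finally show ?thesis .
 qed
 have Th_sum: "(\<Sum>k\<le>K. sq (Th k v)) <= (2 * CD + 2 * CG) * sq v" if v: "v : D ` dom" for K v
 proof -
  have "(\<Sum>k\<le>K. sq (Th k v)) <= (\<Sum>k\<le>K. 2 * sq (Th k v - Gam k v) + 2 * sq (Gam k v))"
  proof (rule sum_mono)
   fix k show "sq (Th k v) <= 2 * sq (Th k v - Gam k v) + 2 * sq (Gam k v)"
    using two[of "Th k v - Gam k v" "Gam k v"] by simp
  qed
  also have "... = 2 * (\<Sum>k\<le>K. sq (Th k v - Gam k v)) + 2 * (\<Sum>k\<le>K. sq (Gam k v))"
   by (simp only: sum.distrib sum_distrib_left)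
  also have "... <= 2 * (CD * sq v) + 2 * (CG * sq v)" by (intro add_mono mult_left_mono CD(2)[OF v] CG(2)) auto
  finally show ?thesis by (simp only: distrib_right mult.assoc)
 qed
 define M where "M = 2 * (4/3) * C0^4 + 2 * ((2 * CD + 2 * CG) / \<delta>\<^sup>2)"
 have "(\<Sum>k\<le>K. sq (QQ (tk k) u)) <= M * sq u" for K u
 proof -
  define v where "v = D (QQ 1 u)"
  have v: "v : D ` dom" unfolding v_def using QQ_dom[of 1 u] by simp
  have u: "u = PP 1 u + B v" unfolding v_def using PQ_sum[of 1 u] by simp
  have nv: "sq v <= sq u / \<delta>\<^sup>2"
  proof -
   have "\<delta> * norm v <= norm u" using DQQ_norm[of 1 u] by (simp add: v_def)
   then have "norm v <= norm u / \<delta>" using \<delta>_pos by (simp add: pos_le_divide_eq mult.commute)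
   then have "sq v <= (norm u / \<delta>)\<^sup>2" by (rule power_mono) simp
   then show ?thesis by (simp add: power_divide)
  qed
  have each: "sq (QQ (tk k) u) <= 2 * C0^4 * sq u * (tk k / tk 0)\<^sup>2 + 2 * sq (Th k v)" for k
  proof -
   have "QQ (tk k) u = QQ (tk k) (PP 1 u) + Th k v"
    unfolding Th_def using linear_add[OF QQ_linear[of "tk k"], of "PP 1 u" "B v"] u by simp
   then have "sq (QQ (tk k) u) <= 2 * sq (QQ (tk k) (PP 1 u)) + 2 * sq (Th k v)" using two by simp
   also have "sq (QQ (tk k) (PP 1 u)) <= ((tk k / 1) * C0\<^sup>2 * norm u)\<^sup>2" by (intro power_mono QQ_PP_norm) auto
   also have "((tk k / 1) * C0\<^sup>2 * norm u)\<^sup>2 = C0^4 * sq u * (tk k / tk 0)\<^sup>2"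
    by (simp add: tk_def power_mult_distrib power_mult[symmetric] mult_ac)
   finally show ?thesis by (simp add: mult.assoc)
  qed
  have "(\<Sum>k\<le>K. sq (QQ (tk k) u)) <= (\<Sum>k\<le>K. 2 * C0^4 * sq u * (tk k / tk 0)\<^sup>2 + 2 * sq (Th k v))"
   by (rule sum_mono) (rule each)
  also have "... = 2 * C0^4 * sq u * (\<Sum>k\<in>{0..K}. (tk k / tk 0)\<^sup>2) + 2 * (\<Sum>k\<le>K. sq (Th k v))"
   by (simp only: sum.distrib sum_distrib_left atLeast0AtMost)
  also have "... <= 2 * C0^4 * sq u * (4/3) + 2 * ((2 * CD + 2 * CG) * sq v)"
   by (intro add_mono mult_left_mono scale_square_sum Th_sum[OF v]) auto
  also have "... <= 2 * C0^4 * sq u * (4/3) + 2 * ((2 * CD + 2 * CG) * (sq u / \<delta>\<^sup>2))"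
   by (intro add_left_mono mult_left_mono nv) (use CD(1) CG(1) in auto)
  also have "... = M * sq u" by (simp add: M_def algebra_simps add_divide_distrib)
  finally show ?thesis .
 qed
 then show ?thesis using CD(1) CG(1) by (intro exI[of _ M]) (auto simp: M_def)
qed

text \<open>Passing from the dyadic sum to the integral: on each dyadic interval \<open>QQ t u\<close> is comparable to
 its value at the endpoint, and for \<open>t > 1\<close> it decays like \<open>1/t\<close>.\<close>

theorem square_function:
 "\<exists>C\<ge>0. \<forall>u F. (\<forall>t>0. F t = ennreal (sq (QQ t u) / t)) \<longrightarrow>
  (\<integral>\<^sup>+t\<in>{0<..}. F t \<partial>lborel) <= ennreal (C * sq u)"
proof -
 obtain CS where CS: "CS >= 0" "!!K u. (\<Sum>k\<le>K. sq (QQ (tk k) u)) <= CS * sq u" using dyadic_square_function by blast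
 have coer: "norm x <= Cc * norm (D x)" if x: "x : dom" "x : closure (D ` dom)" for x
 proof -
  obtain G where G: "has_weak_gradient x G" "norm x + (\<Sum>j\<in>UNIV. norm (G $ j)) <= Cc * norm (D x)"
   using gradient[OF x] by (elim exE conjE)
  have "(\<Sum>j\<in>UNIV. norm (G $ j)) >= 0" by (intro sum_nonneg) simp
  with G(2) show ?thesis by linarith
 qed
 define Ci where "Ci = Bn * Cc * (1 + C0) / \<delta>\<^sup>2"
 have Ci: "norm (QQ t u) <= Ci / t * norm u" if "t > 0" for t u unfolding Ci_def by (rule QQ_decay[OF coer that Cc_nonneg])
 define K1 where "K1 = (2 + 3 * C0)\<^sup>2"
 have sq: "sq (QQ t u) <= K1 * sq (QQ s u)" if "0 < t" "t <= s" "s <= 2 * t" for t s u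
 proof -
  have "sq (QQ t u) <= ((2 + 3 * C0) * norm (QQ s u))\<^sup>2" by (intro power_mono QQ_comparable that) simp
  then show ?thesis by (simp add: K1_def power_mult_distrib)
 qed
 have "(\<integral>\<^sup>+t\<in>{0<..}. F t \<partial>lborel) <= ennreal ((K1 * CS + 2 * Ci\<^sup>2) * sq u)"
  if F: "\<forall>t>0. F t = ennreal (sq (QQ t u) / t)" for u and F :: "real => ennreal"
 proof -
  define I where "I k = {tk (Suc k)<..tk k}" for k
  define a where "a k = 2 * K1 * sq (QQ (tk k) u) / tk k" for k
  define b where "b k = Ci\<^sup>2 * sq u * (tk k)^3" for k
  define J where "J k = {2^k<..2^Suc k :: real}" for k :: nat
  let ?A = "%t. \<Sum>k. ennreal (a k) * indicator (I k) t" and ?B = "%t. \<Sum>k. ennreal (b k) * indicator (J k) t"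
  have ptw: "F t * indicator {0<..} t <= ?A t + ?B t" for t
  proof -
   have tm: "f k <= (\<Sum>k. f k)" for f :: "nat => ennreal" and k using sum_le_suminf[OF summableI, of "{k}" f] by simp
   consider "t <= 0" | "0 < t" "t <= 1" | "t > 1" by linarith
   then show ?thesis
   proof cases
    case 2
    define k where "k = (LEAST k. tk (Suc k) < t)"
    have "\<exists>n. (1/2)^n < t" by (rule real_arch_pow_inv) (use 2 in auto)
    then obtain n where "(1/2)^n < t" by blast
    then have "tk n < t" by (simp add: tk_def)
    then have "tk (Suc n) < t" using tk_pos(1)[of n] unfolding tk_Suc by linarith
    then have k1: "tk (Suc k) < t" unfolding k_def by (rule LeastI)
    have k2: "t <= tk k"
    proof (cases k)
     case 0
     then show ?thesis using 2 by (simp add: tk_def)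
    next
     case (Suc i)
     then have "\<not> tk (Suc i) < t" using not_less_Least[of i "%k. tk (Suc k) < t"] unfolding k_def[symmetric] by simp
     then show ?thesis using Suc by simp
    qed
    have "sq (QQ t u) / t <= (K1 * sq (QQ (tk k) u)) / (tk k / 2)"
     using k1 k2 2 unfolding tk_Suc by (intro frac_le sq) (auto simp: K1_def)
    then have "sq (QQ t u) / t <= a k" by (simp add: a_def mult_ac)
    then have "F t * indicator {0<..} t <= ennreal (a k) * indicator (I k) t"
     using F 2 k1 k2 by (simp add: I_def ennreal_leI del: ennreal_power)
    also have "... <= ?A t" by (rule tm)
    finally show ?thesis by (rule add_increasing2[rotated]) simp
   next
    case 3
    define k where "k = (LEAST k. t <= 2^Suc k)"
    have "\<exists>n. t < 2^n" by (rule real_arch_pow) simp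
    then obtain n where "t < 2^n" by blast
    also have "(2::real)^n <= 2^Suc n" by (rule power_increasing) auto
    finally have "t <= 2^Suc n" by (rule less_imp_le)
    then have k1: "t <= 2^Suc k" unfolding k_def by (rule LeastI)
    have k2: "2^k < t"
    proof (cases k)
     case 0
     then show ?thesis using 3 by simp
    next
     case (Suc i)
     then have "\<not> t <= 2^Suc i" using not_less_Least[of i "%k. t <= 2^Suc k"] unfolding k_def[symmetric] by simp
     then show ?thesis using Suc by simp
    qed
    have tp: "t > 0" using 3 by simp
    have "sq (QQ t u) <= (Ci / t * norm u)\<^sup>2" by (intro power_mono Ci tp) simp
    then have "sq (QQ t u) / t <= (Ci / t * norm u)\<^sup>2 / t" by (rule divide_right_mono) (use tp in simp)
    also have "... = Ci\<^sup>2 * sq u * (inverse t)^3"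
     by (simp add: power_mult_distrib power_divide field_simps power2_eq_square power3_eq_cube)
    also have "... <= Ci\<^sup>2 * sq u * (tk k)^3"
    proof (intro mult_left_mono power_mono)
     have "inverse t <= inverse (2^k)" by (rule le_imp_inverse_le) (use k2 in auto)
     then show "inverse t <= tk k" by (simp add: tk_def power_one_over inverse_eq_divide)
    qed (use tp in auto)
    also have "... = b k" by (simp add: b_def)
    finally have "F t * indicator {0<..} t <= ennreal (b k) * indicator (J k) t"
     using F tp k1 k2 by (simp add: J_def ennreal_leI del: ennreal_power power_Suc)
    also have "... <= ?B t" by (rule tm)
    finally show ?thesis by (rule add_increasing[rotated]) simp
   qed simp
  qed
  have "(\<integral>\<^sup>+t\<in>{0<..}. F t \<partial>lborel) <= (NN t. ?A t + ?B t)" by (rule nn_integral_mono) (rule ptw)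
  also have "... = (NN t. ?A t) + (NN t. ?B t)" by (rule nn_integral_add) (simp_all add: I_def J_def)
  also have "(NN t. ?A t) = (\<Sum>k. \<integral>\<^sup>+t. ennreal (a k) * indicator (I k) t \<partial>lborel)"
   by (rule nn_integral_suminf) (simp add: I_def)
  also have "... = (\<Sum>k. ennreal (K1 * sq (QQ (tk k) u)))"
  proof (rule arg_cong[where f = suminf], rule ext)
   fix k
   have "emeasure lborel (I k) = ennreal (tk k / 2)" unfolding I_def tk_Suc by (subst emeasure_lborel_Ioc) (auto simp: less_imp_le)
   then have "(NN t. ennreal (a k) * indicator (I k) t) = ennreal (a k) * ennreal (tk k / 2)"
    by (subst nn_integral_cmult_indicator) (auto simp: I_def)
   also have "... = ennreal (a k * (tk k / 2))" by (rule ennreal_mult'[symmetric]) (simp add: a_def K1_def less_imp_le)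
   also have "a k * (tk k / 2) = K1 * sq (QQ (tk k) u)" by (simp add: a_def)
   finally show "(NN t. ennreal (a k) * indicator (I k) t) = ennreal (K1 * sq (QQ (tk k) u))" .
  qed
  also have "... <= ennreal (K1 * CS * sq u)" unfolding suminf_eq_SUP
  proof (rule SUP_least)
   fix n
   have "(\<Sum>k<n. ennreal (K1 * sq (QQ (tk k) u))) = ennreal (\<Sum>k<n. K1 * sq (QQ (tk k) u))"
    by (rule sum_ennreal) (simp add: K1_def)
   also have "... <= ennreal (K1 * CS * sq u)"
   proof (rule ennreal_leI)
    have "(\<Sum>k<n. K1 * sq (QQ (tk k) u)) <= (\<Sum>k\<le>n. K1 * sq (QQ (tk k) u))"
     by (rule sum_mono2) (auto simp: K1_def)
    also have "... = K1 * (\<Sum>k\<le>n. sq (QQ (tk k) u))" by (rule sum_distrib_left[symmetric])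
    also have "... <= K1 * (CS * sq u)" by (rule mult_left_mono[OF CS(2)]) (simp add: K1_def)
    finally show "(\<Sum>k<n. K1 * sq (QQ (tk k) u)) <= K1 * CS * sq u" by (simp only: mult.assoc)
   qed
   finally show "(\<Sum>k<n. ennreal (K1 * sq (QQ (tk k) u))) <= ennreal (K1 * CS * sq u)" .
  qed
  also have "(NN t. ?B t) = (\<Sum>k. \<integral>\<^sup>+t. ennreal (b k) * indicator (J k) t \<partial>lborel)"
   by (rule nn_integral_suminf) (simp add: J_def)
  also have "... <= (\<Sum>k. ennreal (Ci\<^sup>2 * sq u * (1/2)^k))"
  proof (rule suminf_le)
   fix k
   have "emeasure lborel (J k) = ennreal (2^k)" unfolding J_def by (subst emeasure_lborel_Ioc) auto
   then have "(NN t. ennreal (b k) * indicator (J k) t) = ennreal (b k) * ennreal (2^k)"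
    by (subst nn_integral_cmult_indicator) (auto simp: J_def)
   also have "... = ennreal (b k * 2^k)" by (rule ennreal_mult'[symmetric]) (simp add: b_def less_imp_le)
   also have "b k * 2^k = Ci\<^sup>2 * sq u * (tk k * (tk k * (tk k * 2^k)))" by (simp add: b_def power3_eq_cube)
   also have "... = Ci\<^sup>2 * sq u * (tk k * tk k)" by (simp only: tk_inv mult_1_right)
   also have "... <= Ci\<^sup>2 * sq u * (tk k * 1)" by (intro mult_left_mono tk_le_1) (auto simp: less_imp_le)
   finally show "(NN t. ennreal (b k) * indicator (J k) t) <= ennreal (Ci\<^sup>2 * sq u * (1/2)^k)"
    by (simp add: tk_def ennreal_leI del: ennreal_power)
  qed auto
  also have "... = ennreal (Ci\<^sup>2 * sq u * 2)"
   by (rule suminf_ennreal_eq) (use geometric_sums[of "1/2 :: real"] in \<open>auto intro!: sums_mult\<close>)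
  finally have "(\<integral>\<^sup>+t\<in>{0<..}. F t \<partial>lborel) <= ennreal (K1 * CS * sq u) + ennreal (Ci\<^sup>2 * sq u * 2)"
   by (simp add: add_mono)
  also have "... = ennreal ((K1 * CS + 2 * Ci\<^sup>2) * sq u)"
  proof -
   have "K1 >= 0" by (simp add: K1_def)
   then show ?thesis using CS(1) by (simp add: ennreal_plus[symmetric] algebra_simps del: ennreal_plus ennreal_power)
  qed
  finally show ?thesis .
 qed
 then show ?thesis using CS(1) by (intro exI[of _ "K1 * CS + 2 * Ci\<^sup>2"]) (auto simp: K1_def)
qed

end

section \<open>The square function estimate for \<open>BD\<close>\<close>

lemma hprod_scaleC: "hprod (scaleC_L2 c u) v = c * hprod u v" by transfer (simp add: sum_distrib_left[symmetric] mult.assoc)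

lemma scaleR_eq_scaleC: "r *R u = scaleC_L2 (of_real r) u"
proof (rule L2_eqI)
 have sc: "r *R v = complex_of_real r *s v" for v :: "complex^'b"
  unfolding vec_eq_iff vector_scaleR_component vector_smult_component by (simp add: scaleR_conv_of_real)
 show "AE x in lborel. fn (r *R u) x = fn (scaleC_L2 (of_real r) u) x"
  using fn_scaleR[of r u] fn_scaleC[of "of_real r" u] by eventually_elim (simp only: sc)
qed

lemma scaleC_i:
 shows "linear (scaleC_L2 \<i> :: ('n::finite, 'm::finite) L2 => _)"
  and "scaleC_L2 \<i> (scaleC_L2 \<i> u) = - (u :: ('n, 'm) L2)"
  and "norm (scaleC_L2 \<i> u) = norm (u :: ('n, 'm) L2)"
  and "bm \<omega> ==> scaleC_L2 \<i> (mult \<omega> u) = mult \<omega> (scaleC_L2 \<i> (u :: ('n, 'm) L2))"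
proof -
 show "linear (scaleC_L2 \<i> :: ('n, 'm) L2 => _)"
 proof (rule linearI)
  fix u v :: "('n, 'm) L2" and r :: real
  show "scaleC_L2 \<i> (u + v) = scaleC_L2 \<i> u + scaleC_L2 \<i> v"
  by (rule L2_eqI, use fn_scaleC[of \<i> "u + v"] fn_add[of u v] fn_add[of "scaleC_L2 \<i> u" "scaleC_L2 \<i> v"] fn_scaleC[of \<i> u] fn_scaleC[of \<i> v] in eventually_elim) (simp add: vec_eq_iff distrib_left)
  show "scaleC_L2 \<i> (r *R u) = r *R scaleC_L2 \<i> u"
  by (rule L2_eqI, use fn_scaleC[of \<i> "r *R u"] fn_scaleR[of r u] fn_scaleR[of r "scaleC_L2 \<i> u"] fn_scaleC[of \<i> u] in eventually_elim) (simp add: vec_eq_iff)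
 qed
 show "scaleC_L2 \<i> (scaleC_L2 \<i> u) = - u"
 proof (rule L2_eqI)
  have m: "- u = (-1) *R u" by simp
  show "AE x in lborel. fn (scaleC_L2 \<i> (scaleC_L2 \<i> u)) x = fn (- u) x"
   unfolding m using fn_scaleC[of \<i> "scaleC_L2 \<i> u"] fn_scaleC[of \<i> u] fn_scaleR[of "-1" u]
   by eventually_elim (simp add: vec_eq_iff mult.assoc[symmetric])
 qed
 have n: "AE x in lborel. norm (fn (scaleC_L2 \<i> u) x) = norm (fn u x)"
  using fn_scaleC[of \<i> u] by eventually_elim (simp add: norm_vector_scalar_mult)
 have "norm (scaleC_L2 \<i> u) <= 1 * norm u" by (rule norm_mono_AE) (use n in auto)
 moreover have "norm u <= 1 * norm (scaleC_L2 \<i> u)" by (rule norm_mono_AE) (use n in auto)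
 ultimately show "norm (scaleC_L2 \<i> u) = norm u" by simp
 show "scaleC_L2 \<i> (mult \<omega> u) = mult \<omega> (scaleC_L2 \<i> u)" if b: "bm \<omega>"
 by (rule L2_eqI, use fn_scaleC[of \<i> "mult \<omega> u"] fn_mult[OF b, of u] fn_mult[OF b, of "scaleC_L2 \<i> u"] fn_scaleC[of \<i> u] in eventually_elim) (simp add: vec_eq_iff)
qed

lemma matrix_multiplication_fn:
 assumes "matrix_multiplication_operator B"
 obtains b where "!!u. AE x in lborel. fn (B u) x = b x *v fn u x"
proof -
 obtain b where b: "!!u. AE x in lebesgue. rep_L2 (B u) x = b x *v rep_L2 u x"
  using assms by (auto simp: matrix_multiplication_operator_def)
 have "AE x in lborel. fn (B u) x = b x *v fn u x" for u
  using b[of u, unfolded AE_completion_iff] fn_rep[of "B u"] fn_rep[of u] by eventually_elim simp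
 then show thesis by (rule that)
qed

lemma matrix_multiplication_commute:
 assumes "matrix_multiplication_operator B"
 shows "B (scaleC_L2 c u) = scaleC_L2 c (B u)" and "bm \<omega> ==> B (mult \<omega> u) = mult \<omega> (B u)"
proof -
 obtain b where b: "!!u. AE x in lborel. fn (B u) x = b x *v fn u x" by (rule matrix_multiplication_fn[OF assms]) (rule that)
 show "B (scaleC_L2 c u) = scaleC_L2 c (B u)"
 by (rule L2_eqI, use b[of "scaleC_L2 c u"] fn_scaleC[of c u] fn_scaleC[of c "B u"] b[of u] in eventually_elim) (simp add: vector_scalar_commute)
 show "B (mult \<omega> u) = mult \<omega> (B u)" if m: "bm \<omega>"
 proof (rule L2_eqI)
  have sc: "M *v (r *R v) = r *R (M *v v)" for M :: "complex^'b^'b" and r v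
   by (simp add: matrix_vector_mult_def vec_eq_iff scaleR_sum_right)
  show "AE x in lborel. fn (B (mult \<omega> u)) x = fn (mult \<omega> (B u)) x"
   using b[of "mult \<omega> u"] fn_mult[OF m, of u] fn_mult[OF m, of "B u"] b[of u] by eventually_elim (simp add: sc)
 qed
qed

text \<open>Symmetry of \<open>D\<close> for the real inner product implies symmetry for the hermitian one, because the domain is invariant under
multiplication by \<open>\<i>\<close>.\<close>

lemma kato_from_operators:
 fixes domD :: "('n::finite, 'm::finite) L2 set"
  and D B :: "('n, 'm) L2 => ('n, 'm) L2"
 assumes sa: "self_adjoint_operator domD D"
  and fo: "first_order_const_coeff_operator domD D"
  and co: "\<exists>C. \<forall>u \<in> domD Int closure (D ` domD).
     \<exists>g. has_weak_gradient u g \<and> norm u + norm g <= C * norm (D u)"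
  and bl: "bounded_linear B" and mm: "matrix_multiplication_operator B" and d: "\<delta> > 0"
  and ac: "\<forall>u\<in>domD. Re (hprod (B (D u)) (D u)) >= \<delta> * sq (D u)"
 shows "\<exists>a a0 Cc. kato (scaleC_L2 \<i>) domD D B \<delta> a a0 Cc"
proof -
 let ?J = "scaleC_L2 \<i> :: ('n, 'm) L2 => ('n, 'm) L2"
 have dd: "densely_defined_operator domD D" and gr: "adjoint_graph domD D = {(u, D u) | u. u : domD}"
  using sa by (auto simp: self_adjoint_operator_def)
 have d0: "0 : domD" and dadd: "!!u v. u : domD ==> v : domD ==> u + v : domD \<and> D (u + v) = D u + D v"
  and dsc: "!!c u. u : domD ==> scaleC_L2 c u : domD \<and> D (scaleC_L2 c u) = scaleC_L2 c (D u)"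
  and dde: "closure domD = UNIV"
  using dd unfolding densely_defined_operator_def by blast+
 have sym: "D x \<bullet> y = x \<bullet> D y" if "x : domD" "y : domD" for x y
 proof -
  have "(y, D y) : adjoint_graph domD D" unfolding gr using that by blast
  then have "hprod (D x) y = hprod x (D y)" using that by (simp add: adjoint_graph_def)
  then show ?thesis by (simp add: inner_L2_def)
 qed
 have adj: "v : domD \<and> D v = w" if h: "!!x. x : domD ==> D x \<bullet> v = x \<bullet> w" for v w
 proof -
  have "hprod (D x) v = hprod x w" if x: "x : domD" for x
  proof (rule complex_eqI)
   show "Re (hprod (D x) v) = Re (hprod x w)" using h[OF x] by (simp add: inner_L2_def)
   have "D (?J x) \<bullet> v = ?J x \<bullet> w" using h[of "?J x"] dsc[OF x] by simp
   then have "?J (D x) \<bullet> v = ?J x \<bullet> w" using dsc[OF x] by simp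
   then show "Im (hprod (D x) v) = Im (hprod x w)" by (simp add: inner_L2_def hprod_scaleC)
  qed
  then have "(v, w) : adjoint_graph domD D" by (simp add: adjoint_graph_def)
  then show ?thesis unfolding gr by blast
 qed
 obtain A A0 where fm: "!!u \<phi>. u : domD ==> test_function \<phi> ==>
   distribution (D u) \<phi> = (\<Sum>j\<in>UNIV. A j *v distribution_partial j u \<phi>) + A0 *v distribution u \<phi>"
  using fo unfolding first_order_const_coeff_operator_def by blast
 obtain C where C: "!!u. u : domD ==> u : closure (D ` domD) ==> \<exists>g. has_weak_gradient u g \<and> norm u + norm g <= C * norm (D u)"
  using co by blast
 define Cc where "Cc = real (CARD('n)) * \<bar>C\<bar>"
 have lin: "linear ((*v) M)" for M :: "complex^'m^'m"
  by (rule linearI) (simp_all add: matrix_vector_mult_def vec_eq_iff scaleR_sum_right sum.distrib distrib_left)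
 have "dirac ?J domD D B \<delta>"
 proof (rule dirac.intro)
  show "linear ?J" by (rule scaleC_i)
  show "?J (?J x) = - x" "norm (?J x) = norm x" for x by (rule scaleC_i)+
  show "subspace domD" unfolding subspace_def scaleR_eq_scaleC using d0 dadd dsc by blast
  show "D (r *R x) = r *R D x" if "x : domD" for x r unfolding scaleR_eq_scaleC using dsc[OF that] by blast
  show "B (?J x) = ?J (B x)" for x by (rule matrix_multiplication_commute(1)[OF mm])
  show "\<delta> * sq (D x) <= B (D x) \<bullet> D x" if "x : domD" for x using ac that by (simp add: inner_L2_def)
  show "closure domD = UNIV" by (rule dde)
  show "D (x + y) = D x + D y" if "x : domD" "y : domD" for x y using dadd[OF that] ..
  show "?J x : domD" "D (?J x) = ?J (D x)" if "x : domD" for x using dsc[OF that] by blast+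
  show "D x \<bullet> y = x \<bullet> D y" if "x : domD" "y : domD" for x y by (rule sym[OF that])
  show "v : domD \<and> D v = w" if "!!x. x : domD ==> D x \<bullet> v = x \<bullet> w" for v w by (rule adj[OF that])
  show "bounded_linear B" by (rule bl)
  show "\<delta> > 0" by (rule d)
 qed
 moreover have "diffop domD D (%j. (*v) (A j)) ((*v) A0)"
 proof (rule diffop.intro)
  show "linear ((*v) (A j))" "linear ((*v) A0)" for j by (rule lin)+
  show "D u \<bullet> v = u \<bullet> D v" if "u : domD" "v : domD" for u v by (rule sym[OF that])
  show "v : domD \<and> D v = w" if "!!x. x : domD ==> D x \<bullet> v = x \<bullet> w" for v w by (rule adj[OF that])
 qed (rule fm)
 moreover have "kato_axioms ?J domD D B Cc"
 proof (unfold_locales)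
  show "B (mult \<omega> u) = mult \<omega> (B u)" if "bm \<omega>" for \<omega> u by (rule matrix_multiplication_commute(2)[OF mm that])
  show "?J (mult \<omega> u) = mult \<omega> (?J u)" if "bm \<omega>" for \<omega> u by (rule scaleC_i(4)[OF that])
  show "Cc >= 0" by (simp add: Cc_def)
  show "\<exists>G. has_weak_gradient u G \<and> norm u + (\<Sum>j\<in>UNIV. norm (G $ j)) <= Cc * norm (D u)"
   if u: "u : domD" "u : closure (D ` domD)" for u
  proof -
   obtain g where g: "has_weak_gradient u g" "norm u + norm g <= C * norm (D u)" using C[OF u] by blast
   have "(\<Sum>j\<in>UNIV. norm (g $ j)) <= (\<Sum>j\<in>(UNIV :: 'n set). norm g)"
    by (intro sum_mono Finite_Cartesian_Product.norm_nth_le)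
   then have "norm u + (\<Sum>j\<in>UNIV. norm (g $ j)) <= 1 * norm u + real CARD('n) * norm g" by simp
   also have "... <= real CARD('n) * norm u + real CARD('n) * norm g"
    by (intro add_right_mono mult_right_mono) (auto simp: Suc_leI)
   also have "... = real CARD('n) * (norm u + norm g)" by (simp add: distrib_left)
   also have "... <= real CARD('n) * (\<bar>C\<bar> * norm (D u))"
   proof (rule mult_left_mono)
    have "C * norm (D u) <= \<bar>C\<bar> * norm (D u)" by (rule mult_right_mono) auto
    with g(2) show "norm u + norm g <= \<bar>C\<bar> * norm (D u)" by linarith
   qed simp
   finally show ?thesis using g(1) by (intro exI[of _ g]) (simp add: Cc_def mult.assoc)
  qed
 qed
 ultimately show ?thesis unfolding kato_def by blast
qed

theorem mainTheorem6:
  fixes domD :: "('n::finite, 'm::finite) L2 set"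
    and D B :: "('n, 'm) L2 \<Rightarrow> ('n, 'm) L2"
    and \<delta> :: real
  assumes "self_adjoint_operator domD D"
    and "first_order_const_coeff_operator domD D"
    and "\<exists>C. \<forall>u \<in> domD \<inter> closure (D ` domD).
           \<exists>g. has_weak_gradient u g \<and> norm u + norm g \<le> C * norm (D u)"
    and "bounded_linear B"
    and "matrix_multiplication_operator B"
    and "\<delta> > 0"
    and "\<forall>u\<in>domD. Re (hprod (B (D u)) (D u)) \<ge> \<delta> * (norm (D u))\<^sup>2"
  shows "\<exists>C. \<forall>u.
           (\<integral>\<^sup>+ t\<in>{0<..}. ennreal ((norm (t *\<^sub>R B (D (resolvent_BDBD domD D B t u))))\<^sup>2 / t) \<partial>lborel)
             \<le> ennreal (C * (norm u)\<^sup>2)"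
proof -
 obtain a a0 Cc where "kato (scaleC_L2 \<i>) domD D B \<delta> a a0 Cc" using kato_from_operators[OF assms] by blast
 then interpret kato "scaleC_L2 \<i>" domD D B \<delta> a a0 Cc .
 obtain C where C: "C >= 0" "!!u F. (\<forall>t>0. F t = ennreal (sq (QQ t u) / t)) ==>
   (\<integral>\<^sup>+t\<in>{0<..}. F t \<partial>lborel) <= ennreal (C * sq u)" using square_function by blast
 have "t *R B (D (resolvent_BDBD domD D B t u)) = QQ t u" if "t > 0" for t u
  unfolding resolvent_BDBD_def resolvent_unique_inverse[OF that] using QQ_eq[of t u] that by simp
 then have "(\<integral>\<^sup>+ t\<in>{0<..}. ennreal (sq (t *R B (D (resolvent_BDBD domD D B t u))) / t) \<partial>lborel)
   <= ennreal (C * sq u)" for u by (intro C(2)) simp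
 then show ?thesis by blast
qed

end
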